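(* Fix $\bar\delta>0$. There exists a constant $C_{\mathrm{ssco}}\ge1$ (depending only on $d,k,k_{\min}$, the $\sigma_l$ and $\bar\delta$) such that for every box $B\subseteq\mathbb R^d$ of positive measure and every $\delta\in(0,\bar\delta]$ there is a linear operator $C_{B,\delta}:V_{\mathrm{harm}}(B^\delta)\to V_{\mathrm{harm}}(B)$ with (1) $\operatorname{rank}C_{B,\delta}\le C(1+\operatorname{diam}B/\delta)^d$, with $C$ depending only on $d,k,k_{\min}$, the $\sigma_l$ and $\bar\delta$; (2) for all $u\in V_{\mathrm{harm}}(B^\delta)$: $$\sum_{l=0}^k(\delta/C_{\mathrm{ssco}})^l|u-C_{B,\delta}u|_{H^l(B)}\le\frac12\sum_{l=0}^k(\delta/C_{\mathrm{ssco}})^l|u|_{H^l(B^\delta)}.$$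
   Context: Setting: $d,k\in\mathbb N$, $k>d/2$, $k_{\min}\in\{0,\dots,k\}$, $\sigma_{k_{\min}},\dots,\sigma_k\ge0$ with $\sigma_{k_{\min}},\sigma_k>0$; $V=\{v\in L^1_{\mathrm{loc}}(\mathbb R^d):\partial^\alpha v\in L^2(\mathbb R^d)\ \forall|\alpha|\in\{k_{\min},\dots,k\}\}$ (elements continuous, in $H^k_{\mathrm{loc}}$); $a(u,v)=\sum_{l=k_{\min}}^k\sigma_l\sum_{|\alpha|=l}\frac{l!}{\alpha!}(\partial^\alpha u,\partial^\alpha v)_{L^2(\mathbb R^d)}$. Pairwise distinct points $x_1,\dots,x_N$; $V_0=\{v\in V:v(x_n)=0\ \forall n\}$. For open $B$, $V_{\mathrm{harm}}(B)=\{u\in V:u(x_n)=0\text{ whenever }x_n\in B,\ a(u,v)=0\ \forall v\in V_0\text{ with }\operatorname{supp}v\subseteq B\}$. A box is $B=\prod_{i=1}^d(a_i,b_i)$; $B^\delta=\prod_i(a_i-\delta,b_i+\delta)$. The rank of a linear operator is the dimension of its range. *)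

theory Defs
  imports "HOL-Analysis.Analysis"
begin

type_synonym 'd fn = "real^'d \<Rightarrow> real"

definition cpd :: "'d::finite \<Rightarrow> 'd fn \<Rightarrow> 'd fn" where
  "cpd i f = (\<lambda>x. deriv (\<lambda>t::real. f (x + t *\<^sub>R axis i 1)) 0)"

fun pd_list :: "'d::finite list \<Rightarrow> 'd fn \<Rightarrow> 'd fn" where
  "pd_list [] f = f"
| "pd_list (i # is) f = cpd i (pd_list is f)"

definition mi_order :: "('d::finite \<Rightarrow> nat) \<Rightarrow> nat" where
  "mi_order \<alpha> = (\<Sum>i\<in>UNIV. \<alpha> i)"

definition mi_fact :: "('d::finite \<Rightarrow> nat) \<Rightarrow> nat" where
  "mi_fact \<alpha> = (\<Prod>i\<in>UNIV. fact (\<alpha> i))"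

text \<open>Classical derivative d^alpha (order of differentiation irrelevant for smooth functions).\<close>
definition cpartial :: "('d::finite \<Rightarrow> nat) \<Rightarrow> 'd fn \<Rightarrow> 'd fn" where
  "cpartial \<alpha> f = pd_list (SOME is. \<forall>i. count_list is i = \<alpha> i) f"

definition supp :: "'d::finite fn \<Rightarrow> (real^'d) set" where
  "supp f = closure {x. f x \<noteq> 0}"

definition test_fun :: "'d::finite fn \<Rightarrow> bool" where
  "test_fun \<phi> \<longleftrightarrow> compact (supp \<phi>) \<and>
     (\<forall>is. continuous_on UNIV (pd_list is \<phi>) \<and>
        (\<forall>i x. (\<lambda>t::real. pd_list is \<phi> (x + t *\<^sub>R axis i 1)) differentiable (at 0)))"

definition loc_int :: "'d::finite fn \<Rightarrow> bool" where
  "loc_int u \<longleftrightarrow> (\<forall>K. compact K \<longrightarrow> set_integrable lborel K u)"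

definition L2 :: "'d::finite fn \<Rightarrow> bool" where
  "L2 g \<longleftrightarrow> g \<in> borel_measurable lborel \<and> integrable lborel (\<lambda>x. (g x)^2)"

definition weak_deriv :: "('d::finite \<Rightarrow> nat) \<Rightarrow> 'd fn \<Rightarrow> 'd fn \<Rightarrow> bool" where
  "weak_deriv \<alpha> u g \<longleftrightarrow> loc_int u \<and> loc_int g \<and>
     (\<forall>\<phi>. test_fun \<phi> \<longrightarrow>
        (\<integral>x. u x * cpartial \<alpha> \<phi> x \<partial>lborel) = (-1) ^ mi_order \<alpha> * (\<integral>x. g x * \<phi> x \<partial>lborel))"

definition wd :: "('d::finite \<Rightarrow> nat) \<Rightarrow> 'd fn \<Rightarrow> 'd fn" where
  "wd \<alpha> u = (SOME g. weak_deriv \<alpha> u g)"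

text \<open>The space V (elements identified with their continuous representative).\<close>
definition Vsp :: "nat \<Rightarrow> nat \<Rightarrow> 'd::finite fn set" where
  "Vsp k kmin = {v. continuous_on UNIV v \<and> loc_int v \<and>
      (\<forall>\<alpha>::'d \<Rightarrow> nat. kmin \<le> mi_order \<alpha> \<and> mi_order \<alpha> \<le> k \<longrightarrow>
          (\<exists>g. weak_deriv \<alpha> v g \<and> L2 g))}"

definition abil :: "nat \<Rightarrow> nat \<Rightarrow> (nat \<Rightarrow> real) \<Rightarrow> 'd::finite fn \<Rightarrow> 'd fn \<Rightarrow> real" where
  "abil k kmin \<sigma> u v = (\<Sum>l\<in>{kmin..k}. \<sigma> l *
      (\<Sum>\<alpha>\<in>{\<alpha>::'d \<Rightarrow> nat. mi_order \<alpha> = l}.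
         (fact l / real (mi_fact \<alpha>)) * (\<integral>x. wd \<alpha> u x * wd \<alpha> v x \<partial>lborel)))"

definition V0 :: "nat \<Rightarrow> nat \<Rightarrow> nat \<Rightarrow> (nat \<Rightarrow> real^'d) \<Rightarrow> 'd::finite fn set" where
  "V0 k kmin N x = {v \<in> Vsp k kmin. \<forall>n<N. v (x n) = 0}"

definition Vharm :: "nat \<Rightarrow> nat \<Rightarrow> (nat \<Rightarrow> real) \<Rightarrow> nat \<Rightarrow> (nat \<Rightarrow> real^'d)
    \<Rightarrow> (real^'d) set \<Rightarrow> 'd::finite fn set" where
  "Vharm k kmin \<sigma> N x B = {u \<in> Vsp k kmin. (\<forall>n<N. x n \<in> B \<longrightarrow> u (x n) = 0) \<and>
      (\<forall>v \<in> V0 k kmin N x. supp v \<subseteq> B \<longrightarrow> abil k kmin \<sigma> u v = 0)}"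

definition hsemi :: "nat \<Rightarrow> (real^'d) set \<Rightarrow> 'd::finite fn \<Rightarrow> real" where
  "hsemi l B u = sqrt (\<Sum>\<alpha>\<in>{\<alpha>::'d \<Rightarrow> nat. mi_order \<alpha> = l}.
      (fact l / real (mi_fact \<alpha>)) * (LINT y:B|lborel. (wd \<alpha> u y)^2))"

definition enlarge :: "real^'d \<Rightarrow> real^'d \<Rightarrow> real \<Rightarrow> (real^'d::finite) set" where
  "enlarge a b \<delta> = box (a - (\<chi> i. \<delta>)) (b + (\<chi> i. \<delta>))"

definition lin_on :: "'d::finite fn set \<Rightarrow> ('d fn \<Rightarrow> 'd fn) \<Rightarrow> bool" where
  "lin_on S T \<longleftrightarrow> (\<forall>u\<in>S. \<forall>w\<in>S. T (\<lambda>y. u y + w y) = (\<lambda>y. T u y + T w y)) \<and>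
     (\<forall>u\<in>S. \<forall>c::real. T (\<lambda>y. c * u y) = (\<lambda>y. c * T u y))"

definition rank_le :: "'d::finite fn set \<Rightarrow> ('d fn \<Rightarrow> 'd fn) \<Rightarrow> real \<Rightarrow> bool" where
  "rank_le S T r \<longleftrightarrow> (\<exists>m::nat. \<exists>\<phi>::nat \<Rightarrow> 'd fn. real m \<le> r \<and>
     (\<forall>u\<in>S. \<exists>c::nat \<Rightarrow> real. T u = (\<lambda>y. \<Sum>j<m. c j * \<phi> j y)))"

end

(* Restriction is a linear inclusion of V_harm(B^delta) into V_harm(B), so it suffices to find a
   low-rank operator T on X = V_harm(B^delta) itself. Let a and b be the quadratic forms
   sum_l delta^(2l) |.|_l^2 on B^delta and on B. Choose a-orthonormal vectors in X with b > eps greedily.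
   When the process stops, T is the a-orthogonal projection onto their span: it needs no completeness
   of X, and b(u - Tu) <= eps a(u). The number of vectors is bounded by Bessel's inequality, because
     b(u) <= K sum_j f_j(u)^2 + (eps / 2) a(u)
   for the O((1 + diam B / delta)^d) functionals f_j given by the means of the derivatives of order < k
   over the cubes of a grid of mesh size delta / n. This estimate combines the Caccioppoli inequality
   (testing the equation with omega^(2k) u for a cutoff omega bounds the k-th seminorm on B by the lower ones
   on B^(delta/2)) with the Poincare inequality on each cube. The elements of V are handled by mollification;
   their derivatives of order below k_min are obtained as L^2_loc limits by Poincare's inequality. *)
theory Submission
  imports Defs
begin

text \<open>The interpolation points do not disturb the Caccioppoli step: \<open>u\<close> vanishes
  at those inside B^delta, and the cutoff vanishes outside, so omega^(2k) u is an admissible test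
  function whatever the points are. This is why no constant depends on \<open>N\<close> or
  \<open>x\<close>. The exponent 2k is dictated by the Leibniz rule: after up to k derivatives a
  factor omega^k must be left over, so that the mixed terms can be absorbed into the principal term
  omega^(2k) |D^k u|^2.

  The smallness comes from the mesh alone. Poincare on a cube of side delta / n trades order l for
  order l + 1 at the price (delta / n)^2, which up to n^-2 is the ratio of the weights delta^(2l +
  2) and delta^(2l). Hence a large n suffices, no further damping of the weights is called for, and
  C_ssco = 1 can be taken. The value eps = 1 / (4 (k + 1)) comes from passing between sums of
  squared seminorms and sums of seminorms. The bound \<delta>bar enters through Caccioppoli: the
  terms of the bilinear form of order below k scale with fewer powers of 1 / delta than the leading
  one.\<close>

section \<open>Calculus of smooth functions on R^d\<close>

text \<open>Differentiability means total differentiability of every iterated partial derivative.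
  Symmetry of the second partials is part of the predicate: every closure property below carries it
  along, and \<open>pd_list_perm\<close> reads it off.\<close>

definition smooth :: "'d::finite fn \<Rightarrow> bool" where
  "smooth f \<longleftrightarrow> (\<forall>is. (\<forall>x. pd_list is f differentiable (at x)) \<and>
     (\<forall>i j. cpd i (cpd j (pd_list is f)) = cpd j (cpd i (pd_list is f))))"

lemma pd_list_append: "pd_list (is @ js) f = pd_list is (pd_list js f)"
  by (induction "is") auto

text \<open>Closure properties are proved by exhibiting an invariant class \<open>S\<close>, so that
  no formula for derivatives of arbitrary order has to be written down.\<close>

lemma smooth_coinduct:
  assumes "f \<in> S"
    and "\<And>g x. g \<in> S \<Longrightarrow> g differentiable (at x)"
    and "\<And>g i. g \<in> S \<Longrightarrow> cpd i g \<in> S"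
    and "\<And>g i j. g \<in> S \<Longrightarrow> cpd i (cpd j g) = cpd j (cpd i g)"
  shows "smooth f"
proof -
  have "pd_list is f \<in> S" for "is"
    by (induction "is") (auto simp: assms)
  then show ?thesis
    unfolding smooth_def using assms by blast
qed

lemma smooth_pd_list: "smooth f \<Longrightarrow> smooth (pd_list is f)"
  unfolding smooth_def by (metis pd_list_append)

lemma smooth_cpd: "smooth f \<Longrightarrow> smooth (cpd i f)"
  using smooth_pd_list[of f "[i]"] by simp

lemma smooth_differentiable: "smooth f \<Longrightarrow> f differentiable (at x)"
  unfolding smooth_def by (metis pd_list.simps(1))

lemma smooth_commute: "smooth f \<Longrightarrow> cpd i (cpd j f) = cpd j (cpd i f)"
  unfolding smooth_def by (metis pd_list.simps(1))

lemma smooth_continuous: "smooth f \<Longrightarrow> continuous_on S f"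
  by (meson smooth_differentiable differentiable_imp_continuous_within continuous_at_imp_continuous_on)

lemma smooth_measurable: "smooth f \<Longrightarrow> f \<in> borel_measurable borel"
  using smooth_continuous borel_measurable_continuous_onI by blast

lemma has_derivative_line:
  fixes f :: "'d::finite fn"
  assumes "(f has_derivative f') (at (x + s *\<^sub>R v))"
  shows "((\<lambda>t::real. f (x + t *\<^sub>R v)) has_real_derivative f' v) (at s)"
proof -
  have "((\<lambda>t. x + t *\<^sub>R v) has_derivative (\<lambda>t. t *\<^sub>R v)) (at s)"
    by (auto intro!: derivative_eq_intros)
  then have "(f \<circ> (\<lambda>t. x + t *\<^sub>R v) has_derivative f' \<circ> (\<lambda>t. t *\<^sub>R v)) (at s)"
    using assms by (intro diff_chain_at) auto
  moreover have "f' (t *\<^sub>R v) = t * f' v" for t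
    using assms has_derivative_bounded_linear bounded_linear.linear linear_scale by fastforce
  then have eq: "(\<lambda>t. f' (t *\<^sub>R v)) = (*) (f' v)"
    by (simp add: fun_eq_iff mult.commute)
  ultimately show ?thesis
    unfolding has_field_derivative_def o_def eq by simp
qed

lemma cpd_eq:
  fixes f :: "'d::finite fn"
  assumes "(f has_derivative f') (at x)"
  shows "cpd i f x = f' (axis i 1)"
  unfolding cpd_def using has_derivative_line[of f f' x 0 "axis i 1"] assms
  by (simp add: DERIV_imp_deriv)

lemma has_derivative_cpd:
  fixes f :: "'d::finite fn"
  assumes "f differentiable (at x)"
  shows "(f has_derivative (\<lambda>h. \<Sum>i\<in>UNIV. h $ i * cpd i f x)) (at x)"
proof -
  obtain f' where f': "(f has_derivative f') (at x)"
    using assms differentiable_def by blast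
  then have lin: "linear f'" using has_derivative_linear by blast
  have "f' h = (\<Sum>i\<in>UNIV. h $ i * cpd i f x)" for h
  proof -
    have "f' h = f' (\<Sum>i\<in>UNIV. h $ i *\<^sub>R axis i 1)"
      by (metis basis_expansion scalar_mult_eq_scaleR)
    also have "\<dots> = (\<Sum>i\<in>UNIV. h $ i * f' (axis i 1))"
      using lin by (simp add: linear_sum linear_scale)
    finally show ?thesis using cpd_eq[OF f'] by simp
  qed
  then have "f' = (\<lambda>h. \<Sum>i\<in>UNIV. h $ i * cpd i f x)" by auto
  then show ?thesis using f' by simp
qed

lemma sum_axis: "(\<Sum>j\<in>UNIV. axis i 1 $ j * c j) = (c i :: real)"
  by (simp add: axis_def if_distrib[where f="\<lambda>a. a * _"] cong: if_cong)

lemma cpd_line: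
  fixes f :: "'d::finite fn"
  assumes "\<And>x. f differentiable (at x)"
  shows "((\<lambda>t::real. f (x + t *\<^sub>R axis i 1)) has_real_derivative cpd i f (x + s *\<^sub>R axis i 1)) (at s)"
proof -
  have "(f has_derivative (\<lambda>h. \<Sum>j\<in>UNIV. h $ j * cpd j f (x + s *\<^sub>R axis i 1))) (at (x + s *\<^sub>R axis i 1))"
    using has_derivative_cpd assms by blast
  from has_derivative_line[OF this] show ?thesis
    by (simp add: sum_axis)
qed

lemma cpd_const [simp]: "cpd i (\<lambda>_. c) = (\<lambda>_. 0)"
  unfolding cpd_def by simp

lemma cpd_add:
  assumes "\<And>x. f differentiable (at x)" "\<And>x. g differentiable (at x)"
  shows "cpd i (\<lambda>x. f x + g x) = (\<lambda>x. cpd i f x + cpd i g x)"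
proof
  fix x
  note h = has_derivative_cpd[OF assms(1)[of x]] has_derivative_cpd[OF assms(2)[of x]]
  show "cpd i (\<lambda>x. f x + g x) x = cpd i f x + cpd i g x"
    using cpd_eq[OF has_derivative_add[OF h], of i] by (simp add: sum_axis)
qed

lemma cpd_mult:
  assumes "\<And>x. f differentiable (at x)" "\<And>x. g differentiable (at x)"
  shows "cpd i (\<lambda>x. f x * g x) = (\<lambda>x. f x * cpd i g x + cpd i f x * g x)"
proof
  fix x
  note h = has_derivative_cpd[OF assms(1)[of x]] has_derivative_cpd[OF assms(2)[of x]]
  show "cpd i (\<lambda>x. f x * g x) x = f x * cpd i g x + cpd i f x * g x"
    using cpd_eq[OF has_derivative_mult[OF h], of i] by (simp add: sum_axis)
qed

lemma has_derivative_affine: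
  fixes f :: "'d::finite fn"
  assumes "\<And>x. f differentiable (at x)"
  shows "((\<lambda>x. r * f (s *\<^sub>R x + c)) has_derivative (\<lambda>h. \<Sum>i\<in>UNIV. h $ i * (r * s * cpd i f (s *\<^sub>R x + c)))) (at x)"
proof -
  have "((\<lambda>x. s *\<^sub>R x + c) has_derivative (\<lambda>h. s *\<^sub>R h)) (at x)"
    by (auto intro!: derivative_eq_intros)
  from diff_chain_at[OF this has_derivative_cpd[OF assms]]
  have "((\<lambda>x. f (s *\<^sub>R x + c)) has_derivative (\<lambda>h. \<Sum>i\<in>UNIV. (s *\<^sub>R h) $ i * cpd i f (s *\<^sub>R x + c))) (at x)"
    by (simp add: o_def)
  from has_derivative_mult_right[OF this, of r]
  show ?thesis
    by (rule has_derivative_eq_rhs) (auto simp: sum_distrib_left mult_ac)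
qed

lemma cpd_affine:
  fixes f :: "'d::finite fn"
  assumes "\<And>x. f differentiable (at x)"
  shows "cpd i (\<lambda>x. r * f (s *\<^sub>R x + c)) = (\<lambda>x. r * s * cpd i f (s *\<^sub>R x + c))"
proof
  fix x
  show "cpd i (\<lambda>x. r * f (s *\<^sub>R x + c)) x = r * s * cpd i f (s *\<^sub>R x + c)"
    using cpd_eq[OF has_derivative_affine[where f=f, OF assms], where i=i]
    by (simp add: sum_axis)
qed

lemma smooth_affine:
  fixes f :: "'d::finite fn"
  assumes "smooth f"
  shows "smooth (\<lambda>x. r * f (s *\<^sub>R x + c))"
proof (rule smooth_coinduct)
  let ?S = "{g. \<exists>r h. smooth h \<and> g = (\<lambda>x. r * h (s *\<^sub>R x + c))}"
  show "(\<lambda>x. r * f (s *\<^sub>R x + c)) \<in> ?S" using assms by auto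
  fix g x assume "g \<in> ?S"
  then obtain r h where h: "smooth h" and g: "g = (\<lambda>x. r * h (s *\<^sub>R x + c))" by auto
  note d = smooth_differentiable[OF h] smooth_differentiable[OF smooth_cpd[OF h]]
  show "g differentiable (at x)"
    unfolding g differentiable_def using has_derivative_affine[OF d(1)] by blast
  show "cpd i g \<in> ?S" for i
    unfolding g cpd_affine[OF d(1)] using smooth_cpd[OF h] by auto
  show "cpd i (cpd j g) = cpd j (cpd i g)" for i j
    unfolding g cpd_affine[OF d(1)] cpd_affine[OF d(2)] smooth_commute[OF h, of i j] ..
qed

lemma pd_list_affine:
  fixes f :: "'d::finite fn"
  assumes "smooth f"
  shows "pd_list is (\<lambda>x. r * f (s *\<^sub>R x + c)) = (\<lambda>x. r * s ^ length is * pd_list is f (s *\<^sub>R x + c))"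
proof (induction "is")
  case (Cons i "is")
  show ?case
    using cpd_affine[OF smooth_differentiable[OF smooth_pd_list[OF assms]], of i "r * s ^ length is" "is" s c]
    by (simp add: Cons mult_ac)
qed simp

lemma smooth_cmult: "smooth f \<Longrightarrow> smooth (\<lambda>x. r * f x)"
  using smooth_affine[of f r 1 0] by simp

lemma pd_list_cmult: "smooth f \<Longrightarrow> pd_list is (\<lambda>x. r * f x) = (\<lambda>x. r * pd_list is f x)"
  using pd_list_affine[of f "is" r 1 0] by simp

lemma smooth_const [simp]: "smooth (\<lambda>_. c)"
  by (rule smooth_coinduct[where S="range (\<lambda>c _. c)"]) auto

lemma smooth_add:
  assumes "smooth f" "smooth g"
  shows "smooth (\<lambda>x. f x + g x)"
proof (rule smooth_coinduct)
  let ?S = "{h. \<exists>f g. smooth f \<and> smooth g \<and> h = (\<lambda>x. f x + g x)}"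
  show "(\<lambda>x. f x + g x) \<in> ?S" using assms by auto
  fix h x assume "h \<in> ?S"
  then obtain f g where fg: "smooth f" "smooth g" and h: "h = (\<lambda>x. f x + g x)" by auto
  note d = smooth_differentiable
  show "h differentiable (at x)" unfolding h using d[OF fg(1)] d[OF fg(2)] by (rule differentiable_add)
  show "cpd i h \<in> ?S" for i
    unfolding h cpd_add[OF d[OF fg(1)] d[OF fg(2)]] using smooth_cpd[OF fg(1)] smooth_cpd[OF fg(2)] by blast
  show "cpd i (cpd j h) = cpd j (cpd i h)" for i j
    unfolding h cpd_add[OF d[OF fg(1)] d[OF fg(2)]] cpd_add[OF d[OF smooth_cpd[OF fg(1)]] d[OF smooth_cpd[OF fg(2)]]]
      smooth_commute[OF fg(1), of i j] smooth_commute[OF fg(2), of i j] ..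
qed

lemma pd_list_add:
  assumes "smooth f" "smooth g"
  shows "pd_list is (\<lambda>x. f x + g x) = (\<lambda>x. pd_list is f x + pd_list is g x)"
proof (induction "is")
  case (Cons i "is")
  show ?case
    using cpd_add[OF smooth_differentiable[OF smooth_pd_list[OF assms(1)]] smooth_differentiable[OF smooth_pd_list[OF assms(2)]]]
    by (simp add: Cons)
qed simp

lemma smooth_diff: "smooth f \<Longrightarrow> smooth g \<Longrightarrow> smooth (\<lambda>x. f x - g x)"
  using smooth_add[OF _ smooth_cmult[of g "-1"], of f] by simp

lemma pd_list_diff:
  "smooth f \<Longrightarrow> smooth g \<Longrightarrow> pd_list is (\<lambda>x. f x - g x) = (\<lambda>x. pd_list is f x - pd_list is g x)"
  using pd_list_add[OF _ smooth_cmult[of g "-1"], of f] pd_list_cmult[of g _ "-1"] by simp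

text \<open>The invariant class for \<open>smooth_mult\<close>. Single products are not closed under
  \<open>cpd\<close>, finite sums of products are.\<close>

inductive smooth_products :: "'d::finite fn \<Rightarrow> bool" where
  mult: "smooth f \<Longrightarrow> smooth g \<Longrightarrow> smooth_products (\<lambda>x. f x * g x)"
| add: "smooth_products f \<Longrightarrow> smooth_products g \<Longrightarrow> smooth_products (\<lambda>x. f x + g x)"

text \<open>Differentiability of \<open>cpd i h\<close> is carried through the induction because the
  sum case has to differentiate \<open>cpd j f x + cpd j g x\<close> once more to compare the mixed
  second partials.\<close>

lemma smooth_products_step:
  assumes "smooth_products h"
  shows "(\<forall>x. h differentiable (at x)) \<and> (\<forall>i. smooth_products (cpd i h) \<and> (\<forall>x. cpd i h differentiable (at x))) \<and>
      (\<forall>i j. cpd i (cpd j h) = cpd j (cpd i h))"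
  using assms
proof induction
  case (mult f g)
  note d = smooth_differentiable
  note s = mult smooth_cpd[OF mult(1)] smooth_cpd[OF mult(2)]
  have 1: "cpd i (\<lambda>x. f x * g x) = (\<lambda>x. f x * cpd i g x + cpd i f x * g x)" for i
    by (rule cpd_mult) (use s d in auto)
  have 2: "cpd i (\<lambda>x. f x * cpd j g x) = (\<lambda>x. f x * cpd i (cpd j g) x + cpd i f x * cpd j g x)" for i j
    by (rule cpd_mult) (use s d in auto)
  have 3: "cpd i (\<lambda>x. cpd j f x * g x) = (\<lambda>x. cpd j f x * cpd i g x + cpd i (cpd j f) x * g x)" for i j
    by (rule cpd_mult) (use s d in auto)
  have 4: "cpd i (cpd j (\<lambda>x. f x * g x)) = (\<lambda>x. (f x * cpd i (cpd j g) x + cpd i f x * cpd j g x) + (cpd j f x * cpd i g x + cpd i (cpd j f) x * g x))" for i j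
  proof -
    have "\<And>x. (\<lambda>x. f x * cpd j g x) differentiable (at x)" "\<And>x. (\<lambda>x. cpd j f x * g x) differentiable (at x)"
      by (intro differentiable_mult d s)+
    then show ?thesis unfolding 1 by (simp add: cpd_add 2 3)
  qed
  have c: "cpd i (cpd j (\<lambda>x. f x * g x)) = cpd j (cpd i (\<lambda>x. f x * g x))" for i j
    unfolding 4 smooth_commute[OF mult(1), of i j] smooth_commute[OF mult(2), of i j] by (simp add: algebra_simps)
  have "smooth_products (cpd i (\<lambda>x. f x * g x))" for i
    unfolding 1 using s by (intro smooth_products.intros) auto
  moreover have "cpd i (\<lambda>x. f x * g x) differentiable (at x)" for i x
    unfolding 1 using s d by (intro differentiable_add differentiable_mult) auto
  ultimately show ?case using c s d by (auto intro!: differentiable_mult)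
next
  case (add f g)
  have 1: "cpd i (\<lambda>x. f x + g x) = (\<lambda>x. cpd i f x + cpd i g x)" for i
    by (rule cpd_add) (use add in auto)
  have 2: "cpd i (\<lambda>x. cpd j f x + cpd j g x) = (\<lambda>x. cpd i (cpd j f) x + cpd i (cpd j g) x)" for i j
    by (rule cpd_add) (use add in auto)
  show ?case unfolding 1 2 using add by (auto intro!: smooth_products.intros)
qed

lemma smooth_mult:
  assumes "smooth f" "smooth g"
  shows "smooth (\<lambda>x. f x * g x)"
proof (rule smooth_coinduct[where S="Collect smooth_products"])
  show "(\<lambda>x. f x * g x) \<in> Collect smooth_products" using smooth_products.mult[OF assms] by simp
  fix h x assume "h \<in> Collect smooth_products"
  then have h: "smooth_products h" by simp
  note step = smooth_products_step[OF h]
  show "h differentiable (at x)" by (rule conjunct1[OF step, rule_format])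
  show "cpd i h \<in> Collect smooth_products" for i
    using conjunct1[OF conjunct2[OF step], rule_format, of i] by simp
  show "cpd i (cpd j h) = cpd j (cpd i h)" for i j
    by (rule conjunct2[OF conjunct2[OF step], rule_format])
qed

lemma smooth_prod: "finite A \<Longrightarrow> (\<And>i. i \<in> A \<Longrightarrow> smooth (f i)) \<Longrightarrow> smooth (\<lambda>x. \<Prod>i\<in>A. f i x)"
proof (induction A rule: finite_induct)
  case (insert i A)
  then have "smooth (\<lambda>x. f i x * (\<Prod>i\<in>A. f i x))" by (intro smooth_mult) auto
  then show ?case using insert by simp
qed simp

lemma smooth_power: "smooth f \<Longrightarrow> smooth (\<lambda>x. f x ^ n)"
proof (induction n)
  case (Suc n)
  then have "smooth (\<lambda>x. f x * f x ^ n)" by (intro smooth_mult) auto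
  then show ?case by simp
qed simp

section \<open>Reordering derivatives and the Leibniz rule\<close>

lemma pd_list_move:
  assumes "smooth f" shows "pd_list (xs @ i # ys) f = pd_list (i # xs @ ys) f"
  using smooth_commute[OF smooth_pd_list[OF assms]]
  by (induction xs) auto

text \<open>The bridge from lists of directions to multi-indices: \<open>cpartial\<close> picks its
  list by \<open>SOME\<close>, and for smooth functions the choice does not matter.\<close>

lemma pd_list_perm:
  assumes "smooth f" "\<And>i. count_list is i = count_list js i"
  shows "pd_list is f = pd_list js f"
  using assms(2)
proof (induction "is" arbitrary: js)
  case Nil
  then have "\<forall>i. i \<notin> set js" by (metis count_list.simps(1) count_list_0_iff)
  then show ?case by simp
next
  case (Cons i "is")
  then have "count_list js i \<noteq> 0" by (metis count_list.simps(2) Suc_eq_plus1 nat.distinct(1))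
  then have "i \<in> set js" by (metis count_notin)
  then obtain xs ys where js: "js = xs @ i # ys" by (meson split_list)
  have "count_list is j = count_list (xs @ ys) j" for j
    using Cons.prems[of j] unfolding js by (auto split: if_splits)
  then have "pd_list is f = pd_list (xs @ ys) f" using Cons.IH by blast
  then show ?case unfolding js pd_list_move[OF assms(1)] by simp
qed

text \<open>The splittings of a list into two complementary subsequences: the summands of the Leibniz rule.\<close>
fun splits :: "'a list \<Rightarrow> ('a list \<times> 'a list) list" where
  "splits [] = [([], [])]"
| "splits (i # is) = map (\<lambda>(a, b). (a, i # b)) (splits is) @ map (\<lambda>(a, b). (i # a, b)) (splits is)"

text \<open>The Leibniz terms in which at least one derivative falls on the first factor. Separating
  them from \<open>([], is)\<close> isolates the principal term in the Caccioppoli estimate.\<close>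

fun proper_splits :: "'a list \<Rightarrow> ('a list \<times> 'a list) list" where
  "proper_splits [] = []"
| "proper_splits (i # is) = map (\<lambda>(a, b). (a, i # b)) (proper_splits is) @ map (\<lambda>(a, b). (i # a, b)) (splits is)"

lemma sum_list_splits:
  fixes F :: "_ \<Rightarrow> real"
  shows "(\<Sum>p\<leftarrow>splits is. F p) = F ([], is) + (\<Sum>p\<leftarrow>proper_splits is. F p)"
proof (induction "is" arbitrary: F)
  case (Cons i "is")
  have "(\<Sum>p\<leftarrow>splits is. F (case p of (a, b) \<Rightarrow> (a, i # b))) = F ([], i # is) + (\<Sum>p\<leftarrow>proper_splits is. F (case p of (a, b) \<Rightarrow> (a, i # b)))"
    using Cons[of "\<lambda>p. F (case p of (a, b) \<Rightarrow> (a, i # b))"] by simp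
  then show ?case by (simp add: o_def)
qed simp

lemma splits_length: "(a, b) \<in> set (splits is) \<Longrightarrow> length a + length b = length is"
  by (induction "is" arbitrary: a b) auto

lemma proper_splits_length: "(a, b) \<in> set (proper_splits is) \<Longrightarrow> length a + length b = length is \<and> a \<noteq> []"
  by (induction "is" arbitrary: a b) (auto dest: splits_length)

lemma length_splits: "length (splits is) = 2 ^ length is"
  by (induction "is") auto

lemma length_proper_splits: "length (proper_splits is) \<le> 2 ^ length is"
  by (induction "is") (auto simp: length_splits)

lemma pd_list_mult:
  assumes "smooth f" "smooth g"
  shows "pd_list is (\<lambda>x. f x * g x) = (\<lambda>x. \<Sum>(a, b)\<leftarrow>splits is. pd_list a f x * pd_list b g x)"
proof (induction "is")
  case (Cons i "is")
  have d: "\<And>x. (\<lambda>x. \<Sum>(a, b)\<leftarrow>L. pd_list a f x * pd_list b g x) differentiable (at x)" for L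
  proof (induction L)
    case (Cons p L)
    obtain a b where "p = (a, b)" by force
    then show ?case
      by simp (intro differentiable_add differentiable_mult Cons smooth_differentiable smooth_pd_list assms)
  qed simp
  have m: "cpd i (\<lambda>x. pd_list a f x * pd_list b g x) = (\<lambda>x. pd_list a f x * pd_list (i # b) g x + pd_list (i # a) f x * pd_list b g x)" for a b
    by (subst cpd_mult) (auto intro!: smooth_differentiable smooth_pd_list assms)
  have "cpd i (\<lambda>x. \<Sum>(a, b)\<leftarrow>L. pd_list a f x * pd_list b g x) =
     (\<lambda>x. (\<Sum>(a, b)\<leftarrow>L. pd_list a f x * pd_list (i # b) g x) + (\<Sum>(a, b)\<leftarrow>L. pd_list (i # a) f x * pd_list b g x))" for L
  proof (induction L)
    case (Cons p L)
    obtain a b where p: "p = (a, b)" by force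
    have "cpd i (\<lambda>x. pd_list a f x * pd_list b g x + (\<Sum>(a, b)\<leftarrow>L. pd_list a f x * pd_list b g x)) =
       (\<lambda>x. cpd i (\<lambda>x. pd_list a f x * pd_list b g x) x + cpd i (\<lambda>x. (\<Sum>(a, b)\<leftarrow>L. pd_list a f x * pd_list b g x)) x)"
      by (rule cpd_add; intro d differentiable_mult smooth_differentiable smooth_pd_list assms)
    then show ?case
      by (simp add: p Cons m algebra_simps)
  qed simp
  from this[of "splits is"] show ?case
    by (simp add: Cons o_def split_def)
qed simp

section \<open>A smooth bump\<close>

text \<open>The flat function exp(-1/t), extended by zero to t \<le> 0, with a polynomial in 1/t as
  a factor. The factor makes the family closed under differentiation.\<close>

definition expfun :: "real poly \<Rightarrow> real \<Rightarrow> real" where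
  "expfun p t = (if t > 0 then poly p (1 / t) * exp (- (1 / t)) else 0)"

lemma poly_exp_tendsto_0: "((\<lambda>s::real. poly p s * exp (- s)) \<longlongrightarrow> 0) at_top"
proof -
  have "((\<lambda>s::real. \<Sum>i\<le>degree p. coeff p i * (s ^ i / exp s)) \<longlongrightarrow> (\<Sum>i\<le>degree p. coeff p i * 0)) at_top"
    by (intro tendsto_sum tendsto_mult tendsto_const tendsto_power_div_exp_0)
  moreover have "poly p s * exp (- s) = (\<Sum>i\<le>degree p. coeff p i * (s ^ i / exp s))" for s
    by (simp add: poly_altdef sum_distrib_right exp_minus divide_inverse mult.assoc)
  ultimately show ?thesis by simp
qed

text \<open>For t > 0 this is the product rule, with 1/t^2 appearing as the monomial. At t = 0 the
  right difference quotient becomes s p(s) exp(-s) with s = 1/t tending to infinity, hence tends to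
  0.\<close>

lemma DERIV_expfun: "(expfun p has_real_derivative expfun (monom 1 2 * (p - pderiv p)) t) (at t)"
proof -
  consider "t > 0" | "t < 0" | "t = 0" by linarith
  then show ?thesis
  proof cases
    case 1
    have "((\<lambda>t. poly p (1 / t) * exp (- (1 / t))) has_real_derivative expfun (monom 1 2 * (p - pderiv p)) t) (at t)"
      using 1 by (auto intro!: derivative_eq_intros poly_DERIV[THEN DERIV_chain2]
        simp: expfun_def poly_monom field_simps power2_eq_square)
    moreover have "eventually (\<lambda>x. x > 0) (nhds t)" using eventually_nhds_in_open[of "{0<..}" t] 1 by simp
    ultimately show ?thesis
      by (subst DERIV_cong_ev[OF refl _ refl]) (auto elim: eventually_mono simp: expfun_def)
  next
    case 2
    have "eventually (\<lambda>x. x < 0) (nhds t)" using eventually_nhds_in_open[of "{..<0}" t] 2 by simp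
    then show ?thesis
      using 2 by (subst DERIV_cong_ev[OF refl _ refl, where g="\<lambda>_. 0"]) (auto elim: eventually_mono simp: expfun_def)
  next
    case 3
    have "((\<lambda>h. expfun p h / h) \<longlongrightarrow> 0) (at_right 0)"
    proof -
      have "((\<lambda>s. poly (p * monom 1 1) s * exp (- s)) \<longlongrightarrow> 0) at_top" by (rule poly_exp_tendsto_0)
      then have "((\<lambda>h::real. poly (p * monom 1 1) (inverse h) * exp (- inverse h)) \<longlongrightarrow> 0) (at_right 0)"
        by (rule filterlim_compose[OF _ filterlim_inverse_at_top_right])
      then show ?thesis
        by (rule Lim_transform_eventually)
           (auto simp: eventually_at_filter expfun_def poly_monom field_simps)
    qed
    moreover have "((\<lambda>h. expfun p h / h) \<longlongrightarrow> 0) (at_left 0)"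
      by (rule tendsto_eventually) (auto simp: eventually_at_filter expfun_def)
    ultimately have "((\<lambda>h. expfun p h / h) \<longlongrightarrow> 0) (at 0)"
      by (simp add: filterlim_at_split)
    then show ?thesis
      unfolding 3 by (simp add: DERIV_def expfun_def)
  qed
qed

lemma smooth_expfun_coord:
  fixes i :: "'d::finite"
  shows "smooth (\<lambda>x. expfun p (1 + s * x $ i))"
proof (rule smooth_coinduct)
  let ?F = "\<lambda>c p (x::real^'d). c * expfun p (1 + s * x $ i)"
  let ?S = "{g. \<exists>c p. g = ?F c p}"
  have D: "(?F c p has_derivative (\<lambda>h. h $ i * ?F (c * s) (monom 1 2 * (p - pderiv p)) x)) (at x)" for c p x
  proof -
    have "((\<lambda>x::real^'d. 1 + s * x $ i) has_derivative (\<lambda>h. s * h $ i)) (at x)"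
      by (auto intro!: derivative_eq_intros bounded_linear_imp_has_derivative bounded_linear_vec_nth)
    from diff_chain_at[OF this DERIV_expfun[unfolded has_field_derivative_def]]
    have "((\<lambda>x. expfun p (1 + s * x $ i)) has_derivative
        (\<lambda>h. expfun (monom 1 2 * (p - pderiv p)) (1 + s * x $ i) * (s * h $ i))) (at x)"
      by (simp add: o_def)
    from has_derivative_mult_right[OF this, of c] show ?thesis
      by (rule has_derivative_eq_rhs) (auto simp: mult_ac)
  qed
  \<comment> \<open>A partial derivative in another direction vanishes. It stays in the class as the
    member with coefficient 0.\<close>
  have C: "cpd j (?F c p) = ?F (if i = j then c * s else 0) (monom 1 2 * (p - pderiv p))" for c p j
    using cpd_eq[OF D] by (fastforce simp: axis_def)
  show "(\<lambda>x. expfun p (1 + s * x $ i)) \<in> ?S" by (auto intro!: exI[of _ 1] exI[of _ p])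
  fix g x assume "g \<in> ?S"
  then obtain c p where g: "g = ?F c p" by auto
  show "g differentiable (at x)" unfolding g differentiable_def using D by blast
  show "cpd j g \<in> ?S" for j unfolding g C by blast
  show "cpd j (cpd l g) = cpd l (cpd j g)" for j l unfolding g C by auto
qed

text \<open>A product of one-dimensional bumps supported in |x_i| \<le> 1/d. The Euclidean norm is
  at most the l1 norm, so the support lies in the unit ball.\<close>

definition bump :: "'d::finite fn" where
  "bump x = (\<Prod>i\<in>UNIV. expfun 1 (1 + (- real CARD('d)) * x $ i) * expfun 1 (1 + real CARD('d) * x $ i))"

lemma smooth_bump: "smooth (bump :: 'd::finite fn)"
  unfolding bump_def[abs_def] by (intro smooth_prod smooth_mult smooth_expfun_coord) auto

lemma bump_nonneg: "bump x \<ge> 0"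
  unfolding bump_def by (intro prod_nonneg) (auto simp: expfun_def)

lemma bump_pos: "bump 0 > 0"
  unfolding bump_def by (intro prod_pos) (auto simp: expfun_def)

lemma bump_eq_0:
  fixes x :: "real^'d::finite"
  assumes "norm x > 1" shows "bump x = 0"
proof -
  have "\<exists>i. \<bar>x $ i\<bar> * real CARD('d) > 1"
  proof (rule ccontr)
    assume "\<nexists>i. \<bar>x $ i\<bar> * real CARD('d) > 1"
    then have "\<bar>x $ i\<bar> \<le> 1 / real CARD('d)" for i by (simp add: field_simps not_less)
    then have "(\<Sum>i\<in>UNIV. \<bar>x $ i\<bar>) \<le> (\<Sum>i\<in>(UNIV::'d set). 1 / real CARD('d))" by (intro sum_mono)
    then show False using norm_le_l1_cart[of x] assms by simp
  qed
  then obtain i where i: "\<bar>x $ i\<bar> * real CARD('d) > 1" by blast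
  then have "expfun 1 (1 + (- real CARD('d)) * x $ i) * expfun 1 (1 + real CARD('d) * x $ i) = 0"
    by (cases "x $ i \<ge> 0") (auto simp: expfun_def mult.commute)
  then show ?thesis unfolding bump_def by (metis (mono_tags) finite_class.finite_UNIV UNIV_I prod_zero)
qed

section \<open>Affine changes of variables in Lebesgue integrals\<close>

lemma nn_integral_affine:
  fixes f :: "'a::euclidean_space \<Rightarrow> ennreal"
  assumes [measurable]: "f \<in> borel_measurable borel" and "c \<noteq> 0"
  shows "(\<integral>\<^sup>+x. f x \<partial>lborel) = ennreal (\<bar>c\<bar> ^ DIM('a)) * (\<integral>\<^sup>+x. f (t + c *\<^sub>R x) \<partial>lborel)"
  by (subst lborel_affine[OF assms(2), of t])
     (simp add: nn_integral_density nn_integral_distr nn_integral_cmult)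

lemma integrable_affine:
  fixes f :: "'a::euclidean_space \<Rightarrow> real"
  assumes f: "integrable lborel f" and "c \<noteq> 0"
  shows "integrable lborel (\<lambda>x. f (t + c *\<^sub>R x))"
  using f f[THEN borel_measurable_integrable] assms(2) unfolding integrable_iff_bounded
  by (subst (asm) nn_integral_affine[where c=c and t=t]) (auto simp: ennreal_mult_less_top)

lemma integral_affine:
  fixes f :: "'a::euclidean_space \<Rightarrow> real"
  assumes f: "integrable lborel f" and c: "c \<noteq> 0"
  shows "(\<integral>x. f x \<partial>lborel) = \<bar>c\<bar> ^ DIM('a) * (\<integral>x. f (t + c *\<^sub>R x) \<partial>lborel)"
proof -
  have [measurable]: "f \<in> borel_measurable borel" using f by simp
  show ?thesis
    using integrable_affine[OF f c, of t]
    by (subst lborel_affine[OF c, of t]) (simp add: integral_density integral_distr)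
qed

lemma integrable_translate:
  fixes f :: "'a::euclidean_space \<Rightarrow> real"
  shows "integrable lborel f \<Longrightarrow> integrable lborel (\<lambda>x. f (x + t))"
  using integrable_affine[of f 1 t] by (simp add: add.commute)

lemma integral_translate:
  fixes f :: "'a::euclidean_space \<Rightarrow> real"
  shows "integrable lborel f \<Longrightarrow> (\<integral>x. f (x + t) \<partial>lborel) = (\<integral>x. f x \<partial>lborel)"
  using integral_affine[of f 1 t] by (simp add: add.commute)

section \<open>Continuity of translations\<close>

text \<open>The positive part of 1_U(x) - 1_U(x + z) tends to 0 pointwise, by openness at points of
  \<open>U\<close> and trivially elsewhere, and it is dominated by 1_U. A function and its translate
  have equal integrals, so the L1 distance is twice the integral of this positive part.\<close>

lemma translation_continuous_open:
  fixes U :: "'a::euclidean_space set"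
  assumes U: "open U" "emeasure lborel U < \<infinity>" and z: "z \<longlonglongrightarrow> 0"
  shows "(\<lambda>n. \<integral>x. \<bar>indicator U (x + z n) - indicator U x\<bar> \<partial>lborel) \<longlonglongrightarrow> (0::real)"
proof -
  let ?f = "indicator U :: 'a \<Rightarrow> real"
  have [measurable]: "U \<in> sets borel" using U by simp
  have i: "integrable lborel ?f" using U by simp
  note it = integrable_translate[OF i]
  have ib: "integrable lborel (\<lambda>x. max 0 (?f x - ?f (x + t)))" for t
    by (rule Bochner_Integration.integrable_bound[OF i]) (auto simp: indicator_def)
  have eq: "(\<integral>x. \<bar>?f (x + t) - ?f x\<bar> \<partial>lborel) = 2 * (\<integral>x. max 0 (?f x - ?f (x + t)) \<partial>lborel)" for t
  proof -
    have "(\<integral>x. \<bar>?f (x + t) - ?f x\<bar> \<partial>lborel) = (\<integral>x. (?f (x + t) - ?f x) + 2 * max 0 (?f x - ?f (x + t)) \<partial>lborel)"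
      by (rule Bochner_Integration.integral_cong) (auto simp: max_def)
    also have "\<dots> = ((\<integral>x. ?f (x + t) \<partial>lborel) - (\<integral>x. ?f x \<partial>lborel)) + 2 * (\<integral>x. max 0 (?f x - ?f (x + t)) \<partial>lborel)"
      using i it ib by (subst Bochner_Integration.integral_add) auto
    finally show ?thesis using integral_translate[OF i] by simp
  qed
  have "(\<lambda>n. \<integral>x. max 0 (?f x - ?f (x + z n)) \<partial>lborel) \<longlonglongrightarrow> (\<integral>x. 0 \<partial>(lborel::'a measure))"
  proof (rule integral_dominated_convergence[where w="?f"])
    show "AE x in lborel. (\<lambda>n. max 0 (?f x - ?f (x + z n))) \<longlonglongrightarrow> 0"
    proof (rule AE_I2, rule tendsto_eventually)
      fix x :: 'a
      show "\<forall>\<^sub>F n in sequentially. max 0 (?f x - ?f (x + z n)) = 0"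
      proof (cases "x \<in> U")
        case True
        have "(\<lambda>n. x + z n) \<longlonglongrightarrow> x + 0" by (intro tendsto_intros z)
        then have "\<forall>\<^sub>F n in sequentially. x + z n \<in> U"
          using True U(1) topological_tendstoD by fastforce
        then show ?thesis by eventually_elim (auto simp: indicator_def)
      qed (auto simp: indicator_def)
    qed
  qed (use i in \<open>auto simp: indicator_def\<close>)
  then show ?thesis unfolding eq by (auto intro: tendsto_mult_right_zero)
qed

lemma tendsto_0_real_approx:
  fixes a :: "nat \<Rightarrow> real"
  assumes nn: "\<And>n. a n \<ge> 0"
    and "\<And>e. e > 0 \<Longrightarrow> \<exists>b. b \<longlonglongrightarrow> 0 \<and> (\<forall>n. a n \<le> b n + e)"
  shows "a \<longlonglongrightarrow> 0"
proof (rule LIMSEQ_I)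
  fix r :: real assume "0 < r"
  then obtain b where b: "b \<longlonglongrightarrow> 0" "\<forall>n. a n \<le> b n + r / 2" using assms(2)[of "r / 2"] by auto
  have "\<forall>\<^sub>F n in sequentially. b n < r / 2" using order_tendstoD(2)[OF b(1), of "r / 2"] \<open>0 < r\<close> by simp
  then obtain N where N: "\<forall>n\<ge>N. b n < r / 2" by (auto simp: eventually_sequentially)
  show "\<exists>no. \<forall>n\<ge>no. norm (a n - 0) < r"
  proof (intro exI allI impI)
    fix n assume "N \<le> n"
    then have "b n < r / 2" "a n \<le> b n + r / 2" using b(2) N by auto
    then show "norm (a n - 0) < r" using nn[of n] by simp
  qed
qed

text \<open>Translations preserve the L1 norm, so by \<open>step\<close> the property survives L1
  approximation. It passes from open sets to measurable sets of finite measure by outer regularity,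
  and from there to all integrable functions.\<close>

lemma translation_continuous_L1:
  fixes f :: "'a::euclidean_space \<Rightarrow> real"
  assumes f: "integrable lborel f" and z: "z \<longlonglongrightarrow> 0"
  shows "(\<lambda>n. \<integral>x. \<bar>f (x + z n) - f x\<bar> \<partial>lborel) \<longlonglongrightarrow> 0"
proof -
  have step: "(\<integral>x. \<bar>f (x + t) - f x\<bar> \<partial>lborel) \<le> (\<integral>x. \<bar>g (x + t) - g x\<bar> \<partial>lborel) + 2 * (\<integral>x. \<bar>f x - g x\<bar> \<partial>lborel)"
    if i: "integrable lborel f" "integrable lborel g" for f g :: "'a \<Rightarrow> real" and t
  proof -
    have d: "integrable lborel (\<lambda>x. \<bar>f x - g x\<bar>)" using i by auto
    have "(\<integral>x. \<bar>f (x + t) - f x\<bar> \<partial>lborel) \<le> (\<integral>x. \<bar>g (x + t) - g x\<bar> + (\<bar>f (x + t) - g (x + t)\<bar> + \<bar>f x - g x\<bar>) \<partial>lborel)"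
      using i integrable_translate[OF i(1)] integrable_translate[OF i(2)] by (intro integral_mono) auto
    also have "\<dots> = (\<integral>x. \<bar>g (x + t) - g x\<bar> \<partial>lborel) + ((\<integral>x. \<bar>f (x + t) - g (x + t)\<bar> \<partial>lborel) + (\<integral>x. \<bar>f x - g x\<bar> \<partial>lborel))"
      using i integrable_translate[OF i(1)] integrable_translate[OF i(2)] by simp
    finally show ?thesis using integral_translate[OF d] by simp
  qed
  show ?thesis using f
  proof (induction rule: integrable_induct)
    case (base A c)
    then have [measurable]: "A \<in> sets borel" by simp
    have "(\<lambda>n. \<integral>x. \<bar>indicator A (x + z n) - indicator A x\<bar> \<partial>lborel) \<longlonglongrightarrow> (0::real)"
    proof (rule tendsto_0_real_approx)
      fix e :: real assume "e > 0"
      obtain U where U: "open U" "A \<subseteq> U" "emeasure lborel (U - A) < ennreal (e / 2)"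
        using outer_regular_lborel[of A "e / 2"] base \<open>e > 0\<close> by auto
      then have [measurable]: "U \<in> sets borel" by simp
      have "emeasure lborel U \<le> emeasure lborel A + emeasure lborel (U - A)"
        using emeasure_subadditive[of A lborel "U - A"] U(2) base by (simp add: Un_absorb1)
      also have "\<dots> < \<infinity>" using base U(3) by (auto simp: less_top[symmetric] ennreal_add_eq_top)
      finally have fU: "emeasure lborel U < \<infinity>" .
      have iA: "integrable lborel (indicator A :: 'a \<Rightarrow> real)" "integrable lborel (indicator U :: 'a \<Rightarrow> real)" using base fU by auto
      have "(\<integral>x. \<bar>indicator A x - indicator U x :: real\<bar> \<partial>lborel) = (\<integral>x. indicator (U - A) x \<partial>(lborel :: 'a measure))"
        by (rule Bochner_Integration.integral_cong) (use U(2) in \<open>auto simp: indicator_def\<close>)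
      also have "\<dots> = measure lborel (U - A)" by simp
      also have "\<dots> \<le> e / 2" using U(3) \<open>e > 0\<close> unfolding measure_def by (intro enn2real_leI) auto
      finally have *: "2 * (\<integral>x. \<bar>indicator A x - indicator U x :: real\<bar> \<partial>lborel) \<le> e" by simp
      show "\<exists>b. b \<longlonglongrightarrow> 0 \<and> (\<forall>n. (\<integral>x. \<bar>indicator A (x + z n) - indicator A x\<bar> \<partial>lborel) \<le> b n + e)"
      proof (intro exI conjI allI)
        show "(\<lambda>n. \<integral>x. \<bar>indicator U (x + z n) - indicator U x :: real\<bar> \<partial>lborel) \<longlonglongrightarrow> 0"
          by (rule translation_continuous_open[OF U(1) fU z])
        show "(\<integral>x. \<bar>indicator A (x + z n) - indicator A x\<bar> \<partial>lborel) \<le> (\<integral>x. \<bar>indicator U (x + z n) - indicator U x :: real\<bar> \<partial>lborel) + e" for n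
          using step[OF iA, of "z n"] * by linarith
      qed
    qed auto
    from tendsto_mult_right_zero[OF this, of "\<bar>c\<bar>"]
    have "(\<lambda>n. \<integral>x. \<bar>c\<bar> * \<bar>indicator A (x + z n) - indicator A x\<bar> \<partial>lborel) \<longlonglongrightarrow> 0" by simp
    moreover have eq: "\<bar>indicator A y *\<^sub>R c - indicator A x *\<^sub>R c\<bar> = \<bar>c\<bar> * \<bar>indicator A y - indicator A x\<bar>" for x y :: 'a
      by (metis abs_mult mult.commute left_diff_distrib real_scaleR_def)
    ultimately show ?case by (simp only: eq)
  next
    case (add f g)
    show ?case
    proof (rule tendsto_sandwich[OF _ _ tendsto_const tendsto_add_zero[OF add(3,4)]])
      show "\<forall>\<^sub>F n in sequentially. (\<integral>x. \<bar>f (x + z n) + g (x + z n) - (f x + g x)\<bar> \<partial>lborel)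
         \<le> (\<integral>x. \<bar>f (x + z n) - f x\<bar> \<partial>lborel) + (\<integral>x. \<bar>g (x + z n) - g x\<bar> \<partial>lborel)"
      proof (intro always_eventually allI)
        fix n
        note i = add(1,2) integrable_translate[OF add(1), of "z n"] integrable_translate[OF add(2), of "z n"]
        have "(\<integral>x. \<bar>f (x + z n) + g (x + z n) - (f x + g x)\<bar> \<partial>lborel) \<le> (\<integral>x. \<bar>f (x + z n) - f x\<bar> + \<bar>g (x + z n) - g x\<bar> \<partial>lborel)"
          using i by (intro integral_mono) auto
        also have "\<dots> = (\<integral>x. \<bar>f (x + z n) - f x\<bar> \<partial>lborel) + (\<integral>x. \<bar>g (x + z n) - g x\<bar> \<partial>lborel)"
          using i by (intro Bochner_Integration.integral_add) auto
        finally show "(\<integral>x. \<bar>f (x + z n) + g (x + z n) - (f x + g x)\<bar> \<partial>lborel)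
         \<le> (\<integral>x. \<bar>f (x + z n) - f x\<bar> \<partial>lborel) + (\<integral>x. \<bar>g (x + z n) - g x\<bar> \<partial>lborel)" .
      qed
    qed auto
  next
    case (lim f s)
    have "(\<lambda>i. \<integral>x. \<bar>f x - s i x\<bar> \<partial>lborel) \<longlonglongrightarrow> (\<integral>x. 0 \<partial>(lborel :: 'a measure))"
    proof (rule integral_dominated_convergence[where w="\<lambda>x. 3 * norm (f x)"])
      show "AE x in lborel. (\<lambda>i. \<bar>f x - s i x\<bar>) \<longlonglongrightarrow> 0"
      proof (rule AE_I2)
        fix x :: 'a
        have "(\<lambda>i. s i x) \<longlonglongrightarrow> f x" using lim(2) by simp
        from tendsto_rabs[OF tendsto_diff[OF tendsto_const this, of "f x"]]
        show "(\<lambda>i. \<bar>f x - s i x\<bar>) \<longlonglongrightarrow> 0" by simp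
      qed
      show "AE x in lborel. norm \<bar>f x - s i x\<bar> \<le> 3 * norm (f x)" for i
      proof (rule AE_I2)
        fix x :: 'a
        have "\<bar>s i x\<bar> \<le> 2 * \<bar>f x\<bar>" using lim(3)[of x i] by simp
        then show "norm \<bar>f x - s i x\<bar> \<le> 3 * norm (f x)" by simp
      qed
    qed (use lim in auto)
    then have l0: "(\<lambda>i. \<integral>x. \<bar>f x - s i x\<bar> \<partial>lborel) \<longlonglongrightarrow> 0" by simp
    show ?case
    proof (rule tendsto_0_real_approx)
      fix e :: real assume "e > 0"
      then obtain i where "(\<integral>x. \<bar>f x - s i x\<bar> \<partial>lborel) < e / 2"
        using order_tendstoD(2)[OF l0, of "e / 2"] by (auto simp: eventually_sequentially)
      note i = this
      show "\<exists>b. b \<longlonglongrightarrow> 0 \<and> (\<forall>n. (\<integral>x. \<bar>f (x + z n) - f x\<bar> \<partial>lborel) \<le> b n + e)"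
      proof (intro exI conjI allI)
        show "(\<lambda>n. \<integral>x. \<bar>s i (x + z n) - s i x\<bar> \<partial>lborel) \<longlonglongrightarrow> 0" by (rule lim(5))
        show "(\<integral>x. \<bar>f (x + z n) - f x\<bar> \<partial>lborel) \<le> (\<integral>x. \<bar>s i (x + z n) - s i x\<bar> \<partial>lborel) + e" for n
          using step[OF lim(4) lim(1)[of i], of "z n"] i by linarith
      qed
    qed auto
  qed
qed

lemma translation_continuous_L1_ball:
  fixes f :: "'a::euclidean_space \<Rightarrow> real"
  assumes "integrable lborel f" "e > 0"
  shows "\<exists>d>0. \<forall>z. norm z < d \<longrightarrow> (\<integral>x. \<bar>f (x + z) - f x\<bar> \<partial>lborel) < e"
proof -
  have "((\<lambda>z. \<integral>x. \<bar>f (x + z) - f x\<bar> \<partial>lborel) \<longlongrightarrow> 0) (at 0)"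
    unfolding tendsto_at_iff_sequentially using translation_continuous_L1[OF assms(1)] by (auto simp: o_def)
  then have "\<forall>\<^sub>F z in at 0. (\<integral>x. \<bar>f (x + z) - f x\<bar> \<partial>lborel) < e" using assms(2) order_tendstoD(2) by blast
  then obtain d where d: "d > 0" "\<And>z. z \<noteq> 0 \<Longrightarrow> norm z < d \<Longrightarrow> (\<integral>x. \<bar>f (x + z) - f x\<bar> \<partial>lborel) < e"
    by (auto simp: eventually_at dist_norm)
  show ?thesis
  proof (intro exI[of _ d] conjI allI impI d(1))
    fix z :: 'a assume "norm z < d" then show "(\<integral>x. \<bar>f (x + z) - f x\<bar> \<partial>lborel) < e"
      using d(2)[of z] assms(2) by (cases "z = 0") auto
  qed
qed

lemma translation_continuous_L1_nn:
  fixes f :: "'a::euclidean_space \<Rightarrow> real"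
  assumes f: "integrable lborel f" "e > 0"
  shows "\<exists>d>0. \<forall>z. norm z < d \<longrightarrow> (\<integral>\<^sup>+x. ennreal \<bar>f (x + z) - f x\<bar> \<partial>lborel) \<le> ennreal e"
proof -
  have "(\<integral>\<^sup>+x. ennreal \<bar>f (x + z) - f x\<bar> \<partial>lborel) = ennreal (\<integral>x. \<bar>f (x + z) - f x\<bar> \<partial>lborel)" for z
    using f integrable_translate[OF f(1)] by (intro nn_integral_eq_integral) auto
  then show ?thesis using translation_continuous_L1_ball[OF assms] by (metis ennreal_leI less_imp_le)
qed

text \<open>Reduces L2 continuity of translations to the L1 case: the signed square g |g| is
  integrable when g is square integrable, and its increments dominate the squared increments of
  g.\<close>

lemma square_diff_le: "(a - b)\<^sup>2 \<le> 2 * \<bar>a * \<bar>a\<bar> - b * \<bar>b\<bar>\<bar>" for a b :: real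
proof -
  have same: "(a - b)\<^sup>2 \<le> 2 * \<bar>a * a - b * b\<bar>" if "a \<ge> 0" "b \<ge> 0" for a b :: real
  proof -
    have "(a - b)\<^sup>2 = \<bar>a - b\<bar> * \<bar>a - b\<bar>" by (simp add: power2_eq_square)
    also have "\<dots> \<le> \<bar>a - b\<bar> * \<bar>a + b\<bar>" using that by (intro mult_left_mono) auto
    also have "\<dots> = \<bar>a * a - b * b\<bar>" by (simp add: abs_mult[symmetric] algebra_simps)
    finally show ?thesis by (rule order_trans) simp
  qed
  have diff: "(a + b)\<^sup>2 \<le> 2 * (a * a + b * b)" for a b :: real
    using sum_squares_bound[of a b] by (simp add: power2_eq_square algebra_simps)
  consider "a \<ge> 0 \<and> b \<ge> 0" | "a \<le> 0 \<and> b \<le> 0" | "a \<ge> 0 \<and> b \<le> 0" | "a \<le> 0 \<and> b \<ge> 0" by linarith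
  then show ?thesis
  proof cases
    case 1 then show ?thesis using same[of a b] by auto
  next
    case 2 then show ?thesis using same[of "-a" "-b"] by (auto simp: power2_commute abs_minus_commute)
  next
    case 3 then have "\<bar>a * \<bar>a\<bar> - b * \<bar>b\<bar>\<bar> = a * a + b * b" by auto
    then show ?thesis using diff[of a "-b"] by auto
  next
    case 4 then have "\<bar>a * \<bar>a\<bar> - b * \<bar>b\<bar>\<bar> = a * a + b * b" by auto
    then show ?thesis using diff[of "-a" b] by (auto simp: power2_commute)
  qed
qed

lemma translation_continuous_L2:
  fixes g :: "'a::euclidean_space \<Rightarrow> real"
  assumes [measurable]: "g \<in> borel_measurable borel" and fin: "(\<integral>\<^sup>+x. ennreal ((g x)\<^sup>2) \<partial>lborel) < \<infinity>" and "e > 0"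
  shows "\<exists>d>0. \<forall>z. norm z < d \<longrightarrow> (\<integral>\<^sup>+x. ennreal ((g (x + z) - g x)\<^sup>2) \<partial>lborel) \<le> ennreal e"
proof -
  let ?f = "\<lambda>x. 2 * (g x * \<bar>g x\<bar>)"
  have "integrable lborel (\<lambda>x. g x * \<bar>g x\<bar>)"
    using fin by (intro integrableI_bounded) (auto simp: abs_mult power2_eq_square)
  then have "integrable lborel ?f" by simp
  from translation_continuous_L1_nn[OF this \<open>e > 0\<close>]
  obtain d where d: "d > 0" "\<And>z. norm z < d \<Longrightarrow> (\<integral>\<^sup>+x. ennreal \<bar>?f (x + z) - ?f x\<bar> \<partial>lborel) \<le> ennreal e" by auto
  have "(\<integral>\<^sup>+x. ennreal ((g (x + z) - g x)\<^sup>2) \<partial>lborel) \<le> (\<integral>\<^sup>+x. ennreal \<bar>?f (x + z) - ?f x\<bar> \<partial>lborel)" for z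
  proof (intro nn_integral_mono ennreal_leI)
    fix x
    have "2 * \<bar>p - q\<bar> = \<bar>2 * p - 2 * q\<bar>" for p q :: real by (auto simp: abs_if)
    then show "(g (x + z) - g x)\<^sup>2 \<le> \<bar>?f (x + z) - ?f x\<bar>"
      using square_diff_le[of "g (x + z)" "g x"] by simp
  qed
  then show ?thesis using d by (intro exI[of _ d]) (blast intro: order_trans)
qed

text \<open>By Tonelli the double integral is an average of the \<open>x\<close>-integrals against
  the probability density \<rho>, and only shifts of norm at most \<open>r\<close> carry
  weight.\<close>

lemma nn_integral_kernel_le:
  fixes \<Phi> :: "'a::euclidean_space \<Rightarrow> 'a \<Rightarrow> ennreal" and \<rho> :: "'a \<Rightarrow> real"
  assumes [measurable]: "case_prod \<Phi> \<in> borel_measurable (borel \<Otimes>\<^sub>M borel)" "\<rho> \<in> borel_measurable borel"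
    and one: "(\<integral>\<^sup>+z. ennreal (\<rho> z) \<partial>lborel) = 1"
    and supp: "\<And>z. norm z > r \<Longrightarrow> \<rho> z = 0"
    and le: "\<And>z. norm z \<le> r \<Longrightarrow> (\<integral>\<^sup>+x. \<Phi> x z \<partial>lborel) \<le> \<epsilon>"
  shows "(\<integral>\<^sup>+x. (\<integral>\<^sup>+z. \<Phi> x z * ennreal (\<rho> z) \<partial>lborel) \<partial>lborel) \<le> \<epsilon>"
proof -
  have "(\<integral>\<^sup>+x. (\<integral>\<^sup>+z. \<Phi> x z * ennreal (\<rho> z) \<partial>lborel) \<partial>lborel) = (\<integral>\<^sup>+z. (\<integral>\<^sup>+x. \<Phi> x z * ennreal (\<rho> z) \<partial>lborel) \<partial>lborel)"
    by (rule lborel_pair.Fubini') simp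
  also have "\<dots> = (\<integral>\<^sup>+z. (\<integral>\<^sup>+x. \<Phi> x z \<partial>lborel) * ennreal (\<rho> z) \<partial>lborel)"
    by (intro nn_integral_cong nn_integral_multc) simp
  also have "\<dots> \<le> (\<integral>\<^sup>+z. \<epsilon> * ennreal (\<rho> z) \<partial>lborel)"
  proof (rule nn_integral_mono)
    fix z show "(\<integral>\<^sup>+x. \<Phi> x z \<partial>lborel) * ennreal (\<rho> z) \<le> \<epsilon> * ennreal (\<rho> z)"
      using le[of z] supp[of z] by (cases "norm z \<le> r") (auto intro: mult_right_mono)
  qed
  also have "\<dots> = \<epsilon>" using one by (simp add: nn_integral_cmult)
  finally show ?thesis .
qed

section \<open>Compactly supported smooth functions and convolution\<close>

definition csmooth :: "real \<Rightarrow> 'd::finite fn \<Rightarrow> bool" where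
  "csmooth r f \<longleftrightarrow> smooth f \<and> (\<forall>x. norm x > r \<longrightarrow> f x = 0)"

definition conv :: "'d::finite fn \<Rightarrow> 'd fn \<Rightarrow> 'd fn" where
  "conv u f x = (\<integral>y. u y * f (x - y) \<partial>lborel)"

lemma cpd_eq_0:
  fixes f :: "'d::finite fn"
  assumes "open U" "x \<in> U" "\<And>y. y \<in> U \<Longrightarrow> f y = 0"
  shows "cpd i f x = 0"
proof -
  have "(f has_derivative (\<lambda>_. 0)) (at x)"
    by (rule has_derivative_transform_within_open[OF has_derivative_const[of 0] assms(1,2)]) (use assms in auto)
  then show ?thesis using cpd_eq by fastforce
qed

lemma pd_list_eq_0:
  fixes f :: "'d::finite fn"
  assumes "open U" "x \<in> U" "\<And>y. y \<in> U \<Longrightarrow> f y = 0"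
  shows "pd_list is f x = 0"
  using assms(2)
proof (induction "is" arbitrary: x)
  case (Cons i "is")
  show ?case unfolding pd_list.simps by (rule cpd_eq_0[OF assms(1) Cons(2)]) (use Cons in auto)
qed (use assms in auto)

lemma csmooth_pd_list: "csmooth r f \<Longrightarrow> csmooth r (pd_list is f)"
  unfolding csmooth_def
proof (intro conjI allI impI, goal_cases)
  case (2 x)
  then show ?case by (intro pd_list_eq_0[where U="{x. norm x > r}"]) (auto intro!: open_Collect_less continuous_intros)
qed (auto intro: smooth_pd_list)

lemma csmooth_cpd: "csmooth r f \<Longrightarrow> csmooth r (cpd i f)"
  using csmooth_pd_list[of r f "[i]"] by simp

lemma csmooth_bounded:
  fixes f :: "'d::finite fn"
  assumes "csmooth r f" shows "\<exists>B>0. \<forall>x. \<bar>f x\<bar> \<le> B"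
proof -
  have "compact (f ` cball 0 r)"
    using assms by (intro compact_continuous_image smooth_continuous) (auto simp: csmooth_def)
  then obtain B where B: "B > 0" "\<And>x. norm x \<le> r \<Longrightarrow> \<bar>f x\<bar> \<le> B"
    by (metis bounded_pos compact_imp_bounded imageI mem_cball_0 real_norm_def)
  show ?thesis
  proof (intro exI conjI allI)
    fix x show "\<bar>f x\<bar> \<le> B" using B assms by (cases "norm x \<le> r") (auto simp: csmooth_def)
  qed fact
qed

lemma csmooth_uniform:
  fixes f :: "'d::finite fn"
  assumes f: "csmooth r f" and "e > 0"
  shows "\<exists>d>0. \<forall>x y. norm (x - y) < d \<longrightarrow> \<bar>f x - f y\<bar> < e"
proof -
  have "uniformly_continuous_on (cball 0 (r + 1)) f"
    using f by (intro compact_uniformly_continuous smooth_continuous) (auto simp: csmooth_def)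
  then obtain d where d: "d > 0" "\<And>x y. norm x \<le> r + 1 \<Longrightarrow> norm y \<le> r + 1 \<Longrightarrow> norm (x - y) < d \<Longrightarrow> \<bar>f x - f y\<bar> < e"
    using \<open>e > 0\<close> unfolding uniformly_continuous_on_def by (auto simp: dist_norm)
  show ?thesis
  \<comment> \<open>The distance bound 1 ensures that once one of the points leaves the ball of
    radius r + 1, both lie outside the support.\<close>
  proof (intro exI[of _ "min d 1"] conjI allI impI)
    fix x y :: "real^'d" assume xy: "norm (x - y) < min d 1"
    show "\<bar>f x - f y\<bar> < e"
    proof (cases "norm x \<le> r + 1 \<and> norm y \<le> r + 1")
      case False
      have "norm x \<le> norm y + norm (x - y)" "norm y \<le> norm x + norm (x - y)"
        using norm_triangle_sub[of x y] norm_triangle_sub[of y x] by (auto simp: norm_minus_commute)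
      then have "norm x > r" "norm y > r" using False xy by auto
      then show ?thesis using f \<open>e > 0\<close> by (simp add: csmooth_def)
    qed (use d xy in auto)
  qed (use d in auto)
qed

text \<open>A first-order Taylor bound that is uniform in \<open>x\<close>, as needed to
  differentiate under the integral sign. It is the mean value theorem on the segment combined with
  uniform continuity of the partials; \<open>e\<close> is shared equally among the d
  directions.\<close>

lemma csmooth_linearization:
  fixes f :: "'d::finite fn"
  assumes f: "csmooth r f" and "e > 0"
  shows "\<exists>d>0. \<forall>x h. norm h < d \<longrightarrow> \<bar>f (x + h) - f x - (\<Sum>i\<in>UNIV. h $ i * cpd i f x)\<bar> \<le> e * norm h"
proof -
  define e' where "e' = e / CARD('d)"
  have e': "e' > 0" unfolding e'_def using \<open>e > 0\<close> by simp
  have "\<forall>i. \<exists>d>0. \<forall>x y. norm (x - y) < d \<longrightarrow> \<bar>cpd i f x - cpd i f y\<bar> < e'"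
    using csmooth_uniform[OF csmooth_cpd[OF f] e'] by auto
  then obtain D where D: "\<And>i. D i > 0" "\<And>i x y. norm (x - y) < D i \<Longrightarrow> \<bar>cpd i f x - cpd i f y\<bar> < e'"
    by metis
  define d where "d = Min (range D)"
  have d: "d > 0" "\<And>i. d \<le> D i" unfolding d_def using D by auto
  have "\<bar>f (x + h) - f x - (\<Sum>i\<in>UNIV. h $ i * cpd i f x)\<bar> \<le> e * norm h" if h: "norm h < d" for x h
  proof -
    have "((\<lambda>t. f (x + t *\<^sub>R h)) has_real_derivative (\<Sum>i\<in>UNIV. h $ i * cpd i f (x + t *\<^sub>R h))) (at t)" for t
      using f by (intro has_derivative_line has_derivative_cpd smooth_differentiable) (simp add: csmooth_def)
    then obtain \<xi> where \<xi>: "0 < \<xi>" "\<xi> < 1" "f (x + 1 *\<^sub>R h) - f (x + 0 *\<^sub>R h) = (1 - 0) * (\<Sum>i\<in>UNIV. h $ i * cpd i f (x + \<xi> *\<^sub>R h))"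
      using MVT2[of 0 1 "\<lambda>t. f (x + t *\<^sub>R h)" "\<lambda>t. (\<Sum>i\<in>UNIV. h $ i * cpd i f (x + t *\<^sub>R h))"] by auto
    have "f (x + h) - f x - (\<Sum>i\<in>UNIV. h $ i * cpd i f x) = (\<Sum>i\<in>UNIV. h $ i * (cpd i f (x + \<xi> *\<^sub>R h) - cpd i f x))"
      using \<xi>(3) by (simp add: sum_subtractf right_diff_distrib)
    also have "\<bar>\<dots>\<bar> \<le> (\<Sum>i\<in>(UNIV::'d set). norm h * e')"
    proof (rule order_trans[OF sum_abs sum_mono])
      fix i
      have "norm (x + \<xi> *\<^sub>R h - x) < D i"
        using \<xi> h d(2)[of i] mult_left_le_one_le[of "norm h" \<xi>] by simp
      then show "\<bar>h $ i * (cpd i f (x + \<xi> *\<^sub>R h) - cpd i f x)\<bar> \<le> norm h * e'"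
        unfolding abs_mult using less_imp_le[OF D(2)] by (intro mult_mono component_le_norm_cart) auto
    qed
    also have "\<dots> = e * norm h" unfolding e'_def by simp
    finally show ?thesis .
  qed
  then show ?thesis using d by auto
qed

lemma loc_int_measurable:
  fixes u :: "'d::finite fn"
  assumes "loc_int u" shows "u \<in> borel_measurable borel"
proof (rule borel_measurable_LIMSEQ_real)
  show "(\<lambda>x. indicator (cball 0 (real n)) x *\<^sub>R u x) \<in> borel_measurable borel" for n
    using assms unfolding loc_int_def set_integrable_def by (metis borel_measurable_integrable compact_cball measurable_lborel2)
  fix x :: "real^'d"
  obtain N where "norm x \<le> real N" using real_arch_simple by blast
  then have "\<forall>\<^sub>F n in sequentially. indicator (cball 0 (real n)) x *\<^sub>R u x = u x"
    by (intro eventually_sequentiallyI[of N]) (auto simp: indicator_def)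
  then show "(\<lambda>n. indicator (cball 0 (real n)) x *\<^sub>R u x) \<longlonglongrightarrow> u x" by (rule tendsto_eventually)
qed

lemma loc_int_integrable_mult:
  fixes u :: "'d::finite fn"
  assumes u: "loc_int u" and [measurable]: "f \<in> borel_measurable borel"
    and B: "\<And>x. \<bar>f x\<bar> \<le> B" and s: "\<And>x. x \<notin> cball c r \<Longrightarrow> f x = 0"
  shows "integrable lborel (\<lambda>x. u x * f x)"
proof (rule Bochner_Integration.integrable_bound)
  have [measurable]: "u \<in> borel_measurable borel" by (rule loc_int_measurable[OF u])
  show "(\<lambda>x. u x * f x) \<in> borel_measurable lborel" by simp
  have "integrable lborel (\<lambda>x. indicator (cball c r) x *\<^sub>R u x)"
    using u unfolding loc_int_def set_integrable_def by auto
  then show "integrable lborel (\<lambda>x. B * (indicator (cball c r) x *\<^sub>R u x))" by (rule integrable_mult_right)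
  have "norm (u x * f x) \<le> norm (B * (indicator (cball c r) x *\<^sub>R u x))" for x
  proof (cases "x \<in> cball c r")
    case True
    have "\<bar>u x\<bar> * \<bar>f x\<bar> \<le> \<bar>u x\<bar> * \<bar>B\<bar>" using B[of x] by (intro mult_left_mono) auto
    then show ?thesis using True by (simp add: abs_mult mult.commute)
  qed (use s in auto)
  then show "AE x in lborel. norm (u x * f x) \<le> norm (B * (indicator (cball c r) x *\<^sub>R u x))" by simp
qed

lemma csmooth_measurable: "csmooth r f \<Longrightarrow> f \<in> borel_measurable borel"
  by (simp add: csmooth_def smooth_measurable)

lemma conv_integrable:
  fixes u :: "'d::finite fn"
  assumes u: "loc_int u" and f: "csmooth r f"
  shows "integrable lborel (\<lambda>y. u y * f (x - y))"
proof -
  obtain B where "\<And>x. \<bar>f x\<bar> \<le> B" using csmooth_bounded[OF f] by auto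
  moreover have "(\<lambda>y. f (x - y)) \<in> borel_measurable borel"
    using measurable_compose[OF _ csmooth_measurable[OF f], of "\<lambda>y. x - y"] by simp
  ultimately show ?thesis
    using f by (intro loc_int_integrable_mult[OF u, where B=B and c=x and r=r]) (auto simp: csmooth_def dist_norm)
qed

text \<open>The remainder of the convolution is the uniform Taylor remainder of \<open>f\<close>
  integrated against |u| over the ball of radius r + 1 about \<open>x\<close>. For increments
  shorter than 1, all terms involving \<open>f\<close> vanish outside that ball.\<close>

lemma conv_has_derivative:
  fixes u :: "'d::finite fn"
  assumes u: "loc_int u" and f: "csmooth r f"
  shows "(conv u f has_derivative (\<lambda>h. \<Sum>i\<in>UNIV. h $ i * conv u (cpd i f) x)) (at x)"
  unfolding has_derivative_at_alt
proof (intro conjI allI impI)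
  show "bounded_linear (\<lambda>h. \<Sum>i\<in>UNIV. h $ i * conv u (cpd i f) x)"
    by (intro bounded_linear_sum bounded_linear_compose[OF bounded_linear_mult_left bounded_linear_vec_nth])
  fix e :: real assume "0 < e"
  note um [measurable] = loc_int_measurable[OF u]
  define J where "J = (\<lambda>y. \<bar>indicator (cball x (r + 1)) y *\<^sub>R u y\<bar>)"
  define I where "I = (\<integral>y. J y \<partial>lborel)"
  have iJ: "integrable lborel J"
    unfolding J_def using u unfolding loc_int_def set_integrable_def by auto
  have I0: "I \<ge> 0" unfolding I_def J_def by simp
  \<comment> \<open>\<open>I\<close> may be zero, hence the added 1.\<close>
  define e' where "e' = e / (I + 1)"
  have e': "e' > 0" "e' * I \<le> e" unfolding e'_def using I0 \<open>0 < e\<close> by (auto simp: field_simps)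
  obtain d where d: "d > 0" "\<And>x h. norm h < d \<Longrightarrow> \<bar>f (x + h) - f x - (\<Sum>i\<in>UNIV. h $ i * cpd i f x)\<bar> \<le> e' * norm h"
    using csmooth_linearization[OF f e'(1)] by auto
  show "\<exists>d>0. \<forall>y. norm (y - x) < d \<longrightarrow> norm (conv u f y - conv u f x - (\<Sum>i\<in>UNIV. (y - x) $ i * conv u (cpd i f) x)) \<le> e * norm (y - x)"
  proof (intro exI[of _ "min d 1"] conjI allI impI)
    fix x' assume x': "norm (x' - x) < min d 1"
    define h where "h = x' - x"
    define G where "G = (\<lambda>y. u y * f (x' - y) - u y * f (x - y) - (\<Sum>i\<in>UNIV. h $ i * (u y * cpd i f (x - y))))"
    note ci = conv_integrable[OF u f] conv_integrable[OF u csmooth_cpd[OF f]]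
    have "conv u f x' - conv u f x - (\<Sum>i\<in>UNIV. h $ i * conv u (cpd i f) x) = (\<integral>y. G y \<partial>lborel)"
      unfolding conv_def G_def using ci by (simp add: Bochner_Integration.integral_sum)
    also have "\<bar>\<dots>\<bar> \<le> (\<integral>y. e' * norm h * J y \<partial>lborel)"
    proof (rule order_trans[OF integral_abs_bound integral_mono])
      show "integrable lborel (\<lambda>y. \<bar>G y\<bar>)"
        unfolding G_def using ci by (intro integrable_abs Bochner_Integration.integrable_diff Bochner_Integration.integrable_sum) auto
      show "integrable lborel (\<lambda>y. e' * norm h * J y)" using iJ by auto
      fix y
      have G: "G y = u y * (f ((x - y) + h) - f (x - y) - (\<Sum>i\<in>UNIV. h $ i * cpd i f (x - y)))"
        unfolding G_def h_def by (simp add: right_diff_distrib sum_distrib_left mult_ac algebra_simps)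
      show "\<bar>G y\<bar> \<le> e' * norm h * J y"
      proof (cases "y \<in> cball x (r + 1)")
        case True
        have "\<bar>G y\<bar> \<le> \<bar>u y\<bar> * (e' * norm h)"
          unfolding G abs_mult using d(2)[of h "x - y"] x' by (intro mult_left_mono) (auto simp: h_def)
        then show ?thesis using True by (simp add: J_def mult_ac)
      next
        case False
        then have "norm (x - y) > r + 1" by (simp add: dist_norm)
        moreover have "norm (x - y) \<le> norm (x - y + h) + norm h"
          using norm_triangle_sub[of "x - y" "x - y + h"] by (simp add: norm_minus_commute)
        ultimately have "norm (x - y) > r" "norm (x - y + h) > r" using x' by (auto simp: h_def)
        then have "f (x - y) = 0" "f (x - y + h) = 0" "cpd i f (x - y) = 0" for i
          using f csmooth_cpd[OF f, of i] by (auto simp: csmooth_def)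
        then show ?thesis unfolding G using e' by (simp add: J_def)
      qed
    qed
    also have "\<dots> = (e' * I) * norm h" by (simp add: I_def)
    also have "\<dots> \<le> e * norm h" using e' by (intro mult_right_mono) auto
    finally show "norm (conv u f x' - conv u f x - (\<Sum>i\<in>UNIV. (x' - x) $ i * conv u (cpd i f) x)) \<le> e * norm (x' - x)"
      by (simp add: h_def)
  qed (use d in auto)
qed

lemma cpd_conv:
  fixes u :: "'d::finite fn"
  assumes "loc_int u" "csmooth r f"
  shows "cpd i (conv u f) = conv u (cpd i f)"
  using cpd_eq[OF conv_has_derivative[OF assms]] by (auto simp: sum_axis)

lemma pd_list_conv:
  fixes u :: "'d::finite fn"
  assumes "loc_int u" "csmooth r f"
  shows "pd_list is (conv u f) = conv u (pd_list is f)"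
  by (induction "is") (auto simp: cpd_conv[OF assms(1) csmooth_pd_list[OF assms(2)]])

lemma smooth_conv:
  fixes u :: "'d::finite fn"
  assumes u: "loc_int u" and f: "csmooth r f"
  shows "smooth (conv u f)"
proof (rule smooth_coinduct[where S="{conv u g | g. csmooth r g}"])
  show "conv u f \<in> {conv u g | g. csmooth r g}" using f by auto
  fix g x assume "g \<in> {conv u g | g. csmooth r g}"
  then obtain p where p: "csmooth r p" and g: "g = conv u p" by auto
  show "g differentiable (at x)" unfolding g differentiable_def using conv_has_derivative[OF u p] by blast
  show "cpd i g \<in> {conv u g | g. csmooth r g}" for i unfolding g cpd_conv[OF u p] using csmooth_cpd[OF p] by auto
  show "cpd i (cpd j g) = cpd j (cpd i g)" for i j
    unfolding g cpd_conv[OF u p] cpd_conv[OF u csmooth_cpd[OF p]]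
    using smooth_commute[of p i j] p by (simp add: csmooth_def)
qed

lemma csmooth_test_fun:
  assumes "csmooth r f" shows "test_fun f"
proof -
  have "supp f \<subseteq> cball 0 r"
    unfolding supp_def using assms by (intro closure_minimal) (auto simp: csmooth_def not_less[symmetric])
  then have "compact (supp f)" unfolding supp_def by (metis bounded_cball bounded_subset closed_closure compact_eq_bounded_closed)
  moreover have "(\<lambda>t. pd_list is f (x + t *\<^sub>R axis i 1)) differentiable (at 0)" for "is" i x
    using cpd_line[of "pd_list is f" x i 0] smooth_differentiable[OF smooth_pd_list] assms
    by (auto simp: csmooth_def real_differentiable_def)
  ultimately show ?thesis
    using assms unfolding test_fun_def by (auto simp: csmooth_def intro: smooth_continuous smooth_pd_list)
qed

lemma csmooth_integrable:
  fixes f :: "'d::finite fn"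
  assumes "csmooth r f" shows "integrable lborel f"
proof -
  have "loc_int (\<lambda>_::real^'d. 1)" unfolding loc_int_def set_integrable_def
    by (auto intro!: integrable_real_indicator emeasure_compact_finite borel_compact)
  then show ?thesis using loc_int_integrable_mult[of "\<lambda>_. 1" f _ 0 r] csmooth_bounded[OF assms] csmooth_measurable[OF assms] assms
    by (auto simp: csmooth_def)
qed

section \<open>Mollification\<close>

definition mollifier :: "real \<Rightarrow> 'd::finite fn" where
  "mollifier e x = inverse (\<integral>y. bump (inverse e *\<^sub>R (y::real^'d)) \<partial>lborel) * bump (inverse e *\<^sub>R x)"

lemma csmooth_bump: "csmooth 1 (bump :: 'd::finite fn)"
  unfolding csmooth_def using smooth_bump bump_eq_0 by blast

lemma integral_bump_pos: "(\<integral>x. bump (x::real^'d::finite) \<partial>lborel) > 0"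
proof -
  have "open {x::real^'d. bump (0::real^'d) / 2 < bump x}"
    by (intro open_Collect_less continuous_intros smooth_continuous smooth_bump)
  moreover have "(0::real^'d) \<in> {x. bump (0::real^'d) / 2 < bump x}"
    using bump_pos by simp
  ultimately obtain r where r: "r > 0" "ball 0 r \<subseteq> {x::real^'d. bump (0::real^'d) / 2 < bump x}"
    by (rule openE)
  have "0 < bump (0::real^'d) / 2 * measure lborel (ball (0::real^'d) r)"
    using content_ball_pos[OF r(1), of "0::real^'d"] by (intro mult_pos_pos) (simp_all add: bump_pos)
  also have "\<dots> = (\<integral>x. bump (0::real^'d) / 2 * indicator (ball (0::real^'d) r) x \<partial>lborel)"
    by simp
  also have "\<dots> \<le> (\<integral>x. bump (x::real^'d) \<partial>lborel)"
  proof (rule integral_mono)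
    show "integrable lborel (bump :: 'd fn)" by (rule csmooth_integrable[OF csmooth_bump])
    fix x :: "real^'d"
    show "bump (0::real^'d) / 2 * indicator (ball (0::real^'d) r) x \<le> bump x"
      using r(2) bump_nonneg[of x] by (cases "x \<in> ball 0 r") (auto simp: subset_iff intro: less_imp_le)
    show "integrable lborel (\<lambda>x. bump (0::real^'d) / 2 * indicator (ball (0::real^'d) r) x)"
      using emeasure_lborel_ball_finite[of "0::real^'d" r] by (intro integrable_mult_right integrable_real_indicator) auto
  qed
  finally show ?thesis .
qed

lemma integral_bump_scaled:
  assumes "e > 0"
  shows "(\<integral>x. bump (inverse e *\<^sub>R (x::real^'d::finite)) \<partial>lborel) = e ^ CARD('d) * (\<integral>x. bump (x::real^'d) \<partial>lborel)"
  using integral_affine[OF csmooth_integrable[OF csmooth_bump[where 'd='d]], of "inverse e" 0] assms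
  by (simp add: field_simps)

lemma csmooth_mollifier: assumes "e > 0" shows "csmooth e (mollifier e :: 'd::finite fn)"
proof -
  have "smooth (mollifier e :: 'd fn)"
    unfolding mollifier_def[abs_def] using smooth_affine[OF smooth_bump, of _ _ 0] by simp
  moreover have "mollifier e x = 0" if "norm x > e" for x :: "real^'d"
    using that assms bump_eq_0[of "inverse e *\<^sub>R x"] by (simp add: mollifier_def field_simps)
  ultimately show ?thesis by (simp add: csmooth_def)
qed

lemma mollifier_nonneg: "mollifier e x \<ge> 0"
  unfolding mollifier_def by (intro mult_nonneg_nonneg bump_nonneg) (simp add: Bochner_Integration.integral_nonneg bump_nonneg)

lemma integral_mollifier:
  assumes "e > 0" shows "(\<integral>x. mollifier e (x::real^'d::finite) \<partial>lborel) = 1"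
proof -
  have "(\<integral>x. bump (inverse e *\<^sub>R (x::real^'d)) \<partial>lborel) > 0"
    unfolding integral_bump_scaled[OF assms] using integral_bump_pos[where 'd='d] assms by (intro mult_pos_pos) auto
  then show ?thesis unfolding mollifier_def by simp
qed

lemma nn_integral_mollifier:
  assumes "e > 0" shows "(\<integral>\<^sup>+x. ennreal (mollifier e (x::real^'d::finite)) \<partial>lborel) = 1"
  using nn_integral_eq_integral[OF csmooth_integrable[OF csmooth_mollifier[OF assms, where 'd='d]]] integral_mollifier[OF assms, where 'd='d]
  by (simp add: mollifier_nonneg)

text \<open>Pure scaling: each derivative produces a factor 1/e, and the Jacobian cancels the
  normalisation.\<close>

lemma mollifier_deriv_bound:
  "\<exists>C. \<forall>e>0. (\<integral>x. \<bar>pd_list is (mollifier e) (x::real^'d::finite)\<bar> \<partial>lborel) \<le> C * inverse e ^ length is"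
proof (intro exI allI impI)
  fix e :: real assume e: "e > 0"
  let ?I = "\<integral>x. bump (x::real^'d) \<partial>lborel" and ?J = "\<integral>x. \<bar>pd_list is bump (x::real^'d)\<bar> \<partial>lborel"
  have i: "integrable lborel (\<lambda>x::real^'d. \<bar>pd_list is bump x\<bar>)"
    by (intro integrable_abs csmooth_integrable[of 1] csmooth_pd_list csmooth_bump)
  have "pd_list is (mollifier e) = (\<lambda>x. inverse (e ^ CARD('d) * ?I) * inverse e ^ length is * pd_list is bump (inverse e *\<^sub>R x))"
    using pd_list_affine[OF smooth_bump, of "is" "inverse (e ^ CARD('d) * ?I)" "inverse e" 0]
    unfolding mollifier_def[abs_def] integral_bump_scaled[OF e] by simp
  then have "(\<integral>x. \<bar>pd_list is (mollifier e) (x::real^'d)\<bar> \<partial>lborel) = inverse (e ^ CARD('d) * ?I) * inverse e ^ length is * (\<integral>x. \<bar>pd_list is bump (inverse e *\<^sub>R x)\<bar> \<partial>lborel)"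
    using e integral_bump_pos[where 'd='d] by (simp add: abs_mult power_abs)
  also have "(\<integral>x. \<bar>pd_list is bump (inverse e *\<^sub>R (x::real^'d))\<bar> \<partial>lborel) = e ^ CARD('d) * ?J"
    using integral_affine[OF i, of "inverse e" 0] e by (simp add: field_simps)
  finally show "(\<integral>x. \<bar>pd_list is (mollifier e) (x::real^'d)\<bar> \<partial>lborel) \<le> (?J / ?I) * inverse e ^ length is"
    using e integral_bump_pos[where 'd='d] by (simp add: field_simps)
qed

lemma conv_eq:
  fixes u :: "'d::finite fn"
  assumes "loc_int u" "csmooth r f"
  shows "integrable lborel (\<lambda>z. u (x - z) * f z)" "conv u f x = (\<integral>z. u (x - z) * f z \<partial>lborel)"
  using integrable_affine[OF conv_integrable[OF assms], of "-1" x x] integral_affine[OF conv_integrable[OF assms], of "-1" x x]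
  by (auto simp: conv_def)

lemma conv_mollifier_diff:
  fixes g :: "'d::finite fn"
  assumes g: "loc_int g" and e: "e > 0"
  shows "ennreal \<bar>conv g (mollifier e) x - g x\<bar> \<le> (\<integral>\<^sup>+z. ennreal \<bar>g (x - z) - g x\<bar> * ennreal (mollifier e z) \<partial>lborel)"
proof -
  note c = conv_eq[OF g csmooth_mollifier[OF e], of x] csmooth_integrable[OF csmooth_mollifier[OF e]]
  have i: "integrable lborel (\<lambda>z. (g (x - z) - g x) * mollifier e z)"
    using c unfolding left_diff_distrib by (intro Bochner_Integration.integrable_diff) auto
  have "conv g (mollifier e) x - g x = (\<integral>z. (g (x - z) - g x) * mollifier e z \<partial>lborel)"
    using c integral_mollifier[OF e, where 'd='d] unfolding left_diff_distrib
    by (subst Bochner_Integration.integral_diff) auto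
  then have "ennreal \<bar>conv g (mollifier e) x - g x\<bar> \<le> (\<integral>\<^sup>+z. norm ((g (x - z) - g x) * mollifier e z) \<partial>lborel)"
    using integral_norm_bound_ennreal[OF i] by simp
  then show ?thesis by (simp add: abs_mult ennreal_mult mollifier_nonneg)
qed

text \<open>Jensen's inequality for the square and the probability density
  \<open>mollifier e\<close>, obtained from Cauchy-Schwarz by splitting the density into two square
  roots.\<close>

lemma conv_mollifier_diff2:
  fixes g :: "'d::finite fn"
  assumes g: "loc_int g" and e: "e > 0"
  shows "ennreal ((conv g (mollifier e) x - g x)\<^sup>2) \<le> (\<integral>\<^sup>+z. ennreal ((g (x - z) - g x)\<^sup>2) * ennreal (mollifier e z) \<partial>lborel)"
proof -
  have [measurable]: "g \<in> borel_measurable borel" "mollifier e \<in> borel_measurable (borel :: (real^'d) measure)"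
    using loc_int_measurable[OF g] csmooth_measurable[OF csmooth_mollifier[OF e]] by auto
  have s: "ennreal (sqrt (mollifier e z)) * ennreal (sqrt (mollifier e z)) = ennreal (mollifier e z)" for z :: "real^'d"
    using mollifier_nonneg[of e z] by (simp add: ennreal_mult[symmetric])
  have "ennreal ((conv g (mollifier e) x - g x)\<^sup>2) = (ennreal \<bar>conv g (mollifier e) x - g x\<bar>)\<^sup>2"
    by (simp add: ennreal_power)
  also have "\<dots> \<le> (\<integral>\<^sup>+z. ennreal \<bar>g (x - z) - g x\<bar> * ennreal (mollifier e z) \<partial>lborel)\<^sup>2"
    by (intro power_mono conv_mollifier_diff assms) auto
  also have "\<dots> = (\<integral>\<^sup>+z. (ennreal \<bar>g (x - z) - g x\<bar> * ennreal (sqrt (mollifier e z))) * ennreal (sqrt (mollifier e z)) \<partial>lborel)\<^sup>2"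
    by (simp add: mult.assoc s)
  also have "\<dots> \<le> (\<integral>\<^sup>+z. (ennreal \<bar>g (x - z) - g x\<bar> * ennreal (sqrt (mollifier e z)))\<^sup>2 \<partial>lborel) * (\<integral>\<^sup>+z. (ennreal (sqrt (mollifier e (z::real^'d))))\<^sup>2 \<partial>lborel)"
    by (rule Cauchy_Schwarz_nn_integral) auto
  also have "(\<integral>\<^sup>+z. (ennreal (sqrt (mollifier e (z::real^'d))))\<^sup>2 \<partial>lborel) = 1"
    using nn_integral_mollifier[OF e, where 'd='d] by (simp add: power2_eq_square s)
  finally show ?thesis
    by (simp add: power_mult_distrib power2_eq_square[of "ennreal (sqrt _)"] s ennreal_power)
qed

lemma ennreal_tendsto_0_I:
  fixes f :: "'a \<Rightarrow> ennreal"
  assumes "\<And>e::real. e > 0 \<Longrightarrow> \<forall>\<^sub>F n in F. f n \<le> ennreal e"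
  shows "(f \<longlongrightarrow> 0) F"
proof (rule order_tendstoI)
  fix a :: ennreal assume "0 < a"
  then obtain e where e: "e > 0" "ennreal e < a"
  proof (cases a)
    case (real r)
    then show ?thesis using \<open>0 < a\<close> that[of "r / 2"] by (auto simp: ennreal_less_iff)
  next
    case top
    then show ?thesis using that[of 1] by simp
  qed
  from assms[OF e(1)] show "\<forall>\<^sub>F n in F. f n < a"
    by eventually_elim (use e(2) in \<open>auto intro: le_less_trans\<close>)
qed auto

abbreviation moll :: "nat \<Rightarrow> 'd::finite fn" where "moll n \<equiv> mollifier (inverse (real (Suc n)))"

lemma moll_eventually:
  assumes "d > 0" shows "\<forall>\<^sub>F n in sequentially. inverse (real (Suc n)) < d"
  using order_tendstoD(2)[OF LIMSEQ_inverse_real_of_nat assms] .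

lemma conv_moll_L1:
  fixes g :: "'d::finite fn"
  assumes i: "integrable lborel g" and l: "loc_int g"
  shows "(\<lambda>n. \<integral>\<^sup>+x. ennreal \<bar>conv g (moll n) x - g x\<bar> \<partial>lborel) \<longlonglongrightarrow> 0"
proof (rule ennreal_tendsto_0_I)
  fix \<epsilon> :: real assume "\<epsilon> > 0"
  then obtain d where d: "d > 0" "\<And>z. norm z < d \<Longrightarrow> (\<integral>\<^sup>+x. ennreal \<bar>g (x + z) - g x\<bar> \<partial>lborel) \<le> ennreal \<epsilon>"
    using translation_continuous_L1_nn[OF i] by blast
  note [measurable] = loc_int_measurable[OF l]
  show "\<forall>\<^sub>F n in sequentially. (\<integral>\<^sup>+x. ennreal \<bar>conv g (moll n) x - g x\<bar> \<partial>lborel) \<le> ennreal \<epsilon>"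
    using moll_eventually[OF d(1)]
  proof eventually_elim
    case (elim n)
    let ?e = "inverse (real (Suc n))"
    have "(\<integral>\<^sup>+x. ennreal \<bar>conv g (moll n) x - g x\<bar> \<partial>lborel) \<le> (\<integral>\<^sup>+x. (\<integral>\<^sup>+z. ennreal \<bar>g (x - z) - g x\<bar> * ennreal (moll n z) \<partial>lborel) \<partial>lborel)"
      by (intro nn_integral_mono conv_mollifier_diff l) simp
    also have "\<dots> \<le> ennreal \<epsilon>"
    proof (rule nn_integral_kernel_le[where r="?e"])
      show "(\<integral>\<^sup>+x. ennreal \<bar>g (x - z) - g x\<bar> \<partial>lborel) \<le> ennreal \<epsilon>" if "norm z \<le> ?e" for z
        using d(2)[of "-z"] that elim by simp
    qed (use csmooth_mollifier[of ?e, where 'd='d] in \<open>auto simp: csmooth_def nn_integral_mollifier intro: smooth_measurable\<close>)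
    finally show ?case .
  qed
qed

section \<open>Local square integrability\<close>

text \<open>The squared L2 norm over \<open>S\<close> as an \<open>ennreal\<close>. Triangle and
  limit arguments then require measurability only, and finiteness is checked at the end.\<close>

definition sqn :: "(real^'d) set \<Rightarrow> 'd::finite fn \<Rightarrow> ennreal" where
  "sqn S f = (\<integral>\<^sup>+x. ennreal ((f x)\<^sup>2) * indicator S x \<partial>lborel)"

definition L2loc :: "'d::finite fn \<Rightarrow> bool" where
  "L2loc f \<longleftrightarrow> f \<in> borel_measurable borel \<and> (\<forall>R. sqn (cball 0 R) f < \<infinity>)"

definition L2conv :: "(nat \<Rightarrow> 'd::finite fn) \<Rightarrow> 'd fn \<Rightarrow> bool" where
  "L2conv F f \<longleftrightarrow> (\<forall>R. (\<lambda>n. sqn (cball 0 R) (\<lambda>x. F n x - f x)) \<longlonglongrightarrow> 0)"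

lemma L2loc_measurable: "L2loc f \<Longrightarrow> f \<in> borel_measurable borel"
  by (simp add: L2loc_def)

lemma sqn_mono: "S \<subseteq> T \<Longrightarrow> sqn S f \<le> sqn T f"
  unfolding sqn_def by (intro nn_integral_mono mult_left_mono) (auto simp: indicator_def)

lemma sqn_le: "(\<And>x. x \<in> S \<Longrightarrow> \<bar>f x\<bar> \<le> \<bar>g x\<bar>) \<Longrightarrow> sqn S f \<le> sqn S g"
  unfolding sqn_def by (intro nn_integral_mono) (auto simp: indicator_def abs_le_square_iff[symmetric])

lemma sqn_cong_AE: "AE x in lborel. f x = g x \<Longrightarrow> sqn S f = sqn S g"
  unfolding sqn_def by (intro nn_integral_cong_AE) (auto elim: eventually_mono)

lemma sqn_cmult:
  assumes [measurable]: "f \<in> borel_measurable borel" "S \<in> sets borel"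
  shows "sqn S (\<lambda>x. c * f x) = ennreal (c\<^sup>2) * sqn S f"
  unfolding sqn_def
  by (subst nn_integral_cmult[symmetric]) (auto simp: power_mult_distrib ennreal_mult mult.assoc)

lemma sqn_add:
  assumes [measurable]: "f \<in> borel_measurable borel" "g \<in> borel_measurable borel" "S \<in> sets borel"
  shows "sqn S (\<lambda>x. f x + g x) \<le> 2 * (sqn S f + sqn S g)"
proof -
  have "ennreal ((f x + g x)\<^sup>2) \<le> 2 * (ennreal ((f x)\<^sup>2) + ennreal ((g x)\<^sup>2))" for x
  proof -
    have "2 * ((f x)\<^sup>2 + (g x)\<^sup>2) - (f x + g x)\<^sup>2 = (f x - g x)\<^sup>2" by (simp add: power2_eq_square algebra_simps)
    then have "(f x + g x)\<^sup>2 \<le> 2 * ((f x)\<^sup>2 + (g x)\<^sup>2)" using zero_le_power2[of "f x - g x"] by (metis diff_ge_0_iff_ge)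
    then have "ennreal ((f x + g x)\<^sup>2) \<le> ennreal (2 * ((f x)\<^sup>2 + (g x)\<^sup>2))" by (rule ennreal_leI)
    then show ?thesis by (simp add: ennreal_mult ennreal_plus)
  qed
  then have "sqn S (\<lambda>x. f x + g x) \<le> (\<integral>\<^sup>+x. 2 * (ennreal ((f x)\<^sup>2) * indicator S x + ennreal ((g x)\<^sup>2) * indicator S x) \<partial>lborel)"
    unfolding sqn_def by (intro nn_integral_mono) (auto simp: indicator_def)
  also have "\<dots> = 2 * (sqn S f + sqn S g)"
    unfolding sqn_def by (simp add: nn_integral_cmult nn_integral_add)
  finally show ?thesis .
qed

lemma sqn_diff:
  assumes "f \<in> borel_measurable borel" "g \<in> borel_measurable borel" "S \<in> sets borel"
  shows "sqn S (\<lambda>x. f x - g x) \<le> 2 * (sqn S f + sqn S g)"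
proof -
  have "sqn S (\<lambda>x. - g x) = sqn S g" by (simp add: sqn_def)
  then show ?thesis using sqn_add[of f "\<lambda>x. - g x" S] assms by simp
qed

text \<open>If the product is not integrable, the Bochner integral on the left is 0 by convention
  and the bound is trivial.\<close>

lemma sqn_CS:
  fixes f g :: "'d::finite fn"
  assumes [measurable]: "f \<in> borel_measurable borel" "g \<in> borel_measurable borel" "S \<in> sets borel"
  shows "ennreal ((\<integral>x. f x * g x * indicator S x \<partial>lborel)\<^sup>2) \<le> sqn S f * sqn S g"
proof (cases "integrable lborel (\<lambda>x. f x * g x * indicator S x)")
  case True
  have "ennreal ((\<integral>x. f x * g x * indicator S x \<partial>lborel)\<^sup>2) = (ennreal (norm (\<integral>x. f x * g x * indicator S x \<partial>lborel)))\<^sup>2"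
    by (simp add: ennreal_power)
  also have "\<dots> \<le> (\<integral>\<^sup>+x. ennreal (norm (f x * g x * indicator S x)) \<partial>lborel)\<^sup>2"
    by (intro power_mono integral_norm_bound_ennreal True) auto
  also have "\<dots> = (\<integral>\<^sup>+x. (ennreal \<bar>f x\<bar> * indicator S x) * (ennreal \<bar>g x\<bar> * indicator S x) \<partial>lborel)\<^sup>2"
    by (intro arg_cong[where f="\<lambda>a. a\<^sup>2"] nn_integral_cong) (auto simp: indicator_def abs_mult ennreal_mult)
  also have "\<dots> \<le> (\<integral>\<^sup>+x. (ennreal \<bar>f x\<bar> * indicator S x)\<^sup>2 \<partial>lborel) * (\<integral>\<^sup>+x. (ennreal \<bar>g x\<bar> * indicator S x)\<^sup>2 \<partial>lborel)"
    by (rule Cauchy_Schwarz_nn_integral) auto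
  also have "\<dots> = sqn S f * sqn S g"
    unfolding sqn_def
    by (intro arg_cong2[where f="(*)"] nn_integral_cong) (auto simp: indicator_def power_mult_distrib ennreal_power)
  finally show ?thesis .
qed (simp add: not_integrable_integral_eq)

lemma sqn_indicator: "S \<in> sets borel \<Longrightarrow> sqn S (\<lambda>_. 1) = emeasure lborel S"
  unfolding sqn_def by simp

lemma sqn_finite_integrable:
  fixes f :: "'d::finite fn"
  assumes [measurable]: "f \<in> borel_measurable borel" "S \<in> sets borel" and "sqn S f < \<infinity>" "emeasure lborel S < \<infinity>"
  shows "integrable lborel (\<lambda>x. indicator S x * f x)"
proof (rule integrableI_bounded)
  have "(\<integral>\<^sup>+x. ennreal (norm (indicator S x * f x)) \<partial>lborel) \<le> (\<integral>\<^sup>+x. ennreal ((f x)\<^sup>2) * indicator S x + indicator S x \<partial>lborel)"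
  proof (rule nn_integral_mono)
    fix x
    have "\<bar>f x\<bar> \<le> (f x)\<^sup>2 + 1" using zero_le_power2[of "\<bar>f x\<bar> - 1"] by (simp add: power2_diff)
    then have "ennreal \<bar>f x\<bar> \<le> ennreal ((f x)\<^sup>2) + 1" by (metis ennreal_1 ennreal_leI ennreal_plus zero_le_one zero_le_power2)
    then show "ennreal (norm (indicator S x * f x)) \<le> ennreal ((f x)\<^sup>2) * indicator S x + indicator S x" by (auto simp: indicator_def)
  qed
  also have "\<dots> < \<infinity>" using assms by (subst nn_integral_add) (auto simp: sqn_def)
  finally show "(\<integral>\<^sup>+x. ennreal (norm (indicator S x * f x)) \<partial>lborel) < \<infinity>" .
qed simp

lemma L2loc_loc_int:
  assumes "L2loc f" shows "loc_int f"
  unfolding loc_int_def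
proof (intro allI impI)
  fix K :: "(real^'a) set" assume K: "compact K"
  then obtain R where R: "K \<subseteq> cball 0 R" using bounded_subset_ballD[OF compact_imp_bounded[OF K], of 0] ball_subset_cball by (metis order_trans)
  have "sqn K f < \<infinity>" using le_less_trans[OF sqn_mono[OF R]] assms by (auto simp: L2loc_def)
  then have "integrable lborel (\<lambda>x. indicator K x * f x)"
    by (rule sqn_finite_integrable[OF L2loc_measurable[OF assms] borel_compact[OF K]]) (use emeasure_compact_finite[OF K] in simp)
  then show "set_integrable lborel K f" unfolding set_integrable_def by simp
qed

lemma conv_moll_L2_global:
  fixes g :: "'d::finite fn"
  assumes [measurable]: "g \<in> borel_measurable borel" and fin: "sqn UNIV g < \<infinity>"
  shows "(\<lambda>n. \<integral>\<^sup>+x. ennreal ((conv g (moll n) x - g x)\<^sup>2) \<partial>lborel) \<longlonglongrightarrow> 0"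
proof (rule ennreal_tendsto_0_I)
  fix \<epsilon> :: real assume "\<epsilon> > 0"
  have "sqn (cball 0 R) g < \<infinity>" for R using le_less_trans[OF sqn_mono fin] by auto
  then have l: "loc_int g" by (intro L2loc_loc_int) (auto simp: L2loc_def)
  obtain d where d: "d > 0" "\<And>z. norm z < d \<Longrightarrow> (\<integral>\<^sup>+x. ennreal ((g (x + z) - g x)\<^sup>2) \<partial>lborel) \<le> ennreal \<epsilon>"
    using translation_continuous_L2[OF assms(1) _ \<open>\<epsilon> > 0\<close>] fin by (auto simp: sqn_def)
  show "\<forall>\<^sub>F n in sequentially. (\<integral>\<^sup>+x. ennreal ((conv g (moll n) x - g x)\<^sup>2) \<partial>lborel) \<le> ennreal \<epsilon>"
    using moll_eventually[OF d(1)]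
  proof eventually_elim
    case (elim n)
    let ?e = "inverse (real (Suc n))"
    have "(\<integral>\<^sup>+x. ennreal ((conv g (moll n) x - g x)\<^sup>2) \<partial>lborel) \<le> (\<integral>\<^sup>+x. (\<integral>\<^sup>+z. ennreal ((g (x - z) - g x)\<^sup>2) * ennreal (moll n z) \<partial>lborel) \<partial>lborel)"
      by (intro nn_integral_mono conv_mollifier_diff2 l) simp
    also have "\<dots> \<le> ennreal \<epsilon>"
    proof (rule nn_integral_kernel_le[where r="?e"])
      show "(\<integral>\<^sup>+x. ennreal ((g (x - z) - g x)\<^sup>2) \<partial>lborel) \<le> ennreal \<epsilon>" if "norm z \<le> ?e" for z
        using d(2)[of "-z"] that elim by simp
    qed (use csmooth_mollifier[of ?e, where 'd='d] in \<open>auto simp: csmooth_def nn_integral_mollifier intro: smooth_measurable\<close>)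
    finally show ?case .
  qed
qed

text \<open>The kernel has radius at most 1, so on the ball of radius \<open>R\<close> the
  convolution sees \<open>g\<close> only on the ball of radius \<open>R + 1\<close>. Local
  approximation results thus follow from global ones for truncated functions.\<close>

lemma conv_localize:
  fixes g :: "'d::finite fn"
  assumes "norm x \<le> R" "csmooth r f" "r \<le> 1"
  shows "conv g f x = conv (\<lambda>y. indicator (cball 0 (R + 1)) y * g y) f x"
  unfolding conv_def
proof (rule Bochner_Integration.integral_cong[OF refl])
  fix y :: "real^'d"
  show "g y * f (x - y) = indicator (cball 0 (R + 1)) y * g y * f (x - y)"
  proof (cases "norm y \<le> R + 1")
    case False
    have "norm y \<le> norm x + norm (x - y)" using norm_triangle_sub[of y x] by (simp only: norm_minus_commute)
    then have "norm (x - y) > r" using assms False by linarith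
    then show ?thesis using assms by (simp add: csmooth_def)
  qed auto
qed

lemma moll_csmooth: "csmooth (inverse (real (Suc n))) (moll n)"
  by (rule csmooth_mollifier) simp

lemma moll_radius: "inverse (real (Suc n)) \<le> 1"
  by (simp add: field_simps)

lemma conv_moll_L2conv:
  fixes g :: "'d::finite fn"
  assumes g: "L2loc g"
  shows "L2conv (\<lambda>n. conv g (moll n)) g"
  unfolding L2conv_def
proof
  fix R
  let ?g = "\<lambda>y. indicator (cball 0 (R + 1)) y * g y"
  have m [measurable]: "g \<in> borel_measurable borel" using g by (rule L2loc_measurable)
  have "sqn UNIV ?g = sqn (cball 0 (R + 1)) g"
    unfolding sqn_def by (intro nn_integral_cong) (auto simp: indicator_def)
  then have "(\<lambda>n. \<integral>\<^sup>+x. ennreal ((conv ?g (moll n) x - ?g x)\<^sup>2) \<partial>lborel) \<longlonglongrightarrow> 0"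
    using g by (intro conv_moll_L2_global, measurable) (auto simp: L2loc_def)
  then show "(\<lambda>n. sqn (cball 0 R) (\<lambda>x. conv g (moll n) x - g x)) \<longlonglongrightarrow> 0"
  proof (rule tendsto_sandwich[OF _ _ tendsto_const, rotated -1])
    show "\<forall>\<^sub>F n in sequentially. sqn (cball 0 R) (\<lambda>x. conv g (moll n) x - g x) \<le> (\<integral>\<^sup>+x. ennreal ((conv ?g (moll n) x - ?g x)\<^sup>2) \<partial>lborel)"
    proof (rule always_eventually, rule allI)
      fix n
      show "sqn (cball 0 R) (\<lambda>x. conv g (moll n) x - g x) \<le> (\<integral>\<^sup>+x. ennreal ((conv ?g (moll n) x - ?g x)\<^sup>2) \<partial>lborel)"
        unfolding sqn_def using conv_localize[where R=R and g=g, OF _ moll_csmooth moll_radius]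
        by (intro nn_integral_mono) (auto simp: indicator_def)
    qed
  qed auto
qed

section \<open>Uniqueness of weak derivatives\<close>

lemma csmooth_reflect:
  fixes f :: "'d::finite fn"
  assumes "csmooth r f" shows "csmooth (r + norm x) (\<lambda>y. f (x - y))"
proof -
  have "smooth (\<lambda>y. 1 * f ((-1) *\<^sub>R y + x))" using assms by (intro smooth_affine) (simp add: csmooth_def)
  then have "smooth (\<lambda>y. f (x - y))" by simp
  moreover have "f (x - y) = 0" if "norm y > r + norm x" for y
    using that assms norm_triangle_ineq2[of y x] by (simp add: csmooth_def norm_minus_commute)
  ultimately show ?thesis by (simp add: csmooth_def)
qed

text \<open>Every mollification of \<open>g\<close> at \<open>x\<close> is a pairing with a
  reflected mollifier and so vanishes. On each ball the mollifications of a truncation of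
  \<open>g\<close> agree with these and converge to \<open>g\<close> in L1.\<close>

lemma du_Bois_Reymond:
  fixes g :: "'d::finite fn"
  assumes l: "loc_int g" and 0: "\<And>r f. csmooth r f \<Longrightarrow> (\<integral>x. g x * f x \<partial>lborel) = 0"
  shows "AE x in lborel. g x = 0"
proof -
  note m [measurable] = loc_int_measurable[OF l]
  have c0: "conv g (moll n) x = 0" for n x
    unfolding conv_def using 0[OF csmooth_reflect[OF moll_csmooth]] by simp
  have "AE x in lborel. norm x \<le> real N \<longrightarrow> g x = 0" for N :: nat
  proof -
    let ?R = "real N"
    let ?g = "\<lambda>y. indicator (cball 0 (?R + 1)) y * g y"
    have i: "integrable lborel ?g" using l unfolding loc_int_def set_integrable_def by simp
    have l': "loc_int ?g"
      unfolding loc_int_def set_integrable_def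
      using i by (auto intro!: integrable_mult_indicator[where 'b=real, simplified] borel_compact)
    have "(\<integral>\<^sup>+x. ennreal \<bar>g x\<bar> * indicator (cball 0 ?R) x \<partial>lborel) \<le> (\<integral>\<^sup>+x. ennreal \<bar>conv ?g (moll n) x - ?g x\<bar> \<partial>lborel)" for n
      using conv_localize[where R="?R" and g=g, OF _ moll_csmooth moll_radius] c0
      by (intro nn_integral_mono) (auto simp: indicator_def)
    then have "(\<integral>\<^sup>+x. ennreal \<bar>g x\<bar> * indicator (cball 0 ?R) x \<partial>lborel) \<le> 0"
      by (intro tendsto_lowerbound[OF conv_moll_L1[OF i l']]) auto
    then have "AE x in lborel. ennreal \<bar>g x\<bar> * indicator (cball 0 ?R) x = 0"
      by (subst nn_integral_0_iff_AE[symmetric]; measurable) auto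
    then show ?thesis by eventually_elim (auto simp: indicator_def split: if_splits)
  qed
  then have "AE x in lborel. \<forall>N::nat. norm x \<le> real N \<longrightarrow> g x = 0" unfolding AE_all_countable by blast
  then show ?thesis by eventually_elim (meson real_arch_simple)
qed

lemma loc_int_integrable_csmooth:
  fixes u :: "'d::finite fn"
  assumes "loc_int u" "csmooth r f"
  shows "integrable lborel (\<lambda>x. u x * f x)"
proof -
  obtain B where "\<And>x. \<bar>f x\<bar> \<le> B" using csmooth_bounded[OF assms(2)] by auto
  then show ?thesis
    using assms(2) by (intro loc_int_integrable_mult[OF assms(1), where B=B and c=0 and r=r] csmooth_measurable[OF assms(2)])
      (auto simp: csmooth_def)
qed

lemma loc_int_lincomb:
  fixes u v :: "'d::finite fn"
  assumes "loc_int u" "loc_int v" shows "loc_int (\<lambda>x. a * u x + b * v x)"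
  using assms unfolding loc_int_def set_integrable_def
  by (auto simp: distrib_left mult.left_commute[of "indicator _ _"] intro!: Bochner_Integration.integrable_add integrable_mult_right)

text \<open>Since \<open>wd\<close> is chosen by \<open>SOME\<close>, this is what identifies it
  almost everywhere with any weak derivative constructed by other means.\<close>

lemma weak_deriv_unique:
  fixes u :: "'d::finite fn"
  assumes "weak_deriv \<alpha> u g" "weak_deriv \<alpha> u h"
  shows "AE x in lborel. g x = h x"
proof -
  have l: "loc_int g" "loc_int h" using assms by (auto simp: weak_deriv_def)
  have l': "loc_int (\<lambda>x. g x - h x)" using loc_int_lincomb[OF l, of 1 "-1"] by simp
  have "AE x in lborel. g x - h x = 0"
  proof (rule du_Bois_Reymond[OF l'])
    fix r and f :: "'d fn" assume f: "csmooth r f"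
    note i = loc_int_integrable_csmooth[OF l(1) f] loc_int_integrable_csmooth[OF l(2) f]
    have "(-1) ^ mi_order \<alpha> * (\<integral>x. g x * f x \<partial>lborel) = (-1) ^ mi_order \<alpha> * (\<integral>x. h x * f x \<partial>lborel)"
      using assms csmooth_test_fun[OF f] unfolding weak_deriv_def by auto
    then have "(\<integral>x. g x * f x \<partial>lborel) = (\<integral>x. h x * f x \<partial>lborel)" by simp
    then show "(\<integral>x. (g x - h x) * f x \<partial>lborel) = 0" using i by (simp add: left_diff_distrib)
  qed
  then show ?thesis by simp
qed

section \<open>Integration by parts\<close>

lemma continuous_csupp_integrable:
  fixes f :: "'d::finite fn"
  assumes "continuous_on UNIV f" "\<And>x. norm x > r \<Longrightarrow> f x = 0"
  shows "integrable lborel f"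
proof -
  have "integrable lborel (\<lambda>x. indicator (cball 0 r) x *\<^sub>R f x)"
    using continuous_on_subset[OF assms(1)] by (intro borel_integrable_compact) auto
  moreover have "(\<lambda>x. indicator (cball 0 r) x *\<^sub>R f x) = f"
    using assms(2) by (force simp: indicator_def)
  ultimately show ?thesis by simp
qed

lemma continuous_loc_int:
  fixes f :: "'d::finite fn"
  assumes "continuous_on UNIV f" shows "loc_int f"
  unfolding loc_int_def set_integrable_def
  by (intro allI impI borel_integrable_compact continuous_on_subset[OF assms]) auto

lemma continuous_csupp_bounded:
  fixes f :: "'d::finite fn"
  assumes "continuous_on UNIV f" "\<And>x. norm x > r \<Longrightarrow> f x = 0"
  obtains B where "B > 0" "\<And>x. \<bar>f x\<bar> \<le> B"
proof -
  have "compact (f ` cball 0 r)"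
    using continuous_on_subset[OF assms(1)] by (intro compact_continuous_image) auto
  then obtain B where B: "B > 0" "\<And>x. norm x \<le> r \<Longrightarrow> \<bar>f x\<bar> \<le> B"
    by (metis bounded_pos compact_imp_bounded imageI mem_cball_0 real_norm_def)
  show thesis
  proof (rule that[OF B(1)])
    fix x show "\<bar>f x\<bar> \<le> B" using B assms(2)[of x] by (cases "norm x \<le> r") auto
  qed
qed

text \<open>By translation invariance every difference quotient of \<open>p\<close> in direction
  \<open>i\<close> has integral 0. The quotients are bounded by the mean value theorem and supported
  in a fixed ball, so dominated convergence yields the claim.\<close>

lemma integral_partial_derivative_0:
  fixes p p' :: "'d::finite fn"
  assumes d: "\<And>x. ((\<lambda>t. p (x + t *\<^sub>R axis i 1)) has_real_derivative p' x) (at 0)"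
    and p': "continuous_on UNIV p'" and p: "continuous_on UNIV p"
    and s: "\<And>x. norm x > r \<Longrightarrow> p x = 0" "\<And>x. norm x > r \<Longrightarrow> p' x = 0"
  shows "(\<integral>x. p' x \<partial>lborel) = 0"
proof -
  obtain B where B: "B > 0" "\<And>x. \<bar>p' x\<bar> \<le> B" using continuous_csupp_bounded[OF p' s(2)] by blast
  have [measurable]: "p \<in> borel_measurable borel" "p' \<in> borel_measurable borel"
    using p p' by (auto intro: borel_measurable_continuous_onI)
  have pi: "integrable lborel p" by (rule continuous_csupp_integrable[OF p s(1)])
  define h where "h n = inverse (real (Suc n))" for n
  have h: "0 < h n" "h n \<le> 1" for n by (auto simp: h_def field_simps)
  have h0: "h \<longlonglongrightarrow> 0" unfolding h_def[abs_def] by (rule LIMSEQ_inverse_real_of_nat)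
  let ?Q = "\<lambda>n x. (p (x + h n *\<^sub>R axis i 1) - p x) / h n"
  have line: "((\<lambda>t. p (x + t *\<^sub>R axis i 1)) has_real_derivative p' (x + s *\<^sub>R axis i 1)) (at s)" for x s
    using d[of "x + s *\<^sub>R axis i 1"] DERIV_shift[of "\<lambda>t. p (x + t *\<^sub>R axis i 1)" _ 0 s]
    by (simp add: scaleR_add_left add_ac)
  have Qb: "\<bar>?Q n x\<bar> \<le> B * indicator (cball 0 (r + 1)) x" for n x
  proof (cases "norm x \<le> r + 1")
    case True
    obtain \<xi> where "p (x + h n *\<^sub>R axis i 1) - p (x + 0 *\<^sub>R axis i 1) = (h n - 0) * p' (x + \<xi> *\<^sub>R axis i 1)"
      using MVT2[OF h(1)[of n], of "\<lambda>t. p (x + t *\<^sub>R axis i 1)" "\<lambda>t. p' (x + t *\<^sub>R axis i 1)"] line by blast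
    then have "?Q n x = p' (x + \<xi> *\<^sub>R axis i 1)" using h(1)[of n] by simp
    then show ?thesis using B True by simp
  next
    case False
    have "norm x \<le> norm (x + h n *\<^sub>R axis i 1) + norm (h n *\<^sub>R axis i 1 :: real^'d)"
      using norm_triangle_ineq4[of "x + h n *\<^sub>R axis i 1" "h n *\<^sub>R axis i 1"] by simp
    also have "norm (h n *\<^sub>R axis i 1 :: real^'d) \<le> 1" using h[of n] by simp
    finally show ?thesis using False s(1)[of x] s(1)[of "x + h n *\<^sub>R axis i 1"] by simp
  qed
  have "(\<lambda>n. \<integral>x. ?Q n x \<partial>lborel) \<longlonglongrightarrow> (\<integral>x. p' x \<partial>lborel)"
  proof (rule integral_dominated_convergence[where w="\<lambda>x. B * indicator (cball 0 (r + 1)) x"])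
    show "integrable lborel (\<lambda>x. B * indicator (cball (0::real^'d) (r + 1)) x)"
      using emeasure_lborel_cball_finite[of "0::real^'d" "r + 1"] by (intro integrable_mult_right integrable_real_indicator) auto
    show "AE x in lborel. (\<lambda>n. ?Q n x) \<longlonglongrightarrow> p' x"
    proof (rule AE_I2)
      fix x
      have "((\<lambda>t. (p (x + t *\<^sub>R axis i 1) - p x) / t) \<longlongrightarrow> p' x) (at 0)"
        using d[of x] by (simp add: DERIV_def)
      moreover have "filterlim h (at 0) sequentially"
        unfolding filterlim_at using h0 h(1) by (auto intro!: always_eventually) (metis less_irrefl)
      ultimately show "(\<lambda>n. ?Q n x) \<longlonglongrightarrow> p' x" by (rule filterlim_compose)
    qed
    show "AE x in lborel. norm (?Q n x) \<le> B * indicator (cball 0 (r + 1)) x" for n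
      using Qb by simp
  qed simp_all
  moreover have "(\<integral>x. ?Q n x \<partial>lborel) = 0" for n
    using integral_translate[OF pi] integrable_translate[OF pi] pi by simp
  then have "(\<lambda>n. \<integral>x. ?Q n x \<partial>lborel) = (\<lambda>_. 0)" by (rule ext)
  ultimately show ?thesis by (metis LIMSEQ_const_iff)
qed

lemma eventually_line_far:
  fixes x v :: "'a::real_normed_vector"
  assumes "norm x > r" shows "\<forall>\<^sub>F t in nhds (0::real). norm (x + t *\<^sub>R v) > r"
proof -
  have "open {t::real. r < norm (x + t *\<^sub>R v)}" by (intro open_Collect_less continuous_intros)
  from eventually_nhds_in_open[OF this, of 0] show ?thesis using assms by simp
qed

text \<open>The assumptions on \<psi> are exactly what \<open>test_fun\<close> supplies for its
  iterated partials: differentiability along coordinate lines and continuity, rather than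
  \<open>smooth\<close>.\<close>

lemma integral_by_parts:
  fixes f \<psi> :: "'d::finite fn"
  assumes f: "smooth f" and d: "\<And>x. (\<lambda>t. \<psi> (x + t *\<^sub>R axis i 1)) differentiable (at 0)"
    and c: "continuous_on UNIV \<psi>" "continuous_on UNIV (cpd i \<psi>)"
    and s: "\<And>x. norm x > r \<Longrightarrow> \<psi> x = 0"
  shows "(\<integral>x. f x * cpd i \<psi> x \<partial>lborel) = - (\<integral>x. cpd i f x * \<psi> x \<partial>lborel)"
proof -
  have d\<psi>: "((\<lambda>t. \<psi> (x + t *\<^sub>R axis i 1)) has_real_derivative cpd i \<psi> x) (at 0)" for x
    using d[of x] unfolding cpd_def by (simp add: DERIV_deriv_iff_real_differentiable)
  have s': "cpd i \<psi> x = 0" if "norm x > r" for x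
  proof -
    have "\<forall>\<^sub>F t in nhds 0. norm (x + t *\<^sub>R axis i 1) > r" using that by (rule eventually_line_far)
    then have "\<forall>\<^sub>F t in nhds 0. \<psi> (x + t *\<^sub>R axis i 1) = 0" by eventually_elim (rule s)
    then have "((\<lambda>t. \<psi> (x + t *\<^sub>R axis i 1)) has_real_derivative 0) (at 0)"
      by (subst DERIV_cong_ev[OF refl _ refl, where g="\<lambda>_. 0"]) auto
    then show ?thesis using d\<psi> DERIV_unique by blast
  qed
  have cf: "continuous_on UNIV f" "continuous_on UNIV (cpd i f)"
    by (intro smooth_continuous smooth_cpd f)+
  let ?p' = "\<lambda>x. f x * cpd i \<psi> x + cpd i f x * \<psi> x"
  have "(\<integral>x. ?p' x \<partial>lborel) = 0"
  proof (rule integral_partial_derivative_0[where p="\<lambda>x. f x * \<psi> x" and i=i and r=r])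
    fix x
    have "((\<lambda>t. f (x + t *\<^sub>R axis i 1)) has_real_derivative cpd i f x) (at 0)"
      using cpd_line[of f x i 0, OF smooth_differentiable[OF f]] by simp
    from DERIV_mult[OF this d\<psi>[of x]]
    show "((\<lambda>t. f (x + t *\<^sub>R axis i 1) * \<psi> (x + t *\<^sub>R axis i 1)) has_real_derivative ?p' x) (at 0)"
      by (simp add: mult.commute add.commute)
  qed (auto intro!: continuous_on_add continuous_on_mult cf c simp: s s')
  moreover have "integrable lborel (\<lambda>x. f x * cpd i \<psi> x)" "integrable lborel (\<lambda>x. cpd i f x * \<psi> x)"
    by (rule continuous_csupp_integrable[where r=r]; auto intro!: continuous_on_mult cf c simp: s s')+
  ultimately show ?thesis by simp
qed

lemma pd_list_test_fun_eq_0: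
  fixes \<phi> :: "'d::finite fn"
  assumes t: "test_fun \<phi>" and s: "\<And>x. norm x > r \<Longrightarrow> \<phi> x = 0" and x: "norm x > r"
  shows "pd_list is \<phi> x = 0"
  using x
proof (induction "is" arbitrary: x)
  case (Cons i "is")
  have "\<forall>\<^sub>F t in nhds 0. norm (x + t *\<^sub>R axis i 1) > r" using Cons.prems by (rule eventually_line_far)
  then have "\<forall>\<^sub>F t in nhds 0. pd_list is \<phi> (x + t *\<^sub>R axis i 1) = 0" by eventually_elim (rule Cons.IH)
  then have "((\<lambda>t. pd_list is \<phi> (x + t *\<^sub>R axis i 1)) has_real_derivative 0) (at 0)"
    by (subst DERIV_cong_ev[OF refl _ refl, where g="\<lambda>_. 0"]) auto
  then show ?case by (simp add: cpd_def DERIV_imp_deriv)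
qed (use s in auto)

lemma test_fun_radius:
  fixes \<phi> :: "'d::finite fn"
  assumes "test_fun \<phi>"
  obtains r where "\<And>x. norm x > r \<Longrightarrow> \<phi> x = 0"
proof -
  have "bounded (supp \<phi>)" using assms unfolding test_fun_def by (auto intro: compact_imp_bounded)
  then obtain r where r: "\<And>x. x \<in> supp \<phi> \<Longrightarrow> norm x \<le> r" unfolding bounded_iff by blast
  show thesis
  proof (rule that[of r])
    fix x :: "real^'d" assume "norm x > r"
    then have "x \<notin> supp \<phi>" using r[of x] by auto
    then show "\<phi> x = 0" unfolding supp_def using closure_subset[of "{x. \<phi> x \<noteq> 0}"] by auto
  qed
qed

lemma integral_by_parts_list:
  fixes f \<phi> :: "'d::finite fn"
  assumes f: "smooth f" and t: "test_fun \<phi>"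
  shows "(\<integral>x. f x * pd_list is \<phi> x \<partial>lborel) = (-1) ^ length is * (\<integral>x. pd_list (rev is) f x * \<phi> x \<partial>lborel)"
  using f
proof (induction "is" arbitrary: f)
  case (Cons i "is")
  obtain r where r: "\<And>x. norm x > r \<Longrightarrow> \<phi> x = 0" using test_fun_radius[OF t] by blast
  have "(\<integral>x. f x * cpd i (pd_list is \<phi>) x \<partial>lborel) = - (\<integral>x. cpd i f x * pd_list is \<phi> x \<partial>lborel)"
  proof (rule integral_by_parts[OF Cons.prems, where r=r])
    show "continuous_on UNIV (cpd i (pd_list is \<phi>))" using t unfolding test_fun_def by (metis pd_list.simps(2))
  qed (use t pd_list_test_fun_eq_0[OF t r] in \<open>auto simp: test_fun_def\<close>)
  then show ?case using Cons.IH[OF smooth_cpd[OF Cons.prems]] by (simp add: pd_list_append)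
qed simp

section \<open>Multi-indices and weak derivatives\<close>

definition mi_list :: "('d::finite \<Rightarrow> nat) \<Rightarrow> 'd list" where
  "mi_list \<alpha> = (SOME is. \<forall>i. count_list is i = \<alpha> i)"

lemma count_mi_list: "count_list (mi_list \<alpha>) = \<alpha>"
proof -
  have "\<exists>is. \<forall>i. count_list is i = \<alpha> i"
  proof -
    obtain xs where xs: "mset xs = Abs_multiset \<alpha>" using ex_mset by blast
    have "count (mset xs) = \<alpha>" unfolding xs by (simp add: Abs_multiset_inverse)
    then show ?thesis by (metis count_mset)
  qed
  from someI_ex[OF this] show ?thesis unfolding mi_list_def by auto
qed

lemma cpartial_eq: "cpartial \<alpha> f = pd_list (mi_list \<alpha>) f"
  by (simp add: cpartial_def mi_list_def)

lemma mi_order_count: "mi_order (count_list is) = length is"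
  unfolding mi_order_def by (simp add: sum_count_set)

lemma length_mi_list: "length (mi_list \<alpha>) = mi_order \<alpha>"
  using mi_order_count[of "mi_list \<alpha>"] by (simp add: count_mi_list)

lemma pd_list_mi_list: "smooth f \<Longrightarrow> pd_list (mi_list (count_list is)) f = pd_list is f"
  by (rule pd_list_perm) (auto simp: count_mi_list)

text \<open>The function y \<mapsto> f (x - y) is a test function, so the derivatives move from the
  kernel to \<open>u\<close>. The sign from the reflection cancels the sign in the definition of a
  weak derivative.\<close>

lemma conv_weak_deriv:
  fixes u :: "'d::finite fn"
  assumes w: "weak_deriv (count_list is) u g" and f: "csmooth r f"
  shows "conv u (pd_list is f) = conv g f"
proof
  fix x
  have sf: "smooth f" using f by (simp add: csmooth_def)
  let ?p = "\<lambda>y. f (x - y)"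
  have p: "csmooth (r + norm x) ?p" by (rule csmooth_reflect[OF f])
  have "cpartial (count_list is) ?p = pd_list is ?p"
    unfolding cpartial_eq using p by (simp add: pd_list_mi_list csmooth_def)
  also have "\<dots> = (\<lambda>y. (-1) ^ length is * pd_list is f (x - y))"
    using pd_list_affine[OF sf, of "is" 1 "-1" x] by simp
  finally have "cpartial (count_list is) ?p = (\<lambda>y. (-1) ^ length is * pd_list is f (x - y))" .
  moreover have "(\<integral>y. u y * cpartial (count_list is) ?p y \<partial>lborel) = (-1) ^ mi_order (count_list is) * (\<integral>y. g y * ?p y \<partial>lborel)"
    using w csmooth_test_fun[OF p] unfolding weak_deriv_def by blast
  ultimately have "(\<integral>y. u y * ((-1) ^ length is * pd_list is f (x - y)) \<partial>lborel) = (-1) ^ length is * (\<integral>y. g y * f (x - y) \<partial>lborel)"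
    by (simp only: mi_order_count)
  moreover have "u y * ((-1) ^ length is * q) = (-1) ^ length is * (u y * q)" for y q by (rule mult.left_commute)
  ultimately have "(\<integral>y. (-1) ^ length is * (u y * pd_list is f (x - y)) \<partial>lborel) = (-1) ^ length is * (\<integral>y. g y * f (x - y) \<partial>lborel)"
    by (simp only:)
  then have "(-1) ^ length is * (\<integral>y. u y * pd_list is f (x - y) \<partial>lborel) = (-1) ^ length is * (\<integral>y. g y * f (x - y) \<partial>lborel)"
    by (simp only: integral_mult_right_zero)
  then show "conv u (pd_list is f) x = conv g f x" unfolding conv_def by simp
qed

lemma L2conv_pairing:
  fixes F :: "nat \<Rightarrow> 'd::finite fn"
  assumes F: "\<And>n. L2loc (F n)" and f: "L2loc f" and c: "L2conv F f"
    and [measurable]: "\<psi> \<in> borel_measurable borel" and B: "\<And>x. \<bar>\<psi> x\<bar> \<le> B" and s: "\<And>x. norm x > r \<Longrightarrow> \<psi> x = 0"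
  shows "(\<lambda>n. \<integral>x. F n x * \<psi> x \<partial>lborel) \<longlonglongrightarrow> (\<integral>x. f x * \<psi> x \<partial>lborel)"
proof -
  note m [measurable] = L2loc_measurable[OF F] L2loc_measurable[OF f]
  let ?S = "cball (0::real^'d) r"
  have i: "integrable lborel (\<lambda>x. h x * \<psi> x)" if "L2loc h" for h
    by (rule loc_int_integrable_mult[OF L2loc_loc_int[OF that] _ B, where c=0 and r=r]) (use s in auto)
  have "sqn ?S \<psi> \<le> sqn ?S (\<lambda>_. B)" using B by (intro sqn_le) (meson abs_ge_self order_trans)
  also have "\<dots> = ennreal (B\<^sup>2) * emeasure lborel ?S" using sqn_cmult[of "\<lambda>_. 1" ?S B] sqn_indicator[of ?S] by simp
  also have "\<dots> < \<infinity>" using emeasure_lborel_cball_finite[of "0::real^'d" r] by (simp add: ennreal_mult_less_top)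
  finally have fin: "sqn ?S \<psi> \<noteq> \<infinity>" by simp
  have le: "ennreal (((\<integral>x. F n x * \<psi> x \<partial>lborel) - (\<integral>x. f x * \<psi> x \<partial>lborel))\<^sup>2) \<le> sqn ?S (\<lambda>x. F n x - f x) * sqn ?S \<psi>" for n
  proof -
    have "(\<integral>x. F n x * \<psi> x \<partial>lborel) - (\<integral>x. f x * \<psi> x \<partial>lborel) = (\<integral>x. (F n x - f x) * \<psi> x * indicator ?S x \<partial>lborel)"
      by (subst Bochner_Integration.integral_diff[symmetric, OF i[OF F] i[OF f]], rule Bochner_Integration.integral_cong)
         (use s in \<open>auto simp: indicator_def left_diff_distrib not_le\<close>)
    then show ?thesis using sqn_CS[of "\<lambda>x. F n x - f x" \<psi> ?S] by simp
  qed
  have "(\<lambda>n. sqn ?S (\<lambda>x. F n x - f x) * sqn ?S \<psi>) \<longlonglongrightarrow> 0 * sqn ?S \<psi>"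
    using c fin unfolding L2conv_def by (intro tendsto_mult_ennreal) auto
  then have "(\<lambda>n. ennreal (((\<integral>x. F n x * \<psi> x \<partial>lborel) - (\<integral>x. f x * \<psi> x \<partial>lborel))\<^sup>2)) \<longlonglongrightarrow> ennreal 0"
    by (intro tendsto_sandwich[OF _ always_eventually[OF allI[OF le]] tendsto_const]) auto
  then have "(\<lambda>n. ((\<integral>x. F n x * \<psi> x \<partial>lborel) - (\<integral>x. f x * \<psi> x \<partial>lborel))\<^sup>2) \<longlonglongrightarrow> 0"
    by (subst (asm) tendsto_ennreal_iff) auto
  then have "(\<lambda>n. sqrt (((\<integral>x. F n x * \<psi> x \<partial>lborel) - (\<integral>x. f x * \<psi> x \<partial>lborel))\<^sup>2)) \<longlonglongrightarrow> sqrt 0"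
    by (rule tendsto_real_sqrt)
  then show ?thesis by (simp add: tendsto_rabs_zero_iff LIM_zero_iff)
qed

lemma continuous_L2loc:
  fixes f :: "'d::finite fn"
  assumes "continuous_on UNIV f" shows "L2loc f"
  unfolding L2loc_def
proof (intro conjI allI)
  show m: "f \<in> borel_measurable borel" by (rule borel_measurable_continuous_onI[OF assms])
  fix R
  have "compact (f ` cball 0 R)"
    using continuous_on_subset[OF assms] by (intro compact_continuous_image) auto
  then obtain B where B: "B > 0" "\<And>x. norm x \<le> R \<Longrightarrow> \<bar>f x\<bar> \<le> B"
    by (metis bounded_pos compact_imp_bounded imageI mem_cball_0 real_norm_def)
  let ?S = "cball (0::real^'d) R"
  have "sqn ?S f \<le> sqn ?S (\<lambda>_. B)" using B by (intro sqn_le) (auto intro: order_trans)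
  also have "\<dots> = ennreal (B\<^sup>2) * emeasure lborel ?S" using sqn_cmult[of "\<lambda>_. 1" ?S B] sqn_indicator[of ?S] by simp
  also have "\<dots> < \<infinity>" using emeasure_lborel_cball_finite[of "0::real^'d" R] by (simp add: ennreal_mult_less_top)
  finally show "sqn ?S f < \<infinity>" .
qed

lemma smooth_L2loc: "smooth f \<Longrightarrow> L2loc f"
  by (intro continuous_L2loc smooth_continuous)

text \<open>Weak differentiation is a closed operation: integration by parts holds for each
  \<open>F n\<close>, and both sides converge by \<open>L2conv_pairing\<close>. This is the tool
  that produces weak derivatives from smooth approximations.\<close>

lemma weak_deriv_limit:
  fixes F :: "nat \<Rightarrow> 'd::finite fn"
  assumes F: "\<And>n. smooth (F n)" and u: "L2loc u" and g: "L2loc g"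
    and c: "L2conv F u" "L2conv (\<lambda>n. pd_list (mi_list \<alpha>) (F n)) g"
  shows "weak_deriv \<alpha> u g"
  unfolding weak_deriv_def
proof (intro conjI allI impI L2loc_loc_int u g)
  fix \<phi> :: "'d fn" assume t: "test_fun \<phi>"
  obtain r where r: "\<And>x. norm x > r \<Longrightarrow> \<phi> x = 0" using test_fun_radius[OF t] by blast
  have conts: "continuous_on UNIV (pd_list is \<phi>)" for "is" using t by (auto simp: test_fun_def)
  have meas: "pd_list is \<phi> \<in> borel_measurable borel" for "is" by (rule borel_measurable_continuous_onI[OF conts])
  have z: "pd_list is \<phi> x = 0" if "norm x > r" for "is" x by (rule pd_list_test_fun_eq_0[OF t r that])
  let ?l = "mi_list \<alpha>"
  obtain B where B: "\<And>x. \<bar>pd_list ?l \<phi> x\<bar> \<le> B" using continuous_csupp_bounded[OF conts, of r ?l] z by metis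
  obtain B' where B': "\<And>x. \<bar>\<phi> x\<bar> \<le> B'" using continuous_csupp_bounded[OF conts[of "[]"], of r] r by (metis pd_list.simps(1))
  have eq: "(\<integral>x. F n x * pd_list ?l \<phi> x \<partial>lborel) = (-1) ^ mi_order \<alpha> * (\<integral>x. pd_list ?l (F n) x * \<phi> x \<partial>lborel)" for n
  proof -
    \<comment> \<open>Integration by parts reverses the order of the derivatives, which is
      immaterial for the smooth \<open>F n\<close>.\<close>
    have "pd_list (rev ?l) (F n) = pd_list ?l (F n)" by (rule pd_list_perm[OF F]) (simp flip: count_mset)
    then show ?thesis using integral_by_parts_list[OF F[of n] t, of ?l] by (simp add: length_mi_list)
  qed
  have "(\<lambda>n. \<integral>x. F n x * pd_list ?l \<phi> x \<partial>lborel) \<longlonglongrightarrow> (\<integral>x. u x * pd_list ?l \<phi> x \<partial>lborel)"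
    by (rule L2conv_pairing[OF smooth_L2loc[OF F] u c(1) meas B z])
  moreover have "(\<lambda>n. \<integral>x. pd_list ?l (F n) x * \<phi> x \<partial>lborel) \<longlonglongrightarrow> (\<integral>x. g x * \<phi> x \<partial>lborel)"
    by (rule L2conv_pairing[OF smooth_L2loc[OF smooth_pd_list[OF F]] g c(2) meas[of "[]", simplified] B' r])
  ultimately show "(\<integral>x. u x * cpartial \<alpha> \<phi> x \<partial>lborel) = (-1) ^ mi_order \<alpha> * (\<integral>x. g x * \<phi> x \<partial>lborel)"
    unfolding cpartial_eq eq by (intro LIMSEQ_unique[OF _ tendsto_mult_left])
qed

section \<open>The Poincare inequality on convex sets\<close>

definition grad2 :: "'d::finite fn \<Rightarrow> 'd fn" where
  "grad2 w x = (\<Sum>i\<in>UNIV. (cpd i w x)\<^sup>2)"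

lemma grad2_nonneg: "grad2 w x \<ge> 0"
  unfolding grad2_def by (intro sum_nonneg) simp

lemma grad2_continuous: "smooth w \<Longrightarrow> continuous_on UNIV (grad2 w)"
  unfolding grad2_def[abs_def] by (intro continuous_intros smooth_continuous smooth_cpd)

text \<open>The fundamental theorem of calculus along the segment from \<open>y\<close> to
  \<open>x\<close>, followed by Cauchy-Schwarz first in the directions and then in the
  parameter.\<close>

lemma segment_difference:
  fixes w :: "'d::finite fn"
  assumes w: "smooth w" and D: "norm (x - y) \<le> D"
  shows "ennreal ((w x - w y)\<^sup>2) \<le> ennreal (D\<^sup>2) * (\<integral>\<^sup>+t. ennreal (grad2 w (y + t *\<^sub>R (x - y))) * indicator {0..1} t \<partial>lborel)"
proof -
  let ?h = "x - y"
  define f where "f = (\<lambda>t::real. \<Sum>i\<in>UNIV. ?h $ i * cpd i w (y + t *\<^sub>R ?h))"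
  have cl: "continuous_on UNIV (\<lambda>t::real. g (y + t *\<^sub>R ?h))" if "continuous_on UNIV g" for g :: "'d fn"
    by (rule continuous_on_compose2[OF that]) (auto intro!: continuous_intros)
  have cf: "continuous_on UNIV f" unfolding f_def by (intro continuous_intros cl smooth_continuous smooth_cpd w)
  have [measurable]: "f \<in> borel_measurable borel" by (rule borel_measurable_continuous_onI[OF cf])
  have "((\<lambda>t. w (y + t *\<^sub>R ?h)) has_real_derivative f t) (at t)" for t
    unfolding f_def by (intro has_derivative_line has_derivative_cpd smooth_differentiable w)
  then have F: "has_bochner_integral lborel (\<lambda>t. f t * indicator {0..1} t) (w (y + 1 *\<^sub>R ?h) - w (y + 0 *\<^sub>R ?h))"
    using cf by (intro has_bochner_integral_FTC_Icc_real) (auto simp: continuous_on_eq_continuous_at)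
  have sq: "(f t)\<^sup>2 \<le> D\<^sup>2 * grad2 w (y + t *\<^sub>R ?h)" for t
  proof -
    have "(f t)\<^sup>2 \<le> (\<Sum>i\<in>UNIV. (?h $ i)\<^sup>2) * grad2 w (y + t *\<^sub>R ?h)"
      unfolding grad2_def f_def by (rule Cauchy_Schwarz_ineq_sum)
    also have "(\<Sum>i\<in>UNIV. (?h $ i)\<^sup>2) = (norm ?h)\<^sup>2"
      unfolding power2_norm_eq_inner inner_vec_def by (simp add: power2_eq_square)
    also have "\<dots> * grad2 w (y + t *\<^sub>R ?h) \<le> D\<^sup>2 * grad2 w (y + t *\<^sub>R ?h)"
      using D by (intro mult_right_mono power_mono grad2_nonneg) auto
    finally show ?thesis .
  qed
  have gm: "(\<lambda>t. ennreal (grad2 w (y + t *\<^sub>R ?h)) * indicator {0..1} t) \<in> borel_measurable lborel"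
    using borel_measurable_continuous_onI[OF cl[OF grad2_continuous[OF w]]] by simp
  have "ennreal \<bar>w x - w y\<bar> \<le> (\<integral>\<^sup>+t. norm (f t * indicator {0..1} t) \<partial>lborel)"
    using integral_norm_bound_ennreal[of lborel "\<lambda>t. f t * indicator {0..1} t"] F
    by (simp add: has_bochner_integral_iff)
  also have "\<dots> = (\<integral>\<^sup>+t. (ennreal \<bar>f t\<bar> * indicator {0..1} t) * indicator {0..1} t \<partial>lborel)"
    by (intro nn_integral_cong) (auto simp: indicator_def)
  finally have "(ennreal \<bar>w x - w y\<bar>)\<^sup>2 \<le> (\<integral>\<^sup>+t. (ennreal \<bar>f t\<bar> * indicator {0..1} t) * indicator {0..1} t \<partial>lborel)\<^sup>2"
    by (rule power_mono) simp
  also have "\<dots> \<le> (\<integral>\<^sup>+t. (ennreal \<bar>f t\<bar> * indicator {0..1} t)\<^sup>2 \<partial>lborel) * (\<integral>\<^sup>+t. (indicator {0..1::real} t)\<^sup>2 \<partial>lborel)"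
    by (rule Cauchy_Schwarz_nn_integral) auto
  also have "(\<integral>\<^sup>+t. (indicator {0..1::real} t :: ennreal)\<^sup>2 \<partial>lborel) = (\<integral>\<^sup>+t. indicator {0..1::real} t \<partial>lborel)"
    by (intro nn_integral_cong) (auto simp: indicator_def)
  also have "\<dots> = 1" by simp
  also have "(\<integral>\<^sup>+t. (ennreal \<bar>f t\<bar> * indicator {0..1} t)\<^sup>2 \<partial>lborel) \<le> (\<integral>\<^sup>+t. ennreal (D\<^sup>2) * (ennreal (grad2 w (y + t *\<^sub>R ?h)) * indicator {0..1} t) \<partial>lborel)"
  proof (rule nn_integral_mono)
    fix t
    have "ennreal \<bar>f t\<bar> ^ 2 \<le> ennreal (D\<^sup>2) * ennreal (grad2 w (y + t *\<^sub>R ?h))"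
      using ennreal_leI[OF sq[of t]] by (simp add: ennreal_power ennreal_mult grad2_nonneg)
    then show "(ennreal \<bar>f t\<bar> * indicator {0..1} t)\<^sup>2 \<le> ennreal (D\<^sup>2) * (ennreal (grad2 w (y + t *\<^sub>R ?h)) * indicator {0..1} t)"
      by (auto simp: indicator_def)
  qed
  also have "\<dots> = ennreal (D\<^sup>2) * (\<integral>\<^sup>+t. ennreal (grad2 w (y + t *\<^sub>R ?h)) * indicator {0..1} t \<partial>lborel)"
    by (rule nn_integral_cmult[OF gm])
  finally show ?thesis by (simp add: ennreal_power)
qed

text \<open>The substitution has Jacobian t^d, which is at least 2^-d.\<close>

lemma nn_integral_convex_combination:
  fixes g :: "real^'d::finite \<Rightarrow> ennreal"
  assumes [measurable]: "g \<in> borel_measurable borel" and t: "t \<ge> 1/2"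
  shows "(\<integral>\<^sup>+x. g (c + t *\<^sub>R x) \<partial>lborel) \<le> 2 ^ CARD('d) * (\<integral>\<^sup>+x. g x \<partial>lborel)"
proof -
  have t0: "t \<noteq> 0" using t by auto
  have "1 \<le> (2 * t) ^ CARD('d)" using t by (intro one_le_power) auto
  also have "\<dots> = 2 ^ CARD('d) * \<bar>t\<bar> ^ CARD('d)" using t by (simp add: power_mult_distrib)
  finally have "ennreal 1 \<le> ennreal (2 ^ CARD('d) * \<bar>t\<bar> ^ CARD('d))" by (rule ennreal_leI)
  also have "\<dots> = 2 ^ CARD('d) * ennreal (\<bar>t\<bar> ^ CARD('d))" by (simp add: ennreal_mult flip: ennreal_power)
  finally have "1 * (\<integral>\<^sup>+x. g (c + t *\<^sub>R x) \<partial>lborel) \<le> 2 ^ CARD('d) * ennreal (\<bar>t\<bar> ^ CARD('d)) * (\<integral>\<^sup>+x. g (c + t *\<^sub>R x) \<partial>lborel)"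
    by (intro mult_right_mono) auto
  also have "\<dots> = 2 ^ CARD('d) * (\<integral>\<^sup>+x. g x \<partial>lborel)"
    using nn_integral_affine[OF assms(1) t0, of c] by (simp add: mult.assoc)
  finally show ?thesis by simp
qed

text \<open>The substitution degenerates when the chosen variable has a small coefficient. One of t
  and 1 - t is at least 1/2, so integrating first in \<open>x\<close> or in \<open>y\<close>
  accordingly bounds the Jacobian for every t. Convexity keeps the intermediate point in
  \<open>S\<close>.\<close>

lemma segment_average:
  fixes g :: "real^'d::finite \<Rightarrow> ennreal"
  assumes [measurable]: "g \<in> borel_measurable borel" "S \<in> sets borel" and S: "convex S" and t: "t \<in> {0..1}"
  shows "(\<integral>\<^sup>+x. \<integral>\<^sup>+y. g (y + t *\<^sub>R (x - y)) * indicator S x * indicator S y \<partial>lborel \<partial>lborel)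
    \<le> emeasure lborel S * (2 ^ CARD('d) * (\<integral>\<^sup>+x. g x * indicator S x \<partial>lborel))"
proof -
  let ?G = "\<lambda>x. g x * indicator S x"
  let ?I = "\<integral>\<^sup>+x. ?G x \<partial>lborel"
  have [measurable]: "?G \<in> borel_measurable borel" by simp
  have c: "y + t *\<^sub>R (x - y) = (1 - t) *\<^sub>R y + t *\<^sub>R x" for x y :: "real^'d" by (simp add: algebra_simps)
  have b: "g (y + t *\<^sub>R (x - y)) * indicator S x * indicator S y \<le> ?G ((1 - t) *\<^sub>R y + t *\<^sub>R x)" for x y
  proof (cases "x \<in> S \<and> y \<in> S")
    case True
    then have "(1 - t) *\<^sub>R y + t *\<^sub>R x \<in> S" using S t by (intro convexD) auto
    then show ?thesis using True by (simp add: c)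
  qed (auto simp: indicator_def)
  show ?thesis
  proof (cases "t \<ge> 1/2")
    case True
    have "(\<integral>\<^sup>+x. \<integral>\<^sup>+y. g (y + t *\<^sub>R (x - y)) * indicator S x * indicator S y \<partial>lborel \<partial>lborel)
        = (\<integral>\<^sup>+y. \<integral>\<^sup>+x. g (y + t *\<^sub>R (x - y)) * indicator S x * indicator S y \<partial>lborel \<partial>lborel)"
      by (rule lborel_pair.Fubini'[symmetric]) measurable
    also have "\<dots> \<le> (\<integral>\<^sup>+y. (2 ^ CARD('d) * ?I) * indicator S y \<partial>lborel)"
    proof (rule nn_integral_mono)
      fix y
      have "(\<integral>\<^sup>+x. g (y + t *\<^sub>R (x - y)) * indicator S x * indicator S y \<partial>lborel) \<le> (\<integral>\<^sup>+x. ?G ((1 - t) *\<^sub>R y + t *\<^sub>R x) \<partial>lborel)"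
        using b by (intro nn_integral_mono) blast
      also have "\<dots> \<le> 2 ^ CARD('d) * ?I" by (rule nn_integral_convex_combination) (use True in auto)
      finally show "(\<integral>\<^sup>+x. g (y + t *\<^sub>R (x - y)) * indicator S x * indicator S y \<partial>lborel) \<le> (2 ^ CARD('d) * ?I) * indicator S y"
        by (auto simp: indicator_def)
    qed
    also have "\<dots> = emeasure lborel S * (2 ^ CARD('d) * ?I)" by (subst nn_integral_cmult_indicator) (auto simp: mult.commute)
    finally show ?thesis .
  next
    case False
    have "(\<integral>\<^sup>+x. \<integral>\<^sup>+y. g (y + t *\<^sub>R (x - y)) * indicator S x * indicator S y \<partial>lborel \<partial>lborel)
       \<le> (\<integral>\<^sup>+x. (2 ^ CARD('d) * ?I) * indicator S x \<partial>lborel)"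
    proof (rule nn_integral_mono)
      fix x
      have "(\<integral>\<^sup>+y. g (y + t *\<^sub>R (x - y)) * indicator S x * indicator S y \<partial>lborel) \<le> (\<integral>\<^sup>+y. ?G (t *\<^sub>R x + (1 - t) *\<^sub>R y) \<partial>lborel)"
        using b by (intro nn_integral_mono) (simp only: add.commute[of "t *\<^sub>R x"])
      also have "\<dots> \<le> 2 ^ CARD('d) * ?I" by (rule nn_integral_convex_combination) (use False in auto)
      finally show "(\<integral>\<^sup>+y. g (y + t *\<^sub>R (x - y)) * indicator S x * indicator S y \<partial>lborel) \<le> (2 ^ CARD('d) * ?I) * indicator S x"
        by (auto simp: indicator_def)
    qed
    also have "\<dots> = emeasure lborel S * (2 ^ CARD('d) * ?I)" by (subst nn_integral_cmult_indicator) (auto simp: mult.commute)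
    finally show ?thesis .
  qed
qed

lemma sqn_grad2:
  fixes w :: "'d::finite fn"
  assumes w: "smooth w" and [measurable]: "S \<in> sets borel"
  shows "(\<integral>\<^sup>+x. ennreal (grad2 w x) * indicator S x \<partial>lborel) = (\<Sum>i\<in>UNIV. sqn S (cpd i w))"
proof -
  have [measurable]: "cpd i w \<in> borel_measurable borel" for i by (intro smooth_measurable smooth_cpd w)
  have "(\<integral>\<^sup>+x. ennreal (grad2 w x) * indicator S x \<partial>lborel) = (\<integral>\<^sup>+x. (\<Sum>i\<in>UNIV. ennreal ((cpd i w x)\<^sup>2) * indicator S x) \<partial>lborel)"
    unfolding grad2_def by (intro nn_integral_cong, subst sum_ennreal[symmetric]) (auto simp: sum_distrib_right)
  also have "\<dots> = (\<Sum>i\<in>UNIV. sqn S (cpd i w))"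
    unfolding sqn_def by (rule nn_integral_sum) measurable
  finally show ?thesis .
qed

lemma pairwise_difference:
  fixes w :: "'d::finite fn"
  assumes w: "smooth w" and [measurable]: "S \<in> sets borel" and S: "convex S"
    and D: "\<And>x y. x \<in> S \<Longrightarrow> y \<in> S \<Longrightarrow> norm (x - y) \<le> D"
  shows "(\<integral>\<^sup>+x. \<integral>\<^sup>+y. ennreal ((w x - w y)\<^sup>2) * indicator S x * indicator S y \<partial>lborel \<partial>lborel)
    \<le> ennreal (D\<^sup>2) * (emeasure lborel S * (2 ^ CARD('d) * (\<Sum>i\<in>UNIV. sqn S (cpd i w))))"
proof -
  note [measurable] = borel_measurable_continuous_onI[OF grad2_continuous[OF w]] smooth_measurable[OF w]
  let ?H = "\<lambda>x y t. ennreal (grad2 w (y + t *\<^sub>R (x - y))) * indicator {0..1::real} t * indicator S x * indicator S y"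
  let ?R = "emeasure lborel S * (2 ^ CARD('d) * (\<Sum>i\<in>UNIV. sqn S (cpd i w)))"
  have "(\<integral>\<^sup>+x. \<integral>\<^sup>+y. ennreal ((w x - w y)\<^sup>2) * indicator S x * indicator S y \<partial>lborel \<partial>lborel)
    \<le> (\<integral>\<^sup>+x. \<integral>\<^sup>+y. ennreal (D\<^sup>2) * (\<integral>\<^sup>+t. ?H x y t \<partial>lborel) \<partial>lborel \<partial>lborel)"
  proof (intro nn_integral_mono)
    fix x y :: "real^'d"
    show "ennreal ((w x - w y)\<^sup>2) * indicator S x * indicator S y \<le> ennreal (D\<^sup>2) * (\<integral>\<^sup>+t. ?H x y t \<partial>lborel)"
      using segment_difference[OF w D, of x y] by (auto simp: indicator_def)
  qed
  also have "\<dots> = ennreal (D\<^sup>2) * (\<integral>\<^sup>+x. \<integral>\<^sup>+y. (\<integral>\<^sup>+t. ?H x y t \<partial>lborel) \<partial>lborel \<partial>lborel)"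
    by (simp add: nn_integral_cmult)
  \<comment> \<open>The \<open>t\<close>-integral is moved outermost in two exchanges, because
    \<open>segment_average\<close> holds for fixed \<open>t\<close>.\<close>
  also have "(\<integral>\<^sup>+x. \<integral>\<^sup>+y. (\<integral>\<^sup>+t. ?H x y t \<partial>lborel) \<partial>lborel \<partial>lborel) = (\<integral>\<^sup>+x. \<integral>\<^sup>+t. (\<integral>\<^sup>+y. ?H x y t \<partial>lborel) \<partial>lborel \<partial>lborel)"
    by (intro nn_integral_cong lborel_pair.Fubini') measurable
  also have "\<dots> = (\<integral>\<^sup>+t. \<integral>\<^sup>+x. (\<integral>\<^sup>+y. ?H x y t \<partial>lborel) \<partial>lborel \<partial>lborel)"
    by (rule lborel_pair.Fubini') measurable
  also have "\<dots> \<le> (\<integral>\<^sup>+t. ?R * indicator {0..1::real} t \<partial>lborel)"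
  proof (rule nn_integral_mono)
    fix t :: real
    show "(\<integral>\<^sup>+x. (\<integral>\<^sup>+y. ?H x y t \<partial>lborel) \<partial>lborel) \<le> ?R * indicator {0..1::real} t"
    proof (cases "t \<in> {0..1}")
      case True
      have "(\<integral>\<^sup>+x. (\<integral>\<^sup>+y. ?H x y t \<partial>lborel) \<partial>lborel) = (\<integral>\<^sup>+x. \<integral>\<^sup>+y. ennreal (grad2 w (y + t *\<^sub>R (x - y))) * indicator S x * indicator S y \<partial>lborel \<partial>lborel)"
        using True by simp
      also have "\<dots> \<le> ?R"
        unfolding sqn_grad2[OF w assms(2), symmetric] by (rule segment_average[OF _ _ S True]) measurable
      finally show ?thesis using True by simp
    qed simp
  qed
  also have "\<dots> = ?R" by (simp add: nn_integral_cmult)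
  finally show ?thesis by (simp add: mult_left_mono)
qed

text \<open>A weighted average replaces the plain mean because two weights are used later: a
  mollifier, onto which derivatives can be shifted by parts, in \<open>lower_order_Cauchy\<close>,
  and a normalised indicator in \<open>poincare_wd\<close>. The oscillation w - c is an average of w
  x - w y over \<psi>, which Jensen and the bound \<psi> \<le> M reduce to
  \<open>pairwise_difference\<close>.\<close>

lemma poincare_smooth:
  fixes w \<psi> :: "'d::finite fn"
  assumes w: "smooth w" and Sm: "S \<in> sets borel" and S: "convex S" and R: "S \<subseteq> cball 0 R"
    and D: "\<And>x y. x \<in> S \<Longrightarrow> y \<in> S \<Longrightarrow> norm (x - y) \<le> D"
    and m: "\<psi> \<in> borel_measurable borel" and \<psi>: "\<And>x. 0 \<le> \<psi> x" "\<And>x. \<psi> x \<le> M" "\<And>x. x \<notin> S \<Longrightarrow> \<psi> x = 0"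
    and one: "(\<integral>x. \<psi> x \<partial>lborel) = 1"
  shows "sqn S w \<le> 2 * (ennreal ((\<integral>x. w x * \<psi> x \<partial>lborel)\<^sup>2) * emeasure lborel S)
    + 2 * (ennreal (M * D\<^sup>2) * (emeasure lborel S * (2 ^ CARD('d) * (\<Sum>i\<in>UNIV. sqn S (cpd i w)))))"
proof -
  note [measurable] = Sm m smooth_measurable[OF w]
  define c where "c = (\<integral>x. w x * \<psi> x \<partial>lborel)"
  have M0: "M \<ge> 0" using \<psi>(1,2) order_trans by blast
  have i\<psi>: "integrable lborel \<psi>" using one by (metis not_integrable_integral_eq zero_neq_one)
  have z: "\<psi> x = 0" if "x \<notin> cball 0 R" for x using that R \<psi>(3) by blast
  have iw: "integrable lborel (\<lambda>x. w x * \<psi> x)"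
    by (rule loc_int_integrable_mult[OF continuous_loc_int[OF smooth_continuous[OF w]] m, where B=M and c=0 and r=R])
       (use \<psi> z in auto)
  have nn1: "(\<integral>\<^sup>+y. ennreal (\<psi> y) \<partial>lborel) = 1"
    using nn_integral_eq_integral[OF i\<psi>] \<psi>(1) one by simp
  have pt: "ennreal ((w x - c)\<^sup>2) \<le> (\<integral>\<^sup>+y. ennreal ((w x - w y)\<^sup>2) * ennreal (\<psi> y) \<partial>lborel)" for x
  proof -
    have s: "ennreal (sqrt (\<psi> y)) * ennreal (sqrt (\<psi> y)) = ennreal (\<psi> y)" for y
      using \<psi>(1)[of y] by (simp add: ennreal_mult[symmetric])
    have i: "integrable lborel (\<lambda>y. (w x - w y) * \<psi> y)"
      unfolding left_diff_distrib using iw i\<psi> by (intro Bochner_Integration.integrable_diff) auto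
    have "w x - c = (\<integral>y. (w x - w y) * \<psi> y \<partial>lborel)"
      unfolding left_diff_distrib c_def using iw i\<psi> one by (subst Bochner_Integration.integral_diff) auto
    then have "(ennreal \<bar>w x - c\<bar>)\<^sup>2 \<le> (\<integral>\<^sup>+y. norm ((w x - w y) * \<psi> y) \<partial>lborel)\<^sup>2"
      using integral_norm_bound_ennreal[OF i] by (intro power_mono) auto
    also have "\<dots> = (\<integral>\<^sup>+y. (ennreal \<bar>w x - w y\<bar> * ennreal (sqrt (\<psi> y))) * ennreal (sqrt (\<psi> y)) \<partial>lborel)\<^sup>2"
      using \<psi>(1) by (simp add: mult.assoc s abs_mult ennreal_mult)
    also have "\<dots> \<le> (\<integral>\<^sup>+y. (ennreal \<bar>w x - w y\<bar> * ennreal (sqrt (\<psi> y)))\<^sup>2 \<partial>lborel) * (\<integral>\<^sup>+y. (ennreal (sqrt (\<psi> y)))\<^sup>2 \<partial>lborel)"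
      by (rule Cauchy_Schwarz_nn_integral) auto
    also have "(\<integral>\<^sup>+y. (ennreal (sqrt (\<psi> y)))\<^sup>2 \<partial>lborel) = 1"
      using nn1 by (simp add: power2_eq_square s)
    finally show ?thesis
      by (simp add: power_mult_distrib power2_eq_square[of "ennreal (sqrt _)"] s ennreal_power)
  qed
  have "sqn S (\<lambda>x. w x - c) \<le> (\<integral>\<^sup>+x. \<integral>\<^sup>+y. ennreal M * (ennreal ((w x - w y)\<^sup>2) * indicator S x * indicator S y) \<partial>lborel \<partial>lborel)"
    unfolding sqn_def
  proof (intro nn_integral_mono)
    fix x
    have "ennreal ((w x - c)\<^sup>2) * indicator S x \<le> (\<integral>\<^sup>+y. ennreal ((w x - w y)\<^sup>2) * ennreal (\<psi> y) \<partial>lborel) * indicator S x"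
      by (intro mult_right_mono pt) simp
    also have "\<dots> = (\<integral>\<^sup>+y. ennreal ((w x - w y)\<^sup>2) * ennreal (\<psi> y) * indicator S x \<partial>lborel)"
      by (simp add: nn_integral_multc)
    also have "\<dots> \<le> (\<integral>\<^sup>+y. ennreal M * (ennreal ((w x - w y)\<^sup>2) * indicator S x * indicator S y) \<partial>lborel)"
    proof (intro nn_integral_mono)
      fix y
      show "ennreal ((w x - w y)\<^sup>2) * ennreal (\<psi> y) * indicator S x \<le> ennreal M * (ennreal ((w x - w y)\<^sup>2) * indicator S x * indicator S y)"
      proof (cases "y \<in> S")
        case True
        have "ennreal (\<psi> y) \<le> ennreal M" using \<psi>(2) by (rule ennreal_leI)
        then have "ennreal ((w x - w y)\<^sup>2) * indicator S x * ennreal (\<psi> y) \<le> ennreal ((w x - w y)\<^sup>2) * indicator S x * ennreal M"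
          by (rule mult_left_mono) simp
        then show ?thesis using True by (simp add: mult_ac)
      qed (simp add: \<psi>(3))
    qed
    finally show "ennreal ((w x - c)\<^sup>2) * indicator S x \<le> (\<integral>\<^sup>+y. ennreal M * (ennreal ((w x - w y)\<^sup>2) * indicator S x * indicator S y) \<partial>lborel)" .
  qed
  also have "\<dots> = ennreal M * (\<integral>\<^sup>+x. \<integral>\<^sup>+y. ennreal ((w x - w y)\<^sup>2) * indicator S x * indicator S y \<partial>lborel \<partial>lborel)"
    by (simp add: nn_integral_cmult)
  also have "\<dots> \<le> ennreal M * (ennreal (D\<^sup>2) * (emeasure lborel S * (2 ^ CARD('d) * (\<Sum>i\<in>UNIV. sqn S (cpd i w)))))"
    by (intro mult_left_mono pairwise_difference[OF w Sm S D]) auto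
  finally have osc: "sqn S (\<lambda>x. w x - c) \<le> ennreal (M * D\<^sup>2) * (emeasure lborel S * (2 ^ CARD('d) * (\<Sum>i\<in>UNIV. sqn S (cpd i w))))"
    using M0 by (simp add: ennreal_mult mult.assoc)
  have "sqn S w \<le> 2 * (sqn S (\<lambda>x. w x - c) + sqn S (\<lambda>_. c))"
    using sqn_add[of "\<lambda>x. w x - c" "\<lambda>_. c" S] by simp
  also have "sqn S (\<lambda>_. c) = ennreal (c\<^sup>2) * emeasure lborel S"
    using sqn_cmult[of "\<lambda>_. 1" S c] sqn_indicator[OF Sm] by simp
  also have "2 * (sqn S (\<lambda>x. w x - c) + ennreal (c\<^sup>2) * emeasure lborel S)
     \<le> 2 * (ennreal (M * D\<^sup>2) * (emeasure lborel S * (2 ^ CARD('d) * (\<Sum>i\<in>UNIV. sqn S (cpd i w)))) + ennreal (c\<^sup>2) * emeasure lborel S)"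
    by (intro mult_left_mono add_right_mono osc) auto
  finally show ?thesis unfolding c_def by (simp add: distrib_left add.commute)
qed

section \<open>Completeness of local square integrability\<close>

lemma convergent_of_fast_differences:
  fixes a :: "nat \<Rightarrow> real"
  assumes "\<And>k. 2 ^ k * (a (Suc k) - a k)\<^sup>2 \<le> B"
  shows "convergent a"
proof -
  have q: "sqrt (1/2) < 1" "sqrt (1/2) \<ge> 0" by (auto simp: real_sqrt_lt_1_iff)
  have "summable (\<lambda>k. a (Suc k) - a k)"
  proof (rule summable_comparison_test)
    show "summable (\<lambda>k. sqrt B * sqrt (1/2) ^ k)" using q by (intro summable_mult summable_geometric) auto
    show "\<exists>N. \<forall>k\<ge>N. norm (a (Suc k) - a k) \<le> sqrt B * sqrt (1/2) ^ k"
    proof (intro exI allI impI)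
      fix k
      have "(a (Suc k) - a k)\<^sup>2 \<le> B * (1/2) ^ k" using assms[of k] by (simp add: field_simps power_divide)
      then have "sqrt ((a (Suc k) - a k)\<^sup>2) \<le> sqrt (B * (1/2) ^ k)" by (rule real_sqrt_le_mono)
      then show "norm (a (Suc k) - a k) \<le> sqrt B * sqrt (1/2) ^ k" by (simp only: real_sqrt_abs real_sqrt_mult real_sqrt_power[of "1/2"] real_norm_def)
    qed
  qed
  then have "convergent (\<lambda>n. \<Sum>k<n. a (Suc k) - a k)" by (simp add: summable_iff_convergent)
  then have "convergent (\<lambda>n. a n - a 0)" by (simp add: sum_lessThan_telescope)
  then show ?thesis using convergent_add[OF _ convergent_const[of "a 0"]] by fastforce
qed

lemma ennreal_term_le_suminf: "(f k :: ennreal) \<le> (\<Sum>k. f k)"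
  using sum_le_suminf[of f "{k}"] by simp

text \<open>The Riesz-Fischer argument, localised to balls: a fast subsequence converges almost
  everywhere, and Fatou's lemma turns its limit into an L2 limit of the whole sequence.\<close>

lemma L2_complete:
  fixes F :: "nat \<Rightarrow> 'd::finite fn"
  assumes F: "\<And>n. L2loc (F n)"
    and C: "\<And>R e. e > 0 \<Longrightarrow> \<exists>N. \<forall>m\<ge>N. \<forall>n\<ge>N. sqn (cball 0 R) (\<lambda>x. F m x - F n x) \<le> ennreal e"
  shows "\<exists>g. L2loc g \<and> L2conv F g"
proof -
  note [measurable] = L2loc_measurable[OF F]
  have [measurable]: "cball (0::real^'d) R \<in> sets borel" for R by simp
  \<comment> \<open>The radius grows together with the index, so that one subsequence serves all
    balls.\<close>
  have "\<exists>r. \<forall>k. (\<forall>m\<ge>r k. \<forall>n\<ge>r k. sqn (cball 0 (real k)) (\<lambda>x. F m x - F n x) \<le> ennreal ((1/4) ^ k)) \<and> r (Suc k) > r k"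
  proof (rule dependent_nat_choice)
    show "\<exists>r. \<forall>m\<ge>r. \<forall>n\<ge>r. sqn (cball 0 (real 0)) (\<lambda>x. F m x - F n x) \<le> ennreal ((1/4) ^ 0)"
      by (rule C) simp
    fix r0 k :: nat
    obtain N where N: "\<forall>m\<ge>N. \<forall>n\<ge>N. sqn (cball 0 (real (Suc k))) (\<lambda>x. F m x - F n x) \<le> ennreal ((1/4) ^ Suc k)"
      using C[of "(1/4) ^ Suc k" "real (Suc k)"] by auto
    show "\<exists>y. (\<forall>m\<ge>y. \<forall>n\<ge>y. sqn (cball 0 (real (Suc k))) (\<lambda>x. F m x - F n x) \<le> ennreal ((1/4) ^ Suc k)) \<and> y > r0"
      using N by (intro exI[of _ "N + Suc r0"]) auto
  qed
  then obtain r where r: "\<And>k m n. m \<ge> r k \<Longrightarrow> n \<ge> r k \<Longrightarrow> sqn (cball 0 (real k)) (\<lambda>x. F m x - F n x) \<le> ennreal ((1/4) ^ k)"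
    and mono: "\<And>k. r (Suc k) > r k" by blast
  have sm: "strict_mono r" using mono by (simp add: strict_mono_Suc_iff)
  have conv: "AE x in lborel. norm x \<le> real K \<longrightarrow> convergent (\<lambda>n. F (r n) x)" for K :: nat
  proof -
    \<comment> \<open>Shifting the index by \<open>K\<close> makes every ball of radius
      \<open>k + K\<close> contain the ball of radius \<open>K\<close>. The weight 2^k still leaves
      a summable series against (1/4)^k, and boundedness of its terms forces geometric decay of the
      differences.\<close>
    let ?d = "\<lambda>k x. 2 ^ k * (F (r (Suc k + K)) x - F (r (k + K)) x)\<^sup>2"
    let ?A = "\<lambda>k x. ennreal (?d k x) * indicator (cball 0 (real K)) x"
    have A: "(\<integral>\<^sup>+x. ?A k x \<partial>lborel) \<le> ennreal ((1/2) ^ k)" for k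
    proof -
      have "(\<integral>\<^sup>+x. ?A k x \<partial>lborel) = ennreal (2 ^ k) * sqn (cball 0 (real K)) (\<lambda>x. F (r (Suc k + K)) x - F (r (k + K)) x)"
      proof -
        have m: "(\<lambda>x. ennreal ((F (r (Suc k + K)) x - F (r (k + K)) x)\<^sup>2) * indicator (cball 0 (real K)) x) \<in> borel_measurable lborel" by measurable
        show ?thesis unfolding sqn_def nn_integral_cmult[OF m, symmetric] by (simp add: ennreal_mult mult.assoc)
      qed
      also have "\<dots> \<le> ennreal (2 ^ k) * sqn (cball 0 (real (k + K))) (\<lambda>x. F (r (Suc k + K)) x - F (r (k + K)) x)"
        by (intro mult_left_mono sqn_mono) auto
      also have "\<dots> \<le> ennreal (2 ^ k) * ennreal ((1/4) ^ (k + K))"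
        using strict_mono_leD[OF sm, of "k + K" "Suc k + K"] by (intro mult_left_mono r) auto
      also have "\<dots> = ennreal (2 ^ k * (1/4) ^ (k + K))" by (simp add: ennreal_mult)
      also have "\<dots> \<le> ennreal ((1/2) ^ k)"
      proof (rule ennreal_leI)
        have "2 ^ k * (1/4::real) ^ (k + K) = (1/2) ^ k * (1/4) ^ K" by (simp add: power_add power_mult_distrib[symmetric] flip: mult.assoc)
        also have "\<dots> \<le> (1/2) ^ k * 1" by (intro mult_left_mono power_le_one) auto
        finally show "2 ^ k * (1/4::real) ^ (k + K) \<le> (1/2) ^ k" by simp
      qed
      finally show ?thesis .
    qed
    have "(\<integral>\<^sup>+x. (\<Sum>k. ?A k x) \<partial>lborel) = (\<Sum>k. \<integral>\<^sup>+x. ?A k x \<partial>lborel)"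
      by (rule nn_integral_suminf) measurable
    also have "\<dots> \<le> (\<Sum>k. ennreal ((1/2) ^ k))" by (intro suminf_le A) auto
    also have "\<dots> = ennreal (\<Sum>k. (1/2) ^ k)"
      by (rule suminf_ennreal2) (auto intro!: summable_geometric)
    also have "\<dots> < \<infinity>" by simp
    finally have "AE x in lborel. (\<Sum>k. ?A k x) \<noteq> \<infinity>"
      by (intro nn_integral_noteq_infinite) auto
    then show ?thesis
    proof eventually_elim
      case (elim x)
      show ?case
      proof
        assume x: "norm x \<le> real K"
        define T where "T = (\<Sum>k. ?A k x)"
        define B where "B = enn2real T"
        have "T \<noteq> top" using elim unfolding T_def by simp
        then have B: "B \<ge> 0" "T = ennreal B" unfolding B_def by (simp_all add: ennreal_enn2real_if)
        have le: "?A k x \<le> T" for k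
          unfolding T_def by (rule ennreal_term_le_suminf)
        have "?d k x \<le> B" for k
        proof -
          have "ennreal (?d k x) \<le> ennreal B" using le[of k] x unfolding B(2) by (simp only: indicator_simps mem_cball_0 mult_1_right if_True)
          then show ?thesis using B(1) by (subst (asm) ennreal_le_iff)
        qed
        then have "convergent (\<lambda>k. F (r (k + K)) x)" by (intro convergent_of_fast_differences) simp
        then show "convergent (\<lambda>n. F (r n) x)" using convergent_ignore_initial_segment[of "\<lambda>n. F (r n) x" K] by blast
      qed
    qed
  qed
  then have "AE x in lborel. \<forall>K::nat. norm x \<le> real K \<longrightarrow> convergent (\<lambda>n. F (r n) x)"
    unfolding AE_all_countable by blast
  then have cAE: "AE x in lborel. convergent (\<lambda>n. F (r n) x)"
    by eventually_elim (meson real_arch_simple)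
  define g where "g x = lim (\<lambda>n. F (r n) x)" for x
  have gm [measurable]: "g \<in> borel_measurable borel"
    unfolding g_def[abs_def] by (rule borel_measurable_lim_metric) simp
  \<comment> \<open>Only the second index is sent to the limit along the subsequence;
    \<open>m\<close> stays arbitrary, so the bound covers the whole sequence.\<close>
  have fat: "sqn (cball 0 R) (\<lambda>x. F m x - g x) \<le> ennreal e"
    if N: "\<forall>m\<ge>N. \<forall>n\<ge>N. sqn (cball 0 R) (\<lambda>x. F m x - F n x) \<le> ennreal e" and m: "m \<ge> N" for R e N m
  proof -
    have "sqn (cball 0 R) (\<lambda>x. F m x - g x) \<le> (\<integral>\<^sup>+x. liminf (\<lambda>n. ennreal ((F m x - F (r n) x)\<^sup>2) * indicator (cball 0 R) x) \<partial>lborel)"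
      unfolding sqn_def
    proof (rule nn_integral_mono_AE)
      show "AE x in lborel. ennreal ((F m x - g x)\<^sup>2) * indicator (cball 0 R) x \<le> liminf (\<lambda>n. ennreal ((F m x - F (r n) x)\<^sup>2) * indicator (cball 0 R) x)"
        using cAE
      proof eventually_elim
        case (elim x)
        then have "(\<lambda>n. F (r n) x) \<longlonglongrightarrow> g x" unfolding g_def by (simp add: convergent_LIMSEQ_iff)
        then have l: "(\<lambda>n. ennreal ((F m x - F (r n) x)\<^sup>2)) \<longlonglongrightarrow> ennreal ((F m x - g x)\<^sup>2)"
          by (intro tendsto_intros)
        have "(\<lambda>n. ennreal ((F m x - F (r n) x)\<^sup>2) * indicator (cball 0 R) x) \<longlonglongrightarrow> ennreal ((F m x - g x)\<^sup>2) * indicator (cball 0 R) x"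
          using l by (auto simp: indicator_def)
        from lim_imp_Liminf[OF _ this] show ?case by simp
      qed
    qed
    also have "\<dots> \<le> liminf (\<lambda>n. \<integral>\<^sup>+x. ennreal ((F m x - F (r n) x)\<^sup>2) * indicator (cball 0 R) x \<partial>lborel)"
      by (rule nn_integral_liminf) measurable
    also have "\<dots> \<le> liminf (\<lambda>n. ennreal e)"
    proof (rule Liminf_mono)
      show "\<forall>\<^sub>F n in sequentially. (\<integral>\<^sup>+x. ennreal ((F m x - F (r n) x)\<^sup>2) * indicator (cball 0 R) x \<partial>lborel) \<le> ennreal e"
      proof (rule eventually_sequentiallyI[of N])
        fix n assume "N \<le> n"
        then have "N \<le> r n" using seq_suble[OF sm, of n] by linarith
        then show "(\<integral>\<^sup>+x. ennreal ((F m x - F (r n) x)\<^sup>2) * indicator (cball 0 R) x \<partial>lborel) \<le> ennreal e"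
          using N m unfolding sqn_def by blast
      qed
    qed
    also have "\<dots> = ennreal e" by (simp add: Liminf_const)
    finally show ?thesis .
  qed
  have "L2conv F g"
    unfolding L2conv_def
  proof (intro allI ennreal_tendsto_0_I)
    fix R e :: real assume "e > 0"
    obtain N where "\<forall>m\<ge>N. \<forall>n\<ge>N. sqn (cball 0 R) (\<lambda>x. F m x - F n x) \<le> ennreal e" using C[OF \<open>e > 0\<close>] by blast
    from fat[OF this] show "\<forall>\<^sub>F n in sequentially. sqn (cball 0 R) (\<lambda>x. F n x - g x) \<le> ennreal e"
      by (auto simp: eventually_sequentially)
  qed
  moreover have "L2loc g"
    unfolding L2loc_def
  proof (intro conjI allI gm)
    fix R
    obtain N where N: "\<forall>m\<ge>N. \<forall>n\<ge>N. sqn (cball 0 R) (\<lambda>x. F m x - F n x) \<le> ennreal 1" using C[of 1 R, OF zero_less_one] by blast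
    have "sqn (cball 0 R) g = sqn (cball 0 R) (\<lambda>x. F N x - (F N x - g x))" by simp
    also have "\<dots> \<le> 2 * (sqn (cball 0 R) (F N) + sqn (cball 0 R) (\<lambda>x. F N x - g x))" by (rule sqn_diff) auto
    also have "\<dots> \<le> 2 * (sqn (cball 0 R) (F N) + ennreal 1)" by (intro mult_left_mono add_left_mono fat[OF N]) auto
    also have "\<dots> < \<infinity>" using F[of N] by (auto simp: L2loc_def ennreal_mult_less_top)
    finally show "sqn (cball 0 R) g < \<infinity>" .
  qed
  ultimately show ?thesis by blast
qed

lemma L2conv_Cauchy:
  assumes F: "\<And>n. L2loc (F n)" and g: "L2loc g" and c: "L2conv F g" and e: "e > 0"
  shows "\<exists>N. \<forall>m\<ge>N. \<forall>n\<ge>N. sqn (cball 0 R) (\<lambda>x. F m x - F n x) \<le> ennreal e"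
proof -
  note [measurable] = L2loc_measurable[OF F] L2loc_measurable[OF g]
  have "\<forall>\<^sub>F n in sequentially. sqn (cball 0 R) (\<lambda>x. F n x - g x) < ennreal (e / 4)"
    using c e unfolding L2conv_def by (intro order_tendstoD(2)) auto
  then obtain N where N: "\<And>n. n \<ge> N \<Longrightarrow> sqn (cball 0 R) (\<lambda>x. F n x - g x) \<le> ennreal (e / 4)"
    unfolding eventually_sequentially by (blast intro: less_imp_le)
  show ?thesis
  proof (intro exI allI impI)
    fix m n assume "N \<le> m" "N \<le> n"
    have "sqn (cball 0 R) (\<lambda>x. F m x - F n x) = sqn (cball 0 R) (\<lambda>x. (F m x - g x) - (F n x - g x))" by simp
    also have "\<dots> \<le> 2 * (sqn (cball 0 R) (\<lambda>x. F m x - g x) + sqn (cball 0 R) (\<lambda>x. F n x - g x))" by (rule sqn_diff) auto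
    also have "\<dots> \<le> 2 * (ennreal (e / 4) + ennreal (e / 4))"
      using N \<open>N \<le> m\<close> \<open>N \<le> n\<close> by (intro mult_left_mono add_mono) auto
    also have "\<dots> = ennreal 2 * ennreal (e / 4 + e / 4)" using e by (subst ennreal_plus) auto
    also have "\<dots> = ennreal e" using e by (subst ennreal_mult[symmetric]) auto
    finally show "sqn (cball 0 R) (\<lambda>x. F m x - F n x) \<le> ennreal e" .
  qed
qed

section \<open>Approximation in V by smooth functions\<close>

lemma L2_imp_L2loc: "L2 g \<Longrightarrow> L2loc g"
  unfolding L2loc_def L2_def
proof (intro conjI allI; elim conjE)
  fix R assume g: "g \<in> borel_measurable lborel" "integrable lborel (\<lambda>x. (g x)\<^sup>2)"
  have "sqn (cball 0 R) g \<le> sqn UNIV g" by (rule sqn_mono) simp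
  also have "\<dots> < \<infinity>" using g unfolding sqn_def integrable_iff_bounded by simp
  finally show "sqn (cball 0 R) g < \<infinity>" .
qed simp

text \<open>Poincare on a ball bounds a derivative by the derivatives of the next order, which are
  Cauchy by assumption, and one weighted mean. Integration by parts shifts all derivatives in that
  mean onto the mollifier, so its convergence follows from that of \<open>F\<close> itself.\<close>

lemma lower_order_Cauchy:
  fixes F :: "nat \<Rightarrow> 'd::finite fn"
  assumes F: "\<And>n. smooth (F n)" and u: "L2loc u" and c: "L2conv F u"
    and d: "\<And>i. \<exists>g. L2loc g \<and> L2conv (\<lambda>n. pd_list (i # is) (F n)) g" and e: "e > 0"
  shows "\<exists>N. \<forall>m\<ge>N. \<forall>n\<ge>N. sqn (cball 0 R) (\<lambda>x. pd_list is (F m) x - pd_list is (F n) x) \<le> ennreal e"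
proof -
  \<comment> \<open>The ball has to contain the support of the weight \<open>moll 0\<close>, whose
    radius is 1.\<close>
  define R' where "R' = max R 1"
  let ?S = "cball (0::real^'d) R'" and ?\<psi> = "moll 0 :: 'd fn"
  have \<psi>: "csmooth 1 ?\<psi>" using moll_csmooth[of 0] by simp
  have s\<psi>: "smooth ?\<psi>" using \<psi> by (simp add: csmooth_def)
  obtain M where M: "M > 0" "\<And>x. \<bar>?\<psi> x\<bar> \<le> M" using csmooth_bounded[OF \<psi>] by blast
  have fS: "emeasure lborel ?S \<noteq> \<infinity>" using emeasure_lborel_cball_finite[of "0::real^'d" R'] by simp
  define m where "m = measure lborel ?S"
  have em: "emeasure lborel ?S = ennreal m" unfolding m_def using fS by (simp add: emeasure_eq_ennreal_measure)
  have m0: "m \<ge> 0" by (simp add: m_def)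
  let ?\<chi> = "pd_list (rev is) ?\<psi>"
  have \<chi>: "csmooth 1 ?\<chi>" by (rule csmooth_pd_list[OF \<psi>])
  obtain B where B: "\<And>x. \<bar>?\<chi> x\<bar> \<le> B" using csmooth_bounded[OF \<chi>] by blast
  define a where "a n = (\<integral>x. pd_list is (F n) x * ?\<psi> x \<partial>lborel)" for n
  have a: "a n = (-1) ^ length is * (\<integral>x. F n x * ?\<chi> x \<partial>lborel)" for n
    using integral_by_parts_list[OF F[of n] csmooth_test_fun[OF \<psi>], of "rev is"] unfolding a_def
    by (simp flip: mult.assoc power_mult_distrib)
  have "(\<lambda>n. \<integral>x. F n x * ?\<chi> x \<partial>lborel) \<longlonglongrightarrow> (\<integral>x. u x * ?\<chi> x \<partial>lborel)"
    by (rule L2conv_pairing[OF smooth_L2loc[OF F] u c csmooth_measurable[OF \<chi>] B, of 1]) (use \<chi> in \<open>auto simp: csmooth_def\<close>)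
  then have "Cauchy a" unfolding a[abs_def] by (intro LIMSEQ_imp_Cauchy[OF tendsto_mult_left])
  define K where "K = 2 * (M * (2 * R')\<^sup>2 * (m * (2 ^ CARD('d) * CARD('d))))"
  have R'0: "R' > 0" unfolding R'_def by simp
  have K0: "K \<ge> 0" unfolding K_def using M m0 by simp
  \<comment> \<open>\<open>K\<close> is the constant in front of the gradient part. The tolerances
    \<open>e1\<close> for the next-order derivatives and \<open>e2\<close> for the mean make each of
    the two Poincare terms at most e / 2.\<close>
  define e1 where "e1 = e / (2 * (K + 1))"
  define e2 where "e2 = sqrt (e / (4 * (m + 1)))"
  have e1: "e1 > 0" "K * e1 \<le> e / 2" unfolding e1_def using K0 e by (auto simp: field_simps)
  have e2: "e2 > 0" "2 * (e2\<^sup>2 * m) \<le> e / 2" unfolding e2_def using m0 e by (auto simp: field_simps)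
  have "\<forall>i. \<exists>N. \<forall>m\<ge>N. \<forall>n\<ge>N. sqn ?S (\<lambda>x. pd_list (i # is) (F m) x - pd_list (i # is) (F n) x) \<le> ennreal e1"
  proof
    fix i
    obtain g where "L2loc g" "L2conv (\<lambda>n. pd_list (i # is) (F n)) g" using d by blast
    then show "\<exists>N. \<forall>m\<ge>N. \<forall>n\<ge>N. sqn ?S (\<lambda>x. pd_list (i # is) (F m) x - pd_list (i # is) (F n) x) \<le> ennreal e1"
      by (intro L2conv_Cauchy[OF smooth_L2loc[OF smooth_pd_list[OF F]] _ _ e1(1)])
  qed
  then obtain N where N: "\<And>i p q. p \<ge> N i \<Longrightarrow> q \<ge> N i \<Longrightarrow> sqn ?S (\<lambda>x. pd_list (i # is) (F p) x - pd_list (i # is) (F q) x) \<le> ennreal e1"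
    by metis
  obtain N0 where N0: "\<And>p q. p \<ge> N0 \<Longrightarrow> q \<ge> N0 \<Longrightarrow> \<bar>a p - a q\<bar> < e2"
    using CauchyD[OF \<open>Cauchy a\<close> e2(1)] by auto
  define N1 where "N1 = Max (insert N0 (range N))"
  have N1: "N0 \<le> N1" "\<And>i. N i \<le> N1" unfolding N1_def by (rule Max_ge; simp)+
  show ?thesis
  proof (intro exI allI impI)
    fix p q assume pq: "N1 \<le> p" "N1 \<le> q"
    define w where "w = (\<lambda>x. pd_list is (F p) x - pd_list is (F q) x)"
    have sp: "smooth (pd_list is (F p))" "smooth (pd_list is (F q))" by (intro smooth_pd_list F)+
    have sw: "smooth w" unfolding w_def by (intro smooth_diff sp)
    have cw: "cpd i w = (\<lambda>x. pd_list (i # is) (F p) x - pd_list (i # is) (F q) x)" for i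
      unfolding w_def using pd_list_diff[OF sp, of "[i]"] by simp
    have i: "integrable lborel (\<lambda>x. pd_list is (F n) x * ?\<psi> x)" for n
      by (rule loc_int_integrable_csmooth[OF L2loc_loc_int[OF smooth_L2loc[OF smooth_pd_list[OF F]]] \<psi>])
    have wa: "(\<integral>x. w x * ?\<psi> x \<partial>lborel) = a p - a q"
      unfolding w_def a_def left_diff_distrib using i by (intro Bochner_Integration.integral_diff)
    have "sqn (cball 0 R) w \<le> sqn ?S w" by (intro sqn_mono) (auto simp: R'_def)
    also have "\<dots> \<le> 2 * (ennreal ((\<integral>x. w x * ?\<psi> x \<partial>lborel)\<^sup>2) * emeasure lborel ?S)
      + 2 * (ennreal (M * (2 * R')\<^sup>2) * (emeasure lborel ?S * (2 ^ CARD('d) * (\<Sum>i\<in>UNIV. sqn ?S (cpd i w)))))"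
    proof (rule poincare_smooth[OF sw])
      show "norm (x - y) \<le> 2 * R'" if "x \<in> ?S" "y \<in> ?S" for x y
        using that norm_triangle_ineq4[of x y] by simp
      show "?\<psi> x \<le> M" for x using M(2)[of x] by simp
      show "?\<psi> x = 0" if "x \<notin> ?S" for x using that \<psi> by (auto simp: csmooth_def R'_def)
    qed (use csmooth_measurable[OF \<psi>] mollifier_nonneg integral_mollifier[of 1] in auto)
    also have "\<dots> \<le> 2 * (ennreal (e2\<^sup>2) * ennreal m)
      + 2 * (ennreal (M * (2 * R')\<^sup>2) * (ennreal m * (2 ^ CARD('d) * (\<Sum>i\<in>(UNIV::'d set). ennreal e1))))"
    proof (unfold em wa, intro add_mono mult_left_mono mult_right_mono sum_mono ennreal_leI)
      have "\<bar>a p - a q\<bar> \<le> e2" using N0 N1 pq by (meson less_imp_le order_trans)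
      then show "(a p - a q)\<^sup>2 \<le> e2\<^sup>2" using e2(1) by (simp add: abs_le_square_iff[symmetric])
      show "sqn ?S (cpd i w) \<le> ennreal e1" for i unfolding cw using N N1 pq by (meson order_trans)
    qed auto
    also have "\<dots> = ennreal (2 * (e2\<^sup>2 * m)) + ennreal (K * e1)"
    proof -
      have n2: "(2::ennreal) ^ j = ennreal (2 ^ j)" for j by (metis ennreal_numeral ennreal_power zero_le_numeral)
      have "(\<Sum>i\<in>(UNIV::'d set). ennreal e1) = ennreal (CARD('d) * e1)" using e1(1) by (simp add: ennreal_mult ennreal_of_nat_eq_real_of_nat)
      then show ?thesis
        unfolding K_def n2 using M m0 e1 e2 R'0
        by (simp add: ennreal_mult[symmetric] mult_ac flip: ennreal_numeral)
    qed
    also have "\<dots> = ennreal (2 * (e2\<^sup>2 * m) + K * e1)" using K0 e1 e2 m0 by (subst ennreal_plus) auto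
    also have "\<dots> \<le> ennreal e" using e1 e2 by (intro ennreal_leI) linarith
    finally show "sqn (cball 0 R) (\<lambda>x. pd_list is (F p) x - pd_list is (F q) x) \<le> ennreal e" unfolding w_def .
  qed
qed

lemma L2conv_cong_AE: "L2conv F g \<Longrightarrow> AE x in lborel. g x = h x \<Longrightarrow> L2conv F h"
proof -
  assume c: "L2conv F g" and ae: "AE x in lborel. g x = h x"
  have "sqn S (\<lambda>x. F n x - g x) = sqn S (\<lambda>x. F n x - h x)" for S n
    by (rule sqn_cong_AE) (use ae in eventually_elim, simp)
  then show ?thesis using c by (simp add: L2conv_def)
qed

text \<open>Induction on the distance of the order to \<open>kmin\<close> from below. At orders
  \<open>kmin\<close> and above the derivative exists by definition of V, and its mollifications are
  the derivatives of the mollified function. Each lower order is obtained from the next higher one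
  by \<open>lower_order_Cauchy\<close> and completeness.\<close>

lemma Vsp_approx_aux:
  fixes u :: "'d::finite fn"
  assumes u: "u \<in> Vsp k kmin" and k: "kmin \<le> k" and l: "length is \<le> k"
  shows "\<exists>g. weak_deriv (count_list is) u g \<and> L2loc g \<and> L2conv (\<lambda>n. pd_list is (conv u (moll n))) g"
  using l
proof (induction "kmin - length is" arbitrary: "is")
  case 0
  then have o: "kmin \<le> mi_order (count_list is)" "mi_order (count_list is) \<le> k" by (auto simp: mi_order_count)
  obtain g where g: "weak_deriv (count_list is) u g" "L2 g"
    using u o unfolding Vsp_def by blast
  have li: "loc_int u" using g by (simp add: weak_deriv_def)
  have "pd_list is (conv u (moll n)) = conv g (moll n)" for n
    using pd_list_conv[OF li moll_csmooth] conv_weak_deriv[OF g(1) moll_csmooth] by simp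
  then show ?case using g conv_moll_L2conv[OF L2_imp_L2loc[OF g(2)]] L2_imp_L2loc[OF g(2)] by auto
next
  case (Suc j)
  have cu: "continuous_on UNIV u" using u by (simp add: Vsp_def)
  have li: "loc_int u" by (rule continuous_loc_int[OF cu])
  have ul: "L2loc u" by (rule continuous_L2loc[OF cu])
  have sm: "smooth (conv u (moll n))" for n by (rule smooth_conv[OF li moll_csmooth])
  note c0 = conv_moll_L2conv[OF ul]
  have d: "\<exists>g. L2loc g \<and> L2conv (\<lambda>n. pd_list (i # is) (conv u (moll n))) g" for i
  proof -
    have p: "j = kmin - length (i # is)" "length (i # is) \<le> k" using Suc.hyps(2) k by auto
    show ?thesis using Suc.hyps(1)[OF p] by blast
  qed
  obtain g where g: "L2loc g" "L2conv (\<lambda>n. pd_list is (conv u (moll n))) g"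
    using L2_complete[of "\<lambda>n. pd_list is (conv u (moll n))", OF smooth_L2loc[OF smooth_pd_list[OF sm]] lower_order_Cauchy[OF sm ul c0 d]] by blast
  have "weak_deriv (count_list is) u g"
    by (rule weak_deriv_limit[OF sm ul g(1) c0]) (use g(2) pd_list_mi_list[OF sm] in simp)
  then show ?case using g by blast
qed

text \<open>Transfers the existence result to the representative \<open>wd\<close>. From here on
  \<open>wd\<close> is a genuine locally square integrable weak derivative for every order up to
  \<open>k\<close>, those below \<open>kmin\<close> included.\<close>

theorem Vsp_approx:
  fixes u :: "'d::finite fn"
  assumes u: "u \<in> Vsp k kmin" and k: "kmin \<le> k" and l: "length is \<le> k"
  shows "weak_deriv (count_list is) u (wd (count_list is) u)" "L2loc (wd (count_list is) u)"
    "L2conv (\<lambda>n. pd_list is (conv u (moll n))) (wd (count_list is) u)"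
proof -
  obtain g where g: "weak_deriv (count_list is) u g" "L2loc g" "L2conv (\<lambda>n. pd_list is (conv u (moll n))) g"
    using Vsp_approx_aux[OF assms] by blast
  show w: "weak_deriv (count_list is) u (wd (count_list is) u)"
    unfolding wd_def by (rule someI[of _ g]) (rule g)
  have ae: "AE x in lborel. g x = wd (count_list is) u x" by (rule weak_deriv_unique[OF g(1) w])
  then show "L2conv (\<lambda>n. pd_list is (conv u (moll n))) (wd (count_list is) u)" by (rule L2conv_cong_AE[OF g(3)])
  have "sqn S g = sqn S (wd (count_list is) u)" for S by (rule sqn_cong_AE[OF ae])
  then show "L2loc (wd (count_list is) u)"
    using g(2) w loc_int_measurable unfolding L2loc_def weak_deriv_def by auto
qed

section \<open>Multiplication by smooth functions\<close>

lemma L2loc_add: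
  assumes "L2loc f" "L2loc g" shows "L2loc (\<lambda>x. f x + g x)"
  unfolding L2loc_def
proof (intro conjI allI)
  note [measurable] = L2loc_measurable[OF assms(1)] L2loc_measurable[OF assms(2)]
  show "(\<lambda>x. f x + g x) \<in> borel_measurable borel" by simp
  fix R
  have "sqn (cball 0 R) (\<lambda>x. f x + g x) \<le> 2 * (sqn (cball 0 R) f + sqn (cball 0 R) g)" by (rule sqn_add) auto
  also have "\<dots> < \<infinity>" using assms by (auto simp: L2loc_def ennreal_mult_less_top)
  finally show "sqn (cball 0 R) (\<lambda>x. f x + g x) < \<infinity>" .
qed

lemma L2loc_0: "L2loc (\<lambda>_. 0)"
  by (rule continuous_L2loc) simp

lemma sqn_mult_bounded:
  assumes "f \<in> borel_measurable borel" "S \<in> sets borel" "\<And>x. \<bar>c x\<bar> \<le> B"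
  shows "sqn S (\<lambda>x. c x * f x) \<le> ennreal (B\<^sup>2) * sqn S f"
proof -
  have "sqn S (\<lambda>x. c x * f x) \<le> sqn S (\<lambda>x. B * f x)"
  proof (rule sqn_le)
    fix x show "\<bar>c x * f x\<bar> \<le> \<bar>B * f x\<bar>" unfolding abs_mult using assms(3)[of x] by (intro mult_right_mono) auto
  qed
  then show ?thesis using sqn_cmult[OF assms(1,2)] by simp
qed

lemma L2loc_mult:
  assumes "L2loc f" "csmooth r c" shows "L2loc (\<lambda>x. c x * f x)"
  unfolding L2loc_def
proof (intro conjI allI)
  note [measurable] = L2loc_measurable[OF assms(1)] csmooth_measurable[OF assms(2)]
  show "(\<lambda>x. c x * f x) \<in> borel_measurable borel" by simp
  fix R
  obtain B where B: "\<And>x. \<bar>c x\<bar> \<le> B" using csmooth_bounded[OF assms(2)] by blast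
  have "sqn (cball 0 R) (\<lambda>x. c x * f x) \<le> ennreal (B\<^sup>2) * sqn (cball 0 R) f"
    by (rule sqn_mult_bounded[OF _ _ B]) auto
  also have "\<dots> < \<infinity>" using assms(1) by (auto simp: L2loc_def ennreal_mult_less_top)
  finally show "sqn (cball 0 R) (\<lambda>x. c x * f x) < \<infinity>" .
qed

lemma tendsto_0_le_ennreal:
  fixes f g :: "nat \<Rightarrow> ennreal"
  assumes "g \<longlonglongrightarrow> 0" "\<And>n. f n \<le> g n" shows "f \<longlonglongrightarrow> 0"
  by (rule tendsto_sandwich[OF _ always_eventually[OF allI[OF assms(2)]] tendsto_const assms(1)]) simp

lemma L2conv_add:
  assumes F: "\<And>n. L2loc (F n)" "\<And>n. L2loc (G n)" and fg: "L2loc f" "L2loc g" and c: "L2conv F f" "L2conv G g"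
  shows "L2conv (\<lambda>n x. F n x + G n x) (\<lambda>x. f x + g x)"
  unfolding L2conv_def
proof
  fix R
  note [measurable] = L2loc_measurable[OF F(1)] L2loc_measurable[OF F(2)] L2loc_measurable[OF fg(1)] L2loc_measurable[OF fg(2)]
  have "(\<lambda>n. 2 * (sqn (cball 0 R) (\<lambda>x. F n x - f x) + sqn (cball 0 R) (\<lambda>x. G n x - g x))) \<longlonglongrightarrow> 2 * (0 + 0)"
    using c unfolding L2conv_def by (intro ennreal_tendsto_cmult tendsto_add) auto
  then have lim: "(\<lambda>n. 2 * (sqn (cball 0 R) (\<lambda>x. F n x - f x) + sqn (cball 0 R) (\<lambda>x. G n x - g x))) \<longlonglongrightarrow> 0" by simp
  show "(\<lambda>n. sqn (cball 0 R) (\<lambda>x. F n x + G n x - (f x + g x))) \<longlonglongrightarrow> 0"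
  proof (rule tendsto_0_le_ennreal[OF lim])
    fix n
    have "sqn (cball 0 R) (\<lambda>x. F n x + G n x - (f x + g x)) = sqn (cball 0 R) (\<lambda>x. (F n x - f x) + (G n x - g x))"
      by (simp only: add_diff_add)
    also have "\<dots> \<le> 2 * (sqn (cball 0 R) (\<lambda>x. F n x - f x) + sqn (cball 0 R) (\<lambda>x. G n x - g x))" by (rule sqn_add) auto
    finally show "sqn (cball 0 R) (\<lambda>x. F n x + G n x - (f x + g x)) \<le> \<dots>" .
  qed
qed

lemma L2conv_mult:
  assumes F: "\<And>n. L2loc (F n)" and f: "L2loc f" and c: "L2conv F f" and e: "csmooth r e"
  shows "L2conv (\<lambda>n x. e x * F n x) (\<lambda>x. e x * f x)"
  unfolding L2conv_def
proof
  fix R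
  note [measurable] = L2loc_measurable[OF F] L2loc_measurable[OF f]
  obtain B where B: "\<And>x. \<bar>e x\<bar> \<le> B" using csmooth_bounded[OF e] by blast
  have "(\<lambda>n. ennreal (B\<^sup>2) * sqn (cball 0 R) (\<lambda>x. F n x - f x)) \<longlonglongrightarrow> ennreal (B\<^sup>2) * 0"
    using c unfolding L2conv_def by (intro ennreal_tendsto_cmult) auto
  then have lim: "(\<lambda>n. ennreal (B\<^sup>2) * sqn (cball 0 R) (\<lambda>x. F n x - f x)) \<longlonglongrightarrow> 0" by simp
  show "(\<lambda>n. sqn (cball 0 R) (\<lambda>x. e x * F n x - e x * f x)) \<longlonglongrightarrow> 0"
  proof (rule tendsto_0_le_ennreal[OF lim])
    fix n
    show "sqn (cball 0 R) (\<lambda>x. e x * F n x - e x * f x) \<le> ennreal (B\<^sup>2) * sqn (cball 0 R) (\<lambda>x. F n x - f x)"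
      using sqn_mult_bounded[of "\<lambda>x. F n x - f x" "cball 0 R" e B, OF _ _ B] by (simp add: right_diff_distrib)
  qed
qed

lemma Vsp_continuous: "u \<in> Vsp k kmin \<Longrightarrow> continuous_on UNIV u"
  by (simp add: Vsp_def)

definition leibniz :: "'d list \<Rightarrow> 'd::finite fn \<Rightarrow> 'd fn \<Rightarrow> 'd fn" where
  "leibniz is \<eta> u x = (\<Sum>(a, b)\<leftarrow>splits is. pd_list a \<eta> x * wd (count_list b) u x)"

lemma leibniz_approx:
  fixes u \<eta> :: "'d::finite fn"
  assumes u: "u \<in> Vsp k kmin" and k: "kmin \<le> k" and l: "length is \<le> k" and e: "csmooth r \<eta>"
  shows "L2loc (leibniz is \<eta> u)" "L2conv (\<lambda>n. pd_list is (\<lambda>x. \<eta> x * conv u (moll n) x)) (leibniz is \<eta> u)"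
proof -
  have li: "loc_int u" by (rule continuous_loc_int[OF Vsp_continuous[OF u]])
  have sm: "smooth (conv u (moll n))" for n by (rule smooth_conv[OF li moll_csmooth])
  have se: "smooth \<eta>" using e by (simp add: csmooth_def)
  \<comment> \<open>An arbitrary list of pairs allows induction over the Leibniz sum; the two local
    integrability claims are the premises of \<open>L2conv_add\<close> in the inductive
    step.\<close>
  have "L2loc (\<lambda>x. \<Sum>(a, b)\<leftarrow>L. pd_list a \<eta> x * wd (count_list b) u x) \<and>
    L2conv (\<lambda>n x. \<Sum>(a, b)\<leftarrow>L. pd_list a \<eta> x * pd_list b (conv u (moll n)) x) (\<lambda>x. \<Sum>(a, b)\<leftarrow>L. pd_list a \<eta> x * wd (count_list b) u x)
    \<and> (\<forall>n. L2loc (\<lambda>x. \<Sum>(a, b)\<leftarrow>L. pd_list a \<eta> x * pd_list b (conv u (moll n)) x))"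
    if "\<And>a b. (a, b) \<in> set L \<Longrightarrow> length b \<le> k" for L
    using that
  proof (induction L)
    case Nil
    show ?case using L2loc_0 by (simp add: L2conv_def sqn_def)
  next
    case (Cons p L)
    obtain a b where p: "p = (a, b)" by force
    have b: "length b \<le> k" using Cons.prems p by auto
    note ap = Vsp_approx[OF u k b] csmooth_pd_list[OF e, of a]
    note l2 = smooth_L2loc[OF smooth_pd_list[OF sm, of b]]
    note IH = Cons.IH[OF Cons.prems, simplified]
    have IH: "L2loc (\<lambda>x. \<Sum>(a, b)\<leftarrow>L. pd_list a \<eta> x * wd (count_list b) u x)"
      "L2conv (\<lambda>n x. \<Sum>(a, b)\<leftarrow>L. pd_list a \<eta> x * pd_list b (conv u (moll n)) x) (\<lambda>x. \<Sum>(a, b)\<leftarrow>L. pd_list a \<eta> x * wd (count_list b) u x)"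
      "\<And>n. L2loc (\<lambda>x. \<Sum>(a, b)\<leftarrow>L. pd_list a \<eta> x * pd_list b (conv u (moll n)) x)"
      using Cons.IH Cons.prems by (meson list.set_intros(2))+
    show ?case
      unfolding p list.map sum_list.Cons prod.case
      by (intro conjI allI L2loc_add L2loc_mult[OF _ ap(4)] L2conv_add L2conv_mult[OF _ _ _ ap(4)] ap l2 IH)
  qed
  note T = this
  have bs: "length b \<le> k" if "(a, b) \<in> set (splits is)" for a b
    using splits_length[OF that] l by simp
  show "L2loc (leibniz is \<eta> u)"
    unfolding leibniz_def[abs_def] by (rule T[THEN conjunct1]) (erule bs)
  show "L2conv (\<lambda>n. pd_list is (\<lambda>x. \<eta> x * conv u (moll n) x)) (leibniz is \<eta> u)"
    unfolding leibniz_def[abs_def] pd_list_mult[OF se sm] by (rule T[THEN conjunct2, THEN conjunct1]) (erule bs)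
qed

lemma leibniz_eq_0:
  assumes "open U" "x \<in> U" "\<And>y. y \<in> U \<Longrightarrow> \<eta> y = 0"
  shows "leibniz is \<eta> u x = 0"
  unfolding leibniz_def by (simp add: pd_list_eq_0[OF assms] split_def)

lemma leibniz_weak_deriv:
  fixes u \<eta> :: "'d::finite fn"
  assumes u: "u \<in> Vsp k kmin" and k: "kmin \<le> k" and l: "length is \<le> k" and e: "csmooth r \<eta>"
  shows "weak_deriv (count_list is) (\<lambda>x. \<eta> x * u x) (leibniz is \<eta> u)"
proof (rule weak_deriv_limit)
  have li: "loc_int u" by (rule continuous_loc_int[OF Vsp_continuous[OF u]])
  have sm: "smooth (conv u (moll n))" for n by (rule smooth_conv[OF li moll_csmooth])
  have u2: "L2loc u" by (rule continuous_L2loc[OF Vsp_continuous[OF u]])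
  show sp: "smooth (\<lambda>x. \<eta> x * conv u (moll n) x)" for n
    using e by (intro smooth_mult sm) (simp add: csmooth_def)
  show "L2loc (\<lambda>x. \<eta> x * u x)" by (rule L2loc_mult[OF u2 e])
  show "L2loc (leibniz is \<eta> u)" by (rule leibniz_approx[OF assms])
  show "L2conv (\<lambda>n x. \<eta> x * conv u (moll n) x) (\<lambda>x. \<eta> x * u x)"
    by (rule L2conv_mult[OF smooth_L2loc[OF sm] u2 conv_moll_L2conv[OF u2] e])
  show "L2conv (\<lambda>n. pd_list (mi_list (count_list is)) (\<lambda>x. \<eta> x * conv u (moll n) x)) (leibniz is \<eta> u)"
    using leibniz_approx(2)[OF assms] pd_list_mi_list[OF sp] by simp
qed

text \<open>The Leibniz sum contains derivatives of \<open>u\<close> below order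
  \<open>kmin\<close>, which are only locally square integrable. The compact support of \<eta> turns
  this into global square integrability.\<close>

lemma Vsp_mult:
  fixes u \<eta> :: "'d::finite fn"
  assumes u: "u \<in> Vsp k kmin" and k: "kmin \<le> k" and e: "csmooth r \<eta>"
  shows "(\<lambda>x. \<eta> x * u x) \<in> Vsp k kmin"
  unfolding Vsp_def
proof (intro CollectI conjI allI impI)
  show c: "continuous_on UNIV (\<lambda>x. \<eta> x * u x)"
    using e by (intro continuous_on_mult Vsp_continuous[OF u] smooth_continuous) (simp add: csmooth_def)
  then show "loc_int (\<lambda>x. \<eta> x * u x)" by (rule continuous_loc_int)
  fix \<alpha> :: "'d \<Rightarrow> nat" assume a: "kmin \<le> mi_order \<alpha> \<and> mi_order \<alpha> \<le> k"
  let ?is = "mi_list \<alpha>"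
  have l: "length ?is \<le> k" using a by (simp add: length_mi_list)
  have g: "L2loc (leibniz ?is \<eta> u)" by (rule leibniz_approx[OF u k l e])
  have "leibniz ?is \<eta> u x = 0" if "norm x > r" for x
    by (rule leibniz_eq_0[where U="{x. norm x > r}"])
       (use that e in \<open>auto simp: csmooth_def intro!: open_Collect_less continuous_intros\<close>)
  then have "sqn UNIV (leibniz ?is \<eta> u) = sqn (cball 0 r) (leibniz ?is \<eta> u)"
    unfolding sqn_def by (intro nn_integral_cong) (auto simp: indicator_def not_le)
  moreover note [measurable] = L2loc_measurable[OF g]
  ultimately have "L2 (leibniz ?is \<eta> u)"
    using g unfolding L2_def L2loc_def sqn_def integrable_iff_bounded by simp
  then show "\<exists>g. weak_deriv \<alpha> (\<lambda>x. \<eta> x * u x) g \<and> L2 g"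
    using leibniz_weak_deriv[OF u k l e] by (auto simp: count_mi_list)
qed

lemma wd_mult:
  fixes u \<eta> :: "'d::finite fn"
  assumes u: "u \<in> Vsp k kmin" and k: "kmin \<le> k" and l: "length is \<le> k" and e: "csmooth r \<eta>"
  shows "AE x in lborel. wd (count_list is) (\<lambda>x. \<eta> x * u x) x = leibniz is \<eta> u x"
  by (rule weak_deriv_unique[OF Vsp_approx(1)[OF Vsp_mult[OF u k e] k l] leibniz_weak_deriv[OF assms]])

section \<open>Cutoff functions\<close>

lemma pd_list_one: "pd_list is (\<lambda>_. 1) = (\<lambda>_. if is = [] then 1 else 0)"
proof (cases "is")
  case (Cons i js)
  have "pd_list js (\<lambda>_. 1) = (\<lambda>_. if js = [] then 1 else 0)"
  proof (induction js)
    case (Cons j js) then show ?case by (cases "js = []") auto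
  qed simp
  then show ?thesis using Cons by (cases "js = []") auto
qed simp

text \<open>Each derivative costs at most one factor \<omega>. The constant \<open>K\<close> is
  uniform over all cutoffs obeying the same scaled derivative bounds, so it does not depend on the
  box or on the scale \<open>D\<close>. Induction on \<open>m\<close>, applying Leibniz to \<omega>
  times \<omega>^m.\<close>

lemma pd_list_power_bound:
  fixes \<omega> :: "'d::finite fn"
  assumes C: "C \<ge> 1"
  shows "\<exists>K\<ge>0. \<forall>\<omega> :: 'd fn. \<forall>D\<ge>0. smooth \<omega> \<longrightarrow> (\<forall>x. 0 \<le> \<omega> x \<and> \<omega> x \<le> 1) \<longrightarrow>
     (\<forall>is x. length is \<le> k \<longrightarrow> \<bar>pd_list is \<omega> x\<bar> \<le> C * D ^ length is) \<longrightarrow>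
     (\<forall>is x. length is \<le> k \<longrightarrow> \<bar>pd_list is (\<lambda>x. \<omega> x ^ m) x\<bar> \<le> K * D ^ length is * \<omega> x ^ (m - length is))"
proof (induction m)
  case 0
  show ?case by (rule exI[of _ 1]) (auto simp: pd_list_one)
next
  case (Suc m)
  then obtain K where K: "K \<ge> 0" and b0: "\<forall>\<omega> :: 'd fn. \<forall>D\<ge>0. smooth \<omega> \<longrightarrow> (\<forall>x. 0 \<le> \<omega> x \<and> \<omega> x \<le> 1) \<longrightarrow>
     (\<forall>is x. length is \<le> k \<longrightarrow> \<bar>pd_list is \<omega> x\<bar> \<le> C * D ^ length is) \<longrightarrow>
     (\<forall>is x. length is \<le> k \<longrightarrow> \<bar>pd_list is (\<lambda>x. \<omega> x ^ m) x\<bar> \<le> K * D ^ length is * \<omega> x ^ (m - length is))" by (elim exE conjE)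
  show ?case
  proof (intro exI[of _ "2 ^ k * (C * K)"] conjI allI impI)
    show "0 \<le> 2 ^ k * (C * K)" using C K by simp
    fix \<omega> :: "'d fn" and D :: real and "is" :: "'d list" and x
    assume D: "D \<ge> 0" and s: "smooth \<omega>" and r: "\<forall>x. 0 \<le> \<omega> x \<and> \<omega> x \<le> 1"
      and p: "\<forall>is x. length is \<le> k \<longrightarrow> \<bar>pd_list is \<omega> x\<bar> \<le> C * D ^ length is" and l: "length is \<le> k"
    note b = b0[THEN spec[of _ \<omega>], THEN spec[of _ D], THEN mp, THEN mp, THEN mp, THEN mp, THEN spec, THEN spec, THEN mp, OF D s r p]
    let ?n = "length is"
    let ?B = "C * K * D ^ ?n * \<omega> x ^ (Suc m - ?n)"
    have B0: "?B \<ge> 0" using C K D r by simp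
    have le: "\<bar>pd_list a \<omega> x * pd_list b (\<lambda>x. \<omega> x ^ m) x\<bar> \<le> ?B" if ab: "(a, b) \<in> set (splits is)" for a b
    proof -
      have len: "length a + length b = ?n" by (rule splits_length[OF ab])
      then have bb: "\<bar>pd_list b (\<lambda>x. \<omega> x ^ m) x\<bar> \<le> K * D ^ length b * \<omega> x ^ (m - length b)"
        using l by (intro b) auto
      show ?thesis
      proof (cases "a = []")
        case True
        have "\<bar>\<omega> x * pd_list b (\<lambda>x. \<omega> x ^ m) x\<bar> \<le> \<omega> x * (K * D ^ ?n * \<omega> x ^ (m - ?n))"
          unfolding abs_mult using bb len True r by (intro mult_mono) auto
        also have "\<dots> = K * D ^ ?n * \<omega> x ^ Suc (m - ?n)" by simp
        \<comment> \<open>An inequality because subtraction is truncated: for ?n > m the exponent on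
          the left is 1 and the one on the right is 0. The base lies between 0 and 1.\<close>
        also have "\<dots> \<le> K * D ^ ?n * \<omega> x ^ (Suc m - ?n)"
          using K D r by (intro mult_left_mono power_decreasing) auto
        also have "\<dots> \<le> C * (K * D ^ ?n * \<omega> x ^ (Suc m - ?n))"
          using C K D r by (intro mult_right_mono[of 1 C, simplified]) auto
        finally show ?thesis using True by (simp add: mult.assoc)
      next
        case False
        have ba: "\<bar>pd_list a \<omega> x\<bar> \<le> C * D ^ length a" using p l len by auto
        have "\<bar>pd_list a \<omega> x * pd_list b (\<lambda>x. \<omega> x ^ m) x\<bar> \<le> (C * D ^ length a) * (K * D ^ length b * \<omega> x ^ (m - length b))"
          unfolding abs_mult using bb ba C D by (intro mult_mono) auto
        also have "\<dots> = C * K * D ^ ?n * \<omega> x ^ (m - length b)" by (simp add: len[symmetric] power_add)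
        also have "\<dots> \<le> C * K * D ^ ?n * \<omega> x ^ (Suc m - ?n)"
        proof (intro mult_left_mono power_decreasing)
          have "length a > 0" using False by simp
          then show "Suc m - ?n \<le> m - length b" using len by linarith
        qed (use C K D r in auto)
        finally show ?thesis .
      qed
    qed
    have sum: "\<bar>\<Sum>(a, b)\<leftarrow>L. pd_list a \<omega> x * pd_list b (\<lambda>x. \<omega> x ^ m) x\<bar> \<le> length L * ?B"
      if "\<And>a b. (a, b) \<in> set L \<Longrightarrow> \<bar>pd_list a \<omega> x * pd_list b (\<lambda>x. \<omega> x ^ m) x\<bar> \<le> ?B" for L
      using that
    proof (induction L)
      case (Cons q L)
      obtain a b where q: "q = (a, b)" by force
      have "\<bar>\<Sum>(a, b)\<leftarrow>L. pd_list a \<omega> x * pd_list b (\<lambda>x. \<omega> x ^ m) x\<bar> \<le> length L * ?B"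
        using Cons.prems by (intro Cons.IH) auto
      moreover have "\<bar>pd_list a \<omega> x * pd_list b (\<lambda>x. \<omega> x ^ m) x\<bar> \<le> ?B" using Cons.prems[of a b] q by simp
      ultimately show ?case unfolding q
        by (simp only: list.map sum_list.Cons prod.case list.size of_nat_add of_nat_1 distrib_right mult_1 add.commute[of _ "Suc 0"] Suc_eq_plus1)
    qed simp
    have "pd_list is (\<lambda>x. \<omega> x ^ Suc m) x = (\<Sum>(a, b)\<leftarrow>splits is. pd_list a \<omega> x * pd_list b (\<lambda>x. \<omega> x ^ m) x)"
      using pd_list_mult[OF s smooth_power[OF s, of m], of "is"] by simp
    then have "\<bar>pd_list is (\<lambda>x. \<omega> x ^ Suc m) x\<bar> \<le> length (splits is) * ?B" using sum[OF le] by simp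
    also have "\<dots> \<le> 2 ^ k * ?B"
    proof (rule mult_right_mono[OF _ B0])
      have "(2::real) ^ length is \<le> 2 ^ k" by (rule power_increasing[OF l]) simp
      then show "real (length (splits is)) \<le> 2 ^ k" by (simp add: length_splits)
    qed
    finally show "\<bar>pd_list is (\<lambda>x. \<omega> x ^ Suc m) x\<bar> \<le> 2 ^ k * (C * K) * D ^ length is * \<omega> x ^ (Suc m - length is)"
      by (simp add: mult_ac)
  qed
qed

lemma loc_int_indicator:
  fixes S :: "(real^'d::finite) set"
  assumes "S \<in> sets borel" shows "loc_int (indicator S)"
  unfolding loc_int_def set_integrable_def
proof (intro allI impI)
  fix K :: "(real^'d) set" assume K: "compact K"
  have "emeasure lborel (K \<inter> S) \<le> emeasure lborel K"
    by (rule emeasure_mono) (use K in \<open>auto intro: borel_compact\<close>)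
  also have "\<dots> < \<infinity>" by (rule emeasure_compact_finite[OF K])
  finally have "integrable lborel (indicator (K \<inter> S) :: 'd fn)"
    using assms K by (intro integrable_real_indicator) (auto intro: borel_compact)
  then show "integrable lborel (\<lambda>x. indicator K x *\<^sub>R indicator S x :: real)"
    by (simp only: real_scaleR_def indicator_inter_arith[symmetric])
qed

lemma conv_moll_bound:
  fixes u :: "'d::finite fn"
  assumes u: "loc_int u" "\<And>x. \<bar>u x\<bar> \<le> 1" and f: "csmooth r f"
  shows "\<bar>conv u f x\<bar> \<le> (\<integral>z. \<bar>f z\<bar> \<partial>lborel)"
proof -
  have "\<bar>conv u f x\<bar> \<le> (\<integral>z. \<bar>u (x - z) * f z\<bar> \<partial>lborel)"
    unfolding conv_eq(2)[OF u(1) f] by (rule integral_abs_bound)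
  also have "\<dots> \<le> (\<integral>z. \<bar>f z\<bar> \<partial>lborel)"
  proof (rule integral_mono)
    show "integrable lborel (\<lambda>z. \<bar>u (x - z) * f z\<bar>)" using conv_eq(1)[OF u(1) f] by auto
    show "integrable lborel (\<lambda>z. \<bar>f z\<bar>)" using csmooth_integrable[OF f] by auto
    show "\<bar>u (x - z) * f z\<bar> \<le> \<bar>f z\<bar>" for z
      unfolding abs_mult using u(2)[of "x - z"] by (intro mult_left_le_one_le) auto
  qed
  finally show ?thesis .
qed

lemma mollifier_deriv_bound_list:
  "\<exists>C\<ge>1. \<forall>e>0. \<forall>is. length is \<le> k \<longrightarrow> (\<integral>x. \<bar>pd_list is (mollifier e) (x::real^'d::finite)\<bar> \<partial>lborel) \<le> C * inverse e ^ length is"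
proof -
  let ?L = "{is :: 'd list. length is \<le> k}"
  have fin: "finite ?L" using finite_lists_length_le[of "UNIV :: 'd set" k] by simp
  obtain c where c: "\<And>is e. e > 0 \<Longrightarrow> (\<integral>x. \<bar>pd_list is (mollifier e) (x::real^'d)\<bar> \<partial>lborel) \<le> c is * inverse e ^ length is"
    using mollifier_deriv_bound[where 'd='d] by metis
  define C where "C = 1 + (\<Sum>is\<in>?L. \<bar>c is\<bar>)"
  have "c is \<le> C" if "length is \<le> k" for "is"
    using member_le_sum[of "is" ?L "\<lambda>is. \<bar>c is\<bar>"] that fin unfolding C_def by auto
  then have "(\<integral>x. \<bar>pd_list is (mollifier e) (x::real^'d)\<bar> \<partial>lborel) \<le> C * inverse e ^ length is" if "e > 0" "length is \<le> k" for e "is"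
    using c[OF that(1), of "is"] that by (meson mult_right_mono order_trans zero_le_power less_imp_le positive_imp_inverse_positive)
  moreover have "C \<ge> 1" unfolding C_def by (simp add: sum_nonneg)
  ultimately show ?thesis by blast
qed

text \<open>The indicator of the box grown by \<delta>/4 is mollified at scale \<delta>/8. It is
  then 1 on the box, and its support stays within a growth of 3\<delta>/8, strictly inside the
  enlargement by \<delta>/2. Derivatives scale like (8/\<delta>)^l, which explains the factor
  8^k.\<close>

lemma cutoff_exists:
  "\<exists>C\<ge>1. \<forall>(a::real^'d::finite) b \<delta>. \<delta> > 0 \<longrightarrow> (\<exists>\<omega> r. csmooth r \<omega> \<and> (\<forall>x. 0 \<le> \<omega> x \<and> \<omega> x \<le> 1) \<and>
     (\<forall>x\<in>box a b. \<omega> x = 1) \<and> (\<forall>x. x \<notin> cbox (a - (\<chi> i. 3 * \<delta> / 8)) (b + (\<chi> i. 3 * \<delta> / 8)) \<longrightarrow> \<omega> x = 0) \<and>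
     (\<forall>is x. length is \<le> k \<longrightarrow> \<bar>pd_list is \<omega> x\<bar> \<le> C * inverse \<delta> ^ length is))"
proof -
  obtain C0 where C0: "C0 \<ge> 1" "\<And>e is. e > 0 \<Longrightarrow> length is \<le> k \<Longrightarrow> (\<integral>x. \<bar>pd_list is (mollifier e) (x::real^'d)\<bar> \<partial>lborel) \<le> C0 * inverse e ^ length is"
    using mollifier_deriv_bound_list[of k, where 'd='d] by blast
  show ?thesis
  proof (intro exI[of _ "C0 * 8 ^ k"] conjI allI impI)
    show "1 \<le> C0 * 8 ^ k" using C0(1) mult_mono[of 1 C0 1 "8 ^ k"] by simp
    fix a b :: "real^'d" and \<delta> :: real assume d: "\<delta> > 0"
    let ?E = "cbox (a - (\<chi> i. \<delta> / 4)) (b + (\<chi> i. \<delta> / 4))"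
    let ?S = "cbox (a - (\<chi> i. 3 * \<delta> / 8)) (b + (\<chi> i. 3 * \<delta> / 8))"
    let ?u = "indicator ?E :: 'd fn" and ?e = "\<delta> / 8"
    let ?\<rho> = "mollifier ?e :: 'd fn"
    define \<omega> where "\<omega> = conv ?u ?\<rho>"
    have e: "?e > 0" using d by simp
    note \<rho> = csmooth_mollifier[OF e, where 'd='d]
    have li: "loc_int ?u"
      by (rule loc_int_indicator) simp
    have b1: "\<bar>?u x\<bar> \<le> 1" for x by (simp add: indicator_def)
    have sup: "?\<rho> z = 0" if "\<bar>z $ i\<bar> > ?e" for z i
      using \<rho> that component_le_norm_cart[of z i] by (simp add: csmooth_def)
    have w0: "\<omega> x = 0" if x: "x \<notin> ?S" for x
    proof -
      have "?u (x - z) * ?\<rho> z = 0" for z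
      proof (rule ccontr)
        assume "?u (x - z) * ?\<rho> z \<noteq> 0"
        then have z: "x - z \<in> ?E" "\<And>i. \<bar>z $ i\<bar> \<le> ?e" using sup by (auto simp: not_less[symmetric] split: split_indicator_asm)
        have "x \<in> ?S"
          unfolding mem_box_cart
        proof (intro allI)
          fix i
          show "(a - (\<chi> i. 3 * \<delta> / 8)) $ i \<le> x $ i \<and> x $ i \<le> (b + (\<chi> i. 3 * \<delta> / 8)) $ i"
            using z(1)[unfolded mem_box_cart, rule_format, of i] z(2)[of i] by auto
        qed
        then show False using x by simp
      qed
      then show ?thesis unfolding \<omega>_def conv_eq(2)[OF li \<rho>] by (simp only: Bochner_Integration.integral_zero)
    qed
    have w1: "\<omega> x = 1" if x: "x \<in> box a b" for x
    proof -
      have "?u (x - z) * ?\<rho> z = ?\<rho> z" for z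
      proof (cases "\<forall>i. \<bar>z $ i\<bar> \<le> ?e")
        case True
        have "x - z \<in> ?E"
          unfolding mem_box_cart
        proof (intro allI)
          fix i
          show "(a - (\<chi> i. \<delta> / 4)) $ i \<le> (x - z) $ i \<and> (x - z) $ i \<le> (b + (\<chi> i. \<delta> / 4)) $ i"
            using x[unfolded mem_box_cart, rule_format, of i] True[rule_format, of i] by auto
        qed
        then show ?thesis by simp
      next
        case False
        then show ?thesis using sup by (auto simp: not_le)
      qed
      then show ?thesis unfolding \<omega>_def conv_eq(2)[OF li \<rho>] using integral_mollifier[OF e, where 'd='d] by (simp only:)
    qed
    have "bounded ?S" by (rule bounded_cbox)
    then obtain r where r: "\<And>x. x \<in> ?S \<Longrightarrow> norm x \<le> r" unfolding bounded_iff by blast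
    show "\<exists>\<omega> r. csmooth r \<omega> \<and> (\<forall>x. 0 \<le> \<omega> x \<and> \<omega> x \<le> 1) \<and>
     (\<forall>x\<in>box a b. \<omega> x = 1) \<and> (\<forall>x. x \<notin> ?S \<longrightarrow> \<omega> x = 0) \<and>
     (\<forall>is x. length is \<le> k \<longrightarrow> \<bar>pd_list is \<omega> x\<bar> \<le> C0 * 8 ^ k * inverse \<delta> ^ length is)"
    proof (intro exI conjI allI impI ballI)
      show "csmooth r \<omega>"
        unfolding csmooth_def using smooth_conv[OF li \<rho>] w0 r unfolding \<omega>_def[symmetric] by (meson not_less)
      fix x
      show "0 \<le> \<omega> x" unfolding \<omega>_def conv_eq(2)[OF li \<rho>]
        by (intro Bochner_Integration.integral_nonneg mult_nonneg_nonneg mollifier_nonneg) simp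
      have "\<bar>\<omega> x\<bar> \<le> 1"
        using conv_moll_bound[OF li b1 \<rho>, of x] integral_mollifier[OF e, where 'd='d] unfolding \<omega>_def by (simp add: mollifier_nonneg)
      then show "\<omega> x \<le> 1" by simp
      show "\<omega> x = 1" if "x \<in> box a b" by (rule w1[OF that])
      show "\<omega> x = 0" if "x \<notin> ?S" by (rule w0[OF that])
      fix "is" :: "'d list" assume l: "length is \<le> k"
      have "\<bar>pd_list is \<omega> x\<bar> \<le> (\<integral>z. \<bar>pd_list is ?\<rho> z\<bar> \<partial>lborel)"
        unfolding \<omega>_def pd_list_conv[OF li \<rho>] by (rule conv_moll_bound[OF li b1 csmooth_pd_list[OF \<rho>]])
      also have "\<dots> \<le> C0 * inverse ?e ^ length is" by (rule C0(2)[OF e l])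
      also have "\<dots> = C0 * (8 ^ length is * inverse \<delta> ^ length is)" by (simp add: field_simps power_divide)
      also have "\<dots> \<le> C0 * (8 ^ k * inverse \<delta> ^ length is)"
        using C0(1) d l by (intro mult_left_mono mult_right_mono power_increasing) auto
      finally show "\<bar>pd_list is \<omega> x\<bar> \<le> C0 * 8 ^ k * inverse \<delta> ^ length is" by (simp add: mult.assoc)
    qed
  qed
qed

section \<open>Seminorms\<close>

definition mi_weight :: "('d::finite \<Rightarrow> nat) \<Rightarrow> real" where
  "mi_weight \<alpha> = fact (mi_order \<alpha>) / real (mi_fact \<alpha>)"

text \<open>A Bochner integral, informative only where the square is integrable. For
  \<open>u\<close> in V and orders up to \<open>k\<close> this is guaranteed on bounded sets, hence
  the recurring premise that a set lies in some \<open>cball 0 R\<close>.\<close>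

definition wd_energy :: "('d \<Rightarrow> nat) \<Rightarrow> (real^'d) set \<Rightarrow> 'd::finite fn \<Rightarrow> real" where
  "wd_energy \<alpha> S u = (\<integral>x. indicator S x * (wd \<alpha> u x)\<^sup>2 \<partial>lborel)"

lemma mi_fact_pos: "mi_fact \<alpha> > 0"
  unfolding mi_fact_def by (intro prod_pos) auto

lemma mi_weight_pos: "mi_weight \<alpha> > 0"
  unfolding mi_weight_def using mi_fact_pos[of \<alpha>] by simp

lemma finite_mi_order: "finite {\<alpha> :: 'd::finite \<Rightarrow> nat. mi_order \<alpha> = l}"
proof (rule finite_subset)
  show "{\<alpha> :: 'd \<Rightarrow> nat. mi_order \<alpha> = l} \<subseteq> count_list ` {is. length is = l}"
    by (auto intro!: image_eqI[where x="mi_list _"] simp: count_mi_list length_mi_list)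
  show "finite (count_list ` {is :: 'd list. length is = l})"
    using finite_lists_length_eq[of "UNIV :: 'd set" l] by simp
qed

lemma wd_energy_nonneg: "wd_energy \<alpha> S u \<ge> 0"
  unfolding wd_energy_def by (intro Bochner_Integration.integral_nonneg) simp

lemma hsemi_square:
  fixes u :: "'d::finite fn"
  shows "(hsemi l S u)\<^sup>2 = (\<Sum>\<alpha>\<in>{\<alpha>. mi_order \<alpha> = l}. mi_weight \<alpha> * wd_energy \<alpha> S u)"
proof -
  have "(\<Sum>\<alpha>\<in>{\<alpha>::'d \<Rightarrow> nat. mi_order \<alpha> = l}. (fact l / real (mi_fact \<alpha>)) * (LINT y:S|lborel. (wd \<alpha> u y)\<^sup>2))
    = (\<Sum>\<alpha>\<in>{\<alpha>. mi_order \<alpha> = l}. mi_weight \<alpha> * wd_energy \<alpha> S u)"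
    unfolding wd_energy_def mi_weight_def set_lebesgue_integral_def by (intro sum.cong) auto
  moreover have "\<dots> \<ge> 0"
    by (intro sum_nonneg mult_nonneg_nonneg wd_energy_nonneg less_imp_le[OF mi_weight_pos])
  ultimately show ?thesis unfolding hsemi_def by simp
qed

lemma hsemi_nonneg: "hsemi l S u \<ge> 0"
proof -
  have "(\<Sum>\<alpha>\<in>{\<alpha>. mi_order \<alpha> = l}. (fact l / real (mi_fact \<alpha>)) * (LINT y:S|lborel. (wd \<alpha> u y)\<^sup>2)) \<ge> 0"
    unfolding set_lebesgue_integral_def
    by (intro sum_nonneg mult_nonneg_nonneg Bochner_Integration.integral_nonneg) auto
  then show ?thesis unfolding hsemi_def by simp
qed

text \<open>A crude upper bound for \<open>mi_fact\<close> over all multi-indices of order at most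
  \<open>k\<close>. It allows the energy of a single derivative to be bounded by the weighted
  seminorm.\<close>

definition weight_bound :: "'d::finite itself \<Rightarrow> nat \<Rightarrow> real" where
  "weight_bound _ k = fact k ^ CARD('d)"

lemma weight_bound_pos: "weight_bound TYPE('d::finite) k > 0"
  by (simp add: weight_bound_def)

lemma wd_energy_le_hsemi:
  fixes u :: "'d::finite fn"
  assumes "mi_order \<alpha> \<le> k"
  shows "wd_energy \<alpha> S u \<le> weight_bound TYPE('d) k * (hsemi (mi_order \<alpha>) S u)\<^sup>2"
proof -
  have "mi_fact \<alpha> \<le> (\<Prod>i\<in>(UNIV::'d set). fact k)"
    unfolding mi_fact_def
  proof (intro prod_mono conjI fact_mono_nat)
    fix i show "\<alpha> i \<le> k" using member_le_sum[of i UNIV \<alpha>] assms unfolding mi_order_def by auto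
  qed auto
  then have "mi_fact \<alpha> \<le> fact k ^ CARD('d)" by simp
  then have "real (mi_fact \<alpha>) \<le> real (fact k ^ CARD('d))" by (simp only: of_nat_le_iff)
  then have F: "real (mi_fact \<alpha>) \<le> weight_bound TYPE('d) k" by (simp add: weight_bound_def)
  have "1 = mi_weight \<alpha> * (real (mi_fact \<alpha>) / fact (mi_order \<alpha>))"
    using mi_fact_pos[of \<alpha>] by (simp add: mi_weight_def)
  also have "\<dots> \<le> mi_weight \<alpha> * real (mi_fact \<alpha>)"
    using mi_weight_pos[of \<alpha>] by (intro mult_left_mono) (auto simp: divide_le_eq intro: mult_le_cancel_left1[THEN iffD2] fact_ge_1)
  also have "\<dots> \<le> mi_weight \<alpha> * weight_bound TYPE('d) k"
    using F mi_weight_pos[of \<alpha>] by (intro mult_left_mono) auto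
  finally have 1: "1 \<le> mi_weight \<alpha> * weight_bound TYPE('d) k" .
  have "wd_energy \<alpha> S u \<le> mi_weight \<alpha> * weight_bound TYPE('d) k * wd_energy \<alpha> S u"
    using mult_right_mono[OF 1 wd_energy_nonneg[of \<alpha> S u]] by simp
  also have "\<dots> = weight_bound TYPE('d) k * (mi_weight \<alpha> * wd_energy \<alpha> S u)" by simp
  also have "\<dots> \<le> weight_bound TYPE('d) k * (hsemi (mi_order \<alpha>) S u)\<^sup>2"
    unfolding hsemi_square using weight_bound_pos[where 'd='d, of k]
    by (intro mult_left_mono member_le_sum[where f="\<lambda>\<alpha>. mi_weight \<alpha> * wd_energy \<alpha> S u"] finite_mi_order
        mult_nonneg_nonneg wd_energy_nonneg less_imp_le[OF mi_weight_pos]) auto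
  finally show ?thesis .
qed

lemma L2loc_prod_integrable:
  fixes f g :: "'d::finite fn"
  assumes f: "L2loc f" and g: "L2loc g" and S: "S \<in> sets borel" "S \<subseteq> cball 0 R"
  shows "integrable lborel (\<lambda>x. indicator S x * (f x * g x))"
proof (rule integrableI_bounded)
  note [measurable] = L2loc_measurable[OF f] L2loc_measurable[OF g] S(1)
  show "(\<lambda>x. indicator S x * (f x * g x)) \<in> borel_measurable lborel" by measurable
  have "(\<integral>\<^sup>+x. ennreal (norm (indicator S x * (f x * g x))) \<partial>lborel) \<le> (\<integral>\<^sup>+x. ennreal ((f x)\<^sup>2) * indicator S x + ennreal ((g x)\<^sup>2) * indicator S x \<partial>lborel)"
  proof (rule nn_integral_mono)
    fix x
    have "\<bar>f x * g x\<bar> \<le> (f x)\<^sup>2 + (g x)\<^sup>2"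
    proof -
      have "2 * \<bar>f x * g x\<bar> \<le> (f x)\<^sup>2 + (g x)\<^sup>2"
        using sum_squares_bound[of "\<bar>f x\<bar>" "\<bar>g x\<bar>"] by (simp add: abs_mult mult.assoc)
      then show ?thesis using abs_ge_zero[of "f x * g x"] by linarith
    qed
    then have "ennreal \<bar>f x * g x\<bar> \<le> ennreal ((f x)\<^sup>2) + ennreal ((g x)\<^sup>2)"
      by (metis ennreal_leI ennreal_plus zero_le_power2)
    then show "ennreal (norm (indicator S x * (f x * g x))) \<le> ennreal ((f x)\<^sup>2) * indicator S x + ennreal ((g x)\<^sup>2) * indicator S x"
      by (auto simp: indicator_def)
  qed
  also have "\<dots> = sqn S f + sqn S g" unfolding sqn_def by (rule nn_integral_add) measurable
  also have "\<dots> < \<infinity>"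
    using le_less_trans[OF sqn_mono[OF S(2)]] f g unfolding L2loc_def by simp
  finally show "(\<integral>\<^sup>+x. ennreal (norm (indicator S x * (f x * g x))) \<partial>lborel) < \<infinity>" .
qed

lemma L2loc_square_integrable:
  fixes f :: "'d::finite fn"
  assumes f: "L2loc f" and S: "S \<in> sets borel" "S \<subseteq> cball 0 R"
  shows "integrable lborel (\<lambda>x. indicator S x * (f x)\<^sup>2)"
  using L2loc_prod_integrable[OF f f S] by (simp add: power2_eq_square)

lemma Vsp_wd_L2loc:
  fixes u :: "'d::finite fn"
  assumes "u \<in> Vsp k kmin" "kmin \<le> k" "mi_order \<alpha> \<le> k" shows "L2loc (wd \<alpha> u)"
  using Vsp_approx(2)[OF assms(1,2), of "mi_list \<alpha>"] assms(3) by (simp add: length_mi_list count_mi_list)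

lemma wd_energy_mono:
  fixes u :: "'d::finite fn"
  assumes "u \<in> Vsp k kmin" "kmin \<le> k" "mi_order \<alpha> \<le> k"
    and "S \<subseteq> T" "S \<in> sets borel" "T \<in> sets borel" "T \<subseteq> cball 0 R"
  shows "wd_energy \<alpha> S u \<le> wd_energy \<alpha> T u"
  unfolding wd_energy_def
proof (rule integral_mono)
  note l = Vsp_wd_L2loc[OF assms(1-3)]
  have "S \<subseteq> cball 0 R" using assms by blast
  then show "integrable lborel (\<lambda>x. indicator S x * (wd \<alpha> u x)\<^sup>2)" by (rule L2loc_square_integrable[OF l assms(5)])
  show "integrable lborel (\<lambda>x. indicator T x * (wd \<alpha> u x)\<^sup>2)" by (rule L2loc_square_integrable[OF l assms(6,7)])
  show "indicator S x * (wd \<alpha> u x)\<^sup>2 \<le> indicator T x * (wd \<alpha> u x)\<^sup>2" for x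
    using assms(4) by (intro mult_right_mono) (auto simp: indicator_def)
qed

lemma hsemi_mono:
  fixes u :: "'d::finite fn"
  assumes "u \<in> Vsp k kmin" "kmin \<le> k" "l \<le> k"
    and "S \<subseteq> T" "S \<in> sets borel" "T \<in> sets borel" "T \<subseteq> cball 0 R"
  shows "(hsemi l S u)\<^sup>2 \<le> (hsemi l T u)\<^sup>2"
  unfolding hsemi_square
  by (intro sum_mono mult_left_mono less_imp_le[OF mi_weight_pos] wd_energy_mono[OF assms(1,2) _ assms(4-7)]) (use assms in auto)

section \<open>The Caccioppoli inequality\<close>

lemma integral_sum_list:
  fixes f :: "'b \<Rightarrow> 'a \<Rightarrow> real"
  assumes "\<And>q. q \<in> set L \<Longrightarrow> integrable M (f q)"
  shows "integrable M (\<lambda>x. \<Sum>q\<leftarrow>L. f q x) \<and> (\<integral>x. (\<Sum>q\<leftarrow>L. f q x) \<partial>M) = (\<Sum>q\<leftarrow>L. \<integral>x. f q x \<partial>M)"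
  using assms by (induction L) auto

text \<open>Young's inequality for each lower-order Leibniz term, with parameter 2^k: it may consume
  the fraction 1/(2 * 2^k) of the principal term. There are at most 2^k such terms, so half of the
  principal term survives. In the application \<open>s q\<close> is the power of 1/\<delta> produced
  by differentiating the cutoff.\<close>

lemma absorb_pointwise:
  fixes A \<omega> K :: real and P W s :: "'q \<Rightarrow> real"
  assumes w: "0 \<le> \<omega>" and K: "K \<ge> 0" and len: "length L \<le> 2 ^ k"
    and P: "\<And>q. q \<in> set L \<Longrightarrow> \<bar>P q\<bar> \<le> K * s q * \<omega> ^ k" and s: "\<And>q. s q \<ge> 0"
  shows "\<omega> ^ (2 * k) * A\<^sup>2 / 2 - K\<^sup>2 * 2 ^ k * (\<Sum>q\<leftarrow>L. (s q)\<^sup>2 * (W q)\<^sup>2) \<le> A * (\<omega> ^ (2 * k) * A + (\<Sum>q\<leftarrow>L. P q * W q))"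
proof -
  define z where "z = \<omega> ^ (2 * k) * A\<^sup>2"
  have z0: "z \<ge> 0" unfolding z_def using w by simp
  have one: "- (z / (2 * 2 ^ k) + K\<^sup>2 * 2 ^ k * ((s q)\<^sup>2 * (W q)\<^sup>2)) \<le> A * (P q * W q)" if q: "q \<in> set L" for q
  proof -
    define X where "X = \<omega> ^ k * \<bar>A\<bar>"
    define Y where "Y = K * s q * \<bar>W q\<bar>"
    have XY: "X \<ge> 0" "Y \<ge> 0" unfolding X_def Y_def using w K s by auto
    have "\<bar>A * (P q * W q)\<bar> = \<bar>P q\<bar> * (\<bar>A\<bar> * \<bar>W q\<bar>)" by (simp add: abs_mult)
    also have "\<dots> \<le> (K * s q * \<omega> ^ k) * (\<bar>A\<bar> * \<bar>W q\<bar>)" using P[OF q] by (intro mult_right_mono) auto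
    also have "\<dots> = X * Y" by (simp add: X_def Y_def)
    also have "\<dots> \<le> X\<^sup>2 / (2 * 2 ^ k) + 2 ^ k * Y\<^sup>2"
    proof -
      \<comment> \<open>The second square is added to obtain the slightly weaker but simpler
        coefficient 2^k of Y^2.\<close>
      have "0 \<le> (X - 2 ^ k * Y)\<^sup>2 + (2 ^ k * Y)\<^sup>2" by simp
      then have "2 * 2 ^ k * (X * Y) \<le> X\<^sup>2 + 2 * 2 ^ k * (2 ^ k * Y\<^sup>2)" by (simp add: power2_eq_square algebra_simps)
      then have "X * Y \<le> (X\<^sup>2 + 2 * 2 ^ k * (2 ^ k * Y\<^sup>2)) / (2 * 2 ^ k)" by (simp add: pos_le_divide_eq mult_ac)
      then show ?thesis by (simp add: add_divide_distrib)
    qed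
    also have "X\<^sup>2 = z" unfolding X_def z_def by (simp add: power_mult_distrib power_even_eq)
    also have "2 ^ k * Y\<^sup>2 = K\<^sup>2 * 2 ^ k * ((s q)\<^sup>2 * (W q)\<^sup>2)" unfolding Y_def by (simp add: power_mult_distrib)
    finally show ?thesis by linarith
  qed
  have "- (length L * (z / (2 * 2 ^ k)) + K\<^sup>2 * 2 ^ k * (\<Sum>q\<leftarrow>L. (s q)\<^sup>2 * (W q)\<^sup>2)) \<le> A * (\<Sum>q\<leftarrow>L. P q * W q)"
    using one
  proof (induction L)
    case (Cons q L)
    have "- (length L * (z / (2 * 2 ^ k)) + K\<^sup>2 * 2 ^ k * (\<Sum>q\<leftarrow>L. (s q)\<^sup>2 * (W q)\<^sup>2)) \<le> A * (\<Sum>q\<leftarrow>L. P q * W q)"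
      using Cons by auto
    moreover have "- (z / (2 * 2 ^ k) + K\<^sup>2 * 2 ^ k * ((s q)\<^sup>2 * (W q)\<^sup>2)) \<le> A * (P q * W q)" using Cons.prems by simp
    moreover have "length (q # L) * (z / (2 * 2 ^ k)) = z / (2 * 2 ^ k) + length L * (z / (2 * 2 ^ k))"
      by (simp add: distrib_right add_divide_distrib)
    moreover have "K\<^sup>2 * 2 ^ k * (\<Sum>q\<leftarrow>q # L. (s q)\<^sup>2 * (W q)\<^sup>2) = K\<^sup>2 * 2 ^ k * ((s q)\<^sup>2 * (W q)\<^sup>2) + K\<^sup>2 * 2 ^ k * (\<Sum>q\<leftarrow>L. (s q)\<^sup>2 * (W q)\<^sup>2)"
      by (simp add: distrib_left)
    moreover have "A * (\<Sum>q\<leftarrow>q # L. P q * W q) = A * (P q * W q) + A * (\<Sum>q\<leftarrow>L. P q * W q)"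
      by (simp add: distrib_left)
    ultimately show ?case by linarith
  qed simp
  moreover have "length L * (z / (2 * 2 ^ k)) \<le> 2 ^ k * (z / (2 * 2 ^ k))"
    using len z0 by (intro mult_right_mono) (auto simp: of_nat_le_iff[of _ "2 ^ k", where 'a=real, simplified])
  moreover have "2 ^ k * (z / (2 * 2 ^ k)) = z / 2" by simp
  moreover have "A * (\<omega> ^ (2 * k) * A + (\<Sum>q\<leftarrow>L. P q * W q)) = z + A * (\<Sum>q\<leftarrow>L. P q * W q)"
    by (simp add: z_def power2_eq_square distrib_left mult_ac)
  ultimately show ?thesis unfolding z_def[symmetric] by linarith
qed

text \<open>The integrated form of \<open>absorb_pointwise\<close> for one derivative, with the test
  function \<omega>^(2k) u: a lower bound of its contribution to the bilinear form by the principal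
  energy minus lower-order energies.\<close>

lemma energy_absorb:
  fixes u \<omega> :: "'d::finite fn"
  assumes u: "u \<in> Vsp k kmin" and k: "kmin \<le> k" and l: "length is \<le> k"
    and e: "csmooth r (\<lambda>x. \<omega> x ^ (2 * k))" and w: "\<And>x. 0 \<le> \<omega> x" and K: "K \<ge> 0" and s: "s \<ge> 0"
    and b: "\<And>a x. length a \<le> k \<Longrightarrow> \<bar>pd_list a (\<lambda>x. \<omega> x ^ (2 * k)) x\<bar> \<le> K * s ^ length a * \<omega> x ^ k"
    and S: "closed S" "S \<subseteq> cball 0 R" and z: "\<And>x. x \<notin> S \<Longrightarrow> \<omega> x ^ (2 * k) = 0"
  shows "(\<integral>x. indicator S x * (\<omega> x ^ (2 * k) * (wd (count_list is) u x)\<^sup>2) \<partial>lborel) / 2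
     - K\<^sup>2 * 2 ^ k * (\<Sum>q\<leftarrow>proper_splits is. (s ^ length (fst q))\<^sup>2 * wd_energy (count_list (snd q)) S u)
    \<le> (\<integral>x. wd (count_list is) u x * wd (count_list is) (\<lambda>x. \<omega> x ^ (2 * k) * u x) x \<partial>lborel)"
proof -
  let ?\<zeta> = "\<lambda>x. \<omega> x ^ (2 * k)" and ?A = "wd (count_list is) u" and ?L = "proper_splits is"
  let ?W = "\<lambda>q. wd (count_list (snd q)) u"
  have lenq: "length (fst q) \<le> k" "length (snd q) \<le> k" if "q \<in> set ?L" for q
    using proper_splits_length[of "fst q" "snd q" "is"] that l by auto
  have Sb: "S \<in> sets borel" using S by simp
  have A: "L2loc ?A" by (rule Vsp_approx(2)[OF u k l])
  have Wq: "L2loc (?W q)" if "q \<in> set ?L" for q by (rule Vsp_approx(2)[OF u k lenq(2)[OF that]])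
  note G = leibniz_approx(1)[OF u k l e]
  let ?H = "\<lambda>x. indicator S x * (?A x * leibniz is ?\<zeta> u x)"
  have iH: "integrable lborel ?H" by (rule L2loc_prod_integrable[OF A G Sb S(2)])
  have "integrable lborel (\<lambda>x. indicator S x * (?A x * (?\<zeta> x * ?A x)))"
    by (rule L2loc_prod_integrable[OF A L2loc_mult[OF A e] Sb S(2)])
  moreover have "indicator S x * (?A x * (?\<zeta> x * ?A x)) = indicator S x * (?\<zeta> x * (?A x)\<^sup>2)" for x
    by (simp add: power2_eq_square mult_ac)
  ultimately have i1: "integrable lborel (\<lambda>x. indicator S x * (?\<zeta> x * (?A x)\<^sup>2))" by simp
  let ?E = "\<lambda>q x. (s ^ length (fst q))\<^sup>2 * (indicator S x * (?W q x)\<^sup>2)"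
  have iq: "integrable lborel (?E q)" if "q \<in> set ?L" for q
    by (intro integrable_mult_right L2loc_square_integrable[OF Wq[OF that] Sb S(2)])
  note sl = integral_sum_list[of ?L lborel ?E, OF iq]
  let ?h = "\<lambda>x. indicator S x * (?\<zeta> x * (?A x)\<^sup>2) / 2 - K\<^sup>2 * 2 ^ k * (\<Sum>q\<leftarrow>?L. ?E q x)"
  have "(\<integral>x. ?h x \<partial>lborel) \<le> (\<integral>x. ?H x \<partial>lborel)"
  proof (rule integral_mono)
    show "integrable lborel ?h" using i1 sl by (intro Bochner_Integration.integrable_diff integrable_mult_right integrable_divide) auto
    show "?h x \<le> ?H x" for x
    proof (cases "x \<in> S")
      case True
      have len: "length ?L \<le> 2 ^ k"
        using length_proper_splits[of "is"] power_increasing[OF l, of "2::nat"] by linarith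
      have "leibniz is ?\<zeta> u x = ?\<zeta> x * ?A x + (\<Sum>q\<leftarrow>?L. pd_list (fst q) ?\<zeta> x * ?W q x)"
        unfolding leibniz_def using sum_list_splits[of "\<lambda>q. pd_list (fst q) ?\<zeta> x * ?W q x" "is"] by (simp add: split_def)
      moreover have "?\<zeta> x * (?A x)\<^sup>2 / 2 - K\<^sup>2 * 2 ^ k * (\<Sum>q\<leftarrow>?L. (s ^ length (fst q))\<^sup>2 * (?W q x)\<^sup>2) \<le> ?A x * (?\<zeta> x * ?A x + (\<Sum>q\<leftarrow>?L. pd_list (fst q) ?\<zeta> x * ?W q x))"
        by (rule absorb_pointwise[OF w K len]) (use b lenq s in auto)
      ultimately show ?thesis using True by simp
    qed simp
  qed (rule iH)
  also have "(\<integral>x. ?h x \<partial>lborel) = (\<integral>x. indicator S x * (?\<zeta> x * (?A x)\<^sup>2) \<partial>lborel) / 2 - K\<^sup>2 * 2 ^ k * (\<Sum>q\<leftarrow>?L. \<integral>x. ?E q x \<partial>lborel)"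
    using i1 sl by (subst Bochner_Integration.integral_diff) auto
  also have "(\<Sum>q\<leftarrow>?L. \<integral>x. ?E q x \<partial>lborel) = (\<Sum>q\<leftarrow>?L. (s ^ length (fst q))\<^sup>2 * wd_energy (count_list (snd q)) S u)"
    unfolding wd_energy_def by simp
  \<comment> \<open>Localisation to \<open>S\<close> loses nothing: the cutoff vanishes on the open
    complement of the closed set \<open>S\<close>, and so do all its derivatives there.\<close>
  also have "(\<integral>x. ?H x \<partial>lborel) = (\<integral>x. ?A x * wd (count_list is) (\<lambda>x. ?\<zeta> x * u x) x \<partial>lborel)"
  proof (rule integral_cong_AE)
    have v: "weak_deriv (count_list is) (\<lambda>x. ?\<zeta> x * u x) (wd (count_list is) (\<lambda>x. ?\<zeta> x * u x))"
      by (rule Vsp_approx(1)[OF Vsp_mult[OF u k e] k l])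
    note [measurable] = L2loc_measurable[OF A] L2loc_measurable[OF Vsp_approx(2)[OF Vsp_mult[OF u k e] k l]]
    show "?H \<in> borel_measurable lborel" using iH by simp
    show "(\<lambda>x. ?A x * wd (count_list is) (\<lambda>x. ?\<zeta> x * u x) x) \<in> borel_measurable lborel" by measurable
    show "AE x in lborel. ?H x = ?A x * wd (count_list is) (\<lambda>x. ?\<zeta> x * u x) x"
      using wd_mult[OF u k l e]
    proof eventually_elim
      case (elim x)
      have "leibniz is ?\<zeta> u x = 0" if "x \<notin> S"
        by (rule leibniz_eq_0[where U="- S"]) (use that z S(1) in auto)
      then show ?case using elim by (cases "x \<in> S") auto
    qed
  qed
  finally show ?thesis .
qed

lemma enlarge_simps: "x \<in> enlarge a b \<delta> \<longleftrightarrow> (\<forall>i. a $ i - \<delta> < x $ i \<and> x $ i < b $ i + \<delta>)"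
  unfolding enlarge_def mem_box_cart by simp

lemma box_in_cball: obtains R where "enlarge a b \<delta> \<subseteq> cball 0 R"
  using bounded_box[of "a - (\<chi> i. \<delta>)" "b + (\<chi> i. \<delta>)"] unfolding enlarge_def bounded_iff by (auto simp: subset_iff)

lemma sum_list_le_const:
  fixes f :: "'a \<Rightarrow> real" and B :: real
  assumes "\<And>q. q \<in> set L \<Longrightarrow> f q \<le> B" shows "(\<Sum>q\<leftarrow>L. f q) \<le> length L * B"
  using assms by (induction L) (auto simp: distrib_right intro!: add_mono)

text \<open>Two enlargements occur: harmonicity is assumed on the one by \<delta>, but the
  right-hand side needs only the one by \<delta>/2. The remaining gap of \<delta>/2 leaves room for
  the grid cubes in \<open>coarsening_operator\<close>.\<close>

theorem caccioppoli:
  fixes k kmin :: nat and \<sigma> :: "nat \<Rightarrow> real"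
  assumes k0: "k > 0" and k: "kmin \<le> k" and \<sigma>: "\<forall>l. kmin \<le> l \<and> l \<le> k \<longrightarrow> \<sigma> l \<ge> 0" and \<sigma>k: "\<sigma> k > 0" and db: "\<delta>bar > 0"
  shows "\<exists>C\<ge>0. \<forall>N x a b \<delta>. \<forall>u :: 'd::finite fn. 0 < \<delta> \<longrightarrow> \<delta> \<le> \<delta>bar \<longrightarrow> u \<in> Vharm k kmin \<sigma> N x (enlarge a b \<delta>) \<longrightarrow>
    \<delta> ^ (2 * k) * (hsemi k (box a b) u)\<^sup>2 \<le> C * (\<Sum>j<k. \<delta> ^ (2 * j) * (hsemi j (enlarge a b (\<delta> / 2)) u)\<^sup>2)"
proof -
  obtain C0 where C0: "C0 \<ge> 1" and cut: "\<forall>(a::real^'d) b \<delta>. \<delta> > 0 \<longrightarrow> (\<exists>\<omega> r. csmooth r \<omega> \<and> (\<forall>x. 0 \<le> \<omega> x \<and> \<omega> x \<le> 1) \<and>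
     (\<forall>x\<in>box a b. \<omega> x = 1) \<and> (\<forall>x. x \<notin> cbox (a - (\<chi> i. 3 * \<delta> / 8)) (b + (\<chi> i. 3 * \<delta> / 8)) \<longrightarrow> \<omega> x = 0) \<and>
     (\<forall>is x. length is \<le> k \<longrightarrow> \<bar>pd_list is \<omega> x\<bar> \<le> C0 * inverse \<delta> ^ length is))"
    using cutoff_exists[of k, where 'd='d] by blast
  obtain K where K: "K \<ge> 0" and pw: "\<forall>\<omega> :: 'd fn. \<forall>D\<ge>0. smooth \<omega> \<longrightarrow> (\<forall>x. 0 \<le> \<omega> x \<and> \<omega> x \<le> 1) \<longrightarrow>
     (\<forall>is x. length is \<le> k \<longrightarrow> \<bar>pd_list is \<omega> x\<bar> \<le> C0 * D ^ length is) \<longrightarrow>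
     (\<forall>is x. length is \<le> k \<longrightarrow> \<bar>pd_list is (\<lambda>x. \<omega> x ^ (2 * k)) x\<bar> \<le> K * D ^ length is * \<omega> x ^ (2 * k - length is))"
    using pd_list_power_bound[OF C0, of k "2 * k"] by (elim exE conjE)
  define F where "F = weight_bound TYPE('d) k"
  \<comment> \<open>\<open>M\<close> bounds the surplus powers of \<delta> left over from terms of
    the form whose order is below \<open>k\<close>.\<close>
  define M where "M = max 1 \<delta>bar ^ (2 * k)"
  define W where "W = (\<Sum>l\<in>{kmin..k}. \<sigma> l * (\<Sum>\<alpha>\<in>{\<alpha>::'d \<Rightarrow> nat. mi_order \<alpha> = l}. mi_weight \<alpha>))"
  define C where "C = 2 / \<sigma> k * (W * (K\<^sup>2 * 2 ^ k * (2 ^ k * (M * F))))"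
  have F0: "F > 0" unfolding F_def by (rule weight_bound_pos)
  have M0: "M \<ge> 0" unfolding M_def by simp
  have W0: "W \<ge> 0" unfolding W_def using \<sigma>
    by (intro sum_nonneg mult_nonneg_nonneg less_imp_le[OF mi_weight_pos]) auto
  have CC: "C \<ge> 0" unfolding C_def using W0 M0 F0 \<sigma>k by simp
  show ?thesis
  proof (intro exI[of _ C] conjI allI impI CC)
    fix N x a b \<delta> and u :: "'d fn"
    assume d: "0 < \<delta>" "\<delta> \<le> \<delta>bar" and uH: "u \<in> Vharm k kmin \<sigma> N x (enlarge a b \<delta>)"
    have u: "u \<in> Vsp k kmin" using uH by (simp add: Vharm_def)
    let ?S = "cbox (a - (\<chi> i. 3 * \<delta> / 8)) (b + (\<chi> i. 3 * \<delta> / 8))" and ?B = "enlarge a b (\<delta> / 2)"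
    obtain \<omega> r where \<omega>: "csmooth r \<omega>" "\<forall>x. 0 \<le> \<omega> x \<and> \<omega> x \<le> 1" "\<forall>x\<in>box a b. \<omega> x = 1" "\<forall>x. x \<notin> ?S \<longrightarrow> \<omega> x = 0"
       "\<forall>is x. length is \<le> k \<longrightarrow> \<bar>pd_list is \<omega> x\<bar> \<le> C0 * inverse \<delta> ^ length is"
      using cut[THEN spec, THEN spec, THEN spec, THEN mp, OF d(1), of a b] by (elim exE conjE)
    let ?\<zeta> = "\<lambda>x. \<omega> x ^ (2 * k)" and ?s = "inverse \<delta>"
    have s0: "?s \<ge> 0" using d by simp
    have sm: "smooth \<omega>" using \<omega>(1) by (simp add: csmooth_def)
    have \<zeta>: "csmooth r ?\<zeta>" using \<omega>(1) k0 by (auto simp: csmooth_def intro!: smooth_power)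
    note pw1 = pw[THEN spec, THEN spec, THEN mp, THEN mp, THEN mp, THEN mp, THEN spec, THEN spec, THEN mp, OF s0 sm \<omega>(2) \<omega>(5)]
    have bnd: "\<bar>pd_list c ?\<zeta> y\<bar> \<le> K * ?s ^ length c * \<omega> y ^ k" if "length c \<le> k" for c y
    proof -
      have "\<bar>pd_list c ?\<zeta> y\<bar> \<le> K * ?s ^ length c * \<omega> y ^ (2 * k - length c)" by (rule pw1[OF that])
      also have "\<dots> \<le> K * ?s ^ length c * \<omega> y ^ k"
        using K s0 \<omega>(2) that by (intro mult_left_mono power_decreasing) auto
      finally show ?thesis .
    qed
    have SB: "?S \<subseteq> ?B" "?S \<subseteq> enlarge a b \<delta>"
    proof -
      have "y \<in> enlarge a b c" if y: "y \<in> ?S" and c: "3 * \<delta> / 8 < c" for y c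
        unfolding enlarge_simps
      proof
        fix i
        have "a $ i - 3 * \<delta> / 8 \<le> y $ i" "y $ i \<le> b $ i + 3 * \<delta> / 8"
          using y[unfolded mem_box_cart, rule_format, of i] by auto
        then show "a $ i - c < y $ i \<and> y $ i < b $ i + c" using c by linarith
      qed
      then show "?S \<subseteq> ?B" "?S \<subseteq> enlarge a b \<delta>" using d(1) by auto
    qed
    obtain R where R: "?B \<subseteq> cball 0 R" by (rule box_in_cball)
    have Bb: "?B \<in> sets borel" unfolding enlarge_def by simp
    have SR: "?S \<subseteq> cball 0 R" using SB(1) R by blast
    have z: "?\<zeta> y = 0" if "y \<notin> ?S" for y using \<omega>(4) that k0 by simp
    let ?v = "\<lambda>x. ?\<zeta> x * u x"
    \<comment> \<open>At a point inside the support of the cutoff, \<open>u\<close> vanishes because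
      it satisfies the point conditions on the enlarged box; at all other points the cutoff
      vanishes.\<close>
    have "?v \<in> V0 k kmin N x"
      unfolding V0_def
    proof (intro CollectI conjI allI impI)
      show "?v \<in> Vsp k kmin" by (rule Vsp_mult[OF u k \<zeta>])
      fix n assume "n < N"
      then show "?\<zeta> (x n) * u (x n) = 0"
        using uH z[of "x n"] SB(2) unfolding Vharm_def by (cases "x n \<in> ?S") auto
    qed
    moreover have "supp ?v \<subseteq> enlarge a b \<delta>"
    proof -
      have "{y. ?v y \<noteq> 0} \<subseteq> ?S" using z by fastforce
      then have "supp ?v \<subseteq> ?S" unfolding supp_def by (rule closure_minimal) (rule closed_cbox)
      then show ?thesis using SB(2) by blast
    qed
    ultimately have ab: "abil k kmin \<sigma> u ?v = 0" using uH unfolding Vharm_def by blast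
    define Z where "Z = (\<Sum>j<k. \<delta> ^ (2 * j) * (hsemi j ?B u)\<^sup>2)"
    have Z0: "Z \<ge> 0" unfolding Z_def using d by (intro sum_nonneg mult_nonneg_nonneg) auto
    define E where "E \<alpha> = (\<integral>x. indicator ?S x * (?\<zeta> x * (wd \<alpha> u x)\<^sup>2) \<partial>lborel)" for \<alpha>
    define T where "T \<alpha> = (\<integral>x. wd \<alpha> u x * wd \<alpha> ?v x \<partial>lborel)" for \<alpha>
    define \<rho> where "\<rho> \<alpha> = (\<Sum>q\<leftarrow>proper_splits (mi_list \<alpha>). (?s ^ length (fst q))\<^sup>2 * wd_energy (count_list (snd q)) ?S u)" for \<alpha>
    have E0: "E \<alpha> \<ge> 0" for \<alpha> unfolding E_def using \<omega>(2) by (intro Bochner_Integration.integral_nonneg) simp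
    have TE: "E \<alpha> / 2 - K\<^sup>2 * 2 ^ k * \<rho> \<alpha> \<le> T \<alpha>" if "mi_order \<alpha> \<le> k" for \<alpha>
    proof -
      have l: "length (mi_list \<alpha>) \<le> k" using that by (simp add: length_mi_list)
      have w: "0 \<le> \<omega> y" for y using \<omega>(2) by simp
      show ?thesis
        using energy_absorb[OF u k l \<zeta> w K s0 bnd closed_cbox SR z] unfolding E_def T_def \<rho>_def count_mi_list by simp
    qed
    have \<rho>: "\<delta> ^ (2 * k) * \<rho> \<alpha> \<le> 2 ^ k * (M * F * Z)" if \<alpha>: "mi_order \<alpha> \<le> k" for \<alpha>
    proof -
      let ?L = "proper_splits (mi_list \<alpha>)"
      have l: "length (mi_list \<alpha>) \<le> k" using \<alpha> by (simp add: length_mi_list)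
      have term_le: "\<delta> ^ (2 * k) * ((?s ^ length (fst q))\<^sup>2 * wd_energy (count_list (snd q)) ?S u) \<le> M * F * Z" if q: "q \<in> set ?L" for q
      proof -
        let ?m = "length (fst q)" and ?j = "length (snd q)"
        have len: "?m + ?j = length (mi_list \<alpha>)" "fst q \<noteq> []"
          using proper_splits_length[of "fst q" "snd q" "mi_list \<alpha>"] q by auto
        then have jk: "?j < k" "?m + ?j \<le> k" using l by (cases "fst q"; simp)+
        let ?n = "k - (?m + ?j)"
        \<comment> \<open>The 2k powers are split three ways: 2 ?m of them cancel the cutoff
          derivatives, 2 ?j become the weight of the seminorm of order ?j, and the surplus 2 ?n is
          bounded by \<open>M\<close>. Since \<open>fst q\<close> is nonempty, ?j < k, so only
          seminorms below order \<open>k\<close> appear.\<close>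
        have "\<delta> ^ (2 * k) = \<delta> ^ (2 * ?n) * \<delta> ^ (2 * ?j) * \<delta> ^ (2 * ?m)"
          using jk by (simp flip: power_add) (simp add: algebra_simps)
        then have "\<delta> ^ (2 * k) * (?s ^ ?m)\<^sup>2 = \<delta> ^ (2 * ?n) * \<delta> ^ (2 * ?j) * (\<delta> ^ (2 * ?m) * ?s ^ (2 * ?m))"
          by (simp add: power_even_eq)
        also have "\<delta> ^ (2 * ?m) * ?s ^ (2 * ?m) = 1" using d(1) by (simp add: power_inverse)
        finally have 1: "\<delta> ^ (2 * k) * (?s ^ ?m)\<^sup>2 = \<delta> ^ (2 * ?n) * \<delta> ^ (2 * ?j)" by simp
        have "\<delta> ^ (2 * ?n) \<le> max 1 \<delta>bar ^ (2 * ?n)" using d by (intro power_mono) auto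
        also have "\<dots> \<le> M" unfolding M_def by (intro power_increasing) auto
        finally have 2: "\<delta> ^ (2 * ?n) \<le> M" .
        have o: "mi_order (count_list (snd q)) = ?j" by (rule mi_order_count)
        have "wd_energy (count_list (snd q)) ?S u \<le> wd_energy (count_list (snd q)) ?B u"
          using jk o by (intro wd_energy_mono[OF u k _ SB(1) _ Bb R]) auto
        also have "\<dots> \<le> F * (hsemi ?j ?B u)\<^sup>2"
          using wd_energy_le_hsemi[of "count_list (snd q)" k ?B u] jk unfolding F_def o by simp
        finally have 3: "wd_energy (count_list (snd q)) ?S u \<le> F * (hsemi ?j ?B u)\<^sup>2" .
        have "\<delta> ^ (2 * k) * ((?s ^ ?m)\<^sup>2 * wd_energy (count_list (snd q)) ?S u) = \<delta> ^ (2 * ?n) * (\<delta> ^ (2 * ?j) * wd_energy (count_list (snd q)) ?S u)"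
          unfolding mult.assoc[symmetric] 1 ..
        also have "\<dots> \<le> M * (\<delta> ^ (2 * ?j) * (F * (hsemi ?j ?B u)\<^sup>2))"
          using 2 3 d M0 wd_energy_nonneg by (intro mult_mono mult_left_mono) auto
        also have "\<dots> = M * F * (\<delta> ^ (2 * ?j) * (hsemi ?j ?B u)\<^sup>2)" by simp
        also have "\<dots> \<le> M * F * Z"
          unfolding Z_def using jk M0 F0 d
          by (intro mult_left_mono member_le_sum[where f="\<lambda>j. \<delta> ^ (2 * j) * (hsemi j ?B u)\<^sup>2"]) auto
        finally show ?thesis .
      qed
      have "\<delta> ^ (2 * k) * \<rho> \<alpha> = (\<Sum>q\<leftarrow>?L. \<delta> ^ (2 * k) * ((?s ^ length (fst q))\<^sup>2 * wd_energy (count_list (snd q)) ?S u))"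
        unfolding \<rho>_def by (simp add: sum_list_const_mult)
      also have "\<dots> \<le> length ?L * (M * F * Z)" by (intro sum_list_le_const term_le)
      also have "\<dots> \<le> 2 ^ k * (M * F * Z)"
      proof (rule mult_right_mono)
        have "length ?L \<le> 2 ^ k" using length_proper_splits[of "mi_list \<alpha>"] power_increasing[OF l, of "2::nat"] by linarith
        then show "real (length ?L) \<le> 2 ^ k" by (metis of_nat_le_iff of_nat_numeral of_nat_power)
      qed (use M0 F0 Z0 in simp)
      finally show ?thesis .
    qed
    have "0 = (\<Sum>l\<in>{kmin..k}. \<sigma> l * (\<Sum>\<alpha>\<in>{\<alpha>::'d \<Rightarrow> nat. mi_order \<alpha> = l}. mi_weight \<alpha> * T \<alpha>))"
      using ab unfolding abil_def T_def mi_weight_def by simp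
    also have "\<dots> \<ge> (\<Sum>l\<in>{kmin..k}. \<sigma> l * (\<Sum>\<alpha>\<in>{\<alpha>::'d \<Rightarrow> nat. mi_order \<alpha> = l}. mi_weight \<alpha> * (E \<alpha> / 2 - K\<^sup>2 * 2 ^ k * \<rho> \<alpha>)))"
      using \<sigma> TE by (intro sum_mono mult_left_mono less_imp_le[OF mi_weight_pos]) auto
    finally have le0: "(\<Sum>l\<in>{kmin..k}. \<sigma> l * (\<Sum>\<alpha>\<in>{\<alpha>::'d \<Rightarrow> nat. mi_order \<alpha> = l}. mi_weight \<alpha> * (E \<alpha> / 2)))
       \<le> (\<Sum>l\<in>{kmin..k}. \<sigma> l * (\<Sum>\<alpha>\<in>{\<alpha>::'d \<Rightarrow> nat. mi_order \<alpha> = l}. mi_weight \<alpha> * (K\<^sup>2 * 2 ^ k * \<rho> \<alpha>)))"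
      by (simp add: right_diff_distrib sum_subtractf)
    have "\<sigma> k / 2 * (\<delta> ^ (2 * k) * (hsemi k (box a b) u)\<^sup>2) \<le> \<delta> ^ (2 * k) * (\<sigma> k * (\<Sum>\<alpha>\<in>{\<alpha>::'d \<Rightarrow> nat. mi_order \<alpha> = k}. mi_weight \<alpha> * (E \<alpha> / 2)))"
    proof -
      have "wd_energy \<alpha> (box a b) u \<le> E \<alpha>" if \<alpha>: "mi_order \<alpha> = k" for \<alpha>
        unfolding wd_energy_def E_def
      proof (rule integral_mono)
        have A: "L2loc (wd \<alpha> u)" using \<alpha> by (intro Vsp_wd_L2loc[OF u k]) simp
        have sub: "box a b \<subseteq> ?S"
        proof
          fix y assume y: "y \<in> box a b"
          show "y \<in> ?S" unfolding mem_box_cart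
          proof
            fix i show "(a - (\<chi> i. 3 * \<delta> / 8)) $ i \<le> y $ i \<and> y $ i \<le> (b + (\<chi> i. 3 * \<delta> / 8)) $ i"
              using y[unfolded mem_box_cart, rule_format, of i] d(1) by simp
          qed
        qed
        then have "box a b \<subseteq> cball 0 R" using SR by blast
        then show "integrable lborel (\<lambda>x. indicator (box a b) x * (wd \<alpha> u x)\<^sup>2)" by (intro L2loc_square_integrable[OF A]) auto
        have "integrable lborel (\<lambda>x. indicator ?S x * (wd \<alpha> u x * (?\<zeta> x * wd \<alpha> u x)))"
          by (rule L2loc_prod_integrable[OF A L2loc_mult[OF A \<zeta>] _ SR]) simp
        moreover have "indicator ?S x * (wd \<alpha> u x * (?\<zeta> x * wd \<alpha> u x)) = indicator ?S x * (?\<zeta> x * (wd \<alpha> u x)\<^sup>2)" for x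
          by (simp add: power2_eq_square mult_ac)
        ultimately show "integrable lborel (\<lambda>x. indicator ?S x * (?\<zeta> x * (wd \<alpha> u x)\<^sup>2))" by simp
        show "indicator (box a b) y * (wd \<alpha> u y)\<^sup>2 \<le> indicator ?S y * (?\<zeta> y * (wd \<alpha> u y)\<^sup>2)" for y
          using sub \<omega>(2,3) by (cases "y \<in> box a b") (auto simp: indicator_def)
      qed
      then have "(hsemi k (box a b) u)\<^sup>2 \<le> (\<Sum>\<alpha>\<in>{\<alpha>::'d \<Rightarrow> nat. mi_order \<alpha> = k}. mi_weight \<alpha> * E \<alpha>)"
        unfolding hsemi_square by (intro sum_mono mult_left_mono less_imp_le[OF mi_weight_pos]) auto
      then have "\<sigma> k / 2 * \<delta> ^ (2 * k) * (hsemi k (box a b) u)\<^sup>2 \<le> \<sigma> k / 2 * \<delta> ^ (2 * k) * (\<Sum>\<alpha>\<in>{\<alpha>::'d \<Rightarrow> nat. mi_order \<alpha> = k}. mi_weight \<alpha> * E \<alpha>)"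
        using \<sigma>k d by (intro mult_left_mono) auto
      then show ?thesis by (simp add: sum_divide_distrib[symmetric] mult_ac)
    qed
    \<comment> \<open>All terms of the sum over \<open>l\<close> are nonnegative, so the term of
      order \<open>k\<close> alone is at most the whole.\<close>
    also have "\<dots> \<le> \<delta> ^ (2 * k) * (\<Sum>l\<in>{kmin..k}. \<sigma> l * (\<Sum>\<alpha>\<in>{\<alpha>::'d \<Rightarrow> nat. mi_order \<alpha> = l}. mi_weight \<alpha> * (E \<alpha> / 2)))"
      using k d \<sigma> E0
      by (intro mult_left_mono member_le_sum[where f="\<lambda>l. \<sigma> l * (\<Sum>\<alpha>\<in>{\<alpha>::'d \<Rightarrow> nat. mi_order \<alpha> = l}. mi_weight \<alpha> * (E \<alpha> / 2))"]
            mult_nonneg_nonneg sum_nonneg less_imp_le[OF mi_weight_pos]) auto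
    also have "\<dots> \<le> \<delta> ^ (2 * k) * (\<Sum>l\<in>{kmin..k}. \<sigma> l * (\<Sum>\<alpha>\<in>{\<alpha>::'d \<Rightarrow> nat. mi_order \<alpha> = l}. mi_weight \<alpha> * (K\<^sup>2 * 2 ^ k * \<rho> \<alpha>)))"
      using le0 d by (intro mult_left_mono) auto
    also have "\<dots> = (\<Sum>l\<in>{kmin..k}. \<sigma> l * (\<Sum>\<alpha>\<in>{\<alpha>::'d \<Rightarrow> nat. mi_order \<alpha> = l}. mi_weight \<alpha> * (K\<^sup>2 * 2 ^ k * (\<delta> ^ (2 * k) * \<rho> \<alpha>))))"
      by (simp add: sum_distrib_left mult_ac)
    also have "\<dots> \<le> (\<Sum>l\<in>{kmin..k}. \<sigma> l * (\<Sum>\<alpha>\<in>{\<alpha>::'d \<Rightarrow> nat. mi_order \<alpha> = l}. mi_weight \<alpha> * (K\<^sup>2 * 2 ^ k * (2 ^ k * (M * F * Z)))))"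
      using \<sigma> \<rho> by (intro sum_mono mult_left_mono less_imp_le[OF mi_weight_pos]) auto
    also have "\<dots> = W * (K\<^sup>2 * 2 ^ k * (2 ^ k * (M * F))) * Z"
      unfolding W_def sum_distrib_right by (simp add: sum_distrib_left sum_distrib_right mult_ac)
    finally have "2 / \<sigma> k * (\<sigma> k / 2 * (\<delta> ^ (2 * k) * (hsemi k (box a b) u)\<^sup>2)) \<le> 2 / \<sigma> k * (W * (K\<^sup>2 * 2 ^ k * (2 ^ k * (M * F))) * Z)"
      using \<sigma>k by (intro mult_left_mono) auto
    then show "\<delta> ^ (2 * k) * (hsemi k (box a b) u)\<^sup>2 \<le> C * (\<Sum>j<k. \<delta> ^ (2 * j) * (hsemi j ?B u)\<^sup>2)"
      unfolding Z_def[symmetric] C_def using \<sigma>k by (simp add: mult.assoc)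
  qed
qed

section \<open>The Poincare inequality in V\<close>

lemma sqn_eq_integral:
  fixes f :: "'d::finite fn"
  assumes f: "L2loc f" and S: "S \<in> sets borel" "S \<subseteq> cball 0 R"
  shows "sqn S f = ennreal (\<integral>x. indicator S x * (f x)\<^sup>2 \<partial>lborel)"
proof -
  have "sqn S f = (\<integral>\<^sup>+x. ennreal (indicator S x * (f x)\<^sup>2) \<partial>lborel)"
    unfolding sqn_def by (intro nn_integral_cong) (auto simp: indicator_def)
  also have "\<dots> = ennreal (\<integral>x. indicator S x * (f x)\<^sup>2 \<partial>lborel)"
    by (rule nn_integral_eq_integral[OF L2loc_square_integrable[OF f S]]) simp
  finally show ?thesis .
qed

text \<open>The limit of \<open>poincare_smooth\<close> along the mollifications of
  \<open>u\<close>. Since \<psi> is the normalised indicator of \<open>S\<close>, the mean over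
  \<open>S\<close> appears and the constant depends on the diameter bound \<open>D\<close> and the
  dimension only.\<close>

lemma poincare_wd:
  fixes u :: "'d::finite fn"
  assumes u: "u \<in> Vsp k kmin" and k: "kmin \<le> k" and \<alpha>: "mi_order \<alpha> < k"
    and S: "S \<in> sets borel" "S \<subseteq> cball 0 R" "convex S"
    and D: "\<And>x y. x \<in> S \<Longrightarrow> y \<in> S \<Longrightarrow> norm (x - y) \<le> D" and m: "measure lborel S > 0"
  shows "wd_energy \<alpha> S u \<le> 4 * ((\<integral>x. indicator S x * wd \<alpha> u x \<partial>lborel)\<^sup>2 / measure lborel S)
     + 8 * 2 ^ CARD('d) * D\<^sup>2 * (\<Sum>i\<in>UNIV. wd_energy (\<alpha>(i := Suc (\<alpha> i))) S u)"
proof -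
  define m where "m = measure lborel S"
  have m0: "m > 0" using m by (simp add: m_def)
  let ?is = "mi_list \<alpha>"
  have li: "loc_int u" by (rule continuous_loc_int[OF Vsp_continuous[OF u]])
  have sm: "smooth (conv u (moll n))" for n by (rule smooth_conv[OF li moll_csmooth])
  have cnt: "count_list ?is = \<alpha>" by (rule count_mi_list)
  have cnti: "count_list (i # ?is) = \<alpha>(i := Suc (\<alpha> i))" for i using cnt by auto
  have len: "length ?is \<le> k" "length (i # ?is) \<le> k" for i using \<alpha> by (auto simp: length_mi_list)
  let ?W = "wd \<alpha> u" and ?g = "\<lambda>i. wd (\<alpha>(i := Suc (\<alpha> i))) u"
  define w where "w n = pd_list ?is (conv u (moll n))" for n
  note A = Vsp_approx(2,3)[OF u k len(1), unfolded cnt] Vsp_approx(2,3)[OF u k len(2), unfolded cnti]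
  have sw: "smooth (w n)" for n unfolding w_def by (rule smooth_pd_list[OF sm])
  have cw: "cpd i (w n) = pd_list (i # ?is) (conv u (moll n))" for i n unfolding w_def by simp
  note [measurable] = L2loc_measurable[OF A(1)] L2loc_measurable[OF A(3)] smooth_measurable[OF sw] smooth_measurable[OF smooth_cpd[OF sw]] S(1)
  \<comment> \<open>Its maximum 1 / m cancels the volume of \<open>S\<close> in
    \<open>poincare_smooth\<close>.\<close>
  let ?\<psi> = "\<lambda>x. indicator S x / m"
  define c where "c n = (\<integral>x. w n x * ?\<psi> x \<partial>lborel)" for n
  define c0 where "c0 = (\<integral>x. ?W x * ?\<psi> x \<partial>lborel)"
  have z: "?\<psi> x = 0" if "norm x > R" for x using that S(2) by (auto simp: indicator_def)
  have "c \<longlonglongrightarrow> c0"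
    unfolding c_def c0_def
  proof (rule L2conv_pairing[OF smooth_L2loc[OF sw] A(1)])
    show "L2conv w ?W" using A(2) unfolding w_def .
    show "\<bar>?\<psi> x\<bar> \<le> 1 / m" for x using m0 by (simp add: indicator_def)
  qed (use z in auto)
  have fS: "emeasure lborel S < \<infinity>"
    using le_less_trans[OF emeasure_mono[OF S(2)] emeasure_lborel_cball_finite] by simp
  have em: "emeasure lborel S = ennreal m" unfolding m_def using fS by (simp add: emeasure_eq_ennreal_measure)
  \<comment> \<open>The outermost factor 2 and the factor 2 inside the sum come from replacing the
    mollified functions by their limits plus the errors \<open>e\<close> and \<open>ei\<close>,
    which tend to 0.\<close>
  let ?RHS = "\<lambda>e c ei. 2 * (2 * (ennreal m * ennreal (c\<^sup>2)) + 2 * (ennreal (1 / m * D\<^sup>2) * (ennreal m * (2 ^ CARD('d) * (\<Sum>i\<in>(UNIV::'d set). 2 * (sqn S (?g i) + ei i))))) + e)"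
  have bound: "sqn S ?W \<le> ?RHS (sqn S (\<lambda>x. w n x - ?W x)) (c n) (\<lambda>i. sqn S (\<lambda>x. cpd i (w n) x - ?g i x))" for n
  proof -
    have "sqn S (w n) \<le> 2 * (ennreal ((\<integral>x. w n x * ?\<psi> x \<partial>lborel)\<^sup>2) * emeasure lborel S)
      + 2 * (ennreal (1 / m * D\<^sup>2) * (emeasure lborel S * (2 ^ CARD('d) * (\<Sum>i\<in>UNIV. sqn S (cpd i (w n))))))"
    proof (rule poincare_smooth[OF sw S(1,3,2) D])
      have "(\<integral>x. ?\<psi> x \<partial>lborel) = (\<integral>x. indicator S x \<partial>lborel) / m" by simp
      also have "\<dots> = 1" using m0 by (simp add: m_def)
      finally show "(\<integral>x. ?\<psi> x \<partial>lborel) = 1" .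
    qed (use m0 in \<open>auto simp: indicator_def\<close>)
    also have "\<dots> \<le> 2 * (ennreal m * ennreal ((c n)\<^sup>2)) + 2 * (ennreal (1 / m * D\<^sup>2) * (ennreal m * (2 ^ CARD('d) * (\<Sum>i\<in>UNIV. 2 * (sqn S (?g i) + sqn S (\<lambda>x. cpd i (w n) x - ?g i x))))))"
      unfolding em c_def[symmetric] mult.commute[of "ennreal ((c n)\<^sup>2)"]
    proof (intro add_mono mult_left_mono sum_mono order_refl)
      fix i
      have "sqn S (cpd i (w n)) = sqn S (\<lambda>x. ?g i x + (cpd i (w n) x - ?g i x))" by simp
      also have "\<dots> \<le> 2 * (sqn S (?g i) + sqn S (\<lambda>x. cpd i (w n) x - ?g i x))" by (rule sqn_add) measurable
      finally show "sqn S (cpd i (w n)) \<le> 2 * (sqn S (?g i) + sqn S (\<lambda>x. cpd i (w n) x - ?g i x))" .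
    qed auto
    finally have 1: "sqn S (w n) \<le> \<dots>" .
    have "sqn S ?W = sqn S (\<lambda>x. w n x - (w n x - ?W x))" by simp
    also have "\<dots> \<le> 2 * (sqn S (w n) + sqn S (\<lambda>x. w n x - ?W x))" by (rule sqn_diff) measurable
    also have "\<dots> \<le> 2 * ((2 * (ennreal m * ennreal ((c n)\<^sup>2)) + 2 * (ennreal (1 / m * D\<^sup>2) * (ennreal m * (2 ^ CARD('d) * (\<Sum>i\<in>UNIV. 2 * (sqn S (?g i) + sqn S (\<lambda>x. cpd i (w n) x - ?g i x))))))) + sqn S (\<lambda>x. w n x - ?W x))"
      by (intro mult_left_mono add_right_mono 1) auto
    finally show ?thesis .
  qed
  have "(\<lambda>n. sqn (cball 0 R) (\<lambda>x. w n x - ?W x)) \<longlonglongrightarrow> 0"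
    using A(2) unfolding L2conv_def w_def by (rule spec)
  then have e0: "(\<lambda>n. sqn S (\<lambda>x. w n x - ?W x)) \<longlonglongrightarrow> 0"
    by (rule tendsto_0_le_ennreal[OF _ sqn_mono[OF S(2)]])
  have "(\<lambda>n. sqn (cball 0 R) (\<lambda>x. cpd i (w n) x - ?g i x)) \<longlonglongrightarrow> 0" for i
    using A(4)[of i] unfolding L2conv_def cw by (rule spec)
  then have ei: "(\<lambda>n. sqn S (\<lambda>x. cpd i (w n) x - ?g i x)) \<longlonglongrightarrow> 0" for i
    by (rule tendsto_0_le_ennreal[OF _ sqn_mono[OF S(2)]])
  have pl: "(2::ennreal) ^ j < top" for j by (simp add: power_less_top_ennreal)
  have "(\<lambda>n. ?RHS (sqn S (\<lambda>x. w n x - ?W x)) (c n) (\<lambda>i. sqn S (\<lambda>x. cpd i (w n) x - ?g i x))) \<longlonglongrightarrow> ?RHS 0 c0 (\<lambda>_. 0)"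
    by (intro ennreal_tendsto_cmult tendsto_add tendsto_sum tendsto_const tendsto_ennrealI tendsto_power \<open>c \<longlonglongrightarrow> c0\<close> e0 ei pl)
       auto
  then have "sqn S ?W \<le> ?RHS 0 c0 (\<lambda>_. 0)"
    by (rule LIMSEQ_le_const) (use bound in blast)
  also have "(\<Sum>i\<in>(UNIV::'d set). 2 * (sqn S (?g i) + 0)) = ennreal (2 * (\<Sum>i\<in>UNIV. wd_energy (\<alpha>(i := Suc (\<alpha> i))) S u))"
  proof -
    have "2 * (sqn S (?g i) + 0) = ennreal (2 * wd_energy (\<alpha>(i := Suc (\<alpha> i))) S u)" for i
      unfolding sqn_eq_integral[OF A(3) S(1,2)] wd_energy_def[symmetric] by (simp add: ennreal_mult wd_energy_nonneg)
    then have "(\<Sum>i\<in>(UNIV::'d set). 2 * (sqn S (?g i) + 0)) = (\<Sum>i\<in>UNIV. ennreal (2 * wd_energy (\<alpha>(i := Suc (\<alpha> i))) S u))" by (simp only:)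
    also have "\<dots> = ennreal (\<Sum>i\<in>UNIV. 2 * wd_energy (\<alpha>(i := Suc (\<alpha> i))) S u)"
      by (rule sum_ennreal) (simp add: wd_energy_nonneg)
    finally show ?thesis by (simp only: sum_distrib_left)
  qed
  also have "sqn S ?W = ennreal (wd_energy \<alpha> S u)"
    unfolding sqn_eq_integral[OF A(1) S(1,2)] wd_energy_def ..
  also have "2 * (2 * (ennreal m * ennreal (c0\<^sup>2)) + 2 * (ennreal (1 / m * D\<^sup>2) * (ennreal m * (2 ^ CARD('d) * ennreal (2 * (\<Sum>i\<in>UNIV. wd_energy (\<alpha>(i := Suc (\<alpha> i))) S u))))) + 0)
    = ennreal (4 * (m * c0\<^sup>2) + 8 * 2 ^ CARD('d) * D\<^sup>2 * (\<Sum>i\<in>UNIV. wd_energy (\<alpha>(i := Suc (\<alpha> i))) S u))"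
  proof -
    define X where "X = (\<Sum>i\<in>UNIV. wd_energy (\<alpha>(i := Suc (\<alpha> i))) S u)"
    have X0: "X \<ge> 0" unfolding X_def by (intro sum_nonneg wd_energy_nonneg)
    have n2: "(2::ennreal) ^ j = ennreal (2 ^ j)" for j by (metis ennreal_numeral ennreal_power zero_le_numeral)
    have n2': "(2::ennreal) = ennreal 2" by simp
    have e1: "2 * (ennreal m * ennreal (c0\<^sup>2)) = ennreal (2 * (m * c0\<^sup>2))"
      unfolding n2' using m0 by (simp only: ennreal_mult less_imp_le zero_le_power2 mult_nonneg_nonneg zero_le_numeral)
    have e2: "2 * (ennreal (1 / m * D\<^sup>2) * (ennreal m * (2 ^ CARD('d) * ennreal (2 * X)))) = ennreal (2 * (1 / m * D\<^sup>2 * (m * (2 ^ CARD('d) * (2 * X)))))"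
    proof -
      have "(2::ennreal) ^ CARD('d) * ennreal (2 * X) = ennreal (2 ^ CARD('d) * (2 * X))"
        unfolding n2 using X0 by (intro ennreal_mult[symmetric]) auto
      moreover have "ennreal m * ennreal (2 ^ CARD('d) * (2 * X)) = ennreal (m * (2 ^ CARD('d) * (2 * X)))"
        using X0 m0 by (intro ennreal_mult[symmetric]) auto
      moreover have "ennreal (1 / m * D\<^sup>2) * ennreal (m * (2 ^ CARD('d) * (2 * X))) = ennreal (1 / m * D\<^sup>2 * (m * (2 ^ CARD('d) * (2 * X))))"
        using X0 m0 by (intro ennreal_mult[symmetric]) auto
      moreover have "ennreal 2 * ennreal (1 / m * D\<^sup>2 * (m * (2 ^ CARD('d) * (2 * X)))) = ennreal (2 * (1 / m * D\<^sup>2 * (m * (2 ^ CARD('d) * (2 * X)))))"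
        using X0 m0 by (intro ennreal_mult[symmetric]) auto
      ultimately show ?thesis by (metis n2')
    qed
    have e3: "2 * (1 / m * D\<^sup>2 * (m * (2 ^ CARD('d) * (2 * X)))) = 4 * 2 ^ CARD('d) * D\<^sup>2 * X" using m0 by simp
    have "2 * (ennreal (2 * (m * c0\<^sup>2)) + ennreal (4 * 2 ^ CARD('d) * D\<^sup>2 * X) + 0) = ennreal 2 * ennreal (2 * (m * c0\<^sup>2) + 4 * 2 ^ CARD('d) * D\<^sup>2 * X)"
      using m0 X0 by (simp add: ennreal_plus)
    also have "\<dots> = ennreal (2 * (2 * (m * c0\<^sup>2) + 4 * 2 ^ CARD('d) * D\<^sup>2 * X))" using m0 X0 by (intro ennreal_mult[symmetric]) auto
    also have "2 * (2 * (m * c0\<^sup>2) + 4 * 2 ^ CARD('d) * D\<^sup>2 * X) = 4 * (m * c0\<^sup>2) + 8 * 2 ^ CARD('d) * D\<^sup>2 * X" by simp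
    finally show ?thesis unfolding X_def[symmetric] e1 e2 e3 .
  qed
  finally have fin: "wd_energy \<alpha> S u \<le> 4 * (m * c0\<^sup>2) + 8 * 2 ^ CARD('d) * D\<^sup>2 * (\<Sum>i\<in>UNIV. wd_energy (\<alpha>(i := Suc (\<alpha> i))) S u)"
    using m0 by (subst (asm) ennreal_le_iff) (auto intro!: add_nonneg_nonneg mult_nonneg_nonneg sum_nonneg wd_energy_nonneg)
  have "c0 = (\<integral>x. indicator S x * ?W x \<partial>lborel) / m" unfolding c0_def by (simp add: mult.commute)
  then have "m * c0\<^sup>2 = (\<integral>x. indicator S x * ?W x \<partial>lborel)\<^sup>2 / m" using m0 by (simp add: power2_eq_square)
  then show ?thesis using fin unfolding m_def[symmetric] by simp
qed

section \<open>Lattice cubes\<close>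

text \<open>Half-open cubes, so that the cubes with integer indices partition the space and energies
  add up exactly.\<close>

definition cube :: "real \<Rightarrow> ('d \<Rightarrow> int) \<Rightarrow> (real^'d::finite) set" where
  "cube h z = {x. \<forall>i. h * z i \<le> x $ i \<and> x $ i < h * z i + h}"

lemma cube_floor: "h > 0 \<Longrightarrow> x \<in> cube h z \<longleftrightarrow> z = (\<lambda>i. \<lfloor>x $ i / h\<rfloor>)"
proof -
  assume h: "h > 0"
  have "h * z i \<le> x $ i \<and> x $ i < h * z i + h \<longleftrightarrow> z i = \<lfloor>x $ i / h\<rfloor>" for i
  proof -
    have "h * z i \<le> x $ i \<longleftrightarrow> z i \<le> x $ i / h" using h by (simp add: field_simps)
    moreover have "x $ i < h * z i + h \<longleftrightarrow> x $ i / h < real_of_int (z i) + 1" using h by (simp add: field_simps)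
    ultimately show ?thesis using floor_eq_iff[of "x $ i / h" "z i"] by (metis)
  qed
  then show ?thesis unfolding cube_def by (auto simp: fun_eq_iff)
qed

lemma cube_borel: "cube h z \<in> sets borel"
proof -
  have "cube h z = (\<Inter>i. {x. h * z i \<le> x $ i} \<inter> {x. x $ i < h * z i + h})" by (auto simp: cube_def)
  also have "\<dots> \<in> sets borel"
  proof (rule sets.finite_INT)
    fix i
    have "closed {x :: real^'a. h * z i \<le> x $ i}" by (intro closed_Collect_le continuous_intros)
    moreover have "open {x :: real^'a. x $ i < h * z i + h}" by (intro open_Collect_less continuous_intros)
    ultimately show "{x. h * z i \<le> x $ i} \<inter> {x. x $ i < h * z i + h} \<in> sets borel" by auto
  qed auto
  finally show ?thesis .
qed

lemma cube_convex: "convex (cube h z)"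
proof (rule convexI)
  fix x y and u v :: real
  assume x: "x \<in> cube h z" and y: "y \<in> cube h z" and uv: "0 \<le> u" "0 \<le> v" "u + v = 1"
  show "u *\<^sub>R x + v *\<^sub>R y \<in> cube h z"
    unfolding cube_def
  proof (intro CollectI allI conjI)
    fix i
    have "h * z i \<le> x $ i" "h * z i \<le> y $ i" using x y by (auto simp: cube_def)
    then have "u * (h * z i) + v * (h * z i) \<le> u * x $ i + v * y $ i"
      using uv by (intro add_mono mult_left_mono) auto
    moreover have "u * (h * z i) + v * (h * z i) = h * z i"
      using uv(3) by (simp only: distrib_right[symmetric] mult_1)
    ultimately show "h * z i \<le> (u *\<^sub>R x + v *\<^sub>R y) $ i" by simp
    have "u * x $ i + v * y $ i < h * z i + h"
      using x y uv by (intro convex_bound_lt) (auto simp: cube_def)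
    then show "(u *\<^sub>R x + v *\<^sub>R y) $ i < h * z i + h" by simp
  qed
qed

lemma cube_diameter:
  fixes h :: real and x y :: "real^'d::finite"
  assumes "x \<in> cube h z" "y \<in> cube h z" shows "norm (x - y) \<le> CARD('d) * h"
proof -
  have "norm (x - y) \<le> (\<Sum>i\<in>UNIV. \<bar>(x - y) $ i\<bar>)" by (rule norm_le_l1_cart)
  also have "\<dots> \<le> (\<Sum>i\<in>(UNIV::'d set). h)"
  proof (rule sum_mono)
    fix i
    have "h * z i \<le> x $ i" "x $ i < h * z i + h" "h * z i \<le> y $ i" "y $ i < h * z i + h" using assms by (auto simp: cube_def)
    then show "\<bar>(x - y) $ i\<bar> \<le> h" by simp
  qed
  finally show ?thesis by simp
qed

lemma cube_measure_pos:
  fixes z :: "'d::finite \<Rightarrow> int"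
  assumes h: "h > 0" and R: "cube h z \<subseteq> cball 0 R" shows "measure lborel (cube h z) > 0"
proof -
  let ?c = "\<chi> i. h * z i + h / 2"
  have sub: "ball ?c (h / 2) \<subseteq> cube h z"
  proof
    fix x assume "x \<in> ball ?c (h / 2)"
    then have n: "norm (x - ?c) < h / 2" by (simp add: dist_norm norm_minus_commute)
    have "\<bar>x $ i - (h * z i + h / 2)\<bar> < h / 2" for i
      using le_less_trans[OF component_le_norm_cart n, of i] by simp
    then show "x \<in> cube h z" unfolding cube_def by (auto simp: abs_less_iff) (smt (verit) field_sum_of_halves)+
  qed
  have "0 < measure lborel (ball ?c (h / 2))" using h by (simp add: content_ball_pos)
  also have "\<dots> \<le> measure lborel (cube h z)"
  proof (rule measure_mono_fmeasurable[OF sub])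
    show "cube h z \<in> fmeasurable lborel"
      using le_less_trans[OF emeasure_mono[OF R] emeasure_lborel_cball_finite] cube_borel by (intro fmeasurableI) auto
  qed simp
  finally show ?thesis .
qed

text \<open>The corners belong only to the closed box, so the diameter is first carried over to the
  closure.\<close>

lemma diameter_component:
  fixes a b :: "real^'d::finite"
  assumes "\<And>i. a $ i < b $ i" shows "b $ i - a $ i \<le> diameter (box a b)"
proof -
  have "diameter (box a b) = diameter (cbox a b)"
  proof -
    have "box a b \<noteq> {}" using assms by (simp add: interval_ne_empty_cart)
    then have "closure (box a b) = cbox a b" by (rule closure_box)
    then show ?thesis using diameter_closure[OF bounded_box, of a b] by simp
  qed
  moreover have "dist b a \<le> diameter (cbox a b)"
    using assms by (intro diameter_bounded_bound bounded_cbox) (auto simp: mem_box_cart intro: less_imp_le)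
  moreover have "b $ i - a $ i \<le> dist b a" using component_le_norm_cart[of "b - a" i] by (simp add: dist_norm)
  ultimately show ?thesis by simp
qed

text \<open>With n \<ge> 2 the side is at most \<delta>/2, hence cubes reaching into the enlargement
  by \<delta>/2 stay inside the one by \<delta>. The index set is a product of integer intervals,
  and each side of the box is at most its diameter.\<close>

lemma cube_cover:
  fixes a b :: "real^'d::finite" and n :: nat
  assumes ab: "\<And>i. a $ i < b $ i" and d: "\<delta> > 0" and n: "n \<ge> 2"
  defines "h \<equiv> \<delta> / n"
  obtains Z :: "('d \<Rightarrow> int) set" where "finite Z" "real (card Z) \<le> (real (n + 2) * (1 + diameter (box a b) / \<delta>)) ^ CARD('d)"
    "\<And>x. x \<in> enlarge a b (\<delta> / 2) \<Longrightarrow> \<exists>z\<in>Z. x \<in> cube h z" "\<And>z. z \<in> Z \<Longrightarrow> cube h z \<subseteq> enlarge a b \<delta>"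
proof
  have h: "h > 0" "h \<le> \<delta> / 2" "2 * h \<le> \<delta>" using d n unfolding h_def by (auto simp: field_simps)
  let ?I = "\<lambda>i. {\<lfloor>(a $ i - \<delta> / 2) / h\<rfloor>..\<lfloor>(b $ i + \<delta> / 2) / h\<rfloor>}"
  let ?Z = "PiE UNIV ?I"
  show "finite ?Z" by (intro finite_PiE) auto
  have diam0: "diameter (box a b) \<ge> 0" by (rule diameter_ge_0) (rule bounded_box)
  have "real (card (?I i)) \<le> real (n + 2) * (1 + diameter (box a b) / \<delta>)" for i
  proof -
    have le: "(a $ i - \<delta> / 2) / h \<le> (b $ i + \<delta> / 2) / h" using ab[of i] d h by (intro divide_right_mono) auto
    then have fl: "\<lfloor>(a $ i - \<delta> / 2) / h\<rfloor> \<le> \<lfloor>(b $ i + \<delta> / 2) / h\<rfloor>" by (rule floor_mono)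
    then have "real (card (?I i)) = of_int (\<lfloor>(b $ i + \<delta> / 2) / h\<rfloor> - \<lfloor>(a $ i - \<delta> / 2) / h\<rfloor> + 1)" by simp
    \<comment> \<open>One unit is lost by rounding down the left end, the other counts both ends of
      the integer interval.\<close>
    also have "\<dots> \<le> (b $ i + \<delta> / 2) / h - (a $ i - \<delta> / 2) / h + 2"
      using floor_correct[of "(b $ i + \<delta> / 2) / h"] floor_correct[of "(a $ i - \<delta> / 2) / h"] by simp linarith
    also have "(b $ i + \<delta> / 2) / h - (a $ i - \<delta> / 2) / h = (b $ i - a $ i + \<delta>) / h"
      unfolding diff_divide_distrib[symmetric] by (simp add: algebra_simps)
    also have "\<dots> + 2 \<le> (diameter (box a b) + \<delta>) / h + 2"
      using diameter_component[OF ab, of i] h by (intro add_right_mono divide_right_mono) auto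
    also have "(diameter (box a b) + \<delta>) / h = real n * (1 + diameter (box a b) / \<delta>)"
      unfolding h_def using d n by (simp add: field_simps)
    also have "\<dots> + 2 \<le> real n * (1 + diameter (box a b) / \<delta>) + 2 * (1 + diameter (box a b) / \<delta>)"
      using diam0 d by simp
    also have "\<dots> = real (n + 2) * (1 + diameter (box a b) / \<delta>)"
      by (simp only: of_nat_add of_nat_numeral distrib_right)
    finally show ?thesis .
  qed
  then have "(\<Prod>i\<in>(UNIV::'d set). real (card (?I i))) \<le> (\<Prod>i\<in>(UNIV::'d set). real (n + 2) * (1 + diameter (box a b) / \<delta>))"
    by (intro prod_mono) auto
  then show "real (card ?Z) \<le> (real (n + 2) * (1 + diameter (box a b) / \<delta>)) ^ CARD('d)"
    by (simp only: card_PiE[OF finite_class.finite_UNIV] of_nat_prod prod_constant)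
  show "\<exists>z\<in>?Z. x \<in> cube h z" if x: "x \<in> enlarge a b (\<delta> / 2)" for x
  proof (rule bexI)
    show "x \<in> cube h (\<lambda>i. \<lfloor>x $ i / h\<rfloor>)" using h by (simp add: cube_floor)
    show "(\<lambda>i. \<lfloor>x $ i / h\<rfloor>) \<in> ?Z"
    proof (rule PiE_I)
      fix i
      have "a $ i - \<delta> / 2 \<le> x $ i" "x $ i \<le> b $ i + \<delta> / 2" using x unfolding enlarge_simps by (auto intro: less_imp_le)
      then have "(a $ i - \<delta> / 2) / h \<le> x $ i / h" "x $ i / h \<le> (b $ i + \<delta> / 2) / h" using h by (auto intro: divide_right_mono)
      then show "\<lfloor>x $ i / h\<rfloor> \<in> ?I i" by (auto intro: floor_mono)
    qed simp
  qed
  show "cube h z \<subseteq> enlarge a b \<delta>" if z: "z \<in> ?Z" for z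
  proof
    fix x assume x: "x \<in> cube h z"
    show "x \<in> enlarge a b \<delta>"
      unfolding enlarge_simps
    proof
      fix i
      have zi: "\<lfloor>(a $ i - \<delta> / 2) / h\<rfloor> \<le> z i" "z i \<le> \<lfloor>(b $ i + \<delta> / 2) / h\<rfloor>" using z by (auto simp: PiE_iff)
      then have "(a $ i - \<delta> / 2) / h < z i + 1" "z i \<le> (b $ i + \<delta> / 2) / h" by linarith+
      then have "a $ i - \<delta> / 2 < h * z i + h" "h * z i \<le> b $ i + \<delta> / 2" using h by (auto simp: field_simps)
      moreover have "h * z i \<le> x $ i" "x $ i < h * z i + h" using x by (auto simp: cube_def)
      ultimately show "a $ i - \<delta> < x $ i \<and> x $ i < b $ i + \<delta>" using h by linarith
    qed
  qed
qed

section \<open>Low-rank approximation in a space with a semi-inner product\<close>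

text \<open>The form is only semidefinite: an energy measured on a set does not see what a function
  does elsewhere. Linearity is required on \<open>X\<close> alone, since outside V nothing is known
  about \<open>wd\<close>.\<close>

locale semi_inner_space =
  fixes X :: "('p \<Rightarrow> real) set" and ip :: "('p \<Rightarrow> real) \<Rightarrow> ('p \<Rightarrow> real) \<Rightarrow> real"
  assumes zero_in: "(\<lambda>_. 0) \<in> X"
    and add_in: "u \<in> X \<Longrightarrow> v \<in> X \<Longrightarrow> (\<lambda>y. u y + v y) \<in> X"
    and scale_in: "u \<in> X \<Longrightarrow> (\<lambda>y. c * u y) \<in> X"
    and ip_commute: "ip u v = ip v u"
    and ip_add: "u \<in> X \<Longrightarrow> v \<in> X \<Longrightarrow> w \<in> X \<Longrightarrow> ip (\<lambda>y. u y + v y) w = ip u w + ip v w"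
    and ip_scale: "u \<in> X \<Longrightarrow> w \<in> X \<Longrightarrow> ip (\<lambda>y. c * u y) w = c * ip u w"
    and ip_nonneg: "u \<in> X \<Longrightarrow> 0 \<le> ip u u"
begin

lemma zero_apply:
  assumes add: "\<And>u v. u \<in> X \<Longrightarrow> v \<in> X \<Longrightarrow> f (\<lambda>y. u y + v y) = f u + f v"
    and scale: "\<And>u c. u \<in> X \<Longrightarrow> f (\<lambda>y. c * u y) = c * (f u :: real)"
  shows "f (\<lambda>_. 0) = 0"
  using scale[OF zero_in, of 0] by simp

lemma comb_in: "(\<And>i. i < n \<Longrightarrow> e i \<in> X) \<Longrightarrow> (\<lambda>y. \<Sum>i<(n::nat). c i * e i y) \<in> X"
proof (induction n)
  case 0
  show ?case using zero_in by simp
next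
  case (Suc n)
  have "(\<lambda>y. (\<Sum>i<n. c i * e i y) + c n * e n y) \<in> X"
    by (rule add_in[OF Suc.IH scale_in]) (use Suc.prems in auto)
  then show ?case by simp
qed

lemma comb_apply:
  fixes n :: nat
  assumes add: "\<And>u v. u \<in> X \<Longrightarrow> v \<in> X \<Longrightarrow> f (\<lambda>y. u y + v y) = f u + f v"
    and scale: "\<And>u c. u \<in> X \<Longrightarrow> f (\<lambda>y. c * u y) = c * (f u :: real)"
    and e: "\<And>i. i < n \<Longrightarrow> e i \<in> X"
  shows "f (\<lambda>y. \<Sum>i<n. c i * e i y) = (\<Sum>i<n. c i * f (e i))"
  using e
proof (induction n)
  case 0
  have "f (\<lambda>_. 0) = 0" by (rule zero_apply[OF add scale])
  then show ?case by simp
next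
  case (Suc n)
  have 1: "(\<lambda>y. \<Sum>i<n. c i * e i y) \<in> X" "e n \<in> X" using Suc.prems by (auto intro!: comb_in)
  have "f (\<lambda>y. (\<Sum>i<n. c i * e i y) + c n * e n y) = (\<Sum>i<n. c i * f (e i)) + c n * f (e n)"
    unfolding add[OF 1(1) scale_in[OF 1(2)]] scale[OF 1(2)] using Suc.IH Suc.prems by simp
  then show ?case by simp
qed

lemma ip_comb:
  fixes n :: nat
  shows "(\<And>i. i < n \<Longrightarrow> e i \<in> X) \<Longrightarrow> w \<in> X \<Longrightarrow> ip (\<lambda>y. \<Sum>i<n. c i * e i y) w = (\<Sum>i<n. c i * ip (e i) w)"
  by (rule comb_apply) (simp_all add: ip_add ip_scale)

lemma ip_add_right: "u \<in> X \<Longrightarrow> v \<in> X \<Longrightarrow> w \<in> X \<Longrightarrow> ip w (\<lambda>y. u y + v y) = ip w u + ip w v"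
  using ip_add ip_commute by metis

lemma ip_scale_right: "u \<in> X \<Longrightarrow> w \<in> X \<Longrightarrow> ip w (\<lambda>y. c * u y) = c * ip w u"
  using ip_scale ip_commute by metis

definition orthonormal :: "nat \<Rightarrow> (nat \<Rightarrow> 'p \<Rightarrow> real) \<Rightarrow> bool" where
  "orthonormal n e \<longleftrightarrow> (\<forall>i<n. e i \<in> X) \<and> (\<forall>i<n. \<forall>j<n. ip (e i) (e j) = (if i = j then 1 else 0))"

lemma ip_orthonormal_comb:
  assumes e: "orthonormal n e" and j: "j < n"
  shows "ip (\<lambda>y. \<Sum>i<n. c i * e i y) (e j) = c j"
proof -
  have "ip (\<lambda>y. \<Sum>i<n. c i * e i y) (e j) = (\<Sum>i<n. c i * ip (e i) (e j))"
    using e j by (intro ip_comb) (auto simp: orthonormal_def)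
  also have "\<dots> = (\<Sum>i<n. if i = j then c i else 0)"
    using e j by (intro sum.cong) (auto simp: orthonormal_def)
  finally show ?thesis using j by simp
qed

lemma ip_orthonormal_square:
  assumes e: "orthonormal n e"
  shows "ip (\<lambda>y. \<Sum>i<n. c i * e i y) (\<lambda>y. \<Sum>i<n. c i * e i y) = (\<Sum>i<n. (c i)\<^sup>2)"
proof -
  let ?v = "\<lambda>y. \<Sum>i<n. c i * e i y"
  have eX: "\<And>i. i < n \<Longrightarrow> e i \<in> X" using e by (simp add: orthonormal_def)
  have "ip ?v ?v = (\<Sum>i<n. c i * ip (e i) ?v)" by (intro ip_comb comb_in eX)
  also have "\<dots> = (\<Sum>i<n. (c i)\<^sup>2)"
    using ip_orthonormal_comb[OF e, of _ c] ip_commute[of _ ?v] by (intro sum.cong) (auto simp: power2_eq_square)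
  finally show ?thesis .
qed

text \<open>Applied to the Riesz-type vector with coefficients \<open>f (e i)\<close>, the bound on \<open>f\<close> becomes Bessel's inequality.\<close>
lemma bessel_functional:
  assumes add: "\<And>u v. u \<in> X \<Longrightarrow> v \<in> X \<Longrightarrow> f (\<lambda>y. u y + v y) = f u + f v"
    and scale: "\<And>u c. u \<in> X \<Longrightarrow> f (\<lambda>y. c * u y) = c * (f u :: real)"
    and bound: "\<And>u. u \<in> X \<Longrightarrow> (f u)\<^sup>2 \<le> A * ip u u" and A: "A \<ge> 0" and e: "orthonormal n e"
  shows "(\<Sum>i<n. (f (e i))\<^sup>2) \<le> A"
proof -
  define s where "s = (\<Sum>i<n. (f (e i))\<^sup>2)"
  let ?v = "\<lambda>y. \<Sum>i<n. f (e i) * e i y"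
  have eX: "\<And>i. i < n \<Longrightarrow> e i \<in> X" using e by (simp add: orthonormal_def)
  have "f ?v = s" unfolding s_def power2_eq_square by (rule comb_apply[OF add scale eX])
  moreover have "ip ?v ?v = s" unfolding s_def by (rule ip_orthonormal_square[OF e])
  moreover have "(f ?v)\<^sup>2 \<le> A * ip ?v ?v" by (rule bound[OF comb_in[OF eX]])
  ultimately have "s\<^sup>2 \<le> A * s" by (simp only:)
  moreover have "s \<ge> 0" unfolding s_def by (intro sum_nonneg) simp
  ultimately have "s \<le> A"
  proof (cases "s = 0")
    case False
    then have "s > 0" using \<open>s \<ge> 0\<close> by simp
    then show ?thesis using \<open>s\<^sup>2 \<le> A * s\<close> by (simp add: power2_eq_square)
  qed (use A in simp)
  then show ?thesis by (simp add: s_def)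
qed

lemma orthonormal_extend:
  assumes e: "orthonormal n e" and u: "u \<in> X" "ip u u = 1" "\<And>i. i < n \<Longrightarrow> ip u (e i) = 0"
  shows "orthonormal (Suc n) (e(n := u))"
  unfolding orthonormal_def
proof (intro conjI allI impI)
  fix i assume "i < Suc n" then show "(e(n := u)) i \<in> X" using e u by (auto simp: orthonormal_def less_Suc_eq)
next
  have us: "ip (e i) u = 0" if "i < n" for i using u(3)[OF that] ip_commute by metis
  fix i j assume "i < Suc n" "j < Suc n"
  then show "ip ((e(n := u)) i) ((e(n := u)) j) = (if i = j then 1 else 0)"
    using e u us by (auto simp: orthonormal_def less_Suc_eq)
qed

text \<open>The halved \<epsilon> in \<open>est\<close> is what permits counting. Summing
  \<open>est\<close> over n orthonormal vectors with b > \<epsilon> gives n \<epsilon> \<le> K *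
  card J * A + n \<epsilon> / 2 by Bessel, so n is bounded. A system of maximal size then stands for
  the end of the greedy selection.\<close>

theorem low_rank_approximation:
  fixes b :: "('p \<Rightarrow> real) \<Rightarrow> real" and f :: "'j \<Rightarrow> ('p \<Rightarrow> real) \<Rightarrow> real"
  assumes b_le: "\<And>u. u \<in> X \<Longrightarrow> b u \<le> ip u u"
    and b_scale: "\<And>u c. u \<in> X \<Longrightarrow> b (\<lambda>y. c * u y) = c\<^sup>2 * b u"
    and J: "finite J"
    and add: "\<And>j u v. j \<in> J \<Longrightarrow> u \<in> X \<Longrightarrow> v \<in> X \<Longrightarrow> f j (\<lambda>y. u y + v y) = f j u + f j v"
    and scale: "\<And>j u c. j \<in> J \<Longrightarrow> u \<in> X \<Longrightarrow> f j (\<lambda>y. c * u y) = c * f j u"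
    and bound: "\<And>j u. j \<in> J \<Longrightarrow> u \<in> X \<Longrightarrow> (f j u)\<^sup>2 \<le> A * ip u u" and A: "A \<ge> 0"
    and est: "\<And>u. u \<in> X \<Longrightarrow> b u \<le> K * (\<Sum>j\<in>J. (f j u)\<^sup>2) + \<epsilon> / 2 * ip u u"
    and K: "K \<ge> 0" and \<epsilon>: "\<epsilon> > 0"
  obtains n e where "real n \<le> 2 * K * A / \<epsilon> * card J" "\<And>i. i < n \<Longrightarrow> e i \<in> X"
    "\<And>u. u \<in> X \<Longrightarrow> b (\<lambda>y. u y - (\<Sum>i<n. ip u (e i) * e i y)) \<le> \<epsilon> * ip u u"
proof -
  define good where "good n e \<longleftrightarrow> orthonormal n e \<and> (\<forall>i<n. \<epsilon> < b (e i))" for n e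
  have le: "real n \<le> 2 * K * A / \<epsilon> * card J" if g: "good n e" for n e
  proof -
    have e: "orthonormal n e" using g by (simp add: good_def)
    have eX: "\<And>i. i < n \<Longrightarrow> e i \<in> X" and e1: "\<And>i. i < n \<Longrightarrow> ip (e i) (e i) = 1" using e by (auto simp: orthonormal_def)
    have "real n * \<epsilon> = (\<Sum>i<n. \<epsilon>)" by simp
    also have "\<dots> \<le> (\<Sum>i<n. K * (\<Sum>j\<in>J. (f j (e i))\<^sup>2) + \<epsilon> / 2)"
    proof (rule sum_mono)
      fix i assume i: "i \<in> {..<n}"
      have "\<epsilon> < b (e i)" using g i by (simp add: good_def)
      also have "\<dots> \<le> K * (\<Sum>j\<in>J. (f j (e i))\<^sup>2) + \<epsilon> / 2" using est[OF eX, of i] e1[of i] i by simp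
      finally show "\<epsilon> \<le> K * (\<Sum>j\<in>J. (f j (e i))\<^sup>2) + \<epsilon> / 2" by simp
    qed
    also have "\<dots> = K * (\<Sum>i<n. \<Sum>j\<in>J. (f j (e i))\<^sup>2) + real n * \<epsilon> / 2" by (simp add: sum.distrib sum_distrib_left)
    also have "(\<Sum>i<n. \<Sum>j\<in>J. (f j (e i))\<^sup>2) = (\<Sum>j\<in>J. \<Sum>i<n. (f j (e i))\<^sup>2)" by (rule sum.swap)
    also have "K * (\<Sum>j\<in>J. \<Sum>i<n. (f j (e i))\<^sup>2) \<le> K * (\<Sum>j\<in>J. A)"
      using K by (intro mult_left_mono sum_mono bessel_functional[OF add scale bound A e]) auto
    finally have "real n * \<epsilon> \<le> K * (card J * A) + real n * \<epsilon> / 2" by simp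
    then show ?thesis using \<epsilon> by (simp add: field_simps)
  qed
  let ?N = "{n. \<exists>e. good n e}"
  have "?N \<subseteq> {..nat \<lceil>2 * K * A / \<epsilon> * card J\<rceil>}" using le by (auto simp: le_nat_iff) (meson le_of_int_ceiling of_nat_le_iff order_trans real_nat_ceiling_ge)
  then have fin: "finite ?N" by (rule finite_subset) simp
  have "0 \<in> ?N" by (auto simp: good_def orthonormal_def)
  then have "Max ?N \<in> ?N" using fin by (intro Max_in) auto
  then obtain n e where n: "n = Max ?N" and g: "good n e" by auto
  have e: "orthonormal n e" using g by (simp add: good_def)
  have eX: "\<And>i. i < n \<Longrightarrow> e i \<in> X" using e by (simp add: orthonormal_def)
  have max: "\<not> good (Suc n) e'" for e'
  proof
    assume "good (Suc n) e'"
    then have "Suc n \<in> ?N" by blast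
    then have "Suc n \<le> n" unfolding n by (rule Max_ge[OF fin])
    then show False by simp
  qed
  \<comment> \<open>A violating \<open>w\<close> could be normalised and appended, against
    maximality. Normalisation is possible because \<open>b_le\<close> rules out a violation when ip
    w w = 0.\<close>
  have orth: "b w \<le> \<epsilon> * ip w w" if w: "w \<in> X" and o: "\<And>i. i < n \<Longrightarrow> ip w (e i) = 0" for w
  proof (rule ccontr)
    assume "\<not> b w \<le> \<epsilon> * ip w w"
    then have c: "b w > \<epsilon> * ip w w" by simp
    have p: "ip w w > 0"
    proof (rule ccontr)
      assume "\<not> ip w w > 0"
      then have "ip w w = 0" using ip_nonneg[OF w] by simp
      then show False using c b_le[OF w] by simp
    qed
    define t where "t = 1 / sqrt (ip w w)"
    have t2: "t\<^sup>2 = 1 / ip w w" unfolding t_def using p by (simp add: power_divide)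
    let ?u = "\<lambda>y. t * w y"
    have u: "?u \<in> X" by (rule scale_in[OF w])
    have u1: "ip ?u ?u = 1"
      using ip_scale[OF w u, of t] ip_scale_right[OF w w, of t] t2 p by (simp add: power2_eq_square field_simps)
    have uo: "ip ?u (e i) = 0" if "i < n" for i using ip_scale[OF w eX[OF that], of t] o[OF that] by simp
    have "b ?u = b w / ip w w" using b_scale[OF w, of t] t2 by simp
    then have "\<epsilon> < b ?u" using c p by (simp add: pos_less_divide_eq)
    then have "good (Suc n) (e(n := ?u))"
      using g orthonormal_extend[OF e u u1 uo] by (auto simp: good_def less_Suc_eq)
    then show False using max by blast
  qed
  show thesis
  proof (rule that[OF le[OF g] eX])
    fix u assume u: "u \<in> X"
    define P where "P = (\<lambda>y. \<Sum>i<n. ip u (e i) * e i y)"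
    have P: "P \<in> X" unfolding P_def by (rule comb_in[OF eX])
    define w where "w = (\<lambda>y. u y + (-1) * P y)"
    have w: "w \<in> X" unfolding w_def by (rule add_in[OF u scale_in[OF P]])
    have wo: "ip w (e i) = 0" if "i < n" for i
    proof -
      have "ip w (e i) = ip u (e i) + (-1) * ip P (e i)"
        unfolding w_def using ip_add[OF u scale_in[OF P] eX[OF that], of "-1"] ip_scale[OF P eX[OF that], of "-1"] by simp
      also have "ip P (e i) = ip u (e i)" unfolding P_def by (rule ip_orthonormal_comb[OF e that])
      finally show ?thesis by simp
    qed
    have "ip w P = 0"
    proof -
      have "ip P w = (\<Sum>i<n. ip u (e i) * ip (e i) w)" unfolding P_def by (rule ip_comb[OF eX w])
      then show ?thesis using wo ip_commute[of _ w] by simp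
    qed
    \<comment> \<open>Pythagoras: the residual \<open>w\<close> is orthogonal to the projection
      \<open>P\<close>, so its energy does not exceed that of \<open>u\<close>.\<close>
    have "u = (\<lambda>y. w y + P y)" unfolding w_def by auto
    then have "ip u u = ip w u + ip P u" using ip_add[OF w P u] by metis
    also have "ip w u = ip w w + ip w P" using ip_add_right[OF w P w] \<open>u = (\<lambda>y. w y + P y)\<close> by metis
    also have "ip P u = ip P w + ip P P" using ip_add_right[OF w P P] \<open>u = (\<lambda>y. w y + P y)\<close> by metis
    finally have "ip w w \<le> ip u u" using \<open>ip w P = 0\<close> ip_commute[of P w] ip_nonneg[OF P] by simp
    then have "\<epsilon> * ip w w \<le> \<epsilon> * ip u u" using \<epsilon> by (intro mult_left_mono) auto
    then have "b w \<le> \<epsilon> * ip u u" using orth[OF w wo] by linarith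
    then show "b (\<lambda>y. u y - (\<Sum>i<n. ip u (e i) * e i y)) \<le> \<epsilon> * ip u u" unfolding w_def P_def by simp
  qed
qed

end

section \<open>Linearity\<close>

lemma weak_deriv_lincomb:
  fixes u v :: "'d::finite fn"
  assumes "weak_deriv \<alpha> u g" "weak_deriv \<alpha> v h"
  shows "weak_deriv \<alpha> (\<lambda>x. s * u x + t * v x) (\<lambda>x. s * g x + t * h x)"
  unfolding weak_deriv_def
proof (intro conjI allI impI loc_int_lincomb)
  have l: "loc_int u" "loc_int g" "loc_int v" "loc_int h" using assms by (auto simp: weak_deriv_def)
  then show "loc_int u" "loc_int g" "loc_int v" "loc_int h" .
  fix \<phi> :: "'d fn" assume t: "test_fun \<phi>"
  obtain r where r: "\<And>x. norm x > r \<Longrightarrow> \<phi> x = 0" using test_fun_radius[OF t] by blast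
  have i: "integrable lborel (\<lambda>x. w x * pd_list is \<phi> x)" if "loc_int w" for w "is"
  proof -
    have c: "continuous_on UNIV (pd_list is \<phi>)" using t by (simp add: test_fun_def)
    have z: "pd_list is \<phi> x = 0" if "norm x > r" for x by (rule pd_list_test_fun_eq_0[OF t r that])
    obtain B where "\<And>x. \<bar>pd_list is \<phi> x\<bar> \<le> B" using continuous_csupp_bounded[OF c, of r] z by metis
    then show ?thesis
      using z by (intro loc_int_integrable_mult[OF that borel_measurable_continuous_onI[OF c], where B=B and c=0 and r=r]) auto
  qed
  note i0 = i[of _ "[]", simplified]
  have eq: "(\<integral>x. w x * cpartial \<alpha> \<phi> x \<partial>lborel) = (-1) ^ mi_order \<alpha> * (\<integral>x. w' x * \<phi> x \<partial>lborel)" if "weak_deriv \<alpha> w w'" for w w'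
    using that t by (simp add: weak_deriv_def)
  have "(\<integral>x. (s * u x + t * v x) * cpartial \<alpha> \<phi> x \<partial>lborel) = (\<integral>x. s * (u x * cpartial \<alpha> \<phi> x) + t * (v x * cpartial \<alpha> \<phi> x) \<partial>lborel)"
    by (simp add: algebra_simps)
  also have "\<dots> = s * (\<integral>x. u x * cpartial \<alpha> \<phi> x \<partial>lborel) + t * (\<integral>x. v x * cpartial \<alpha> \<phi> x \<partial>lborel)"
    using i[OF l(1), of "mi_list \<alpha>"] i[OF l(3), of "mi_list \<alpha>"] by (simp add: cpartial_eq)
  also have "\<dots> = (-1) ^ mi_order \<alpha> * (s * (\<integral>x. g x * \<phi> x \<partial>lborel) + t * (\<integral>x. h x * \<phi> x \<partial>lborel))"
    unfolding eq[OF assms(1)] eq[OF assms(2)] by (simp add: distrib_left)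
  also have "s * (\<integral>x. g x * \<phi> x \<partial>lborel) + t * (\<integral>x. h x * \<phi> x \<partial>lborel) = (\<integral>x. s * (g x * \<phi> x) + t * (h x * \<phi> x) \<partial>lborel)"
    using i0[OF l(2)] i0[OF l(4)] by simp
  also have "\<dots> = (\<integral>x. (s * g x + t * h x) * \<phi> x \<partial>lborel)" by (simp add: algebra_simps)
  finally show "(\<integral>x. (s * u x + t * v x) * cpartial \<alpha> \<phi> x \<partial>lborel) = (-1) ^ mi_order \<alpha> * (\<integral>x. (s * g x + t * h x) * \<phi> x \<partial>lborel)" .
qed

lemma L2_prod_integrable:
  assumes "L2 g" "L2 h" shows "integrable lborel (\<lambda>x. g x * h x)"
proof (rule Bochner_Integration.integrable_bound)
  have [measurable]: "g \<in> borel_measurable lborel" "h \<in> borel_measurable lborel" using assms by (auto simp: L2_def)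
  show "integrable lborel (\<lambda>x. (g x)\<^sup>2 + (h x)\<^sup>2)" using assms by (auto simp: L2_def)
  show "(\<lambda>x. g x * h x) \<in> borel_measurable lborel" by measurable
  have "norm (g x * h x) \<le> norm ((g x)\<^sup>2 + (h x)\<^sup>2)" for x
  proof -
    have "2 * \<bar>g x * h x\<bar> \<le> (g x)\<^sup>2 + (h x)\<^sup>2"
      using sum_squares_bound[of "\<bar>g x\<bar>" "\<bar>h x\<bar>"] by (simp add: abs_mult mult.assoc)
    then show ?thesis using abs_ge_zero[of "g x * h x"] by simp
  qed
  then show "AE x in lborel. norm (g x * h x) \<le> norm ((g x)\<^sup>2 + (h x)\<^sup>2)" by simp
qed

lemma L2_lincomb:
  assumes "L2 g" "L2 h" shows "L2 (\<lambda>x. s * g x + t * h x)"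
proof -
  have "integrable lborel (\<lambda>x. s\<^sup>2 * (g x)\<^sup>2 + (2 * s * t) * (g x * h x) + t\<^sup>2 * (h x)\<^sup>2)"
    using assms L2_prod_integrable[OF assms] by (intro Bochner_Integration.integrable_add integrable_mult_right) (auto simp: L2_def)
  moreover have "s\<^sup>2 * (g x)\<^sup>2 + (2 * s * t) * (g x * h x) + t\<^sup>2 * (h x)\<^sup>2 = (s * g x + t * h x)\<^sup>2" for x
    by (simp add: power2_eq_square algebra_simps)
  moreover have "(\<lambda>x. s * g x + t * h x) \<in> borel_measurable lborel"
    using assms by (intro borel_measurable_add borel_measurable_times borel_measurable_const) (auto simp: L2_def)
  ultimately show ?thesis by (simp add: L2_def)
qed

lemma Vsp_lincomb:
  fixes u v :: "'d::finite fn"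
  assumes "u \<in> Vsp k kmin" "v \<in> Vsp k kmin" shows "(\<lambda>x. s * u x + t * v x) \<in> Vsp k kmin"
proof -
  have "\<exists>g. weak_deriv \<alpha> (\<lambda>x. s * u x + t * v x) g \<and> L2 g" if o: "kmin \<le> mi_order \<alpha> \<and> mi_order \<alpha> \<le> k" for \<alpha> :: "'d \<Rightarrow> nat"
  proof -
    obtain g h where "weak_deriv \<alpha> u g" "L2 g" "weak_deriv \<alpha> v h" "L2 h" using assms o unfolding Vsp_def by blast
    then show ?thesis using weak_deriv_lincomb L2_lincomb by blast
  qed
  moreover have "continuous_on UNIV (\<lambda>x. s * u x + t * v x)"
    using assms by (intro continuous_intros Vsp_continuous)
  ultimately show ?thesis by (simp add: Vsp_def continuous_loc_int)
qed

lemma Vsp_weak_deriv: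
  fixes u :: "'d::finite fn"
  assumes "u \<in> Vsp k kmin" "kmin \<le> k" "mi_order \<alpha> \<le> k" shows "weak_deriv \<alpha> u (wd \<alpha> u)"
  using Vsp_approx(1)[OF assms(1,2), of "mi_list \<alpha>"] assms(3) by (simp add: length_mi_list count_mi_list)

lemma wd_lincomb:
  fixes u v :: "'d::finite fn"
  assumes u: "u \<in> Vsp k kmin" and v: "v \<in> Vsp k kmin" and k: "kmin \<le> k" "mi_order \<alpha> \<le> k"
  shows "AE x in lborel. wd \<alpha> (\<lambda>x. s * u x + t * v x) x = s * wd \<alpha> u x + t * wd \<alpha> v x"
  by (rule weak_deriv_unique[OF Vsp_weak_deriv[OF Vsp_lincomb[OF u v] k] weak_deriv_lincomb[OF Vsp_weak_deriv[OF u k] Vsp_weak_deriv[OF v k]]])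

lemma Vsp_wd_L2:
  fixes u :: "'d::finite fn"
  assumes u: "u \<in> Vsp k kmin" and \<alpha>: "kmin \<le> mi_order \<alpha>" "mi_order \<alpha> \<le> k" shows "L2 (wd \<alpha> u)"
proof -
  obtain g where g: "weak_deriv \<alpha> u g" "L2 g" using u \<alpha> unfolding Vsp_def by blast
  have k: "kmin \<le> k" using \<alpha> by simp
  have m: "wd \<alpha> u \<in> borel_measurable lborel" using L2loc_measurable[OF Vsp_wd_L2loc[OF u k \<alpha>(2)]] by simp
  have "AE x in lborel. g x = wd \<alpha> u x" by (rule weak_deriv_unique[OF g(1) Vsp_weak_deriv[OF u k \<alpha>(2)]])
  then have "AE x in lborel. (g x)\<^sup>2 = (wd \<alpha> u x)\<^sup>2" by eventually_elim simp
  then have "integrable lborel (\<lambda>x. (g x)\<^sup>2) = integrable lborel (\<lambda>x. (wd \<alpha> u x)\<^sup>2)"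
    using g(2) m by (intro integrable_cong_AE) (auto simp: L2_def)
  then show ?thesis using g(2) m by (simp add: L2_def)
qed

text \<open>The integrals run over the whole space and converge because only orders from
  \<open>kmin\<close> to \<open>k\<close> enter, where \<open>wd\<close> is globally square
  integrable by \<open>Vsp_wd_L2\<close>.\<close>

lemma abil_lincomb:
  fixes u v w :: "'d::finite fn"
  assumes u: "u \<in> Vsp k kmin" and v: "v \<in> Vsp k kmin" and w: "w \<in> Vsp k kmin" and k: "kmin \<le> k"
  shows "abil k kmin \<sigma> (\<lambda>x. s * u x + t * v x) w = s * abil k kmin \<sigma> u w + t * abil k kmin \<sigma> v w"
proof -
  have "(\<integral>x. wd \<alpha> (\<lambda>x. s * u x + t * v x) x * wd \<alpha> w x \<partial>lborel) = s * (\<integral>x. wd \<alpha> u x * wd \<alpha> w x \<partial>lborel) + t * (\<integral>x. wd \<alpha> v x * wd \<alpha> w x \<partial>lborel)"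
    if o: "kmin \<le> mi_order \<alpha>" "mi_order \<alpha> \<le> k" for \<alpha>
  proof -
    note L = Vsp_wd_L2[OF u o] Vsp_wd_L2[OF v o] Vsp_wd_L2[OF w o]
    note i = L2_prod_integrable[OF L(1,3)] L2_prod_integrable[OF L(2,3)]
    have "(\<integral>x. wd \<alpha> (\<lambda>x. s * u x + t * v x) x * wd \<alpha> w x \<partial>lborel) = (\<integral>x. s * (wd \<alpha> u x * wd \<alpha> w x) + t * (wd \<alpha> v x * wd \<alpha> w x) \<partial>lborel)"
    proof (rule integral_cong_AE)
      show "AE x in lborel. wd \<alpha> (\<lambda>x. s * u x + t * v x) x * wd \<alpha> w x = s * (wd \<alpha> u x * wd \<alpha> w x) + t * (wd \<alpha> v x * wd \<alpha> w x)"
        using wd_lincomb[OF u v k o(2), of s t] by eventually_elim (simp add: algebra_simps)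
    qed (use L2_prod_integrable[OF Vsp_wd_L2[OF Vsp_lincomb[OF u v] o] L(3)] i in auto)
    then show ?thesis using i by simp
  qed
  then have "abil k kmin \<sigma> (\<lambda>x. s * u x + t * v x) w = (\<Sum>l\<in>{kmin..k}. \<sigma> l *
      (\<Sum>\<alpha>\<in>{\<alpha>::'d \<Rightarrow> nat. mi_order \<alpha> = l}. (fact l / real (mi_fact \<alpha>)) * (s * (\<integral>x. wd \<alpha> u x * wd \<alpha> w x \<partial>lborel) + t * (\<integral>x. wd \<alpha> v x * wd \<alpha> w x \<partial>lborel))))"
    unfolding abil_def by (intro sum.cong arg_cong2[where f="(*)"]) auto
  also have "\<dots> = s * abil k kmin \<sigma> u w + t * abil k kmin \<sigma> v w"
    unfolding abil_def by (simp add: sum.distrib sum_distrib_left distrib_left mult_ac)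
  finally show ?thesis .
qed

lemma Vharm_lincomb:
  fixes u v :: "'d::finite fn"
  assumes u: "u \<in> Vharm k kmin \<sigma> N x B" and v: "v \<in> Vharm k kmin \<sigma> N x B" and k: "kmin \<le> k"
  shows "(\<lambda>y. s * u y + t * v y) \<in> Vharm k kmin \<sigma> N x B"
proof -
  have V: "u \<in> Vsp k kmin" "v \<in> Vsp k kmin" using u v by (auto simp: Vharm_def)
  have "abil k kmin \<sigma> (\<lambda>y. s * u y + t * v y) w = 0" if w: "w \<in> V0 k kmin N x" "supp w \<subseteq> B" for w
  proof -
    have "w \<in> Vsp k kmin" using w by (simp add: V0_def)
    then show ?thesis using abil_lincomb[OF V _ k] u v w by (simp add: Vharm_def)
  qed
  then show ?thesis using Vsp_lincomb[OF V] u v by (simp add: Vharm_def)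
qed

lemma Vharm_zero:
  assumes k: "kmin \<le> k" shows "(\<lambda>_. 0) \<in> Vharm k kmin \<sigma> N x (B :: (real^'d::finite) set)"
proof -
  have w: "weak_deriv \<alpha> (\<lambda>_. 0) (\<lambda>_. 0)" for \<alpha> :: "'d \<Rightarrow> nat"
    by (simp add: weak_deriv_def continuous_loc_int)
  have V: "(\<lambda>_. 0) \<in> (Vsp k kmin :: 'd fn set)"
    unfolding Vsp_def using w by (auto simp: continuous_loc_int L2_def intro!: exI[of _ "\<lambda>_. 0"])
  \<comment> \<open>\<open>wd\<close> of the zero function is an unspecified representative, so the
    value 0 is taken from bilinearity with both coefficients 0.\<close>
  have "abil k kmin \<sigma> (\<lambda>_. 0) v = 0" if "v \<in> V0 k kmin N x" for v :: "'d fn"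
    using abil_lincomb[OF V V _ k, of v \<sigma> 0 0] that by (simp add: V0_def)
  then show ?thesis using V by (simp add: Vharm_def)
qed

text \<open>A smaller set contains fewer points and admits fewer test functions.\<close>

lemma Vharm_mono: "A \<subseteq> B \<Longrightarrow> Vharm k kmin \<sigma> N x B \<subseteq> Vharm k kmin \<sigma> N x A"
  unfolding Vharm_def by blast

section \<open>Bilinear forms and means of weak derivatives on bounded sets\<close>

definition wd_pair :: "('d \<Rightarrow> nat) \<Rightarrow> (real^'d) set \<Rightarrow> 'd::finite fn \<Rightarrow> 'd fn \<Rightarrow> real" where
  "wd_pair \<alpha> S u v = (\<integral>x. indicator S x * (wd \<alpha> u x * wd \<alpha> v x) \<partial>lborel)"

text \<open>The integral over \<open>S\<close> without normalisation; the division by the measure of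
  \<open>S\<close> is written out in the estimates.\<close>

definition wd_mean :: "('d \<Rightarrow> nat) \<Rightarrow> (real^'d) set \<Rightarrow> 'd::finite fn \<Rightarrow> real" where
  "wd_mean \<alpha> S u = (\<integral>x. indicator S x * wd \<alpha> u x \<partial>lborel)"

lemma wd_pair_same: "wd_pair \<alpha> S u u = wd_energy \<alpha> S u"
  by (simp add: wd_pair_def wd_energy_def power2_eq_square)

lemma wd_pair_commute: "wd_pair \<alpha> S u v = wd_pair \<alpha> S v u"
  by (simp add: wd_pair_def mult.commute)

lemma wd_pair_lincomb:
  fixes u v w :: "'d::finite fn"
  assumes u: "u \<in> Vsp k kmin" and v: "v \<in> Vsp k kmin" and w: "w \<in> Vsp k kmin" and k: "kmin \<le> k" "mi_order \<alpha> \<le> k"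
    and S: "S \<in> sets borel" "S \<subseteq> cball 0 R"
  shows "wd_pair \<alpha> S (\<lambda>x. s * u x + t * v x) w = s * wd_pair \<alpha> S u w + t * wd_pair \<alpha> S v w"
proof -
  note L = Vsp_wd_L2loc[OF u k] Vsp_wd_L2loc[OF v k] Vsp_wd_L2loc[OF w k] Vsp_wd_L2loc[OF Vsp_lincomb[OF u v] k]
  note i = L2loc_prod_integrable[OF L(1,3) S] L2loc_prod_integrable[OF L(2,3) S] L2loc_prod_integrable[OF L(4,3) S]
  have "wd_pair \<alpha> S (\<lambda>x. s * u x + t * v x) w = (\<integral>x. s * (indicator S x * (wd \<alpha> u x * wd \<alpha> w x)) + t * (indicator S x * (wd \<alpha> v x * wd \<alpha> w x)) \<partial>lborel)"
    unfolding wd_pair_def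
  proof (rule integral_cong_AE)
    show "AE x in lborel. indicator S x * (wd \<alpha> (\<lambda>x. s * u x + t * v x) x * wd \<alpha> w x) = s * (indicator S x * (wd \<alpha> u x * wd \<alpha> w x)) + t * (indicator S x * (wd \<alpha> v x * wd \<alpha> w x))"
      using wd_lincomb[OF u v k, of s t] by eventually_elim (simp add: algebra_simps)
  qed (use borel_measurable_integrable[OF i(3)] borel_measurable_integrable[OF i(1)] borel_measurable_integrable[OF i(2)] in auto)
  then show ?thesis using i by (simp add: wd_pair_def)
qed

lemma L2loc_integrable:
  fixes f :: "'d::finite fn"
  assumes f: "L2loc f" and S: "S \<in> sets borel" "S \<subseteq> cball 0 R"
  shows "integrable lborel (\<lambda>x. indicator S x * f x)"
  using L2loc_prod_integrable[OF f continuous_L2loc[of "\<lambda>_. 1"] S] by simp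

lemma wd_mean_lincomb:
  fixes u v :: "'d::finite fn"
  assumes u: "u \<in> Vsp k kmin" and v: "v \<in> Vsp k kmin" and k: "kmin \<le> k" "mi_order \<alpha> \<le> k"
    and S: "S \<in> sets borel" "S \<subseteq> cball 0 R"
  shows "wd_mean \<alpha> S (\<lambda>x. s * u x + t * v x) = s * wd_mean \<alpha> S u + t * wd_mean \<alpha> S v"
proof -
  note L = Vsp_wd_L2loc[OF u k] Vsp_wd_L2loc[OF v k] Vsp_wd_L2loc[OF Vsp_lincomb[OF u v] k]
  note i = L2loc_integrable[OF L(1) S] L2loc_integrable[OF L(2) S] L2loc_integrable[OF L(3) S]
  have "wd_mean \<alpha> S (\<lambda>x. s * u x + t * v x) = (\<integral>x. s * (indicator S x * wd \<alpha> u x) + t * (indicator S x * wd \<alpha> v x) \<partial>lborel)"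
    unfolding wd_mean_def
  proof (rule integral_cong_AE)
    show "AE x in lborel. indicator S x * wd \<alpha> (\<lambda>x. s * u x + t * v x) x = s * (indicator S x * wd \<alpha> u x) + t * (indicator S x * wd \<alpha> v x)"
      using wd_lincomb[OF u v k, of s t] by eventually_elim (simp add: algebra_simps)
  qed (use borel_measurable_integrable[OF i(3)] borel_measurable_integrable[OF i(1)] borel_measurable_integrable[OF i(2)] in auto)
  then show ?thesis using i by (simp add: wd_mean_def)
qed

text \<open>Cauchy-Schwarz against the constant 1. It yields the boundedness of the grid functionals
  that Bessel's inequality needs.\<close>

lemma wd_mean_square_le:
  fixes u :: "'d::finite fn"
  assumes u: "u \<in> Vsp k kmin" and k: "kmin \<le> k" "mi_order \<alpha> \<le> k"
    and S: "S \<in> sets borel" "S \<subseteq> cball 0 R" and m: "measure lborel S > 0"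
  shows "(wd_mean \<alpha> S u)\<^sup>2 / measure lborel S \<le> wd_energy \<alpha> S u"
proof -
  note L = Vsp_wd_L2loc[OF u k]
  have fS: "emeasure lborel S < \<infinity>"
    using le_less_trans[OF emeasure_mono[OF S(2)] emeasure_lborel_cball_finite] by simp
  have em: "emeasure lborel S = ennreal (measure lborel S)" using fS by (simp add: emeasure_eq_ennreal_measure)
  have "ennreal ((\<integral>x. wd \<alpha> u x * 1 * indicator S x \<partial>lborel)\<^sup>2) \<le> sqn S (wd \<alpha> u) * sqn S (\<lambda>_. 1)"
    by (rule sqn_CS) (use L2loc_measurable[OF L] S in auto)
  also have "\<dots> = ennreal (wd_energy \<alpha> S u * measure lborel S)"
    unfolding sqn_indicator[OF S(1)] sqn_eq_integral[OF L S] em wd_energy_def[symmetric]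
    by (simp add: ennreal_mult wd_energy_nonneg)
  finally have "(wd_mean \<alpha> S u)\<^sup>2 \<le> wd_energy \<alpha> S u * measure lborel S"
    unfolding wd_mean_def by (subst (asm) ennreal_le_iff) (auto intro!: mult_nonneg_nonneg wd_energy_nonneg simp: mult.commute)
  then show ?thesis using m by (simp add: pos_divide_le_eq)
qed

section \<open>Estimates on a grid\<close>

lemma enlarge_borel: "enlarge a b \<delta> \<in> sets borel"
  unfolding enlarge_def by simp

lemma enlarge_mono: "\<delta> \<le> \<epsilon> \<Longrightarrow> enlarge a b \<delta> \<subseteq> enlarge a b \<epsilon>"
  unfolding subset_iff enlarge_simps by (meson add_le_cancel_left diff_left_mono le_less_trans less_le_trans)

lemma box_subset_enlarge: "0 \<le> \<delta> \<Longrightarrow> box a b \<subseteq> enlarge a b \<delta>"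
  using enlarge_mono[of 0 \<delta> a b] by (simp add: enlarge_def zero_vec_def[symmetric])

lemma sum_indicator_cube:
  assumes "h > 0" "finite Z"
  shows "(\<Sum>z\<in>Z. indicator (cube h z) x) = (indicator (\<Union>z\<in>Z. cube h z) x :: real)"
proof -
  have "disjoint_family_on (cube h) Z"
    unfolding disjoint_family_on_def by (auto simp: cube_floor[OF assms(1)])
  then show ?thesis by (simp only: indicator_UN_disjoint[OF assms(2)])
qed

lemma sum_energy_cube:
  fixes u :: "'d::finite fn"
  assumes u: "u \<in> Vsp k kmin" and k: "kmin \<le> k" "mi_order \<alpha> \<le> k" and h: "h > 0" and Z: "finite Z"
    and B: "\<And>z. z \<in> Z \<Longrightarrow> cube h z \<subseteq> B" "B \<subseteq> cball 0 R"
  shows "(\<Sum>z\<in>Z. wd_energy \<alpha> (cube h z) u) = (\<integral>x. indicator (\<Union>z\<in>Z. cube h z) x * (wd \<alpha> u x)\<^sup>2 \<partial>lborel)"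
proof -
  have i: "integrable lborel (\<lambda>x. indicator (cube h z) x * (wd \<alpha> u x)\<^sup>2)" if "z \<in> Z" for z
    using B that by (intro L2loc_square_integrable[OF Vsp_wd_L2loc[OF u k] cube_borel, of h z R]) blast
  have "(\<Sum>z\<in>Z. wd_energy \<alpha> (cube h z) u) = (\<integral>x. (\<Sum>z\<in>Z. indicator (cube h z) x * (wd \<alpha> u x)\<^sup>2) \<partial>lborel)"
    unfolding wd_energy_def using i by (intro Bochner_Integration.integral_sum[symmetric]) auto
  also have "\<dots> = (\<integral>x. indicator (\<Union>z\<in>Z. cube h z) x * (wd \<alpha> u x)\<^sup>2 \<partial>lborel)"
    by (simp only: sum_distrib_right[symmetric] sum_indicator_cube[OF h Z])
  finally show ?thesis .
qed

lemma mi_order_Suc: "mi_order (\<alpha>(i := Suc (\<alpha> i))) = Suc (mi_order \<alpha>)"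
proof -
  have "mi_order (count_list (i # mi_list \<alpha>)) = Suc (mi_order \<alpha>)" by (simp only: mi_order_count list.size length_mi_list)
  moreover have "count_list (i # mi_list \<alpha>) = \<alpha>(i := Suc (\<alpha> i))" using count_mi_list[of \<alpha>] by auto
  ultimately show ?thesis by simp
qed

text \<open>The cubes cover \<open>B'\<close>, lie in \<open>B\<close> and are disjoint, so the
  local Poincare inequalities add up without an overlap constant.\<close>

lemma wd_energy_grid:
  fixes h :: real and u :: "'d::finite fn"
  assumes u: "u \<in> Vsp k kmin" and k: "kmin \<le> k" and \<alpha>: "mi_order \<alpha> < k" and h: "h > 0" and Z: "finite Z"
    and B: "\<And>z. z \<in> Z \<Longrightarrow> cube h z \<subseteq> B" "B \<in> sets borel" "B \<subseteq> cball 0 R"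
    and B': "\<And>x. x \<in> B' \<Longrightarrow> \<exists>z\<in>Z. x \<in> cube h z" "B' \<in> sets borel"
  shows "wd_energy \<alpha> B' u \<le> 4 * (\<Sum>z\<in>Z. (wd_mean \<alpha> (cube h z) u)\<^sup>2 / measure lborel (cube h z))
     + 8 * 2 ^ CARD('d) * (CARD('d) * h)\<^sup>2 * (\<Sum>i\<in>UNIV. wd_energy (\<alpha>(i := Suc (\<alpha> i))) B u)"
proof -
  let ?U = "\<Union>z\<in>Z. cube h z"
  have Ub: "?U \<in> sets borel" using Z cube_borel by (intro sets.finite_UN) auto
  have UR: "?U \<subseteq> cball 0 R" "?U \<subseteq> B" using B by blast+
  have o: "mi_order (\<alpha>(i := Suc (\<alpha> i))) \<le> k" for i
    using \<alpha> by (simp add: mi_order_Suc)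
  have e: "(\<Sum>z\<in>Z. wd_energy \<beta> (cube h z) u) = wd_energy \<beta> ?U u" if "mi_order \<beta> \<le> k" for \<beta>
    using sum_energy_cube[OF u k that h Z B(1,3)] by (simp add: wd_energy_def)
  have "wd_energy \<alpha> B' u \<le> wd_energy \<alpha> ?U u"
    using B' by (intro wd_energy_mono[OF u k less_imp_le[OF \<alpha>] _ _ Ub UR(1)]) auto
  also have "\<dots> = (\<Sum>z\<in>Z. wd_energy \<alpha> (cube h z) u)" using e[of \<alpha>] \<alpha> by simp
  also have "\<dots> \<le> (\<Sum>z\<in>Z. 4 * ((wd_mean \<alpha> (cube h z) u)\<^sup>2 / measure lborel (cube h z))
     + 8 * 2 ^ CARD('d) * (CARD('d) * h)\<^sup>2 * (\<Sum>i\<in>UNIV. wd_energy (\<alpha>(i := Suc (\<alpha> i))) (cube h z) u))"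
  proof (rule sum_mono)
    fix z assume z: "z \<in> Z"
    have R: "cube h z \<subseteq> cball 0 R" using B z by blast
    show "wd_energy \<alpha> (cube h z) u \<le> 4 * ((wd_mean \<alpha> (cube h z) u)\<^sup>2 / measure lborel (cube h z))
     + 8 * 2 ^ CARD('d) * (CARD('d) * h)\<^sup>2 * (\<Sum>i\<in>UNIV. wd_energy (\<alpha>(i := Suc (\<alpha> i))) (cube h z) u)"
      unfolding wd_mean_def by (rule poincare_wd[OF u k \<alpha> cube_borel R cube_convex cube_diameter cube_measure_pos[OF h R]])
  qed
  also have "\<dots> = 4 * (\<Sum>z\<in>Z. (wd_mean \<alpha> (cube h z) u)\<^sup>2 / measure lborel (cube h z))
     + 8 * 2 ^ CARD('d) * (CARD('d) * h)\<^sup>2 * (\<Sum>i\<in>UNIV. \<Sum>z\<in>Z. wd_energy (\<alpha>(i := Suc (\<alpha> i))) (cube h z) u)"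
    unfolding sum.distrib sum_distrib_left[symmetric] by (subst sum.swap) simp
  also have "\<dots> \<le> 4 * (\<Sum>z\<in>Z. (wd_mean \<alpha> (cube h z) u)\<^sup>2 / measure lborel (cube h z))
     + 8 * 2 ^ CARD('d) * (CARD('d) * h)\<^sup>2 * (\<Sum>i\<in>UNIV. wd_energy (\<alpha>(i := Suc (\<alpha> i))) B u)"
    unfolding e[OF o] by (intro add_left_mono mult_left_mono sum_mono wd_energy_mono[OF u k o UR(2) Ub B(2,3)]) auto
  finally show ?thesis .
qed

lemma wd_energy_scale:
  fixes u :: "'d::finite fn"
  assumes u: "u \<in> Vsp k kmin" and k: "kmin \<le> k" "mi_order \<alpha> \<le> k" and S: "S \<in> sets borel" "S \<subseteq> cball 0 R"
  shows "wd_energy \<alpha> S (\<lambda>y. c * u y) = c\<^sup>2 * wd_energy \<alpha> S u"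
proof -
  have cu: "(\<lambda>y. c * u y) \<in> Vsp k kmin" using Vsp_lincomb[OF u u, of c 0] by simp
  have "wd_pair \<alpha> S (\<lambda>y. c * u y) w = c * wd_pair \<alpha> S u w" if "w \<in> Vsp k kmin" for w
    using wd_pair_lincomb[OF u u that k S, of c 0] by simp
  from this[OF cu] this[OF u] show ?thesis
    using wd_pair_commute[of \<alpha> S u "\<lambda>y. c * u y"] by (simp add: wd_pair_same[symmetric] power2_eq_square)
qed

lemma sum_squares_le_square_sum:
  fixes y :: "'a \<Rightarrow> real"
  assumes "finite I" "\<And>i. i \<in> I \<Longrightarrow> y i \<ge> 0"
  shows "(\<Sum>i\<in>I. (y i)\<^sup>2) \<le> (\<Sum>i\<in>I. y i)\<^sup>2"
  using assms
proof (induction I rule: finite_induct)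
  case (insert i I)
  have "0 \<le> 2 * y i * (\<Sum>i\<in>I. y i)" using insert.prems by (intro mult_nonneg_nonneg sum_nonneg) auto
  then show ?case using insert by (simp add: power2_sum)
qed simp

text \<open>The factor d^3 consists of d^2 from the diameter bound d h of a cube and d from the sum
  over the directions of the extra derivative.\<close>

lemma hsemi_grid:
  fixes h :: real and u :: "'d::finite fn"
  assumes u: "u \<in> Vsp k kmin" and k: "kmin \<le> k" and l: "l < k" and h: "h > 0" and Z: "finite Z"
    and B: "\<And>z. z \<in> Z \<Longrightarrow> cube h z \<subseteq> B" "B \<in> sets borel" "B \<subseteq> cball 0 R"
    and B': "\<And>x. x \<in> B' \<Longrightarrow> \<exists>z\<in>Z. x \<in> cube h z" "B' \<in> sets borel"
    and w: "(\<Sum>\<alpha>\<in>{\<alpha>::'d \<Rightarrow> nat. mi_order \<alpha> = l}. mi_weight \<alpha>) \<le> w"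
  shows "(hsemi l B' u)\<^sup>2 \<le> 4 * w * (\<Sum>\<alpha>\<in>{\<alpha>. mi_order \<alpha> = l}. \<Sum>z\<in>Z. (wd_mean \<alpha> (cube h z) u)\<^sup>2 / measure lborel (cube h z))
     + w * (8 * 2 ^ CARD('d) * CARD('d) ^ 3 * weight_bound TYPE('d) k) * h\<^sup>2 * (hsemi (Suc l) B u)\<^sup>2"
proof -
  let ?I = "{\<alpha>::'d \<Rightarrow> nat. mi_order \<alpha> = l}"
  let ?G = "\<lambda>\<alpha>. \<Sum>z\<in>Z. (wd_mean \<alpha> (cube h z) u)\<^sup>2 / measure lborel (cube h z)"
  let ?F = "weight_bound TYPE('d) k" and ?H = "(hsemi (Suc l) B u)\<^sup>2"
  let ?c = "8 * 2 ^ CARD('d) * (CARD('d) * h)\<^sup>2"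
  have F0: "?F > 0" by (rule weight_bound_pos)
  have G0: "?G \<alpha> \<ge> 0" for \<alpha> by (intro sum_nonneg) simp
  have wI: "mi_weight \<alpha> \<le> w" if "\<alpha> \<in> ?I" for \<alpha>
    using member_le_sum[OF that, of mi_weight] finite_mi_order[of l, where 'd='d] w less_imp_le[OF mi_weight_pos] by force
  have E: "wd_energy \<alpha> B' u \<le> 4 * ?G \<alpha> + ?c * (CARD('d) * (?F * ?H))" if a: "\<alpha> \<in> ?I" for \<alpha>
  proof -
    have o: "mi_order (\<alpha>(i := Suc (\<alpha> i))) = Suc l" for i
      using a by (simp add: mi_order_Suc)
    have "mi_order \<alpha> < k" using a l by simp
    note wd_energy_grid[OF u k this h Z B B']
    also have "(\<Sum>i\<in>UNIV. wd_energy (\<alpha>(i := Suc (\<alpha> i))) B u) \<le> (\<Sum>i\<in>(UNIV::'d set). ?F * ?H)"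
    proof (rule sum_mono)
      fix i
      show "wd_energy (\<alpha>(i := Suc (\<alpha> i))) B u \<le> ?F * ?H"
        using wd_energy_le_hsemi[of "\<alpha>(i := Suc (\<alpha> i))" k B u] o[of i] l by simp
    qed
    finally show ?thesis by (simp add: mult_left_mono)
  qed
  have "(hsemi l B' u)\<^sup>2 \<le> (\<Sum>\<alpha>\<in>?I. mi_weight \<alpha> * (4 * ?G \<alpha> + ?c * (CARD('d) * (?F * ?H))))"
    unfolding hsemi_square[of l B' u] by (intro sum_mono mult_left_mono E less_imp_le[OF mi_weight_pos])
  also have "\<dots> = 4 * (\<Sum>\<alpha>\<in>?I. mi_weight \<alpha> * ?G \<alpha>) + (\<Sum>\<alpha>\<in>?I. mi_weight \<alpha>) * (?c * (CARD('d) * (?F * ?H)))"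
    by (simp only: distrib_left sum.distrib sum_distrib_left[symmetric] sum_distrib_right[symmetric] mult.left_commute[of _ "4::real"])
  also have "\<dots> \<le> 4 * (\<Sum>\<alpha>\<in>?I. w * ?G \<alpha>) + w * (?c * (CARD('d) * (?F * ?H)))"
    using w wI G0 F0 by (intro add_mono mult_left_mono mult_right_mono sum_mono) auto
  also have "\<dots> = 4 * w * (\<Sum>\<alpha>\<in>?I. ?G \<alpha>) + w * (8 * 2 ^ CARD('d) * CARD('d) ^ 3 * ?F) * h\<^sup>2 * ?H"
    by (simp add: sum_distrib_left[symmetric] power_mult_distrib power2_eq_square power3_eq_cube)
  finally show ?thesis .
qed

text \<open>Cauchy-Schwarz over the k + 1 orders costs a factor k + 1 on the left, while on the
  right the sum of squares of nonnegative numbers is at most the square of the sum. The remaining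
  1/4 is the square of the desired 1/2.\<close>

lemma sum_seminorms_le:
  fixes x y :: "nat \<Rightarrow> real"
  assumes y: "\<And>l. y l \<ge> 0" and le: "(\<Sum>l\<in>{0..k}. (x l)\<^sup>2) \<le> 1 / (4 * (real k + 1)) * (\<Sum>l\<in>{0..k}. (y l)\<^sup>2)"
  shows "(\<Sum>l\<in>{0..k}. x l) \<le> 1/2 * (\<Sum>l\<in>{0..k}. y l)"
proof (rule power2_le_imp_le)
  have "(\<Sum>l\<in>{0..k}. x l)\<^sup>2 \<le> (real k + 1) * (\<Sum>l\<in>{0..k}. (x l)\<^sup>2)"
    using sum_squared_le_sum_of_squares[of x "{0..k}"] by (simp add: add.commute mult.commute)
  also have "\<dots> \<le> (real k + 1) * (1 / (4 * (real k + 1)) * (\<Sum>l\<in>{0..k}. (y l)\<^sup>2))"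
    by (intro mult_left_mono le) simp
  also have "\<dots> = 1/4 * (\<Sum>l\<in>{0..k}. (y l)\<^sup>2)"
  proof -
    have "c * (1 / (4 * c) * X) = 1/4 * X" if "c \<noteq> 0" for c X :: real using that by simp
    then show ?thesis by (metis add_nonneg_eq_0_iff of_nat_0_le_iff zero_le_one zero_neq_one)
  qed
  also have "\<dots> \<le> 1/4 * (\<Sum>l\<in>{0..k}. y l)\<^sup>2" by (intro mult_left_mono sum_squares_le_square_sum y) auto
  also have "\<dots> = (1/2 * (\<Sum>l\<in>{0..k}. y l))\<^sup>2" by (simp add: power2_eq_square)
  finally show "(\<Sum>l\<in>{0..k}. x l)\<^sup>2 \<le> (1/2 * (\<Sum>l\<in>{0..k}. y l))\<^sup>2" .
  show "0 \<le> 1/2 * (\<Sum>l\<in>{0..k}. y l)" by (intro mult_nonneg_nonneg sum_nonneg y) auto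
qed

section \<open>The coarsening operator\<close>

text \<open>The polarisation of the weighted sum of squared seminorms, see
  \<open>energy_ip_same\<close>.\<close>

definition energy_ip :: "nat \<Rightarrow> real \<Rightarrow> (real^'d) set \<Rightarrow> 'd::finite fn \<Rightarrow> 'd fn \<Rightarrow> real" where
  "energy_ip k \<delta> S u v = (\<Sum>l\<in>{0..k}. \<delta> ^ (2 * l) * (\<Sum>\<alpha>\<in>{\<alpha>::'d \<Rightarrow> nat. mi_order \<alpha> = l}. mi_weight \<alpha> * wd_pair \<alpha> S u v))"

lemma energy_ip_same: "energy_ip k \<delta> S u u = (\<Sum>l\<in>{0..k}. \<delta> ^ (2 * l) * (hsemi l S u)\<^sup>2)"
  unfolding energy_ip_def hsemi_square wd_pair_same ..

lemma energy_ip_lincomb: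
  fixes u v w :: "'d::finite fn"
  assumes u: "u \<in> Vsp k kmin" and v: "v \<in> Vsp k kmin" and w: "w \<in> Vsp k kmin" and k: "kmin \<le> k"
    and S: "S \<in> sets borel" "S \<subseteq> cball 0 R"
  shows "energy_ip k \<delta> S (\<lambda>x. s * u x + t * v x) w = s * energy_ip k \<delta> S u w + t * energy_ip k \<delta> S v w"
proof -
  have "energy_ip k \<delta> S (\<lambda>x. s * u x + t * v x) w = (\<Sum>l\<in>{0..k}. \<delta> ^ (2 * l) * (\<Sum>\<alpha>\<in>{\<alpha>::'d \<Rightarrow> nat. mi_order \<alpha> = l}. mi_weight \<alpha> * (s * wd_pair \<alpha> S u w + t * wd_pair \<alpha> S v w)))"
    unfolding energy_ip_def using wd_pair_lincomb[OF u v w k _ S]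
    by (intro sum.cong arg_cong2[where f="(*)"] refl) auto
  also have "\<dots> = s * energy_ip k \<delta> S u w + t * energy_ip k \<delta> S v w"
    unfolding energy_ip_def by (simp add: distrib_left sum.distrib sum_distrib_left mult_ac)
  finally show ?thesis .
qed

lemma semi_inner_space_Vharm:
  fixes x :: "nat \<Rightarrow> real^'d::finite"
  assumes k: "kmin \<le> k" and S: "S \<in> sets borel" "S \<subseteq> cball 0 R" and d: "\<delta> \<ge> 0"
  shows "semi_inner_space (Vharm k kmin \<sigma> N x B) (energy_ip k \<delta> S)"
proof
  let ?X = "Vharm k kmin \<sigma> N x B"
  have V: "u \<in> Vsp k kmin" if "u \<in> ?X" for u using that by (simp add: Vharm_def)
  show "(\<lambda>_. 0) \<in> ?X" by (rule Vharm_zero[OF k])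
  show "(\<lambda>y. u y + v y) \<in> ?X" if "u \<in> ?X" "v \<in> ?X" for u v using Vharm_lincomb[OF that k, of 1 1] by simp
  show "(\<lambda>y. c * u y) \<in> ?X" if "u \<in> ?X" for u c using Vharm_lincomb[OF that that k, of c 0] by simp
  show "energy_ip k \<delta> S u v = energy_ip k \<delta> S v u" for u v
    unfolding energy_ip_def by (intro sum.cong arg_cong2[where f="(*)"] refl wd_pair_commute)
  show "energy_ip k \<delta> S (\<lambda>y. u y + v y) w = energy_ip k \<delta> S u w + energy_ip k \<delta> S v w" if "u \<in> ?X" "v \<in> ?X" "w \<in> ?X" for u v w
    using energy_ip_lincomb[OF V[OF that(1)] V[OF that(2)] V[OF that(3)] k S, of \<delta> 1 1] by simp
  show "energy_ip k \<delta> S (\<lambda>y. c * u y) w = c * energy_ip k \<delta> S u w" if "u \<in> ?X" "w \<in> ?X" for u w c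
    using energy_ip_lincomb[OF V[OF that(1)] V[OF that(1)] V[OF that(2)] k S, of \<delta> c 0] by simp
  show "0 \<le> energy_ip k \<delta> S u u" if "u \<in> ?X" for u
    unfolding energy_ip_same using d by (intro sum_nonneg) simp
qed

text \<open>The constant is fixed before \<open>N\<close>, \<open>x\<close>, the box and \<delta>:
  the subdivision number \<open>n\<close> and the number of derivatives per cube depend on neither,
  and only the number of cubes grows with diameter / \<delta>.\<close>

theorem coarsening_operator:
  fixes k kmin :: nat and \<sigma> :: "nat \<Rightarrow> real"
  assumes k0: "k > 0" and k: "kmin \<le> k" and \<sigma>: "\<forall>l. kmin \<le> l \<and> l \<le> k \<longrightarrow> \<sigma> l \<ge> 0" and \<sigma>k: "\<sigma> k > 0"
    and db: "\<delta>bar > 0" and \<epsilon>: "\<epsilon> > 0"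
  shows "\<exists>C. \<forall>N (x :: nat \<Rightarrow> real^'d::finite) a b \<delta>. (\<forall>i. a $ i < b $ i) \<longrightarrow> 0 < \<delta> \<longrightarrow> \<delta> \<le> \<delta>bar \<longrightarrow>
    (\<exists>n e. real n \<le> C * (1 + diameter (box a b) / \<delta>) ^ CARD('d) \<and> (\<forall>i<n. e i \<in> Vharm k kmin \<sigma> N x (enlarge a b \<delta>)) \<and>
      (\<forall>u \<in> Vharm k kmin \<sigma> N x (enlarge a b \<delta>).
        (\<Sum>l\<in>{0..k}. \<delta> ^ (2 * l) * (hsemi l (box a b) (\<lambda>y. u y - (\<Sum>i<n. energy_ip k \<delta> (enlarge a b \<delta>) u (e i) * e i y)))\<^sup>2)
          \<le> \<epsilon> * (\<Sum>l\<in>{0..k}. \<delta> ^ (2 * l) * (hsemi l (enlarge a b \<delta>) u)\<^sup>2)))"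
proof -
  obtain C where C: "C \<ge> 0" and cacc: "\<forall>N x a b \<delta>. \<forall>u :: 'd fn. 0 < \<delta> \<longrightarrow> \<delta> \<le> \<delta>bar \<longrightarrow> u \<in> Vharm k kmin \<sigma> N x (enlarge a b \<delta>) \<longrightarrow>
    \<delta> ^ (2 * k) * (hsemi k (box a b) u)\<^sup>2 \<le> C * (\<Sum>j<k. \<delta> ^ (2 * j) * (hsemi j (enlarge a b (\<delta> / 2)) u)\<^sup>2)"
    using caccioppoli[where k=k and kmin=kmin and \<sigma>=\<sigma> and \<delta>bar=\<delta>bar and 'd='d, OF k0 k \<sigma> \<sigma>k db] by (elim exE conjE)
  define F where "F = weight_bound TYPE('d) k"
  define w where "w = (\<Sum>l\<in>{0..k}. \<Sum>\<alpha>\<in>{\<alpha>::'d \<Rightarrow> nat. mi_order \<alpha> = l}. mi_weight \<alpha>)"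
  define c1 where "c1 = w * (8 * 2 ^ CARD('d) * CARD('d) ^ 3 * F)"
  have F0: "F > 0" unfolding F_def by (rule weight_bound_pos)
  have w0: "w \<ge> 0" unfolding w_def by (intro sum_nonneg less_imp_le[OF mi_weight_pos])
  have wl: "(\<Sum>\<alpha>\<in>{\<alpha>::'d \<Rightarrow> nat. mi_order \<alpha> = l}. mi_weight \<alpha>) \<le> w" if "l \<le> k" for l
    unfolding w_def using that
    by (intro member_le_sum[where f="\<lambda>l. \<Sum>\<alpha>\<in>{\<alpha>::'d \<Rightarrow> nat. mi_order \<alpha> = l}. mi_weight \<alpha>"] sum_nonneg less_imp_le[OF mi_weight_pos]) auto
  have c10: "c1 \<ge> 0" unfolding c1_def using w0 F0 by simp
  \<comment> \<open>A mesh so fine that the Poincare remainder, after multiplication by the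
    Caccioppoli factor 1 + C, is at most half of \<epsilon>. The lower bound 2 in \<open>n\<close>
    is the premise of \<open>cube_cover\<close>.\<close>
  obtain n0 :: nat where n0: "2 * ((1 + C) * c1) / \<epsilon> \<le> n0" using real_arch_simple by blast
  define n where "n = max 2 n0"
  have n2: "n \<ge> 2" unfolding n_def by simp
  have small: "(1 + C) * (c1 / (real n)\<^sup>2) \<le> \<epsilon> / 2"
  proof -
    have "2 * ((1 + C) * c1) / \<epsilon> \<le> real n" using n0 unfolding n_def by simp
    also have "\<dots> \<le> (real n)\<^sup>2" using n2 by (simp add: power2_eq_square)
    finally show ?thesis using \<epsilon> n2 by (simp add: field_simps)
  qed
  \<comment> \<open>The derivatives of order below \<open>k\<close>, each paired with its order. One
    functional is used for every such derivative and every cube.\<close>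
  let ?P = "SIGMA l:{..<k}. {\<alpha>::'d \<Rightarrow> nat. mi_order \<alpha> = l}"
  have finP: "finite ?P" by (intro finite_SigmaI finite_mi_order) auto
  define K where "K = (1 + C) * (4 * w)"
  have K0: "K \<ge> 0" unfolding K_def using C w0 by simp
  define Cf where "Cf = 2 * K * F / \<epsilon> * card ?P * real (n + 2) ^ CARD('d)"
  show ?thesis
  proof (intro exI[of _ Cf] allI impI)
    fix N and x :: "nat \<Rightarrow> real^'d" and a b :: "real^'d" and \<delta> :: real
    assume ab: "\<forall>i. a $ i < b $ i" and d: "0 < \<delta>" "\<delta> \<le> \<delta>bar"
    let ?B = "enlarge a b \<delta>" and ?B' = "enlarge a b (\<delta> / 2)"
    let ?X = "Vharm k kmin \<sigma> N x ?B" and ?ip = "energy_ip k \<delta> ?B"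
    define h where "h = \<delta> / n"
    have h: "h > 0" unfolding h_def using d n2 by simp
    obtain Z :: "('d \<Rightarrow> int) set" where Z: "finite Z" "real (card Z) \<le> (real (n + 2) * (1 + diameter (box a b) / \<delta>)) ^ CARD('d)"
      "\<And>x. x \<in> ?B' \<Longrightarrow> \<exists>z\<in>Z. x \<in> cube h z" "\<And>z. z \<in> Z \<Longrightarrow> cube h z \<subseteq> ?B"
      using cube_cover[of a b \<delta> n] ab d n2 unfolding h_def by blast
    obtain R where R: "?B \<subseteq> cball 0 R" by (rule box_in_cball)
    note Bb = enlarge_borel[of a b \<delta>] and B'b = enlarge_borel[of a b "\<delta> / 2"]
    have V: "u \<in> Vsp k kmin" if "u \<in> ?X" for u using that by (simp add: Vharm_def)
    have sub: "box a b \<subseteq> ?B'" "box a b \<subseteq> ?B" "?B' \<subseteq> ?B"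
      using box_subset_enlarge[of "\<delta> / 2" a b] box_subset_enlarge[of \<delta> a b] enlarge_mono[of "\<delta> / 2" \<delta> a b] d by simp_all
    have boxR: "box a b \<subseteq> cball 0 R" and B'R: "?B' \<subseteq> cball 0 R" using sub R by blast+
    have zR: "cube h z \<subseteq> cball 0 R" if "z \<in> Z" for z using Z(4)[OF that] R by blast
    interpret semi_inner_space ?X ?ip
      using d by (intro semi_inner_space_Vharm[OF k Bb R]) simp
    define bq where "bq u = (\<Sum>l\<in>{0..k}. \<delta> ^ (2 * l) * (hsemi l (box a b) u)\<^sup>2)" for u :: "'d fn"
    define m where "m z = measure lborel (cube h z)" for z :: "'d \<Rightarrow> int"
    have m0: "m z > 0" if "z \<in> Z" for z unfolding m_def by (rule cube_measure_pos[OF h zR[OF that]])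
    \<comment> \<open>The scaling makes the square of each functional the weighted squared mean over
      its cube, so that all of them are bounded by the same multiple \<open>F\<close> of the
      energy.\<close>
    define f where "f = (\<lambda>(p, z) u. \<delta> ^ fst p / sqrt (m z) * wd_mean (snd p) (cube h z) u)"
    let ?J = "?P \<times> Z"
    have J: "l < k \<and> mi_order \<alpha> = l \<and> z \<in> Z" if "((l, \<alpha>), z) \<in> ?J" for l \<alpha> z using that by auto
    have f2: "(f ((l, \<alpha>), z) u)\<^sup>2 = \<delta> ^ (2 * l) * ((wd_mean \<alpha> (cube h z) u)\<^sup>2 / m z)" if "z \<in> Z" for l \<alpha> z u
      using m0[OF that] unfolding f_def by (simp add: power_mult_distrib power_divide power_even_eq)
    have term_le: "\<delta> ^ (2 * l) * (hsemi l ?B u)\<^sup>2 \<le> ?ip u u" if "l \<le> k" for l u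
      unfolding energy_ip_same using that d
      by (intro member_le_sum[where f="\<lambda>l. \<delta> ^ (2 * l) * (hsemi l ?B u)\<^sup>2"]) auto
    have est: "bq u \<le> K * (\<Sum>j\<in>?J. (f j u)\<^sup>2) + \<epsilon> / 2 * ?ip u u" if u: "u \<in> ?X" for u
    proof -
      let ?G = "\<lambda>\<alpha>. \<Sum>z\<in>Z. (wd_mean \<alpha> (cube h z) u)\<^sup>2 / m z"
      \<comment> \<open>Everything passes through the intermediate enlargement by \<delta>/2: orders
        below \<open>k\<close> reach it by monotonicity, order \<open>k\<close> by Caccioppoli. The
        grid estimate then leads on to the enlargement by \<delta>.\<close>
      define Y where "Y = (\<Sum>l<k. \<delta> ^ (2 * l) * (hsemi l ?B' u)\<^sup>2)"
      have "bq u = (\<Sum>l<k. \<delta> ^ (2 * l) * (hsemi l (box a b) u)\<^sup>2) + \<delta> ^ (2 * k) * (hsemi k (box a b) u)\<^sup>2"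
        unfolding bq_def by (simp add: atLeast0AtMost lessThan_Suc_atMost[symmetric])
      also have "\<dots> \<le> Y + C * Y"
      proof (rule add_mono)
        show "(\<Sum>l<k. \<delta> ^ (2 * l) * (hsemi l (box a b) u)\<^sup>2) \<le> Y"
          unfolding Y_def using d by (intro sum_mono mult_left_mono hsemi_mono[OF V[OF u] k _ sub(1) _ B'b B'R]) auto
        show "\<delta> ^ (2 * k) * (hsemi k (box a b) u)\<^sup>2 \<le> C * Y" unfolding Y_def using cacc d u by blast
      qed
      finally have 1: "bq u \<le> (1 + C) * Y" by (simp add: distrib_right)
      have "Y \<le> (\<Sum>l<k. 4 * w * (\<Sum>\<alpha>\<in>{\<alpha>. mi_order \<alpha> = l}. \<Sum>z\<in>Z. (f ((l, \<alpha>), z) u)\<^sup>2) + c1 / (real n)\<^sup>2 * (\<delta> ^ (2 * Suc l) * (hsemi (Suc l) ?B u)\<^sup>2))"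
        unfolding Y_def
      proof (rule sum_mono)
        fix l assume l: "l \<in> {..<k}"
        then have lk: "l < k" "l \<le> k" by auto
        have "\<delta> ^ (2 * l) * (hsemi l ?B' u)\<^sup>2 \<le> \<delta> ^ (2 * l) * (4 * w * (\<Sum>\<alpha>\<in>{\<alpha>. mi_order \<alpha> = l}. ?G \<alpha>) + c1 * h\<^sup>2 * (hsemi (Suc l) ?B u)\<^sup>2)"
          unfolding c1_def F_def m_def
          using d by (intro mult_left_mono hsemi_grid[OF V[OF u] k lk(1) h Z(1,4) Bb R Z(3) B'b wl[OF lk(2)]]) auto
        also have "\<dots> = 4 * w * (\<delta> ^ (2 * l) * (\<Sum>\<alpha>\<in>{\<alpha>. mi_order \<alpha> = l}. ?G \<alpha>)) + c1 * (h\<^sup>2 * \<delta> ^ (2 * l)) * (hsemi (Suc l) ?B u)\<^sup>2"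
          by (simp add: distrib_left)
        also have "\<delta> ^ (2 * l) * (\<Sum>\<alpha>\<in>{\<alpha>. mi_order \<alpha> = l}. ?G \<alpha>) = (\<Sum>\<alpha>\<in>{\<alpha>. mi_order \<alpha> = l}. \<Sum>z\<in>Z. (f ((l, \<alpha>), z) u)\<^sup>2)"
          unfolding sum_distrib_left by (intro sum.cong refl) (simp add: f2)
        \<comment> \<open>The square of the mesh size supplies the two powers of \<delta> that the
          weight of order l + 1 has in excess, and leaves 1 / n^2.\<close>
        also have "h\<^sup>2 * \<delta> ^ (2 * l) = \<delta> ^ (2 * Suc l) / (real n)\<^sup>2"
          unfolding h_def by (simp add: power_divide power2_eq_square)
        finally show "\<delta> ^ (2 * l) * (hsemi l ?B' u)\<^sup>2 \<le> 4 * w * (\<Sum>\<alpha>\<in>{\<alpha>. mi_order \<alpha> = l}. \<Sum>z\<in>Z. (f ((l, \<alpha>), z) u)\<^sup>2) + c1 / (real n)\<^sup>2 * (\<delta> ^ (2 * Suc l) * (hsemi (Suc l) ?B u)\<^sup>2)"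
          by (simp add: mult.assoc)
      qed
      also have "\<dots> = 4 * w * (\<Sum>l<k. \<Sum>\<alpha>\<in>{\<alpha>. mi_order \<alpha> = l}. \<Sum>z\<in>Z. (f ((l, \<alpha>), z) u)\<^sup>2) + c1 / (real n)\<^sup>2 * (\<Sum>l<k. \<delta> ^ (2 * Suc l) * (hsemi (Suc l) ?B u)\<^sup>2)"
        by (simp only: sum.distrib sum_distrib_left)
      also have "(\<Sum>l<k. \<Sum>\<alpha>\<in>{\<alpha>. mi_order \<alpha> = l}. \<Sum>z\<in>Z. (f ((l, \<alpha>), z) u)\<^sup>2) = (\<Sum>j\<in>?J. (f j u)\<^sup>2)"
      proof -
        have "(\<Sum>j\<in>?J. (f j u)\<^sup>2) = (\<Sum>p\<in>?P. \<Sum>z\<in>Z. (f (p, z) u)\<^sup>2)" by (simp add: sum.cartesian_product)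
        also have "\<dots> = (\<Sum>l<k. \<Sum>\<alpha>\<in>{\<alpha>. mi_order \<alpha> = l}. \<Sum>z\<in>Z. (f ((l, \<alpha>), z) u)\<^sup>2)"
          using finite_mi_order by (subst sum.Sigma) (auto simp: split_def)
        finally show ?thesis ..
      qed
      also have "4 * w * (\<Sum>j\<in>?J. (f j u)\<^sup>2) + c1 / (real n)\<^sup>2 * (\<Sum>l<k. \<delta> ^ (2 * Suc l) * (hsemi (Suc l) ?B u)\<^sup>2)
        \<le> 4 * w * (\<Sum>j\<in>?J. (f j u)\<^sup>2) + c1 / (real n)\<^sup>2 * ?ip u u"
      proof (intro add_left_mono mult_left_mono)
        have "?ip u u = \<delta> ^ (2 * 0) * (hsemi 0 ?B u)\<^sup>2 + (\<Sum>l<k. \<delta> ^ (2 * Suc l) * (hsemi (Suc l) ?B u)\<^sup>2)"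
          unfolding energy_ip_same atLeast0AtMost lessThan_Suc_atMost[symmetric] by (rule sum.lessThan_Suc_shift)
        then show "(\<Sum>l<k. \<delta> ^ (2 * Suc l) * (hsemi (Suc l) ?B u)\<^sup>2) \<le> ?ip u u" by simp
        show "0 \<le> c1 / (real n)\<^sup>2" using c10 by simp
      qed
      finally have 2: "Y \<le> 4 * w * (\<Sum>j\<in>?J. (f j u)\<^sup>2) + c1 / (real n)\<^sup>2 * ?ip u u" .
      have "bq u \<le> (1 + C) * (4 * w * (\<Sum>j\<in>?J. (f j u)\<^sup>2) + c1 / (real n)\<^sup>2 * ?ip u u)"
        by (rule order_trans[OF 1 mult_left_mono[OF 2]]) (use C in simp)
      also have "\<dots> = K * (\<Sum>j\<in>?J. (f j u)\<^sup>2) + (1 + C) * (c1 / (real n)\<^sup>2) * ?ip u u"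
        unfolding K_def by (simp only: distrib_left mult.assoc)
      also have "\<dots> \<le> K * (\<Sum>j\<in>?J. (f j u)\<^sup>2) + \<epsilon> / 2 * ?ip u u"
        by (intro add_left_mono mult_right_mono small ip_nonneg u)
      finally show ?thesis .
    qed
    have le: "bq u \<le> ?ip u u" if u: "u \<in> ?X" for u
      unfolding bq_def energy_ip_same using d
      by (intro sum_mono mult_left_mono hsemi_mono[OF V[OF u] k _ sub(2) _ Bb R]) auto
    have sc: "bq (\<lambda>y. c * u y) = c\<^sup>2 * bq u" if u: "u \<in> ?X" for u c
    proof -
      have "(hsemi l (box a b) (\<lambda>y. c * u y))\<^sup>2 = c\<^sup>2 * (hsemi l (box a b) u)\<^sup>2" if "l \<le> k" for l
        unfolding hsemi_square sum_distrib_left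
      proof (rule sum.cong[OF refl])
        fix \<alpha> :: "'d \<Rightarrow> nat" assume "\<alpha> \<in> {\<alpha>. mi_order \<alpha> = l}"
        then have "wd_energy \<alpha> (box a b) (\<lambda>y. c * u y) = c\<^sup>2 * wd_energy \<alpha> (box a b) u"
          using that by (intro wd_energy_scale[OF V[OF u] k _ _ boxR]) auto
        then show "mi_weight \<alpha> * wd_energy \<alpha> (box a b) (\<lambda>y. c * u y) = c\<^sup>2 * (mi_weight \<alpha> * wd_energy \<alpha> (box a b) u)" by simp
      qed
      then show ?thesis unfolding bq_def sum_distrib_left by (intro sum.cong) auto
    qed
    have flin: "f j (\<lambda>y. s * u y + t * v y) = s * f j u + t * f j v" if j: "j \<in> ?J" and uv: "u \<in> ?X" "v \<in> ?X" for j u v s t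
    proof -
      obtain l \<alpha> z where [simp]: "j = ((l, \<alpha>), z)" by (cases j) auto
      have lz: "mi_order \<alpha> \<le> k" "z \<in> Z" using J[of l \<alpha> z] j by auto
      show ?thesis
        using wd_mean_lincomb[OF V[OF uv(1)] V[OF uv(2)] k lz(1) cube_borel zR[OF lz(2)], of s t]
        by (simp add: f_def distrib_left mult_ac add_divide_distrib)
    qed
    have fbound: "(f j u)\<^sup>2 \<le> F * ?ip u u" if j: "j \<in> ?J" and u: "u \<in> ?X" for j u
    proof -
      obtain l \<alpha> z where jz: "j = ((l, \<alpha>), z)" by (cases j) auto
      have lz: "mi_order \<alpha> \<le> k" "mi_order \<alpha> = l" "z \<in> Z" "l \<le> k" using J[of l \<alpha> z] j jz by auto
      have "(f j u)\<^sup>2 = \<delta> ^ (2 * l) * ((wd_mean \<alpha> (cube h z) u)\<^sup>2 / m z)" unfolding jz by (rule f2[OF lz(3)])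
      also have "\<dots> \<le> \<delta> ^ (2 * l) * wd_energy \<alpha> (cube h z) u"
        unfolding m_def using d m0[OF lz(3)]
        by (intro mult_left_mono wd_mean_square_le[OF V[OF u] k lz(1) cube_borel zR[OF lz(3)]]) (auto simp: m_def)
      also have "\<dots> \<le> \<delta> ^ (2 * l) * wd_energy \<alpha> ?B u"
        using d by (intro mult_left_mono wd_energy_mono[OF V[OF u] k lz(1) Z(4)[OF lz(3)] cube_borel Bb R]) auto
      also have "\<dots> \<le> \<delta> ^ (2 * l) * (F * (hsemi l ?B u)\<^sup>2)"
        using d wd_energy_le_hsemi[OF lz(1), of ?B u] lz(2) unfolding F_def by (intro mult_left_mono) auto
      also have "\<dots> = F * (\<delta> ^ (2 * l) * (hsemi l ?B u)\<^sup>2)" by simp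
      also have "\<dots> \<le> F * ?ip u u" using F0 by (intro mult_left_mono term_le lz(4)) auto
      finally show ?thesis .
    qed
    obtain n' e where ne: "real n' \<le> 2 * K * F / \<epsilon> * card ?J" "\<And>i. i < n' \<Longrightarrow> e i \<in> ?X"
      "\<And>u. u \<in> ?X \<Longrightarrow> bq (\<lambda>y. u y - (\<Sum>i<n'. ?ip u (e i) * e i y)) \<le> \<epsilon> * ?ip u u"
    proof (rule low_rank_approximation[of bq ?J f F K \<epsilon>])
      show "finite ?J" using finP Z(1) by (rule finite_cartesian_product)
      show "f j (\<lambda>y. u y + v y) = f j u + f j v" if "j \<in> ?J" "u \<in> ?X" "v \<in> ?X" for j u v
        using flin[OF that, of 1 1] by simp
      show "f j (\<lambda>y. c * u y) = c * f j u" if "j \<in> ?J" "u \<in> ?X" for j u c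
        using flin[OF that that(2), of c 0] by simp
    qed (use le sc fbound est F0 K0 \<epsilon> in auto)
    have "real n' \<le> 2 * K * F / \<epsilon> * (card ?P * real (card Z))"
      using ne(1) by (simp add: card_cartesian_product)
    also have "\<dots> \<le> 2 * K * F / \<epsilon> * (card ?P * (real (n + 2) * (1 + diameter (box a b) / \<delta>)) ^ CARD('d))"
      using K0 F0 \<epsilon> Z(2) by (intro mult_left_mono) auto
    also have "\<dots> = Cf * (1 + diameter (box a b) / \<delta>) ^ CARD('d)"
      unfolding Cf_def power_mult_distrib by (simp only: mult.assoc)
    finally show "\<exists>n e. real n \<le> Cf * (1 + diameter (box a b) / \<delta>) ^ CARD('d) \<and> (\<forall>i<n. e i \<in> ?X) \<and>
      (\<forall>u \<in> ?X. (\<Sum>l\<in>{0..k}. \<delta> ^ (2 * l) * (hsemi l (box a b) (\<lambda>y. u y - (\<Sum>i<n. ?ip u (e i) * e i y)))\<^sup>2)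
          \<le> \<epsilon> * (\<Sum>l\<in>{0..k}. \<delta> ^ (2 * l) * (hsemi l ?B u)\<^sup>2))"
      using ne(2,3) unfolding bq_def energy_ip_same by blast
  qed
qed

theorem mainTheorem18:
  fixes k kmin :: nat and \<sigma> :: "nat \<Rightarrow> real" and \<delta>bar :: real
  assumes "2 * k > CARD('d::finite)"
    and "kmin \<le> k"
    and "\<forall>l. kmin \<le> l \<and> l \<le> k \<longrightarrow> \<sigma> l \<ge> 0"
    and "\<sigma> kmin > 0" and "\<sigma> k > 0"
    and "\<delta>bar > 0"
  shows "\<exists>Cs::real. Cs \<ge> 1 \<and> (\<exists>C::real.
     \<forall>(N::nat) (x::nat \<Rightarrow> real^'d). inj_on x {..<N} \<longrightarrow>
     (\<forall>a b :: real^'d. \<forall>\<delta>::real. (\<forall>i. a $ i < b $ i) \<longrightarrow> 0 < \<delta> \<longrightarrow> \<delta> \<le> \<delta>bar \<longrightarrow>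
       (\<exists>Op :: 'd fn \<Rightarrow> 'd fn.
          lin_on (Vharm k kmin \<sigma> N x (enlarge a b \<delta>)) Op \<and>
          Op ` Vharm k kmin \<sigma> N x (enlarge a b \<delta>) \<subseteq> Vharm k kmin \<sigma> N x (box a b) \<and>
          rank_le (Vharm k kmin \<sigma> N x (enlarge a b \<delta>)) Op
             (C * (1 + diameter (box a b) / \<delta>) ^ CARD('d)) \<and>
          (\<forall>u \<in> Vharm k kmin \<sigma> N x (enlarge a b \<delta>).
             (\<Sum>l\<in>{0..k}. (\<delta> / Cs) ^ l * hsemi l (box a b) (\<lambda>y. u y - Op u y))
               \<le> 1/2 * (\<Sum>l\<in>{0..k}. (\<delta> / Cs) ^ l * hsemi l (enlarge a b \<delta>) u)))))"
proof -
  have "CARD('d) > 0" by simp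
  then have k0: "k > 0" using assms(1) by linarith
  \<comment> \<open>The value demanded by \<open>sum_seminorms_le\<close>.\<close>
  define \<epsilon> where "\<epsilon> = 1 / (4 * (real k + 1))"
  have \<epsilon>: "\<epsilon> > 0" unfolding \<epsilon>_def by simp
  obtain C where C: "\<forall>N (x :: nat \<Rightarrow> real^'d) a b \<delta>. (\<forall>i. a $ i < b $ i) \<longrightarrow> 0 < \<delta> \<longrightarrow> \<delta> \<le> \<delta>bar \<longrightarrow>
    (\<exists>n e. real n \<le> C * (1 + diameter (box a b) / \<delta>) ^ CARD('d) \<and> (\<forall>i<n. e i \<in> Vharm k kmin \<sigma> N x (enlarge a b \<delta>)) \<and>
      (\<forall>u \<in> Vharm k kmin \<sigma> N x (enlarge a b \<delta>).
        (\<Sum>l\<in>{0..k}. \<delta> ^ (2 * l) * (hsemi l (box a b) (\<lambda>y. u y - (\<Sum>i<n. energy_ip k \<delta> (enlarge a b \<delta>) u (e i) * e i y)))\<^sup>2)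
          \<le> \<epsilon> * (\<Sum>l\<in>{0..k}. \<delta> ^ (2 * l) * (hsemi l (enlarge a b \<delta>) u)\<^sup>2)))"
    using coarsening_operator[where k=k and kmin=kmin and \<sigma>=\<sigma> and \<delta>bar=\<delta>bar and \<epsilon>=\<epsilon> and 'd='d, OF k0 assms(2,3,5,6) \<epsilon>] by (elim exE)
  show ?thesis
  \<comment> \<open>C_ssco = 1, since the constant \<epsilon> has already been reached by refining
    the grid.\<close>
  proof (rule exI[of _ 1], rule conjI, simp, rule exI[of _ C], intro allI impI)
    fix N and x :: "nat \<Rightarrow> real^'d" and a b :: "real^'d" and \<delta> :: real
    assume ab: "\<forall>i. a $ i < b $ i" and d: "0 < \<delta>" "\<delta> \<le> \<delta>bar"
    let ?B = "enlarge a b \<delta>"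
    let ?X = "Vharm k kmin \<sigma> N x ?B" and ?ip = "energy_ip k \<delta> ?B"
    obtain n e where n: "real n \<le> C * (1 + diameter (box a b) / \<delta>) ^ CARD('d)" and e: "\<And>i. i < n \<Longrightarrow> e i \<in> ?X"
      and err: "\<And>u. u \<in> ?X \<Longrightarrow> (\<Sum>l\<in>{0..k}. \<delta> ^ (2 * l) * (hsemi l (box a b) (\<lambda>y. u y - (\<Sum>i<n. ?ip u (e i) * e i y)))\<^sup>2)
          \<le> \<epsilon> * (\<Sum>l\<in>{0..k}. \<delta> ^ (2 * l) * (hsemi l ?B u)\<^sup>2)"
      using C[rule_format, of a b \<delta> N x] ab d by blast
    obtain R where R: "?B \<subseteq> cball 0 R" by (rule box_in_cball)
    interpret semi_inner_space ?X ?ip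
      using d by (intro semi_inner_space_Vharm[OF assms(2) enlarge_borel R]) simp
    let ?T = "\<lambda>u y. \<Sum>i<n. ?ip u (e i) * e i y"
    show "\<exists>Op :: 'd fn \<Rightarrow> 'd fn. lin_on ?X Op \<and> Op ` ?X \<subseteq> Vharm k kmin \<sigma> N x (box a b) \<and>
          rank_le ?X Op (C * (1 + diameter (box a b) / \<delta>) ^ CARD('d)) \<and>
          (\<forall>u \<in> ?X. (\<Sum>l\<in>{0..k}. (\<delta> / 1) ^ l * hsemi l (box a b) (\<lambda>y. u y - Op u y))
               \<le> 1/2 * (\<Sum>l\<in>{0..k}. (\<delta> / 1) ^ l * hsemi l ?B u))"
    proof (intro exI[of _ ?T] conjI ballI)
      show "lin_on ?X ?T"
        unfolding lin_on_def
      proof (intro conjI ballI allI ext)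
        fix u w y assume uw: "u \<in> ?X" "w \<in> ?X"
        have "?ip (\<lambda>y. u y + w y) (e i) = ?ip u (e i) + ?ip w (e i)" if "i < n" for i by (rule ip_add[OF uw e[OF that]])
        then show "?T (\<lambda>y. u y + w y) y = ?T u y + ?T w y" by (simp add: distrib_right sum.distrib)
      next
        fix u c y assume u: "u \<in> ?X"
        have "?ip (\<lambda>y. c * u y) (e i) = c * ?ip u (e i)" if "i < n" for i by (rule ip_scale[OF u e[OF that]])
        then show "?T (\<lambda>y. c * u y) y = c * ?T u y" by (simp add: sum_distrib_left mult.assoc)
      qed
      show "?T ` ?X \<subseteq> Vharm k kmin \<sigma> N x (box a b)"
      proof (rule image_subsetI)
        fix u
        \<comment> \<open>The basis vectors themselves belong to the space on the larger box, so the
          combination does too; it only remains to restrict.\<close>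
        have "?T u \<in> ?X" by (rule comb_in[OF e])
        then show "?T u \<in> Vharm k kmin \<sigma> N x (box a b)"
          using Vharm_mono[OF box_subset_enlarge[OF less_imp_le[OF d(1)]]] by (rule rev_subsetD)
      qed
      show "rank_le ?X ?T (C * (1 + diameter (box a b) / \<delta>) ^ CARD('d))"
        unfolding rank_le_def
      proof (intro exI[of _ n] exI[of _ e] conjI ballI n)
        fix u
        show "\<exists>c. ?T u = (\<lambda>y. \<Sum>j<n. c j * e j y)" by (rule exI[of _ "\<lambda>i. ?ip u (e i)"]) (rule refl)
      qed
      fix u assume u: "u \<in> ?X"
      show "(\<Sum>l\<in>{0..k}. (\<delta> / 1) ^ l * hsemi l (box a b) (\<lambda>y. u y - ?T u y)) \<le> 1/2 * (\<Sum>l\<in>{0..k}. (\<delta> / 1) ^ l * hsemi l ?B u)"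
      proof (rule sum_seminorms_le)
        show "0 \<le> (\<delta> / 1) ^ l * hsemi l ?B u" for l using d by (simp add: hsemi_nonneg)
        show "(\<Sum>l\<in>{0..k}. ((\<delta> / 1) ^ l * hsemi l (box a b) (\<lambda>y. u y - ?T u y))\<^sup>2) \<le> 1 / (4 * (real k + 1)) * (\<Sum>l\<in>{0..k}. ((\<delta> / 1) ^ l * hsemi l ?B u)\<^sup>2)"
          using err[OF u] unfolding \<epsilon>_def by (simp add: power_mult_distrib power_even_eq)
      qed
    qed
  qed
qed

end
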